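(* Let $k$ be a field and let $R$ be a $k$-algebra. Suppose that $I$ and $J_1\subset J_2$ are (two-sided) ideals of $R$ such that $A=R/I$ is a prime Goldie ring and $J_2/J_1$ is a left and a right $A$-module. Assume that $J_2/J_1$ has Goldie rank $s$ as a left $A$-module and Goldie rank $t$ as a right $A$-module, for some $s<t$. Then there is no finite $\mathbb{N}$-filtration $\Gamma'$ of $R$ such that the associated graded ring $\operatorname{gr}_{\Gamma'}R$ is left noetherian.
   Context: All algebras are associative, unital, over a fixed field $k$. The module structures on $J_2/J_1$ are those induced from the $R$-bimodule structure; in particular $IJ_2\subseteq J_1$ and $J_2I\subseteq J_1$. A Goldie ring is one that is both left and right Goldie. For a prime Goldie ring $A$ with simple artinian ring of fractions $Q(A)$, the Goldie rank of a left $A$-module $M$ is defined to be the length of the left $Q(A)$-module $Q(A)\otimes_A M$; the Goldie rank of a right $A$-module $M$ is the length of the right $Q(A)$-module $M\otimes_A Q(A)$. An $\mathbb{N}$-filtration $\Gamma=\{\Gamma_i : i\in\mathbb{N}\}$ of $R$ (with $0\in\mathbb N$) is an ascending chain of $k$-subspaces of $R$ with $1\in\Gamma_0$, $\bigcup_{j}\Gamma_j=R$ and $\Gamma_i\Gamma_j\subseteq\Gamma_{i+j}$ for all $i,j$. It is finite if $\dim_k\Gamma_i<\infty$ for all $i$. The associated graded ring is $\operatorname{gr}_\Gamma R=\bigoplus_{i\ge 0}\Gamma_i/\Gamma_{i-1}$, with $\Gamma_{-1}=0$. *)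

theory Defs
  imports "HOL-Algebra.Algebra" "HOL-Library.Extended_Nat"
begin

section \<open>Algebras over a field, one-sided ideals\<close>

text \<open>The library's \<^locale>\<open>algebra\<close> requires the algebra to be commutative; this one does not.\<close>

locale assoc_algebra = module K R + field K + algebra_ring?: ring R
  for K :: "('k, 'm) ring_scheme" (structure) and R :: "('k, 'a, 'n) module_scheme" (structure) +
  assumes smult_mult_left:
      "\<lbrakk>a \<in> carrier K; x \<in> carrier R; y \<in> carrier R\<rbrakk>
        \<Longrightarrow> (a \<odot>\<^bsub>R\<^esub> x) \<otimes>\<^bsub>R\<^esub> y = a \<odot>\<^bsub>R\<^esub> (x \<otimes>\<^bsub>R\<^esub> y)"
    and smult_mult_right:
      "\<lbrakk>a \<in> carrier K; x \<in> carrier R; y \<in> carrier R\<rbrakk>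
        \<Longrightarrow> x \<otimes>\<^bsub>R\<^esub> (a \<odot>\<^bsub>R\<^esub> y) = a \<odot>\<^bsub>R\<^esub> (x \<otimes>\<^bsub>R\<^esub> y)"

definition opposite_ring :: "('a, 'm) ring_scheme \<Rightarrow> ('a, 'm) ring_scheme" where
  "opposite_ring A = A\<lparr>monoid.mult := \<lambda>x y. y \<otimes>\<^bsub>A\<^esub> x\<rparr>"

definition left_ideal :: "'a set \<Rightarrow> ('a, 'm) ring_scheme \<Rightarrow> bool" where
  "left_ideal L A \<longleftrightarrow>
     additive_subgroup L A \<and> (\<forall>a\<in>carrier A. \<forall>x\<in>L. a \<otimes>\<^bsub>A\<^esub> x \<in> L)"

text \<open>The library's \<^locale>\<open>noetherian_ring\<close> only speaks about two-sided ideals.\<close>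

definition left_noetherian :: "('a, 'm) ring_scheme \<Rightarrow> bool" where
  "left_noetherian A \<longleftrightarrow>
     (\<forall>L :: nat \<Rightarrow> 'a set. (\<forall>n. left_ideal (L n) A) \<and> (\<forall>n. L n \<subseteq> L (Suc n))
        \<longrightarrow> (\<exists>N. \<forall>n\<ge>N. L n = L N))"


section \<open>Prime Goldie rings and their rings of fractions\<close>

definition prime_ring :: "('a, 'm) ring_scheme \<Rightarrow> bool" where
  "prime_ring A \<longleftrightarrow> ring A \<and> carrier A \<noteq> {\<zero>\<^bsub>A\<^esub>} \<and>
     (\<forall>I J. ideal I A \<and> ideal J A \<and> (\<forall>x\<in>I. \<forall>y\<in>J. x \<otimes>\<^bsub>A\<^esub> y = \<zero>\<^bsub>A\<^esub>)
        \<longrightarrow> I = {\<zero>\<^bsub>A\<^esub>} \<or> J = {\<zero>\<^bsub>A\<^esub>})"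

definition left_annihilator :: "('a, 'm) ring_scheme \<Rightarrow> 'a set \<Rightarrow> 'a set" where
  "left_annihilator A S = {a \<in> carrier A. \<forall>x\<in>S. a \<otimes>\<^bsub>A\<^esub> x = \<zero>\<^bsub>A\<^esub>}"

text \<open>The sum of the \<open>L n\<close> is direct.\<close>

definition independent_family :: "('a, 'm) ring_scheme \<Rightarrow> (nat \<Rightarrow> 'a set) \<Rightarrow> bool" where
  "independent_family A L \<longleftrightarrow>
     (\<forall>n x. (\<forall>i\<le>n. x i \<in> L i) \<and> (\<Oplus>\<^bsub>A\<^esub>i\<in>{..n}. x i) = \<zero>\<^bsub>A\<^esub> \<longrightarrow> (\<forall>i\<le>n. x i = \<zero>\<^bsub>A\<^esub>))"

text \<open>No infinite direct sum of nonzero left ideals, and the ascending chain condition on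
  left annihilators.\<close>

definition left_goldie :: "('a, 'm) ring_scheme \<Rightarrow> bool" where
  "left_goldie A \<longleftrightarrow>
     \<not> (\<exists>L :: nat \<Rightarrow> 'a set. (\<forall>n. left_ideal (L n) A \<and> L n \<noteq> {\<zero>\<^bsub>A\<^esub>}) \<and> independent_family A L) \<and>
     (\<forall>S :: nat \<Rightarrow> 'a set. (\<forall>n. S n \<subseteq> carrier A) \<and>
        (\<forall>n. left_annihilator A (S n) \<subseteq> left_annihilator A (S (Suc n)))
        \<longrightarrow> (\<exists>N. \<forall>n\<ge>N. left_annihilator A (S n) = left_annihilator A (S N)))"

definition goldie_ring :: "('a, 'm) ring_scheme \<Rightarrow> bool" where
  "goldie_ring A \<longleftrightarrow> ring A \<and> left_goldie A \<and> left_goldie (opposite_ring A)"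

definition regular_elements :: "('a, 'm) ring_scheme \<Rightarrow> 'a set" where
  "regular_elements A = {s \<in> carrier A. \<forall>x\<in>carrier A.
     (s \<otimes>\<^bsub>A\<^esub> x = \<zero>\<^bsub>A\<^esub> \<longrightarrow> x = \<zero>\<^bsub>A\<^esub>) \<and> (x \<otimes>\<^bsub>A\<^esub> s = \<zero>\<^bsub>A\<^esub> \<longrightarrow> x = \<zero>\<^bsub>A\<^esub>)}"

text \<open>\<open>Q\<close> is the two-sided classical ring of fractions of \<open>A\<close> with canonical embedding
  \<open>\<phi>\<close>. This determines \<open>(Q, \<phi>)\<close> up to unique isomorphism over \<open>A\<close>. By Goldie's theorem it
  exists and is simple artinian when \<open>A\<close> is a prime Goldie ring.\<close>

definition ring_of_fractions ::
  "('a, 'm) ring_scheme \<Rightarrow> ('q, 'n) ring_scheme \<Rightarrow> ('a \<Rightarrow> 'q) \<Rightarrow> bool" where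
  "ring_of_fractions A Q \<phi> \<longleftrightarrow>
     ring A \<and> ring Q \<and> \<phi> \<in> ring_hom A Q \<and> inj_on \<phi> (carrier A) \<and>
     \<phi> ` regular_elements A \<subseteq> Units Q \<and>
     (\<forall>q\<in>carrier Q. \<exists>s\<in>regular_elements A. \<exists>a\<in>carrier A. q = inv\<^bsub>Q\<^esub> (\<phi> s) \<otimes>\<^bsub>Q\<^esub> \<phi> a) \<and>
     (\<forall>q\<in>carrier Q. \<exists>s\<in>regular_elements A. \<exists>a\<in>carrier A. q = \<phi> a \<otimes>\<^bsub>Q\<^esub> inv\<^bsub>Q\<^esub> (\<phi> s))"


section \<open>Tensor products, length and Goldie rank\<close>

text \<open>\<open>M\<close> and \<open>N\<close> are abelian groups in multiplicative notation (as produced by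
  \<^const>\<open>A_FactGroup\<close> and \<^const>\<open>add_monoid\<close>); \<open>\<rho> x a\<close> is the right action of \<open>A\<close> on
  \<open>M\<close>, and \<open>\<sigma> a y\<close> is the left action of \<open>A\<close> on \<open>N\<close>.\<close>

definition tensor_relations ::
  "('a, 'r) ring_scheme \<Rightarrow> ('x, 'm) monoid_scheme \<Rightarrow> ('x \<Rightarrow> 'a \<Rightarrow> 'x) \<Rightarrow>
   ('y, 'n) monoid_scheme \<Rightarrow> ('a \<Rightarrow> 'y \<Rightarrow> 'y) \<Rightarrow> ('x \<times> 'y \<Rightarrow>\<^sub>0 int) set" where
  "tensor_relations A M \<rho> N \<sigma> = generate (free_Abelian_group (carrier M \<times> carrier N))
     ({frag_of (x \<otimes>\<^bsub>M\<^esub> x', y) - frag_of (x, y) - frag_of (x', y) | x x' y.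
         x \<in> carrier M \<and> x' \<in> carrier M \<and> y \<in> carrier N} \<union>
      {frag_of (x, y \<otimes>\<^bsub>N\<^esub> y') - frag_of (x, y) - frag_of (x, y') | x y y'.
         x \<in> carrier M \<and> y \<in> carrier N \<and> y' \<in> carrier N} \<union>
      {frag_of (\<rho> x a, y) - frag_of (x, \<sigma> a y) | x a y.
         x \<in> carrier M \<and> a \<in> carrier A \<and> y \<in> carrier N})"

definition tensor_product ::
  "('a, 'r) ring_scheme \<Rightarrow> ('x, 'm) monoid_scheme \<Rightarrow> ('x \<Rightarrow> 'a \<Rightarrow> 'x) \<Rightarrow>
   ('y, 'n) monoid_scheme \<Rightarrow> ('a \<Rightarrow> 'y \<Rightarrow> 'y) \<Rightarrow> ('x \<times> 'y \<Rightarrow>\<^sub>0 int) set monoid" where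
  "tensor_product A M \<rho> N \<sigma> =
     free_Abelian_group (carrier M \<times> carrier N) Mod tensor_relations A M \<rho> N \<sigma>"

text \<open>The endomorphism \<open>f \<otimes> g\<close> of the tensor product: the coset of a formal sum
  \<open>\<Sum> n\<^sub>i (x\<^sub>i, y\<^sub>i)\<close> goes to the coset of \<open>\<Sum> n\<^sub>i (f x\<^sub>i, g y\<^sub>i)\<close>.\<close>

definition tensor_map ::
  "('a, 'r) ring_scheme \<Rightarrow> ('x, 'm) monoid_scheme \<Rightarrow> ('x \<Rightarrow> 'a \<Rightarrow> 'x) \<Rightarrow>
   ('y, 'n) monoid_scheme \<Rightarrow> ('a \<Rightarrow> 'y \<Rightarrow> 'y) \<Rightarrow> ('x \<Rightarrow> 'x) \<Rightarrow> ('y \<Rightarrow> 'y) \<Rightarrow>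
   ('x \<times> 'y \<Rightarrow>\<^sub>0 int) set \<Rightarrow> ('x \<times> 'y \<Rightarrow>\<^sub>0 int) set" where
  "tensor_map A M \<rho> N \<sigma> f g T =
     (\<Union>c\<in>T. tensor_relations A M \<rho> N \<sigma>
        #>\<^bsub>free_Abelian_group (carrier M \<times> carrier N)\<^esub>
          frag_extend (\<lambda>(x, y). frag_of (f x, g y)) c)"

text \<open>The length of a module, \<open>\<infinity>\<close> if there are arbitrarily long chains of submodules. The
  module is an abelian group \<open>G\<close> in multiplicative notation on which \<open>q \<in> S\<close> acts by \<open>\<sigma> q\<close>;
  whether it is a left or a right module is irrelevant for its submodules.\<close>

definition module_length ::
  "'s set \<Rightarrow> ('g, 'm) monoid_scheme \<Rightarrow> ('s \<Rightarrow> 'g \<Rightarrow> 'g) \<Rightarrow> enat" where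
  "module_length S G \<sigma> = Sup {enat n | n. \<exists>N :: nat \<Rightarrow> 'g set.
     (\<forall>i\<le>n. subgroup (N i) G \<and> (\<forall>q\<in>S. \<sigma> q ` N i \<subseteq> N i)) \<and> (\<forall>i<n. N i \<subset> N (Suc i))}"

text \<open>The length of \<open>Q \<otimes>\<^sub>A M\<close> as a left \<open>Q\<close>-module, for a left \<open>A\<close>-module \<open>M\<close> with action
  \<open>\<sigma>\<close>, and of \<open>M \<otimes>\<^sub>A Q\<close> as a right \<open>Q\<close>-module, for a right \<open>A\<close>-module \<open>M\<close> with action
  \<open>\<rho>\<close>. Here \<open>(Q, \<phi>)\<close> is the ring of fractions of \<open>A\<close>.\<close>

definition left_goldie_rank ::
  "('a, 'r) ring_scheme \<Rightarrow> ('q, 'n) ring_scheme \<Rightarrow> ('a \<Rightarrow> 'q) \<Rightarrow>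
   ('x, 'm) monoid_scheme \<Rightarrow> ('a \<Rightarrow> 'x \<Rightarrow> 'x) \<Rightarrow> enat" where
  "left_goldie_rank A Q \<phi> M \<sigma> = (let \<rho> = (\<lambda>q a. q \<otimes>\<^bsub>Q\<^esub> \<phi> a) in
     module_length (carrier Q) (tensor_product A (add_monoid Q) \<rho> M \<sigma>)
       (\<lambda>q. tensor_map A (add_monoid Q) \<rho> M \<sigma> (\<lambda>p. q \<otimes>\<^bsub>Q\<^esub> p) id))"

definition right_goldie_rank ::
  "('a, 'r) ring_scheme \<Rightarrow> ('q, 'n) ring_scheme \<Rightarrow> ('a \<Rightarrow> 'q) \<Rightarrow>
   ('x, 'm) monoid_scheme \<Rightarrow> ('x \<Rightarrow> 'a \<Rightarrow> 'x) \<Rightarrow> enat" where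
  "right_goldie_rank A Q \<phi> M \<rho> = (let \<sigma> = (\<lambda>a q. \<phi> a \<otimes>\<^bsub>Q\<^esub> q) in
     module_length (carrier Q) (tensor_product A M \<rho> (add_monoid Q) \<sigma>)
       (\<lambda>q. tensor_map A M \<rho> (add_monoid Q) \<sigma> id (\<lambda>p. p \<otimes>\<^bsub>Q\<^esub> q)))"

text \<open>The abelian group \<open>J\<^sub>2 / J\<^sub>1\<close> of cosets \<open>J\<^sub>1 + x\<close> with \<open>x \<in> J\<^sub>2\<close>. If \<open>I J\<^sub>2 \<subseteq> J\<^sub>1\<close>,
  then \<open>R / I\<close> acts on it from the left by \<open>(I + r) (J\<^sub>1 + x) = J\<^sub>1 + r x\<close>, i.e. by
  \<open>[mod J\<^sub>1:] (I + r) \<Otimes> (J\<^sub>1 + x)\<close>; similarly on the right.\<close>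

definition subquotient :: "('a, 'm) ring_scheme \<Rightarrow> 'a set \<Rightarrow> 'a set \<Rightarrow> 'a set monoid" where
  "subquotient R J\<^sub>2 J\<^sub>1 = R\<lparr>carrier := J\<^sub>2\<rparr> A_Mod J\<^sub>1"


section \<open>Filtrations and associated graded rings\<close>

definition finite_dim_subspace ::
  "('k, 'm) ring_scheme \<Rightarrow> ('k, 'a, 'n) module_scheme \<Rightarrow> 'a set \<Rightarrow> bool" where
  "finite_dim_subspace K R V \<longleftrightarrow> submodule V K R \<and>
     (\<exists>B. finite B \<and> B \<subseteq> V \<and> (\<forall>W. submodule W K R \<and> B \<subseteq> W \<longrightarrow> V \<subseteq> W))"

definition N_filtration ::
  "('k, 'm) ring_scheme \<Rightarrow> ('k, 'a, 'n) module_scheme \<Rightarrow> (nat \<Rightarrow> 'a set) \<Rightarrow> bool" where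
  "N_filtration K R \<Gamma> \<longleftrightarrow>
     (\<forall>i. submodule (\<Gamma> i) K R) \<and> (\<forall>i. \<Gamma> i \<subseteq> \<Gamma> (Suc i)) \<and>
     \<one>\<^bsub>R\<^esub> \<in> \<Gamma> 0 \<and> (\<Union>i. \<Gamma> i) = carrier R \<and>
     (\<forall>i j. \<forall>x\<in>\<Gamma> i. \<forall>y\<in>\<Gamma> j. x \<otimes>\<^bsub>R\<^esub> y \<in> \<Gamma> (i + j))"

definition finite_N_filtration ::
  "('k, 'm) ring_scheme \<Rightarrow> ('k, 'a, 'n) module_scheme \<Rightarrow> (nat \<Rightarrow> 'a set) \<Rightarrow> bool" where
  "finite_N_filtration K R \<Gamma> \<longleftrightarrow> N_filtration K R \<Gamma> \<and> (\<forall>i. finite_dim_subspace K R (\<Gamma> i))"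

text \<open>\<open>\<Gamma>\<^bsub>i-1\<^esub>\<close>, with \<open>\<Gamma>\<^bsub>-1\<^esub> = 0\<close>.\<close>

definition filtration_pred :: "('a, 'n) ring_scheme \<Rightarrow> (nat \<Rightarrow> 'a set) \<Rightarrow> nat \<Rightarrow> 'a set" where
  "filtration_pred R \<Gamma> i = (case i of 0 \<Rightarrow> {\<zero>\<^bsub>R\<^esub>} | Suc j \<Rightarrow> \<Gamma> j)"

text \<open>An element of the associated graded ring is the family \<open>f\<close> of its homogeneous components
  \<open>f i \<in> \<Gamma>\<^sub>i / \<Gamma>\<^bsub>i-1\<^esub>\<close>, almost all of which are zero. In the product,
  \<open>x i \<in> f i\<close> and \<open>y j \<in> g j\<close> range over all representatives; the cosets in the union coincide.\<close>

definition gr_ring :: "('a, 'n) ring_scheme \<Rightarrow> (nat \<Rightarrow> 'a set) \<Rightarrow> (nat \<Rightarrow> 'a set) ring" where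
  "gr_ring R \<Gamma> = (let \<Gamma>' = filtration_pred R \<Gamma> in
     \<lparr>carrier = {f. (\<forall>i. \<exists>x\<in>\<Gamma> i. f i = \<Gamma>' i +>\<^bsub>R\<^esub> x) \<and> finite {i. f i \<noteq> \<Gamma>' i}},
      monoid.mult = (\<lambda>f g n. \<Union>x\<in>Pi UNIV f. \<Union>y\<in>Pi UNIV g.
                \<Gamma>' n +>\<^bsub>R\<^esub> (\<Oplus>\<^bsub>R\<^esub>i\<in>{..n}. x i \<otimes>\<^bsub>R\<^esub> y (n - i))),
      one = (\<lambda>i. if i = 0 then \<Gamma>' 0 +>\<^bsub>R\<^esub> \<one>\<^bsub>R\<^esub> else \<Gamma>' i),
      ring.zero = \<Gamma>',
      add = (\<lambda>f g i. f i <+>\<^bsub>R\<^esub> g i)\<rparr>)"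

end

theory Submission
  imports Defs
begin

text \<open>The proof compares growth. Write \<open>A = R/I\<close> and \<open>N = J\<^sub>2/J\<^sub>1\<close> with the filtrations induced by a filtration
  \<open>\<Gamma>\<close> whose associated graded ring is left noetherian, and let \<open>a n\<close> and \<open>\<nu> n\<close> be the dimensions of their \<open>n\<close>-th terms.
  The ring of fractions is \<open>Q = M\<^sub>r(D)\<close> for a division ring \<open>D = e Q e\<close>, so that \<open>A\<close> has rank \<open>r\<close> on both sides.

  On the right, \<open>N \<otimes>\<^sub>A Q\<close> has length at least \<open>s + 1\<close>. Clearing denominators turns this into an embedding of
  \<open>A\<^bsup>s+1\<^esup>\<close> into \<open>N\<^sup>r\<close> that raises degrees by a bounded amount, hence \<open>(s + 1) a n \<le> r \<nu> (n + d)\<close>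
  (\<open>right_rank_estimate\<close>).

  On the left, \<open>Q \<otimes>\<^sub>A N\<close> has length \<open>s\<close>, which gives a map from \<open>N\<^sup>r\<close> to \<open>A\<^sup>s\<close> whose kernel consists of torsion
  elements. A map of left modules need not be compatible with filtrations, and this is the first use of the noetherian
  condition: \<open>J\<^sub>2\<close> has generators \<open>y\<^sub>j\<close> of degrees \<open>d\<^sub>j\<close> with \<open>J\<^sub>2 \<inter> \<Gamma> n = \<Sum> \<Gamma> (n - d\<^sub>j) y\<^sub>j\<close>
  (\<open>left_ideal_good_generators\<close>), so a left linear map is determined by finitely many values and raises degrees by a bounded
  amount. If \<open>\<theta> n\<close> denotes the dimension of the torsion in the \<open>n\<close>-th term of \<open>N\<close>, then
  \<open>r \<nu> n \<le> r \<theta> n + s a (n + d)\<close> (\<open>left_rank_estimate\<close>).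

  The torsion is negligible: its inverse image in \<open>R\<close> is a left ideal, so it has such generators as well, say \<open>k\<close> of them, each
  killed by a regular element \<open>c\<^sub>j\<close> of \<open>A\<close>. The submodule generated by one of them is a quotient of \<open>A / A c\<^sub>j\<close>, and therefore
  \<open>\<theta> (n + d) \<le> k (a (n + d) - a n)\<close> (\<open>torsion_estimate\<close>).

  Together, \<open>(C + 1) a n \<le> C a (n + d)\<close> for all \<open>n\<close>, with constants \<open>C\<close> and \<open>d\<close>. So \<open>a\<close> grows exponentially, which is
  impossible by an argument of Stephenson and Zhang: a left noetherian graded ring with finite-dimensional components has subexponential
  growth (\<open>subexponential_growth\<close>).

  All dimensions and lengths are lengths of lattices of stable subgroups, with values in the extended natural numbers. This
  single notion covers vector spaces over the base field as well as modules over \<open>Q\<close>.\<close>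

section \<open>Lengths of groups with operators\<close>

definition stable_subgroup ::
  "('g, 'm) monoid_scheme \<Rightarrow> 's set \<Rightarrow> ('s \<Rightarrow> 'g \<Rightarrow> 'g) \<Rightarrow> 'g set \<Rightarrow> bool" where
  "stable_subgroup G S \<sigma> V \<longleftrightarrow> subgroup V G \<and> (\<forall>k\<in>S. \<forall>x\<in>V. \<sigma> k x \<in> V)"

inductive has_chain ::
  "('g, 'm) monoid_scheme \<Rightarrow> 's set \<Rightarrow> ('s \<Rightarrow> 'g \<Rightarrow> 'g) \<Rightarrow> 'g set \<Rightarrow> nat \<Rightarrow> bool"
  for G S \<sigma> where
  zero: "stable_subgroup G S \<sigma> V \<Longrightarrow> has_chain G S \<sigma> V 0"
| Suc: "has_chain G S \<sigma> U n \<Longrightarrow> stable_subgroup G S \<sigma> V \<Longrightarrow> U \<subset> V \<Longrightarrow> has_chain G S \<sigma> V (Suc n)"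

text \<open>With scalars as operators this is the dimension of a subspace; with the elements of a ring as operators it is the length of a
  module. The definition in terms of chains needs neither bases nor composition series.\<close>

definition stable_length ::
  "('g, 'm) monoid_scheme \<Rightarrow> 's set \<Rightarrow> ('s \<Rightarrow> 'g \<Rightarrow> 'g) \<Rightarrow> 'g set \<Rightarrow> enat" where
  "stable_length G S \<sigma> V = Sup {enat n | n. has_chain G S \<sigma> V n}"

lemma has_chain_stable: "has_chain G S \<sigma> V n \<Longrightarrow> stable_subgroup G S \<sigma> V"
  by (induction rule: has_chain.induct)

lemma has_chain_mono:
  "has_chain G S \<sigma> U n \<Longrightarrow> U \<subseteq> V \<Longrightarrow> stable_subgroup G S \<sigma> V \<Longrightarrow> has_chain G S \<sigma> V n"
  by (erule has_chain.cases) (blast intro: has_chain.intros)+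

lemma has_chain_downward:
  assumes "has_chain G S \<sigma> V n" and "m \<le> n" shows "has_chain G S \<sigma> V m"
proof -
  have "has_chain G S \<sigma> V (Suc i) \<Longrightarrow> has_chain G S \<sigma> V i" for i
    by (erule has_chain.cases)
      (auto intro: has_chain_mono)
  with assms(2,1) show ?thesis
    by (induction rule: inc_induct) auto
qed

lemma le_stable_length_iff:
  assumes "stable_subgroup G S \<sigma> V"
  shows "enat n \<le> stable_length G S \<sigma> V \<longleftrightarrow> has_chain G S \<sigma> V n"
proof
  assume *: "enat n \<le> stable_length G S \<sigma> V"
  show "has_chain G S \<sigma> V n"
  proof (cases n)
    case 0 then show ?thesis using assms by (simp add: has_chain.zero)
  next
    case (Suc m)
    have "enat m < stable_length G S \<sigma> V" using * Suc by (simp add: Suc_ile_eq)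
    then obtain i where "has_chain G S \<sigma> V i" "m < i"
      unfolding stable_length_def less_Sup_iff by auto
    then show ?thesis using Suc has_chain_downward[of G S \<sigma> V i n] by simp
  qed
next
  assume "has_chain G S \<sigma> V n"
  then show "enat n \<le> stable_length G S \<sigma> V"
    unfolding stable_length_def by (auto intro!: Sup_upper)
qed

lemma enat_le_by_nat: "(\<And>n. enat n \<le> x \<Longrightarrow> enat n \<le> y) \<Longrightarrow> x \<le> (y::enat)"
proof (rule ccontr)
  assume *: "\<And>n. enat n \<le> x \<Longrightarrow> enat n \<le> y" and "\<not> x \<le> y"
  then obtain m where m: "y = enat m" "enat m < x" by (cases y) auto
  then have "enat (Suc m) \<le> x" by (simp add: Suc_ile_eq)
  from *[OF this] m show False by simp
qed

lemma enat_le_sum_split: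
  fixes x y :: enat
  assumes "enat n \<le> x + y"
  obtains p q where "enat p \<le> x" "enat q \<le> y" "n = p + q"
proof (cases x)
  case (enat a)
  show ?thesis
  proof (rule that[of "min a n" "n - min a n"])
    show "enat (min a n) \<le> x" using enat by simp
    show "enat (n - min a n) \<le> y" using assms enat by (cases y) auto
  qed simp
next
  case infinity
  show ?thesis by (rule that[of n 0]) (use infinity in \<open>auto simp: zero_enat_def[symmetric]\<close>)
qed

lemma sum_le_stable_length:
  assumes "stable_subgroup G S \<sigma> U" and "stable_subgroup H S \<tau> V" and "stable_subgroup L S \<rho> W"
    and "\<And>p q. has_chain G S \<sigma> U p \<Longrightarrow> has_chain H S \<tau> V q \<Longrightarrow> has_chain L S \<rho> W (p + q)"
  shows "stable_length G S \<sigma> U + stable_length H S \<tau> V \<le> stable_length L S \<rho> W"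
proof (rule enat_le_by_nat)
  fix n assume "enat n \<le> stable_length G S \<sigma> U + stable_length H S \<tau> V"
  then obtain p q where "enat p \<le> stable_length G S \<sigma> U" "enat q \<le> stable_length H S \<tau> V" "n = p + q"
    by (rule enat_le_sum_split)
  then show "enat n \<le> stable_length L S \<rho> W"
    using assms by (simp add: le_stable_length_iff)
qed

lemma stable_length_le_sum:
  assumes "stable_subgroup G S \<sigma> U" and "stable_subgroup H S \<tau> V" and "stable_subgroup L S \<rho> W"
    and "\<And>n. has_chain L S \<rho> W n \<Longrightarrow> \<exists>p q. has_chain G S \<sigma> U p \<and> has_chain H S \<tau> V q \<and> n \<le> p + q"
  shows "stable_length L S \<rho> W \<le> stable_length G S \<sigma> U + stable_length H S \<tau> V"
proof (rule enat_le_by_nat)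
  fix n assume "enat n \<le> stable_length L S \<rho> W"
  then have "has_chain L S \<rho> W n" using assms by (simp add: le_stable_length_iff)
  then obtain p q where "has_chain G S \<sigma> U p" "has_chain H S \<tau> V q" "n \<le> p + q"
    using assms by blast
  then have "enat p \<le> stable_length G S \<sigma> U" "enat q \<le> stable_length H S \<tau> V" "enat n \<le> enat p + enat q"
    using assms by (simp_all add: le_stable_length_iff)
  then show "enat n \<le> stable_length G S \<sigma> U + stable_length H S \<tau> V"
    by (meson add_mono order_trans)
qed

lemma stable_length_mono:
  assumes "stable_subgroup G S \<sigma> U" "stable_subgroup G S \<sigma> V" "U \<subseteq> V"
  shows "stable_length G S \<sigma> U \<le> stable_length G S \<sigma> V"
proof (rule enat_le_by_nat)
  fix n assume "enat n \<le> stable_length G S \<sigma> U"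
  then have "has_chain G S \<sigma> U n" using assms(1) by (simp add: le_stable_length_iff)
  then have "has_chain G S \<sigma> V n" using assms(3,2) by (rule has_chain_mono)
  then show "enat n \<le> stable_length G S \<sigma> V" using assms(2) by (simp add: le_stable_length_iff)
qed

locale operator_group = comm_group G for G :: "('g, 'm) monoid_scheme" (structure) +
  fixes S :: "'s set" and \<sigma> :: "'s \<Rightarrow> 'g \<Rightarrow> 'g"
  assumes operator_hom: "k \<in> S \<Longrightarrow> \<sigma> k \<in> hom G G"
begin

abbreviation stable :: "'g set \<Rightarrow> bool" where
  "stable \<equiv> stable_subgroup G S \<sigma>"

abbreviation len :: "'g set \<Rightarrow> enat" where
  "len \<equiv> stable_length G S \<sigma>"

lemma stable_subset: "stable V \<Longrightarrow> x \<in> V \<Longrightarrow> x \<in> carrier G"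
  by (auto simp: stable_subgroup_def dest: subgroup.mem_carrier)

lemma stable_mult: "stable V \<Longrightarrow> x \<in> V \<Longrightarrow> y \<in> V \<Longrightarrow> x \<otimes> y \<in> V"
  by (auto simp: stable_subgroup_def intro: subgroup.m_closed)

lemma stable_inv: "stable V \<Longrightarrow> x \<in> V \<Longrightarrow> inv x \<in> V"
  by (auto simp: stable_subgroup_def intro: subgroup.m_inv_closed)

lemma stable_one: "stable V \<Longrightarrow> \<one> \<in> V"
  by (auto simp: stable_subgroup_def intro: subgroup.one_closed)

lemma stable_op: "stable V \<Longrightarrow> k \<in> S \<Longrightarrow> x \<in> V \<Longrightarrow> \<sigma> k x \<in> V"
  by (auto simp: stable_subgroup_def)

lemma op_mult: "k \<in> S \<Longrightarrow> x \<in> carrier G \<Longrightarrow> y \<in> carrier G \<Longrightarrow> \<sigma> k (x \<otimes> y) = \<sigma> k x \<otimes> \<sigma> k y"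
  using operator_hom by (auto simp: hom_def)

lemma op_one: "k \<in> S \<Longrightarrow> \<sigma> k \<one> = \<one>"
  using operator_hom by (metis hom_one is_group)

lemma stableI:
  assumes "V \<subseteq> carrier G" "\<one> \<in> V" "\<And>x y. x \<in> V \<Longrightarrow> y \<in> V \<Longrightarrow> x \<otimes> y \<in> V"
    "\<And>x. x \<in> V \<Longrightarrow> inv x \<in> V" "\<And>k x. k \<in> S \<Longrightarrow> x \<in> V \<Longrightarrow> \<sigma> k x \<in> V"
  shows "stable V"
  using assms by (auto simp: stable_subgroup_def intro!: subgroup.intro)

lemma stable_trivial: "stable {\<one>}"
  by (rule stableI) (auto simp: op_one)

lemma len_trivial: "len {\<one>} = 0"
proof -
  have "\<not> has_chain G S \<sigma> {\<one>} (Suc 0)"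
  proof
    assume "has_chain G S \<sigma> {\<one>} (Suc 0)"
    then obtain U where "has_chain G S \<sigma> U 0" "U \<subset> {\<one>}"
      by (cases rule: has_chain.cases) auto
    then show False using stable_one[OF has_chain_stable] by blast
  qed
  then have "\<not> enat (Suc 0) \<le> len {\<one>}"
    by (simp add: le_stable_length_iff stable_trivial)
  then show ?thesis
    by (metis Suc_ile_eq not_gr_zero zero_enat_def)
qed

lemma stable_Int:
  assumes "stable U" and "stable V" shows "stable (U \<inter> V)"
  by (rule stableI)
    (use stable_one[OF assms(1)] stable_mult[OF assms(1)] stable_inv[OF assms(1)]
      stable_op[OF assms(1)] stable_subset[OF assms(1)]
      stable_one[OF assms(2)] stable_mult[OF assms(2)] stable_inv[OF assms(2)]
      stable_op[OF assms(2)] in auto)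

lemma mem_set_mult: "x \<in> U <#> V \<longleftrightarrow> (\<exists>u\<in>U. \<exists>v\<in>V. x = u \<otimes> v)"
  by (auto simp: set_mult_def)

lemma set_multI: "u \<in> U \<Longrightarrow> v \<in> V \<Longrightarrow> u \<otimes> v \<in> U <#> V"
  by (auto simp: set_mult_def)

lemma set_multE:
  assumes "x \<in> U <#> V" obtains u v where "u \<in> U" "v \<in> V" "x = u \<otimes> v"
  using assms by (auto simp: set_mult_def)

lemma stable_set_mult:
  assumes U: "stable U" and V: "stable V" shows "stable (U <#> V)"
proof (rule stableI)
  note c = stable_subset[OF U] stable_subset[OF V]
  show "U <#> V \<subseteq> carrier G" using c by (auto simp: mem_set_mult)
  show "\<one> \<in> U <#> V" using set_multI[OF stable_one[OF U] stable_one[OF V]] by simp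
  show "x \<otimes> y \<in> U <#> V" if "x \<in> U <#> V" "y \<in> U <#> V" for x y
  proof -
    obtain u v u' v' where *: "u \<in> U" "v \<in> V" "x = u \<otimes> v" "u' \<in> U" "v' \<in> V" "y = u' \<otimes> v'"
      using \<open>x \<in> U <#> V\<close> \<open>y \<in> U <#> V\<close> by (auto simp: mem_set_mult)
    then have "x \<otimes> y = (u \<otimes> u') \<otimes> (v \<otimes> v')" using c by (simp add: m_ac)
    then show ?thesis using * U V by (auto intro: set_multI stable_mult)
  qed
  show "inv x \<in> U <#> V" if "x \<in> U <#> V" for x
  proof -
    obtain u v where *: "u \<in> U" "v \<in> V" "x = u \<otimes> v" using \<open>x \<in> U <#> V\<close> by (rule set_multE)
    then have "inv x = inv u \<otimes> inv v" using c by (simp add: inv_mult)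
    then show ?thesis using * U V by (auto intro: set_multI stable_inv)
  qed
  show "\<sigma> k x \<in> U <#> V" if "k \<in> S" "x \<in> U <#> V" for k x
  proof -
    obtain u v where *: "u \<in> U" "v \<in> V" "x = u \<otimes> v"
      using \<open>x \<in> U <#> V\<close> by (rule set_multE)
    then have "\<sigma> k x = \<sigma> k u \<otimes> \<sigma> k v" using c that by (simp add: op_mult)
    then show ?thesis using * U V that by (auto intro: set_multI stable_op)
  qed
qed

lemma set_mult_least: "stable W \<Longrightarrow> U \<subseteq> W \<Longrightarrow> V \<subseteq> W \<Longrightarrow> U <#> V \<subseteq> W"
  unfolding set_mult_def by (blast intro: stable_mult)

lemma subset_set_mult1: "stable U \<Longrightarrow> stable V \<Longrightarrow> U \<subseteq> U <#> V"
  using set_multI[OF _ stable_one, of _ U V] stable_subset[of U] by fastforce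

lemma subset_set_mult2: "stable U \<Longrightarrow> stable V \<Longrightarrow> V \<subseteq> U <#> V"
  using set_multI[OF stable_one, of U _ V] stable_subset[of V] by fastforce

text \<open>Subadditivity rests on the modular law: if \<open>W' \<subset> W \<subseteq> UV\<close>, then one of the inclusions
  \<open>W' \<inter> U \<subseteq> W \<inter> U\<close> and \<open>W'U \<inter> V \<subseteq> WU \<inter> V\<close> is strict.\<close>

lemma len_set_mult_le:
  assumes U: "stable U" and V: "stable V"
  shows "len (U <#> V) \<le> len U + len V"
proof (rule stable_length_le_sum[OF U V stable_set_mult[OF U V]])
  have main: "\<exists>p q. has_chain G S \<sigma> (W \<inter> U) p \<and> has_chain G S \<sigma> ((W <#> U) \<inter> V) q \<and> n \<le> p + q"
    if "has_chain G S \<sigma> W n" "W \<subseteq> U <#> V" for W n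
    using that
  proof (induction rule: has_chain.induct)
    case (zero W)
    then show ?case
      by (auto intro!: exI[of _ 0] has_chain.zero stable_Int stable_set_mult U V)
  next
    case (Suc W' n W)
    have W': "stable W'" using Suc.hyps(1) by (rule has_chain_stable)
    obtain p q where p: "has_chain G S \<sigma> (W' \<inter> U) p" and q: "has_chain G S \<sigma> ((W' <#> U) \<inter> V) q"
      and n: "n \<le> p + q" using Suc by auto
    have le: "W' \<inter> U \<subseteq> W \<inter> U" "(W' <#> U) \<inter> V \<subseteq> (W <#> U) \<inter> V"
      using Suc.hyps(3) unfolding set_mult_def by blast+
    have st: "stable (W \<inter> U)" "stable ((W <#> U) \<inter> V)"
      using Suc.hyps by (auto intro!: stable_Int stable_set_mult U V)
    show ?case
    proof (cases "W' \<inter> U = W \<inter> U")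
      case False
      then have "has_chain G S \<sigma> (W \<inter> U) (Suc p)" using p le st by (auto intro!: has_chain.Suc)
      moreover have "has_chain G S \<sigma> ((W <#> U) \<inter> V) q" using q le st has_chain_mono by blast
      ultimately show ?thesis using n by (metis Suc_le_mono add_Suc)
    next
      case True
      have "(W' <#> U) \<inter> V \<noteq> (W <#> U) \<inter> V"
      proof
        assume eq: "(W' <#> U) \<inter> V = (W <#> U) \<inter> V"
        have "W \<subseteq> W'"
        proof
          fix x assume x: "x \<in> W"
          then have "x \<in> U <#> V" using Suc.prems by blast
          then obtain u v where uv: "u \<in> U" "v \<in> V" "x = u \<otimes> v" by (rule set_multE)
          have c: "x \<in> carrier G" "u \<in> carrier G" "v \<in> carrier G"
            using uv U V by (auto intro: stable_subset)
          have "x \<otimes> inv u = v" using c uv by (metis inv_solve_right m_comm)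
          then have "v \<in> (W <#> U) \<inter> V" using x uv U set_multI stable_inv by blast
          then obtain w u' where w: "w \<in> W'" "u' \<in> U" "v = w \<otimes> u'"
            using eq by (blast elim: set_multE)
          have c': "w \<in> carrier G" "u' \<in> carrier G" using w U W' by (auto intro: stable_subset)
          have "x = w \<otimes> (u' \<otimes> u)" using c c' uv w by (simp add: m_ac)
          moreover have wW: "w \<in> W" using w Suc.hyps by auto
          ultimately have "u' \<otimes> u = inv w \<otimes> x" using c c' by (simp add: inv_solve_left)
          then have "u' \<otimes> u \<in> W"
            using stable_mult[OF Suc.hyps(2) stable_inv[OF Suc.hyps(2) wW] x] by simp
          then have "u' \<otimes> u \<in> W \<inter> U" using stable_mult[OF U w(2) uv(1)] by simp
          then have "u' \<otimes> u \<in> W'" using True by auto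
          then show "x \<in> W'" using \<open>x = w \<otimes> (u' \<otimes> u)\<close> w W' by (auto intro: stable_mult)
        qed
        then show False using Suc.hyps by auto
      qed
      then have "has_chain G S \<sigma> ((W <#> U) \<inter> V) (Suc q)" using q le st by (auto intro!: has_chain.Suc)
      moreover have "has_chain G S \<sigma> (W \<inter> U) p" using p True by simp
      ultimately show ?thesis using n by (metis Suc_le_mono add_Suc_right)
    qed
  qed
  fix n assume "has_chain G S \<sigma> (U <#> V) n"
  from main[OF this] obtain p q where "has_chain G S \<sigma> ((U <#> V) \<inter> U) p"
    "has_chain G S \<sigma> (((U <#> V) <#> U) \<inter> V) q" "n \<le> p + q" by auto
  then show "\<exists>p q. has_chain G S \<sigma> U p \<and> has_chain G S \<sigma> V q \<and> n \<le> p + q"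
    by (meson U V Int_lower2 has_chain_mono)
qed

end

text \<open>Linearity is required on the stable subgroup \<open>V\<close> only: the maps of interest are restricted to terms of a filtration, and these remain
  subgroups of one ambient group instead of becoming structures of their own.\<close>

locale linear_on = G: operator_group G S \<sigma> + H: operator_group H S \<tau>
  for G :: "('g, 'm) monoid_scheme" and S :: "'s set" and \<sigma>
    and H :: "('h, 'n) monoid_scheme" and \<tau> +
  fixes V :: "'g set" and f :: "'g \<Rightarrow> 'h"
  assumes stable_domain: "stable_subgroup G S \<sigma> V"
    and map_closed: "x \<in> V \<Longrightarrow> f x \<in> carrier H"
    and map_mult: "x \<in> V \<Longrightarrow> y \<in> V \<Longrightarrow> f (x \<otimes>\<^bsub>G\<^esub> y) = f x \<otimes>\<^bsub>H\<^esub> f y"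
    and map_op: "k \<in> S \<Longrightarrow> x \<in> V \<Longrightarrow> f (\<sigma> k x) = \<tau> k (f x)"
begin

lemma map_one: "f \<one>\<^bsub>G\<^esub> = \<one>\<^bsub>H\<^esub>"
proof -
  have 1: "\<one>\<^bsub>G\<^esub> \<in> V" using stable_domain by (rule G.stable_one)
  then have "f \<one>\<^bsub>G\<^esub> \<otimes>\<^bsub>H\<^esub> f \<one>\<^bsub>G\<^esub> = f \<one>\<^bsub>G\<^esub>" using map_mult[OF 1 1] by simp
  then show ?thesis using map_closed[OF 1] H.l_cancel_one by blast
qed

lemma map_inv: assumes "x \<in> V" shows "f (inv\<^bsub>G\<^esub> x) = inv\<^bsub>H\<^esub> (f x)"
proof -
  have i: "inv\<^bsub>G\<^esub> x \<in> V" and c: "x \<in> carrier G"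
    using G.stable_inv[OF stable_domain] G.stable_subset[OF stable_domain] assms by auto
  have "f (inv\<^bsub>G\<^esub> x) \<otimes>\<^bsub>H\<^esub> f x = \<one>\<^bsub>H\<^esub>"
    using map_mult[OF i assms] c map_one by simp
  then show ?thesis using map_closed[OF i] map_closed[OF assms] by (simp add: H.inv_equality)
qed

lemma stable_vimage:
  assumes "stable_subgroup H S \<tau> W" shows "stable_subgroup G S \<sigma> (V \<inter> f -` W)"
  by (rule G.stableI)
    (use G.stable_one[OF stable_domain] G.stable_mult[OF stable_domain] G.stable_inv[OF stable_domain]
      G.stable_op[OF stable_domain] G.stable_subset[OF stable_domain]
      H.stable_one[OF assms] H.stable_mult[OF assms] H.stable_inv[OF assms] H.stable_op[OF assms]
      in \<open>auto simp: map_one map_mult map_inv map_op\<close>)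

lemma stable_image:
  assumes U: "stable_subgroup G S \<sigma> U" "U \<subseteq> V" shows "stable_subgroup H S \<tau> (f ` U)"
proof -
  have *: "x \<in> U \<Longrightarrow> x \<in> V" for x using U(2) by blast
  show ?thesis
  proof (rule H.stableI)
    show "f ` U \<subseteq> carrier H" using * map_closed by blast
    show "\<one>\<^bsub>H\<^esub> \<in> f ` U" using imageI[OF G.stable_one[OF U(1)], of f] by (simp add: map_one)
    fix x assume "x \<in> f ` U"
    then obtain u where u: "u \<in> U" "x = f u" by blast
    show "inv\<^bsub>H\<^esub> x \<in> f ` U"
      using imageI[OF G.stable_inv[OF U(1) u(1)], of f] u * by (simp add: map_inv)
    show "\<tau> k x \<in> f ` U" if "k \<in> S" for k
      using imageI[OF G.stable_op[OF U(1) that u(1)], of f] u * that by (simp add: map_op)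
    fix y assume "y \<in> f ` U"
    then obtain v where v: "v \<in> U" "y = f v" by blast
    show "x \<otimes>\<^bsub>H\<^esub> y \<in> f ` U"
      using imageI[OF G.stable_mult[OF U(1) u(1) v(1)], of f] u v * by (simp add: map_mult)
  qed
qed

lemma stable_kernel: "stable_subgroup G S \<sigma> (V \<inter> f -` {\<one>\<^bsub>H\<^esub>})"
  by (rule stable_vimage) (rule H.stable_trivial)

lemma restrict: "stable_subgroup G S \<sigma> U \<Longrightarrow> U \<subseteq> V \<Longrightarrow> linear_on G S \<sigma> H \<tau> U f"
  by (intro linear_on.intro linear_on_axioms.intro G.operator_group_axioms H.operator_group_axioms)
    (use map_closed map_mult map_op in \<open>simp_all add: subset_iff\<close>)

text \<open>For a chain in \<open>V\<close>, each strict inclusion \<open>W' \<subset> W\<close> remains strict after intersection with the kernel or after taking images. This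
  is one half of the rank-nullity formula; \<open>kernel_image_le_length\<close> is the other.\<close>

lemma length_le_kernel_image:
  "stable_length G S \<sigma> V
     \<le> stable_length G S \<sigma> (V \<inter> f -` {\<one>\<^bsub>H\<^esub>}) + stable_length H S \<tau> (f ` V)"
proof (rule stable_length_le_sum[OF stable_kernel stable_image[OF stable_domain order.refl] stable_domain])
  have main: "\<exists>p q. has_chain G S \<sigma> (W \<inter> f -` {\<one>\<^bsub>H\<^esub>}) p \<and> has_chain H S \<tau> (f ` W) q \<and> n \<le> p + q"
    if "has_chain G S \<sigma> W n" "W \<subseteq> V" for W n
    using that
  proof (induction rule: has_chain.induct)
    case (zero W)
    interpret W: linear_on G S \<sigma> H \<tau> W f using zero by (rule restrict)
    show ?case using zero by (auto intro!: exI[of _ 0] has_chain.zero W.stable_kernel stable_image)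
  next
    case (Suc W' n W)
    have W': "stable_subgroup G S \<sigma> W'" using Suc.hyps(1) by (rule has_chain_stable)
    interpret W: linear_on G S \<sigma> H \<tau> W f using Suc by (intro restrict)
    obtain p q where p: "has_chain G S \<sigma> (W' \<inter> f -` {\<one>\<^bsub>H\<^esub>}) p" and q: "has_chain H S \<tau> (f ` W') q"
      and n: "n \<le> p + q" using Suc by auto
    have le: "W' \<inter> f -` {\<one>\<^bsub>H\<^esub>} \<subseteq> W \<inter> f -` {\<one>\<^bsub>H\<^esub>}" "f ` W' \<subseteq> f ` W" using Suc.hyps by auto
    have st: "stable_subgroup G S \<sigma> (W \<inter> f -` {\<one>\<^bsub>H\<^esub>})" "stable_subgroup H S \<tau> (f ` W)"
      using W.stable_kernel W.stable_image[OF W.stable_domain order.refl] by auto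
    show ?case
    proof (cases "f ` W' = f ` W")
      case False
      then have "has_chain H S \<tau> (f ` W) (Suc q)" using q le st by (auto intro!: has_chain.Suc)
      moreover have "has_chain G S \<sigma> (W \<inter> f -` {\<one>\<^bsub>H\<^esub>}) p" using p le st has_chain_mono by blast
      ultimately show ?thesis using n by (metis Suc_le_mono add_Suc_right)
    next
      case True
      have "W' \<inter> f -` {\<one>\<^bsub>H\<^esub>} \<noteq> W \<inter> f -` {\<one>\<^bsub>H\<^esub>}"
      proof
        assume eq: "W' \<inter> f -` {\<one>\<^bsub>H\<^esub>} = W \<inter> f -` {\<one>\<^bsub>H\<^esub>}"
        have "W \<subseteq> W'"
        proof
          fix x assume x: "x \<in> W"
          then obtain y where y: "y \<in> W'" "f x = f y" using True by (metis imageE imageI)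
          then have yW: "y \<in> W" using Suc.hyps by auto
          have c: "x \<in> carrier G" "y \<in> carrier G" using x yW Suc.hyps(2) G.stable_subset by auto
          have "f (x \<otimes>\<^bsub>G\<^esub> inv\<^bsub>G\<^esub> y) = \<one>\<^bsub>H\<^esub>"
            using x y yW by (simp add: W.map_mult W.map_inv G.stable_inv[OF W.stable_domain] W.map_closed)
          then have "x \<otimes>\<^bsub>G\<^esub> inv\<^bsub>G\<^esub> y \<in> W'"
            using eq x yW G.stable_mult[OF Suc.hyps(2)] G.stable_inv[OF Suc.hyps(2)] by auto
          then have "(x \<otimes>\<^bsub>G\<^esub> inv\<^bsub>G\<^esub> y) \<otimes>\<^bsub>G\<^esub> y \<in> W'" using y G.stable_mult[OF W'] by auto
          then show "x \<in> W'" using c by (simp add: G.m_assoc)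
        qed
        then show False using Suc.hyps by auto
      qed
      then have "has_chain G S \<sigma> (W \<inter> f -` {\<one>\<^bsub>H\<^esub>}) (Suc p)" using p le st by (auto intro!: has_chain.Suc)
      moreover have "has_chain H S \<tau> (f ` W) q" using q True by simp
      ultimately show ?thesis using n by (metis Suc_le_mono add_Suc)
    qed
  qed
  fix n assume "has_chain G S \<sigma> V n"
  then show "\<exists>p q. has_chain G S \<sigma> (V \<inter> f -` {\<one>\<^bsub>H\<^esub>}) p \<and> has_chain H S \<tau> (f ` V) q \<and> n \<le> p + q"
    by (rule main) simp
qed

end

text \<open>If the value of \<open>h\<close> at \<open>v \<in> V\<close> is determined by the class of \<open>g v\<close> modulo \<open>Y\<close>, then a chain
  in \<open>h V\<close> can be pulled back to \<open>V\<close>, pushed to \<open>g V\<close> and put on top of a chain in \<open>Y\<close>.\<close>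

lemma length_add_le_of_determined:
  fixes G :: "('g, 'm) monoid_scheme" and H :: "('h, 'n) monoid_scheme" and L :: "('l, 'o) monoid_scheme"
  assumes "linear_on G S \<sigma> H \<tau> V g" and "linear_on G S \<sigma> L \<rho> V h"
    and Y: "stable_subgroup H S \<tau> Y"
    and det: "\<And>v. v \<in> V \<Longrightarrow> g v \<in> Y \<Longrightarrow> h v = \<one>\<^bsub>L\<^esub>"
  shows "stable_length H S \<tau> Y + stable_length L S \<rho> (h ` V)
           \<le> stable_length H S \<tau> (set_mult H Y (g ` V))"
proof -
  interpret g: linear_on G S \<sigma> H \<tau> V g by fact
  interpret h: linear_on G S \<sigma> L \<rho> V h by fact
  note V = g.stable_domain
  have sg: "stable_subgroup H S \<tau> (set_mult H Y (g ` (V \<inter> h -` W)))" if "stable_subgroup L S \<rho> W" for W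
    by (intro g.H.stable_set_mult Y g.stable_image h.stable_vimage that) auto
  have main: "has_chain H S \<tau> (set_mult H Y (g ` (V \<inter> h -` W))) (p + q)"
    if "has_chain L S \<rho> W q" "W \<subseteq> h ` V" "has_chain H S \<tau> Y p" for W p q
    using that
  proof (induction rule: has_chain.induct)
    case (zero W)
    have "stable_subgroup H S \<tau> (g ` (V \<inter> h -` W))"
      using zero by (intro g.stable_image h.stable_vimage) auto
    then show ?case using zero
      by (auto intro!: has_chain_mono[OF zero.prems(2)] sg dest: g.H.subset_set_mult1[OF Y])
  next
    case (Suc W' q W)
    have W': "stable_subgroup L S \<rho> W'" using Suc.hyps(1) by (rule has_chain_stable)
    have IH: "has_chain H S \<tau> (set_mult H Y (g ` (V \<inter> h -` W'))) (p + q)" using Suc by auto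
    have le: "set_mult H Y (g ` (V \<inter> h -` W')) \<subseteq> set_mult H Y (g ` (V \<inter> h -` W))"
      using Suc.hyps(3) unfolding set_mult_def by blast
    obtain v where v: "v \<in> V" "h v \<in> W" "h v \<notin> W'" using Suc by blast
    have "g v \<notin> set_mult H Y (g ` (V \<inter> h -` W'))"
    proof
      assume "g v \<in> set_mult H Y (g ` (V \<inter> h -` W'))"
      then obtain x v' where *: "x \<in> Y" "v' \<in> V" "h v' \<in> W'" "g v = x \<otimes>\<^bsub>H\<^esub> g v'"
        by (auto simp: g.H.mem_set_mult)
      have c: "x \<in> carrier H" using * Y g.H.stable_subset by auto
      let ?w = "v \<otimes>\<^bsub>G\<^esub> inv\<^bsub>G\<^esub> v'"
      have iv: "inv\<^bsub>G\<^esub> v' \<in> V" using * V by (auto intro: g.G.stable_inv)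
      then have w: "?w \<in> V" using v V by (auto intro: g.G.stable_mult)
      have "g ?w = x" using * v c iv
        by (simp add: g.map_mult g.map_inv g.map_closed g.H.m_assoc)
      then have "h ?w = \<one>\<^bsub>L\<^esub>" using det w * by simp
      then have "h v \<otimes>\<^bsub>L\<^esub> inv\<^bsub>L\<^esub> (h v') = \<one>\<^bsub>L\<^esub>"
        using * v iv by (simp add: h.map_mult h.map_inv)
      then have "h v = h v'" using * v h.map_closed
        by (metis h.H.inv_closed h.H.inv_equality h.H.inv_inv)
      then show False using * v by simp
    qed
    moreover have "g v \<in> set_mult H Y (g ` (V \<inter> h -` W))"
    proof -
      have "g v \<in> g ` (V \<inter> h -` W)" using v by blast
      from g.H.set_multI[OF g.H.stable_one[OF Y] this] show ?thesis
        using g.map_closed[OF v(1)] by simp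
    qed
    ultimately show ?case using IH le sg[OF Suc.hyps(2)]
      by (auto intro!: has_chain.Suc)
  qed
  have full: "V \<inter> h -` h ` V = V" by auto
  show ?thesis
  proof (rule sum_le_stable_length[OF Y h.stable_image[OF V order.refl]])
    show "stable_subgroup H S \<tau> (set_mult H Y (g ` V))"
      using sg[OF h.stable_image[OF V order.refl]] full by simp
    show "has_chain H S \<tau> (set_mult H Y (g ` V)) (p + q)"
      if "has_chain H S \<tau> Y p" "has_chain L S \<rho> (h ` V) q" for p q
      using main[OF that(2) order.refl that(1)] full by simp
  qed
qed

lemma (in operator_group) linear_on_id: "stable V \<Longrightarrow> linear_on G S \<sigma> G \<sigma> V (\<lambda>x. x)"
  by (intro linear_on.intro linear_on_axioms.intro operator_group_axioms) (auto dest: stable_subset)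

context linear_on
begin

lemma kernel_image_le_length:
  "stable_length G S \<sigma> (V \<inter> f -` {\<one>\<^bsub>H\<^esub>}) + stable_length H S \<tau> (f ` V) \<le> stable_length G S \<sigma> V"
proof -
  have "stable_length G S \<sigma> (V \<inter> f -` {\<one>\<^bsub>H\<^esub>}) + stable_length H S \<tau> (f ` V)
      \<le> stable_length G S \<sigma> (set_mult G (V \<inter> f -` {\<one>\<^bsub>H\<^esub>}) ((\<lambda>x. x) ` V))"
    by (rule length_add_le_of_determined[OF G.linear_on_id[OF stable_domain] linear_on_axioms stable_kernel])
      auto
  also have "\<dots> \<le> stable_length G S \<sigma> V"
    using G.set_mult_least[OF stable_domain]
    by (intro stable_length_mono G.stable_set_mult stable_kernel) (simp_all add: stable_domain)
  finally show ?thesis .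
qed

lemma length_image_le: "stable_length H S \<tau> (f ` V) \<le> stable_length G S \<sigma> V"
  by (rule order_trans[OF _ kernel_image_le_length]) (simp add: add_increasing)

lemma length_le_image:
  assumes "\<And>x. x \<in> V \<Longrightarrow> f x = \<one>\<^bsub>H\<^esub> \<Longrightarrow> x = \<one>\<^bsub>G\<^esub>"
  shows "stable_length G S \<sigma> V \<le> stable_length H S \<tau> (f ` V)"
proof -
  have eq: "V \<inter> f -` {\<one>\<^bsub>H\<^esub>} = {\<one>\<^bsub>G\<^esub>}"
  proof (intro subset_antisym subsetI)
    fix x assume "x \<in> V \<inter> f -` {\<one>\<^bsub>H\<^esub>}"
    then show "x \<in> {\<one>\<^bsub>G\<^esub>}" using assms[of x] by simp
  next
    fix x assume "x \<in> {\<one>\<^bsub>G\<^esub>}"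
    then show "x \<in> V \<inter> f -` {\<one>\<^bsub>H\<^esub>}" using map_one G.stable_one[OF stable_domain] by simp
  qed
  show ?thesis using length_le_kernel_image unfolding eq G.len_trivial by (simp only: add_0)
qed

end

context operator_group
begin

definition family_product :: "(nat \<Rightarrow> 'g set) \<Rightarrow> nat \<Rightarrow> 'g set" where
  "family_product U k = {finprod G v {..<k} | v. \<forall>j<k. v j \<in> U j}"

lemma family_product_0: "family_product U 0 = {\<one>}"
  by (auto simp: family_product_def)

lemma finprod_lessThan_Suc:
  "(\<And>j. j \<le> k \<Longrightarrow> v j \<in> carrier G) \<Longrightarrow> finprod G v {..<Suc k} = finprod G v {..<k} \<otimes> v k"
  by (subst lessThan_Suc, subst finprod_insert) (auto simp: m_comm)

lemma family_product_Suc: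
  assumes "\<And>j. j \<le> k \<Longrightarrow> U j \<subseteq> carrier G"
  shows "family_product U (Suc k) = family_product U k <#> U k"
proof (intro subset_antisym subsetI)
  fix x assume "x \<in> family_product U (Suc k)"
  then obtain v where v: "\<forall>j<Suc k. v j \<in> U j" "x = finprod G v {..<Suc k}"
    by (auto simp: family_product_def)
  then have "x = finprod G v {..<k} \<otimes> v k"
    using assms by (subst finprod_lessThan_Suc[symmetric]) (auto simp: less_Suc_eq_le)
  then show "x \<in> family_product U k <#> U k"
    using v by (auto simp: family_product_def intro!: set_multI)
next
  fix x assume "x \<in> family_product U k <#> U k"
  then obtain y z where "y \<in> family_product U k" "z \<in> U k" "x = y \<otimes> z" by (rule set_multE)
  then obtain v where v: "\<forall>j<k. v j \<in> U j" "x = finprod G v {..<k} \<otimes> z" and z: "z \<in> U k"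
    by (auto simp: family_product_def)
  define w where "w = (\<lambda>j. if j = k then z else v j)"
  have vc: "v j \<in> carrier G" if "j < k" for j using v(1) assms[of j] that by auto
  have zc: "z \<in> carrier G" using z assms[of k] by auto
  have "finprod G w {..<Suc k} = finprod G w {..<k} \<otimes> w k"
    using vc zc by (intro finprod_lessThan_Suc) (auto simp: w_def)
  also have "finprod G w {..<k} = finprod G v {..<k}"
    using vc by (intro finprod_cong') (auto simp: w_def)
  finally have "x = finprod G w {..<Suc k}" using v by (simp add: w_def)
  moreover have "\<forall>j<Suc k. w j \<in> U j" using v z by (simp add: less_Suc_eq w_def)
  ultimately show "x \<in> family_product U (Suc k)" unfolding family_product_def by blast
qed

lemma family_product_subset:
  "(\<And>j. j < k \<Longrightarrow> U j \<subseteq> W) \<Longrightarrow> stable W \<Longrightarrow> family_product U k \<subseteq> W"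
proof (induction k)
  case 0 then show ?case by (simp add: family_product_0 stable_one)
next
  case (Suc k)
  have "U j \<subseteq> carrier G" if "j \<le> k" for j
    using Suc.prems(1)[of j] that stable_subset[OF Suc.prems(2)] by auto
  then show ?case using Suc set_mult_least[OF Suc.prems(2)] by (simp add: family_product_Suc)
qed

lemma stable_family_product:
  "(\<And>j. j < k \<Longrightarrow> stable (U j)) \<Longrightarrow> stable (family_product U k)"
proof (induction k)
  case 0 then show ?case by (simp add: family_product_0 stable_trivial)
next
  case (Suc k)
  have "U j \<subseteq> carrier G" if "j \<le> k" for j
    using stable_subset[OF Suc.prems[of j]] that by auto
  then show ?case using Suc by (simp add: family_product_Suc stable_set_mult)
qed

lemma len_family_product_le:
  "(\<And>j. j < k \<Longrightarrow> stable (U j)) \<Longrightarrow> len (family_product U k) \<le> (\<Sum>j<k. len (U j))"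
proof (induction k)
  case 0 then show ?case by (simp add: family_product_0 len_trivial)
next
  case (Suc k)
  have "U j \<subseteq> carrier G" if "j \<le> k" for j
    using stable_subset[OF Suc.prems[of j]] that by auto
  then have "len (family_product U (Suc k)) \<le> len (family_product U k) + len (U k)"
    using Suc.prems by (simp add: family_product_Suc len_set_mult_le stable_family_product)
  also have "\<dots> \<le> (\<Sum>j<k. len (U j)) + len (U k)" using Suc by (intro add_right_mono) auto
  finally show ?case by simp
qed

end

text \<open>The numerical form of an embedding that is known only through its consequences: if the sum of the \<open>g\<^sub>j v\<^sub>j\<close> determines
  every \<open>h\<^sub>j v\<^sub>j\<close>, then the direct sum of the \<open>h\<^sub>j V\<^sub>j\<close> is a subquotient of \<open>Y\<close>. The summands are split off one at a time
  by \<open>length_add_le_of_determined\<close>.\<close>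

lemma sum_length_le_of_determined:
  fixes G :: "('g, 'm) monoid_scheme" and H :: "('h, 'n) monoid_scheme" and L :: "('l, 'o) monoid_scheme"
    and k :: nat
  assumes H: "operator_group H S \<tau>" and L: "operator_group L S \<rho>"
    and g: "\<And>j. j < k \<Longrightarrow> linear_on G S \<sigma> H \<tau> (V j) (g j)"
    and h: "\<And>j. j < k \<Longrightarrow> linear_on G S \<sigma> L \<rho> (V j) (h j)"
    and det: "\<And>v j. \<forall>j<k. v j \<in> V j \<Longrightarrow> finprod H (\<lambda>j. g j (v j)) {..<k} = \<one>\<^bsub>H\<^esub> \<Longrightarrow> j < k
      \<Longrightarrow> h j (v j) = \<one>\<^bsub>L\<^esub>"
    and Y: "stable_subgroup H S \<tau> Y" "\<And>j. j < k \<Longrightarrow> g j ` V j \<subseteq> Y"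
  shows "(\<Sum>j<k. stable_length L S \<rho> (h j ` V j)) \<le> stable_length H S \<tau> Y"
proof -
  interpret H: operator_group H S \<tau> by fact
  interpret L: operator_group L S \<rho> by fact
  define U where "U j = g j ` V j" for j
  have U: "stable_subgroup H S \<tau> (U j)" if "j < k" for j
    unfolding U_def using linear_on.stable_image[OF g[OF that] linear_on.stable_domain[OF g[OF that]]] by simp
  have main: "(\<Sum>j<i. stable_length L S \<rho> (h j ` V j)) \<le> H.len (H.family_product U i)" if "i \<le> k" for i
    using that
  proof (induction i)
    case 0 then show ?case by simp
  next
    case (Suc i)
    have i: "i < k" using Suc by simp
    have sub: "U j \<subseteq> carrier H" if "j < k" for j
      using H.stable_subset[OF U[OF that]] by auto
    note gi = g[OF i] and hi = h[OF i]
    have "h i v = \<one>\<^bsub>L\<^esub>" if v: "v \<in> V i" "g i v \<in> H.family_product U i" for v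
    proof -
      interpret gi: linear_on G S \<sigma> H \<tau> "V i" "g i" by (rule gi)
      interpret hi: linear_on G S \<sigma> L \<rho> "V i" "h i" by (rule hi)
      obtain w where w: "\<forall>j<i. w j \<in> U j" "g i v = finprod H w {..<i}"
        using v by (auto simp: H.family_product_def)
      then have "\<forall>j. \<exists>x. j < i \<longrightarrow> x \<in> V j \<and> w j = g j x" by (auto simp: U_def)
      then obtain x where x: "\<And>j. j < i \<Longrightarrow> x j \<in> V j \<and> w j = g j (x j)" by metis
      define u where "u j = (if j < i then x j else if j = i then inv\<^bsub>G\<^esub> v else \<one>\<^bsub>G\<^esub>)" for j
      have iv: "inv\<^bsub>G\<^esub> v \<in> V i" using v gi.G.stable_inv[OF gi.stable_domain] by simp
      have u: "u j \<in> V j" if "j < k" for j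
      proof -
        interpret gj: linear_on G S \<sigma> H \<tau> "V j" "g j" by (rule g[OF that])
        show ?thesis using x iv gi.G.stable_one[OF gj.stable_domain] by (auto simp: u_def)
      qed
      have one: "g j \<one>\<^bsub>G\<^esub> = \<one>\<^bsub>H\<^esub>" if "j < k" for j using linear_on.map_one[OF g[OF that]] .
      have car: "g j (u j) \<in> carrier H" if "j < k" for j
        using linear_on.map_closed[OF g[OF that] u[OF that]] .
      have wcar: "w j \<in> carrier H" if "j < i" for j using w sub[of j] that i by auto
      have "finprod H (\<lambda>j. g j (u j)) {..<k} = finprod H (\<lambda>j. g j (u j)) {..<Suc i}"
        using i car one by (intro H.finprod_mono_neutral_cong_left[symmetric]) (auto simp: u_def)
      also have "\<dots> = finprod H (\<lambda>j. g j (u j)) {..<i} \<otimes>\<^bsub>H\<^esub> g i (u i)"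
        using i car by (intro H.finprod_lessThan_Suc) auto
      also have "finprod H (\<lambda>j. g j (u j)) {..<i} = finprod H w {..<i}"
        using wcar x by (intro H.finprod_cong') (auto simp: u_def)
      also have "g i (u i) = inv\<^bsub>H\<^esub> (g i v)" using v gi.map_inv by (simp add: u_def)
      finally have "finprod H (\<lambda>j. g j (u j)) {..<k} = \<one>\<^bsub>H\<^esub>"
        using w v gi.map_closed by (metis H.r_inv)
      then have "h i (u i) = \<one>\<^bsub>L\<^esub>" using det[of u i] u i by auto
      then have "inv\<^bsub>L\<^esub> (h i v) = \<one>\<^bsub>L\<^esub>" using v hi.map_inv by (simp add: u_def)
      then show ?thesis using hi.map_closed v by (metis L.inv_inv L.inv_one)
    qed
    from length_add_le_of_determined[OF gi hi _ this, OF H.stable_family_product]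
    have step: "H.len (H.family_product U i) + stable_length L S \<rho> (h i ` V i) \<le> H.len (H.family_product U (Suc i))"
      using U i sub by (subst H.family_product_Suc) (auto simp: U_def)
    have "(\<Sum>j<i. stable_length L S \<rho> (h j ` V j)) \<le> H.len (H.family_product U i)"
      using Suc by simp
    then have "(\<Sum>j<Suc i. stable_length L S \<rho> (h j ` V j))
        \<le> H.len (H.family_product U i) + stable_length L S \<rho> (h i ` V i)"
      unfolding sum.lessThan_Suc by (rule add_right_mono)
    from order_trans[OF this step] show ?case .
  qed
  have "H.len (H.family_product U k) \<le> H.len Y"
    using U Y by (intro stable_length_mono H.stable_family_product H.family_product_subset) (auto simp: U_def)
  then show ?thesis using main[OF order.refl] by (rule order_trans[rotated])
qed

lemma length_le_common_kernel:
  fixes G :: "('g, 'm) monoid_scheme" and H :: "('h, 'n) monoid_scheme" and k :: nat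
  assumes G: "operator_group G S \<sigma>" and V: "stable_subgroup G S \<sigma> V"
    and f: "\<And>j. j < k \<Longrightarrow> linear_on G S \<sigma> H \<tau> V (f j)"
  shows "stable_length G S \<sigma> V
    \<le> stable_length G S \<sigma> {v \<in> V. \<forall>j<k. f j v = \<one>\<^bsub>H\<^esub>} + (\<Sum>j<k. stable_length H S \<tau> (f j ` V))"
    and "stable_subgroup G S \<sigma> {v \<in> V. \<forall>j<k. f j v = \<one>\<^bsub>H\<^esub>}"
proof -
  interpret G: operator_group G S \<sigma> by fact
  have "stable_subgroup G S \<sigma> {v \<in> V. \<forall>j<i. f j v = \<one>\<^bsub>H\<^esub>} \<and>
    stable_length G S \<sigma> V
    \<le> stable_length G S \<sigma> {v \<in> V. \<forall>j<i. f j v = \<one>\<^bsub>H\<^esub>} + (\<Sum>j<i. stable_length H S \<tau> (f j ` V))" if "i \<le> k" for i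
    using that
  proof (induction i)
    case 0 then show ?case using V by simp
  next
    case (Suc i)
    let ?W = "{v \<in> V. \<forall>j<i. f j v = \<one>\<^bsub>H\<^esub>}"
    have W: "stable_subgroup G S \<sigma> ?W" using Suc by simp
    interpret fi: linear_on G S \<sigma> H \<tau> V "f i" using Suc f by simp
    interpret W: linear_on G S \<sigma> H \<tau> ?W "f i" using W by (rule fi.restrict) auto
    have eq: "?W \<inter> f i -` {\<one>\<^bsub>H\<^esub>} = {v \<in> V. \<forall>j<Suc i. f j v = \<one>\<^bsub>H\<^esub>}"
      by (auto simp: less_Suc_eq)
    have "stable_length H S \<tau> (f i ` ?W) \<le> stable_length H S \<tau> (f i ` V)"
      by (intro stable_length_mono W.stable_image fi.stable_image W V order.refl) auto
    then have "stable_length G S \<sigma> ?W \<le> stable_length G S \<sigma> {v \<in> V. \<forall>j<Suc i. f j v = \<one>\<^bsub>H\<^esub>}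
        + stable_length H S \<tau> (f i ` V)"
      using W.length_le_kernel_image unfolding eq by (rule order_trans[OF _ add_left_mono, rotated])
    moreover have "stable_length G S \<sigma> V \<le> stable_length G S \<sigma> ?W + (\<Sum>j<i. stable_length H S \<tau> (f j ` V))"
      using Suc by simp
    ultimately have "stable_length G S \<sigma> V \<le> (stable_length G S \<sigma> {v \<in> V. \<forall>j<Suc i. f j v = \<one>\<^bsub>H\<^esub>}
        + stable_length H S \<tau> (f i ` V)) + (\<Sum>j<i. stable_length H S \<tau> (f j ` V))"
      by (rule order_trans[OF _ add_right_mono, rotated])
    then show ?case using W.stable_kernel unfolding eq by (simp add: ac_simps)
  qed
  from this[OF order.refl] show "stable_length G S \<sigma> V
    \<le> stable_length G S \<sigma> {v \<in> V. \<forall>j<k. f j v = \<one>\<^bsub>H\<^esub>} + (\<Sum>j<k. stable_length H S \<tau> (f j ` V))"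
    and "stable_subgroup G S \<sigma> {v \<in> V. \<forall>j<k. f j v = \<one>\<^bsub>H\<^esub>}" by auto
qed

section \<open>Filtered rings with left noetherian associated graded ring\<close>

locale filtered_ring = ring R for R :: "('a, 'n) ring_scheme" (structure) +
  fixes \<Gamma> :: "nat \<Rightarrow> 'a set"
  assumes filtration_subgroup: "additive_subgroup (\<Gamma> n) R"
    and filtration_Suc: "\<Gamma> n \<subseteq> \<Gamma> (Suc n)"
    and filtration_one: "\<one> \<in> \<Gamma> 0"
    and filtration_Union: "(\<Union>n. \<Gamma> n) = carrier R"
    and filtration_mult: "x \<in> \<Gamma> i \<Longrightarrow> y \<in> \<Gamma> j \<Longrightarrow> x \<otimes> y \<in> \<Gamma> (i + j)"
begin

lemma filtration_mono: "m \<le> n \<Longrightarrow> \<Gamma> m \<subseteq> \<Gamma> n"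
  by (rule lift_Suc_mono_le[of \<Gamma>]) (rule filtration_Suc)

lemma filtration_carrier: "x \<in> \<Gamma> n \<Longrightarrow> x \<in> carrier R"
  using filtration_subgroup[of n] by (rule additive_subgroup.a_Hcarr)

lemma filtration_add: "x \<in> \<Gamma> n \<Longrightarrow> y \<in> \<Gamma> n \<Longrightarrow> x \<oplus> y \<in> \<Gamma> n"
  using filtration_subgroup[of n] by (rule additive_subgroup.a_closed)

lemma filtration_zero: "\<zero> \<in> \<Gamma> n"
  using filtration_subgroup[of n] by (rule additive_subgroup.zero_closed)

lemma filtration_minus: "x \<in> \<Gamma> n \<Longrightarrow> \<ominus> x \<in> \<Gamma> n"
  using filtration_subgroup[of n] by (rule additive_subgroup.a_inv_closed)

abbreviation pred :: "nat \<Rightarrow> 'a set" where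
  "pred \<equiv> filtration_pred R \<Gamma>"

lemma pred_subgroup: "additive_subgroup (pred n) R"
  using filtration_subgroup by (auto simp: filtration_pred_def zeroideal additive_subgroup.intro
      additive_subgroupI add.triv_subgroup split: nat.split)

lemma pred_abelian: "abelian_subgroup (pred n) R"
  by (rule abelian_subgroupI3[OF pred_subgroup abelian_group_axioms])

lemma pred_subset: "x \<in> pred n \<Longrightarrow> x \<in> \<Gamma> n"
  using filtration_Suc filtration_zero by (auto simp: filtration_pred_def split: nat.splits)

lemma pred_carrier: "x \<in> pred n \<Longrightarrow> x \<in> carrier R"
  using pred_subset filtration_carrier by blast

lemma pred_add: "x \<in> pred n \<Longrightarrow> y \<in> pred n \<Longrightarrow> x \<oplus> y \<in> pred n"
  using pred_subgroup[of n] by (rule additive_subgroup.a_closed)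

lemma pred_zero: "\<zero> \<in> pred n"
  using pred_subgroup[of n] by (rule additive_subgroup.zero_closed)

lemma pred_minus: "x \<in> pred n \<Longrightarrow> \<ominus> x \<in> pred n"
  using pred_subgroup[of n] by (rule additive_subgroup.a_inv_closed)

lemma pred_mult_left: "x \<in> pred i \<Longrightarrow> y \<in> \<Gamma> j \<Longrightarrow> x \<otimes> y \<in> pred (i + j)"
  using filtration_mult filtration_zero filtration_carrier pred_zero
  by (cases i) (auto simp: filtration_pred_def split: nat.splits)

lemma pred_mult_right: "x \<in> \<Gamma> i \<Longrightarrow> y \<in> pred j \<Longrightarrow> x \<otimes> y \<in> pred (i + j)"
  using filtration_mult filtration_zero filtration_carrier pred_zero
  by (cases j) (auto simp: filtration_pred_def split: nat.splits)

lemma finsum_filtration: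
  assumes "finite J" "\<And>j. j \<in> J \<Longrightarrow> f j \<in> H" "additive_subgroup H R"
  shows "(\<Oplus>j\<in>J. f j) \<in> H"
  using assms(1,2)
proof (induction rule: finite_induct)
  case empty then show ?case using assms(3) by (simp add: additive_subgroup.zero_closed)
next
  case (insert j J)
  then have "f j \<in> carrier R" "f \<in> J \<rightarrow> carrier R"
    using additive_subgroup.a_Hcarr[OF assms(3)] by auto
  then show ?case using insert additive_subgroup.a_closed[OF assms(3)] by simp
qed

text \<open>The term \<open>\<Gamma> (n - d)\<close>, which is zero for \<open>n < d\<close>; the case distinction compensates for truncated subtraction.\<close>

definition shifted :: "nat \<Rightarrow> nat \<Rightarrow> 'a set" where
  "shifted n d = (if d \<le> n then \<Gamma> (n - d) else {\<zero>})"

definition combinations :: "(nat \<Rightarrow> 'a) \<Rightarrow> (nat \<Rightarrow> nat) \<Rightarrow> nat \<Rightarrow> nat \<Rightarrow> 'a set" where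
  "combinations x d k n = {(\<Oplus>j\<in>{..<k}. g j \<otimes> x j) | g. \<forall>j<k. g j \<in> shifted n (d j)}"

lemma shifted_subset: "g \<in> shifted n d \<Longrightarrow> g \<in> \<Gamma> n"
  using filtration_mono[of "n - d" n] filtration_zero by (auto simp: shifted_def split: if_splits)

lemma shifted_carrier: "g \<in> shifted n d \<Longrightarrow> g \<in> carrier R"
  using shifted_subset filtration_carrier by blast

lemma shifted_subgroup: "additive_subgroup (shifted n d) R"
  using filtration_subgroup by (auto simp: shifted_def additive_subgroupI add.triv_subgroup)

lemma combinationsI:
  "\<forall>j<k. g j \<in> shifted n (d j) \<Longrightarrow> y = (\<Oplus>j\<in>{..<k}. g j \<otimes> x j) \<Longrightarrow> y \<in> combinations x d k n"
  unfolding combinations_def by (rule CollectI) blast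

lemma combinations_subgroup:
  assumes "\<And>j. j < k \<Longrightarrow> x j \<in> carrier R"
  shows "additive_subgroup (combinations x d k n) R"
proof (rule additive_subgroupI, rule add.subgroupI)
  show "combinations x d k n \<subseteq> carrier R"
    using assms shifted_carrier unfolding combinations_def by (force intro!: finsum_closed)
  have "(\<Oplus>j\<in>{..<k}. \<zero> \<otimes> x j) \<in> combinations x d k n"
    using combinationsI[of k "\<lambda>j. \<zero>" n d] by (simp add: additive_subgroup.zero_closed[OF shifted_subgroup])
  then show "combinations x d k n \<noteq> {}" by blast
  fix y assume "y \<in> combinations x d k n"
  then obtain g where g: "\<forall>j<k. g j \<in> shifted n (d j)" "y = (\<Oplus>j\<in>{..<k}. g j \<otimes> x j)"
    by (auto simp: combinations_def)
  have gc: "g j \<in> carrier R" if "j < k" for j using g that shifted_carrier by blast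
  show "\<ominus> y \<in> combinations x d k n"
  proof -
    have "(\<Oplus>j\<in>{..<k}. (\<ominus> \<one>) \<otimes> (g j \<otimes> x j)) = (\<ominus> \<one>) \<otimes> y"
      unfolding g(2) using gc assms by (intro finsum_rdistr[symmetric]) auto
    also have "\<dots> = \<ominus> y"
    proof -
      have "y \<in> carrier R" unfolding g(2) using gc assms by (auto intro!: finsum_closed)
      then show ?thesis by (simp add: l_minus)
    qed
    also have "(\<Oplus>j\<in>{..<k}. (\<ominus> \<one>) \<otimes> (g j \<otimes> x j)) = (\<Oplus>j\<in>{..<k}. (\<ominus> g j) \<otimes> x j)"
      using gc assms by (intro finsum_cong') (auto simp: l_minus)
    finally have "\<ominus> y = (\<Oplus>j\<in>{..<k}. (\<ominus> g j) \<otimes> x j)" by simp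
    moreover have "\<forall>j<k. \<ominus> g j \<in> shifted n (d j)"
      using g additive_subgroup.a_inv_closed[OF shifted_subgroup] by blast
    ultimately show ?thesis using combinationsI[of k "\<lambda>j. \<ominus> g j" n d] by simp
  qed
  fix z assume "z \<in> combinations x d k n"
  then obtain h where h: "\<forall>j<k. h j \<in> shifted n (d j)" "z = (\<Oplus>j\<in>{..<k}. h j \<otimes> x j)"
    by (auto simp: combinations_def)
  have hc: "h j \<in> carrier R" if "j < k" for j using h that shifted_carrier by blast
  have "y \<oplus> z = (\<Oplus>j\<in>{..<k}. g j \<otimes> x j \<oplus> h j \<otimes> x j)"
    unfolding g(2) h(2) using gc hc assms by (intro finsum_addf[symmetric]) auto
  also have "\<dots> = (\<Oplus>j\<in>{..<k}. (g j \<oplus> h j) \<otimes> x j)"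
    using gc hc assms by (intro finsum_cong') (auto simp: l_distr)
  finally have "y \<oplus> z = (\<Oplus>j\<in>{..<k}. (g j \<oplus> h j) \<otimes> x j)" .
  moreover have "\<forall>j<k. g j \<oplus> h j \<in> shifted n (d j)"
    using g h additive_subgroup.a_closed[OF shifted_subgroup] by blast
  ultimately show "y \<oplus> z \<in> combinations x d k n"
    using combinationsI[of k "\<lambda>j. g j \<oplus> h j" n d] by simp
qed

lemma combinations_mono:
  assumes "m \<le> n" shows "combinations x d k m \<subseteq> combinations x d k n"
proof -
  have "shifted m e \<subseteq> shifted n e" for e
    using assms filtration_mono[of "m - e" "n - e"] filtration_zero by (auto simp: shifted_def)
  then show ?thesis unfolding combinations_def by blast
qed

lemma combinations_Suc:
  assumes "\<And>j. j \<le> k \<Longrightarrow> x j \<in> carrier R"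
    and "y \<in> combinations x d k n" and "g \<in> shifted n (d k)"
  shows "y \<oplus> g \<otimes> x k \<in> combinations x d (Suc k) n"
proof -
  obtain h where h: "\<forall>j<k. h j \<in> shifted n (d j)" "y = (\<Oplus>j\<in>{..<k}. h j \<otimes> x j)"
    using assms(2) by (auto simp: combinations_def)
  have hc: "h j \<in> carrier R" if "j < k" for j using h that shifted_carrier by blast
  define h' where "h' j = (if j = k then g else h j)" for j
  have "(\<Oplus>j\<in>{..<Suc k}. h' j \<otimes> x j) = h' k \<otimes> x k \<oplus> (\<Oplus>j\<in>{..<k}. h' j \<otimes> x j)"
    using hc assms shifted_carrier by (subst lessThan_Suc, subst finsum_insert) (auto simp: h'_def)
  also have "(\<Oplus>j\<in>{..<k}. h' j \<otimes> x j) = y"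
    unfolding h(2) using hc assms by (intro finsum_cong') (auto simp: h'_def)
  finally have "y \<oplus> g \<otimes> x k = (\<Oplus>j\<in>{..<Suc k}. h' j \<otimes> x j)"
    using assms hc shifted_carrier unfolding h(2)
    by (subst a_comm) (auto simp: h'_def intro!: finsum_closed)
  moreover have "\<forall>j<Suc k. h' j \<in> shifted n (d j)"
    using h assms(3) by (auto simp: h'_def less_Suc_eq)
  ultimately show ?thesis using combinationsI[of "Suc k" h' n d] by simp
qed

lemma combinations_mult:
  assumes x: "\<And>j. j < k \<Longrightarrow> x j \<in> carrier R" and r: "r \<in> \<Gamma> i" and y: "y \<in> combinations x d k n"
  shows "r \<otimes> y \<in> combinations x d k (i + n)"
proof -
  obtain g where g: "\<forall>j<k. g j \<in> shifted n (d j)" "y = (\<Oplus>j\<in>{..<k}. g j \<otimes> x j)"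
    using y by (auto simp: combinations_def)
  have gc: "g j \<in> carrier R" if "j < k" for j using g that shifted_carrier by blast
  note rc = filtration_carrier[OF r]
  have "r \<otimes> y = (\<Oplus>j\<in>{..<k}. r \<otimes> (g j \<otimes> x j))"
    unfolding g(2) using gc rc x by (intro finsum_rdistr) auto
  also have "\<dots> = (\<Oplus>j\<in>{..<k}. (r \<otimes> g j) \<otimes> x j)"
    using gc rc x by (intro finsum_cong') (auto simp: m_assoc)
  finally have "r \<otimes> y = (\<Oplus>j\<in>{..<k}. (r \<otimes> g j) \<otimes> x j)" .
  moreover have "\<forall>j<k. r \<otimes> g j \<in> shifted (i + n) (d j)"
  proof (intro allI impI)
    fix j assume "j < k"
    then have gj: "g j \<in> shifted n (d j)" using g by blast
    show "r \<otimes> g j \<in> shifted (i + n) (d j)"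
    proof (cases "d j \<le> n")
      case True
      then have "g j \<in> \<Gamma> (n - d j)" using gj by (simp add: shifted_def)
      from filtration_mult[OF r this] show ?thesis using True by (simp add: shifted_def)
    next
      case False
      then have "g j = \<zero>" using gj by (simp add: shifted_def)
      then show ?thesis using rc additive_subgroup.zero_closed[OF shifted_subgroup] by simp
    qed
  qed
  ultimately show ?thesis using combinationsI[of k "\<lambda>j. r \<otimes> g j" "i + n" d] by simp
qed

lemma combinations_subset_left_ideal:
  assumes L: "left_ideal L R" and x: "\<And>j. j < k \<Longrightarrow> x j \<in> L"
  shows "combinations x d k n \<subseteq> L"
proof
  fix y assume "y \<in> combinations x d k n"
  then obtain g where g: "\<forall>j<k. g j \<in> shifted n (d j)" "y = (\<Oplus>j\<in>{..<k}. g j \<otimes> x j)"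
    by (auto simp: combinations_def)
  show "y \<in> L" unfolding g(2)
    by (rule finsum_filtration) (use L x g shifted_carrier in \<open>auto simp: left_ideal_def\<close>)
qed

lemma combinations_subset_filtration:
  assumes x: "\<And>j. j < k \<Longrightarrow> x j \<in> \<Gamma> (d j)"
  shows "combinations x d k n \<subseteq> \<Gamma> n"
proof
  fix y assume "y \<in> combinations x d k n"
  then obtain g where g: "\<forall>j<k. g j \<in> shifted n (d j)" "y = (\<Oplus>j\<in>{..<k}. g j \<otimes> x j)"
    by (auto simp: combinations_def)
  have "g j \<otimes> x j \<in> \<Gamma> n" if "j < k" for j
  proof (cases "d j \<le> n")
    case True
    then have "g j \<in> \<Gamma> (n - d j)" using g that by (auto simp: shifted_def)
    from filtration_mult[OF this x[OF that]] show ?thesis using True by simp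
  next
    case False
    then have "g j = \<zero>" using g that by (auto simp: shifted_def)
    then show ?thesis using filtration_carrier[OF x[OF that]] filtration_zero by simp
  qed
  then show "y \<in> \<Gamma> n" unfolding g(2) by (intro finsum_filtration filtration_subgroup) auto
qed

text \<open>The representatives in degree \<open>n\<close> of the left ideal of the associated graded ring that is generated by the symbols of
  \<open>x\<^sub>0, \<dots>, x\<^bsub>k-1\<^esub>\<close> in degrees \<open>d\<^sub>0, \<dots>, d\<^bsub>k-1\<^esub>\<close>.\<close>

definition reach :: "(nat \<Rightarrow> 'a) \<Rightarrow> (nat \<Rightarrow> nat) \<Rightarrow> nat \<Rightarrow> nat \<Rightarrow> 'a set" where
  "reach x d k n = pred n <+> combinations x d k n"

lemma mem_reach: "y \<in> reach x d k n \<longleftrightarrow> (\<exists>u\<in>pred n. \<exists>c\<in>combinations x d k n. y = u \<oplus> c)"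
  by (simp add: reach_def set_add_defs)

lemma reach_subgroup:
  "(\<And>j. j < k \<Longrightarrow> x j \<in> carrier R) \<Longrightarrow> additive_subgroup (reach x d k n) R"
  unfolding reach_def by (intro add_additive_subgroups pred_subgroup combinations_subgroup)

lemma pred_subset_reach:
  assumes "\<And>j. j < k \<Longrightarrow> x j \<in> carrier R" "u \<in> pred n" shows "u \<in> reach x d k n"
  unfolding mem_reach
  by (rule bexI[OF _ assms(2)], rule bexI[OF _ additive_subgroup.zero_closed[OF combinations_subgroup[OF assms(1)]]])
    (use pred_carrier[OF assms(2)] in auto)

text \<open>Elements of the associated graded ring are sequences of cosets. Computations are done with sequences of representatives, and
  \<open>admissible\<close> singles out those that represent an element.\<close>

definition admissible :: "(nat \<Rightarrow> 'a) \<Rightarrow> bool" where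
  "admissible y \<longleftrightarrow> (\<forall>i. y i \<in> \<Gamma> i) \<and> finite {i. y i \<notin> pred i}"

definition symbol :: "(nat \<Rightarrow> 'a) \<Rightarrow> nat \<Rightarrow> 'a set" where
  "symbol y = (\<lambda>i. pred i +> y i)"

lemma symbol_eq_iff:
  assumes "\<And>i. y i \<in> carrier R" "\<And>i. z i \<in> carrier R"
  shows "symbol y = symbol z \<longleftrightarrow> (\<forall>i. y i \<ominus> z i \<in> pred i)"
proof -
  have "(pred i +> y i = pred i +> z i) \<longleftrightarrow> y i \<ominus> z i \<in> pred i" for i
  proof -
    interpret abelian_subgroup "pred i" R by (rule pred_abelian)
    show ?thesis
      using a_rcos_module_minus[OF ring_axioms assms(2)[of i] assms(1)[of i]]
        a_repr_independence'[OF _ assms(2)[of i], of "y i"] a_repr_independenceD[OF assms(1)[of i], of "z i"]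
      by metis
  qed
  then show ?thesis by (simp add: symbol_def fun_eq_iff)
qed

lemma coset_eq_pred_iff: "y \<in> carrier R \<Longrightarrow> pred i +> y = pred i \<longleftrightarrow> y \<in> pred i"
  using abelian_subgroup.a_rcos_const[OF pred_abelian, of y i]
    abelian_subgroup.a_rcos_self[OF pred_abelian, of y i] by metis

abbreviation gr :: "(nat \<Rightarrow> 'a set) ring" where
  "gr \<equiv> gr_ring R \<Gamma>"

lemma carrier_gr: "carrier gr = {symbol y | y. admissible y}"
proof (intro subset_antisym subsetI)
  fix f assume "f \<in> carrier gr"
  then have f: "\<forall>i. \<exists>x\<in>\<Gamma> i. f i = pred i +> x" "finite {i. f i \<noteq> pred i}"
    by (simp_all add: gr_ring_def Let_def)
  then obtain y where y: "\<And>i. y i \<in> \<Gamma> i" "\<And>i. f i = pred i +> y i" by metis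
  have "f = symbol y" using y by (simp add: symbol_def fun_eq_iff)
  moreover have "admissible y"
    using y(1) f(2) coset_eq_pred_iff[OF filtration_carrier[OF y(1)]]
    unfolding admissible_def y(2) by simp
  ultimately show "f \<in> {symbol y | y. admissible y}" by blast
next
  fix f assume "f \<in> {symbol y | y. admissible y}"
  then obtain y where y: "admissible y" "f = symbol y" by blast
  then have "\<And>i. y i \<in> carrier R" using filtration_carrier by (auto simp: admissible_def)
  then show "f \<in> carrier gr" using y
    by (auto simp: gr_ring_def Let_def admissible_def symbol_def coset_eq_pred_iff)
qed

lemma admissible_carrier: "admissible y \<Longrightarrow> y i \<in> carrier R"
  using filtration_carrier by (auto simp: admissible_def)

lemma admissible_add:
  assumes "admissible y" "admissible z" shows "admissible (\<lambda>i. y i \<oplus> z i)"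
proof -
  have "finite ({i. y i \<notin> pred i} \<union> {i. z i \<notin> pred i})" using assms by (simp add: admissible_def)
  moreover have "{i. y i \<oplus> z i \<notin> pred i} \<subseteq> {i. y i \<notin> pred i} \<union> {i. z i \<notin> pred i}"
    using pred_add by blast
  ultimately show ?thesis using assms filtration_add by (auto simp: admissible_def intro: finite_subset)
qed

lemma admissible_minus:
  assumes "admissible y" shows "admissible (\<lambda>i. \<ominus> y i)"
proof -
  have "{i. \<ominus> y i \<notin> pred i} \<subseteq> {i. y i \<notin> pred i}"
    using pred_minus by blast
  then show ?thesis using assms filtration_minus by (auto simp: admissible_def intro: finite_subset)
qed

lemma admissible_zero: "admissible (\<lambda>i. \<zero>)"
  by (simp add: admissible_def filtration_zero pred_zero)

lemma symbol_add:
  assumes "admissible y" "admissible z"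
  shows "symbol y \<oplus>\<^bsub>gr\<^esub> symbol z = symbol (\<lambda>i. y i \<oplus> z i)"
  using abelian_subgroup.a_rcos_sum[OF pred_abelian] assms admissible_carrier
  by (simp add: gr_ring_def Let_def symbol_def)

lemma symbol_zero: "\<zero>\<^bsub>gr\<^esub> = symbol (\<lambda>i. \<zero>)"
  using coset_eq_pred_iff[OF zero_closed] pred_zero
  by (simp add: gr_ring_def Let_def symbol_def fun_eq_iff)

lemma gr_add_group: "group (add_monoid gr)"
proof (rule groupI)
  show "\<one>\<^bsub>add_monoid gr\<^esub> \<in> carrier (add_monoid gr)"
    using admissible_zero by (auto simp: carrier_gr symbol_zero)
  show "x \<otimes>\<^bsub>add_monoid gr\<^esub> y \<in> carrier (add_monoid gr)"
    if "x \<in> carrier (add_monoid gr)" "y \<in> carrier (add_monoid gr)" for x y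
    using that admissible_add by (auto simp: carrier_gr symbol_add)
  show "x \<otimes>\<^bsub>add_monoid gr\<^esub> y \<otimes>\<^bsub>add_monoid gr\<^esub> z = x \<otimes>\<^bsub>add_monoid gr\<^esub> (y \<otimes>\<^bsub>add_monoid gr\<^esub> z)"
    if "x \<in> carrier (add_monoid gr)" "y \<in> carrier (add_monoid gr)" "z \<in> carrier (add_monoid gr)" for x y z
    using that by (auto simp: carrier_gr symbol_add admissible_add a_assoc admissible_carrier)
  show "\<one>\<^bsub>add_monoid gr\<^esub> \<otimes>\<^bsub>add_monoid gr\<^esub> x = x" if "x \<in> carrier (add_monoid gr)" for x
    using that by (auto simp: carrier_gr symbol_zero symbol_add admissible_zero admissible_carrier)
  show "\<exists>y\<in>carrier (add_monoid gr). y \<otimes>\<^bsub>add_monoid gr\<^esub> x = \<one>\<^bsub>add_monoid gr\<^esub>"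
    if x: "x \<in> carrier (add_monoid gr)" for x
  proof -
    obtain y where y: "admissible y" "x = symbol y" using x by (auto simp: carrier_gr)
    then have "symbol (\<lambda>i. \<ominus> y i) \<oplus>\<^bsub>gr\<^esub> x = \<zero>\<^bsub>gr\<^esub>"
      by (simp add: symbol_add admissible_minus symbol_zero l_neg admissible_carrier)
    then show ?thesis using admissible_minus[OF y(1)] by (auto simp: carrier_gr)
  qed
qed

lemma gr_minus: "admissible y \<Longrightarrow> inv\<^bsub>add_monoid gr\<^esub> (symbol y) = symbol (\<lambda>i. \<ominus> y i)"
  by (rule group.inv_equality[OF gr_add_group])
    (auto simp: symbol_add admissible_minus symbol_zero l_neg admissible_carrier carrier_gr)

lemma symbol_mult:
  assumes y: "admissible y" and z: "admissible z"
  shows "symbol y \<otimes>\<^bsub>gr\<^esub> symbol z = symbol (\<lambda>n. \<Oplus>i\<in>{..n}. y i \<otimes> z (n - i))"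
proof
  fix n :: nat
  let ?c = "\<lambda>y z. (\<Oplus>i\<in>{..n}. y i \<otimes> z (n - i))"
  have same: "pred n +> ?c y' z' = pred n +> ?c y z"
    if "y' \<in> Pi UNIV (symbol y)" "z' \<in> Pi UNIV (symbol z)" for y' z'
  proof -
    have yc: "y i \<in> carrier R" "y i \<in> \<Gamma> i" and zc: "z i \<in> carrier R" "z i \<in> \<Gamma> i" for i
      using y z admissible_carrier by (auto simp: admissible_def)
    have "\<exists>u\<in>pred i. y' i = u \<oplus> y i" "\<exists>u\<in>pred i. z' i = u \<oplus> z i" for i
      using that by (auto simp: symbol_def a_r_coset_defs Pi_def)
    then obtain u v where u: "\<And>i. u i \<in> pred i" "\<And>i. y' i = u i \<oplus> y i"
      and v: "\<And>i. v i \<in> pred i" "\<And>i. z' i = v i \<oplus> z i" by metis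
    note uc = pred_carrier[OF u(1)] and vc = pred_carrier[OF v(1)]
    have z'\<Gamma>: "z' i \<in> \<Gamma> i" for i using v pred_subset filtration_add zc by metis
    note z'c = filtration_carrier[OF z'\<Gamma>]
    define w where "w i = u i \<otimes> z' (n - i) \<oplus> y i \<otimes> v (n - i)" for i
    have w: "w i \<in> pred n" if "i \<le> n" for i
      using pred_mult_left[OF u(1)[of i] z'\<Gamma>[of "n - i"]] pred_mult_right[OF yc(2)[of i] v(1)[of "n - i"]] that
      by (simp add: w_def pred_add)
    have "y' i \<otimes> z' (n - i) = w i \<oplus> y i \<otimes> z (n - i)" for i
    proof -
      have "y' i \<otimes> z' (n - i) = u i \<otimes> z' (n - i) \<oplus> y i \<otimes> z' (n - i)"
        using u uc yc z'c by (simp add: l_distr)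
      also have "y i \<otimes> z' (n - i) = y i \<otimes> v (n - i) \<oplus> y i \<otimes> z (n - i)"
        using v vc yc zc by (simp add: r_distr)
      finally show ?thesis using uc yc zc vc z'c by (simp add: w_def a_assoc)
    qed
    then have "?c y' z' = (\<Oplus>i\<in>{..n}. w i \<oplus> y i \<otimes> z (n - i))" by simp
    also have "\<dots> = (\<Oplus>i\<in>{..n}. w i) \<oplus> ?c y z"
      using uc yc zc vc z'c by (intro finsum_addf) (auto simp: w_def)
    finally have eq: "?c y' z' = (\<Oplus>i\<in>{..n}. w i) \<oplus> ?c y z" .
    have "(\<Oplus>i\<in>{..n}. w i) \<in> pred n"
      using w by (intro finsum_filtration pred_subgroup) auto
    then have mem: "?c y' z' \<in> pred n +> ?c y z" unfolding eq by (auto simp: a_r_coset_defs)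
    have "?c y z \<in> carrier R" using yc zc by (intro finsum_closed) auto
    then show ?thesis using abelian_subgroup.a_repr_independence'[OF pred_abelian mem] by simp
  qed
  have mem: "y \<in> Pi UNIV (symbol y)" "z \<in> Pi UNIV (symbol z)"
    using abelian_subgroup.a_rcos_self[OF pred_abelian] y z admissible_carrier by (auto simp: symbol_def)
  have "(\<Union>y'\<in>Pi UNIV (symbol y). \<Union>z'\<in>Pi UNIV (symbol z). pred n +> ?c y' z') = pred n +> ?c y z"
  proof (intro subset_antisym UN_least)
    show "pred n +> ?c y' z' \<subseteq> pred n +> ?c y z"
      if "y' \<in> Pi UNIV (symbol y)" "z' \<in> Pi UNIV (symbol z)" for y' z'
      by (rule equalityD1[OF same[OF that]])
    show "pred n +> ?c y z \<subseteq> (\<Union>y'\<in>Pi UNIV (symbol y). \<Union>z'\<in>Pi UNIV (symbol z). pred n +> ?c y' z')"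
    proof
      fix a assume "a \<in> pred n +> ?c y z"
      then show "a \<in> (\<Union>y'\<in>Pi UNIV (symbol y). \<Union>z'\<in>Pi UNIV (symbol z). pred n +> ?c y' z')"
        by (rule UN_I[OF mem(1) UN_I[OF mem(2)]])
    qed
  qed
  then show "(symbol y \<otimes>\<^bsub>gr\<^esub> symbol z) n = symbol (\<lambda>n. \<Oplus>i\<in>{..n}. y i \<otimes> z (n - i)) n"
    by (simp add: gr_ring_def Let_def symbol_def)
qed

lemma admissible_mult:
  assumes y: "admissible y" and z: "admissible z"
  shows "admissible (\<lambda>n. \<Oplus>i\<in>{..n}. y i \<otimes> z (n - i))"
proof -
  have \<Gamma>: "y i \<in> \<Gamma> i" "z i \<in> \<Gamma> i" for i using y z by (auto simp: admissible_def)
  have "y i \<otimes> z (n - i) \<in> \<Gamma> n" if "i \<le> n" for i n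
    using filtration_mult[OF \<Gamma>(1)[of i] \<Gamma>(2)[of "n - i"]] that by simp
  then have 1: "(\<Oplus>i\<in>{..n}. y i \<otimes> z (n - i)) \<in> \<Gamma> n" for n
    by (intro finsum_filtration filtration_subgroup) auto
  obtain p q where p: "\<And>i. y i \<notin> pred i \<Longrightarrow> i \<le> p" and q: "\<And>i. z i \<notin> pred i \<Longrightarrow> i \<le> q"
    using y z by (auto simp: admissible_def finite_nat_set_iff_bounded_le)
  have "(\<Oplus>i\<in>{..n}. y i \<otimes> z (n - i)) \<in> pred n" if n: "p + q < n" for n
  proof (intro finsum_filtration pred_subgroup)
    fix i assume "i \<in> {..n}"
    then have i: "i \<le> n" by simp
    have "y i \<in> pred i \<or> z (n - i) \<in> pred (n - i)" using p[of i] q[of "n - i"] n i by force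
    then show "y i \<otimes> z (n - i) \<in> pred n"
      using pred_mult_left[of "y i" i "z (n - i)" "n - i"] pred_mult_right[of "y i" i "z (n - i)" "n - i"] \<Gamma> i
      by auto
  qed simp
  then have "{n. (\<Oplus>i\<in>{..n}. y i \<otimes> z (n - i)) \<notin> pred n} \<subseteq> {..p + q}"
    by (intro subsetI) (metis (mono_tags, lifting) atMost_iff mem_Collect_eq not_le)
  then show ?thesis using 1 finite_subset by (auto simp: admissible_def)
qed

text \<open>The elements of the associated graded ring that are represented by sequences in \<open>reach x d k\<close> form a left ideal \<open>L k\<close>. These
  ideals ascend, so \<open>L (N + 1) = L N\<close> for some \<open>N\<close>; as \<open>L (N + 1)\<close> contains the symbol of \<open>x\<^sub>N\<close>, so does \<open>L N\<close>.\<close>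

theorem left_noetherian_gr_reach:
  assumes noeth: "left_noetherian gr" and x: "\<And>k. x k \<in> \<Gamma> (d k)"
  obtains k where "x k \<in> reach x d k (d k)"
proof -
  note xc = filtration_carrier[OF x]
  define L where "L k = {symbol y | y. admissible y \<and> (\<forall>i. y i \<in> reach x d k i)}" for k
  note rsub = reach_subgroup[of _ x, OF xc]
  have "left_ideal (L k) gr" for k
  proof -
    interpret G: group "add_monoid gr" by (rule gr_add_group)
    have "subgroup (L k) (add_monoid gr)"
    proof (rule G.subgroupI)
      show "L k \<subseteq> carrier (add_monoid gr)" by (auto simp: L_def carrier_gr)
      show "L k \<noteq> {}" using admissible_zero additive_subgroup.zero_closed[OF rsub] unfolding L_def by blast
      show "inv\<^bsub>add_monoid gr\<^esub> f \<in> L k" if "f \<in> L k" for f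
      proof -
        obtain y where y: "admissible y" "\<forall>i. y i \<in> reach x d k i" "f = symbol y"
          using \<open>f \<in> L k\<close> unfolding L_def by blast
        have "inv\<^bsub>add_monoid gr\<^esub> f = symbol (\<lambda>i. \<ominus> y i)" using y gr_minus by simp
        moreover have "admissible (\<lambda>i. \<ominus> y i)" using y admissible_minus by simp
        moreover have "\<forall>i. \<ominus> y i \<in> reach x d k i"
          using y additive_subgroup.a_inv_closed[OF rsub] by simp
        ultimately show ?thesis unfolding L_def by blast
      qed
      show "f \<otimes>\<^bsub>add_monoid gr\<^esub> g \<in> L k" if "f \<in> L k" "g \<in> L k" for f g
      proof -
        obtain y z where "admissible y" "\<forall>i. y i \<in> reach x d k i" "f = symbol y"
          "admissible z" "\<forall>i. z i \<in> reach x d k i" "g = symbol z"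
          using \<open>f \<in> L k\<close> \<open>g \<in> L k\<close> unfolding L_def by blast
        then have "f \<otimes>\<^bsub>add_monoid gr\<^esub> g = symbol (\<lambda>i. y i \<oplus> z i)" "admissible (\<lambda>i. y i \<oplus> z i)"
          "\<forall>i. y i \<oplus> z i \<in> reach x d k i"
          using additive_subgroup.a_closed[OF rsub] by (auto simp: symbol_add admissible_add)
        then show ?thesis unfolding L_def by blast
      qed
    qed
    moreover have "f \<otimes>\<^bsub>gr\<^esub> g \<in> L k" if "f \<in> carrier gr" "g \<in> L k" for f g
    proof -
      obtain y where y: "admissible y" "f = symbol y" using \<open>f \<in> carrier gr\<close> by (auto simp: carrier_gr)
      obtain z where z: "admissible z" "\<forall>i. z i \<in> reach x d k i" "g = symbol z"
        using \<open>g \<in> L k\<close> unfolding L_def by blast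
      have \<Gamma>: "y i \<in> \<Gamma> i" for i using y by (auto simp: admissible_def)
      have "y i \<otimes> z (n - i) \<in> reach x d k n" if "i \<le> n" for i n
      proof -
        obtain u c where uc: "u \<in> pred (n - i)" "c \<in> combinations x d k (n - i)" "z (n - i) = u \<oplus> c"
          using z(2)[rule_format, of "n - i"] unfolding mem_reach by blast
        have car: "u \<in> carrier R" "c \<in> carrier R"
          using uc pred_carrier additive_subgroup.a_Hcarr[OF combinations_subgroup[OF xc]] by auto
        have "y i \<otimes> u \<in> pred n" using pred_mult_right[OF \<Gamma> uc(1), of i] that by simp
        moreover have "y i \<otimes> c \<in> combinations x d k n"
          using combinations_mult[OF xc \<Gamma> uc(2), of i] that by simp
        moreover have "y i \<otimes> z (n - i) = y i \<otimes> u \<oplus> y i \<otimes> c"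
          using car filtration_carrier[OF \<Gamma>] uc by (simp add: r_distr)
        ultimately show ?thesis by (auto simp: mem_reach)
      qed
      then have "\<forall>n. (\<Oplus>i\<in>{..n}. y i \<otimes> z (n - i)) \<in> reach x d k n"
        by (intro allI finsum_filtration rsub) auto
      then show ?thesis using y z admissible_mult symbol_mult unfolding L_def by blast
    qed
    ultimately show ?thesis by (auto simp: left_ideal_def intro: additive_subgroupI)
  qed
  moreover have "L k \<subseteq> L (Suc k)" for k
  proof -
    have "combinations x d k n \<subseteq> combinations x d (Suc k) n" for n
    proof
      fix c assume c: "c \<in> combinations x d k n"
      then have "c \<oplus> \<zero> \<otimes> x k \<in> combinations x d (Suc k) n"
        using xc additive_subgroup.zero_closed[OF shifted_subgroup] by (intro combinations_Suc)
      then show "c \<in> combinations x d (Suc k) n"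
        using xc additive_subgroup.a_Hcarr[OF combinations_subgroup[OF xc] c] by simp
    qed
    then have "reach x d k n \<subseteq> reach x d (Suc k) n" for n
      using mem_reach by blast
    then show ?thesis unfolding L_def by blast
  qed
  moreover have "(\<forall>n. left_ideal (L n) gr) \<and> (\<forall>n. L n \<subseteq> L (Suc n)) \<longrightarrow> (\<exists>N. \<forall>n\<ge>N. L n = L N)"
    using noeth unfolding left_noetherian_def by (rule spec)
  ultimately have "\<exists>N. \<forall>n\<ge>N. L n = L N" by presburger
  then obtain N where stable: "\<forall>n\<ge>N. L n = L N" by (rule exE)
  have N: "L (Suc N) = L N" by (rule stable[rule_format]) simp
  define y where "y i = (if i = d N then x N else \<zero>)" for i
  have adm: "admissible y"
  proof -
    have "{i. y i \<notin> pred i} \<subseteq> {d N}" using pred_zero by (auto simp: y_def split: if_splits)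
    then have "finite {i. y i \<notin> pred i}" by (rule finite_subset) simp
    moreover have "y i \<in> \<Gamma> i" for i using x[of N] filtration_zero[of i] by (simp add: y_def)
    ultimately show ?thesis by (simp add: admissible_def)
  qed
  have "y i \<in> reach x d (Suc N) i" for i
  proof (cases "i = d N")
    case True
    have "\<zero> \<oplus> \<one> \<otimes> x N \<in> combinations x d (Suc N) i"
      using xc additive_subgroup.zero_closed[OF combinations_subgroup[OF xc]] filtration_one True
      by (intro combinations_Suc) (auto simp: shifted_def)
    then have c: "x N \<in> combinations x d (Suc N) i" using xc by simp
    have "\<exists>u\<in>pred i. \<exists>c\<in>combinations x d (Suc N) i. x N = u \<oplus> c"
      by (rule bexI[OF bexI[OF _ c] pred_zero]) (use xc in simp)
    then have "x N \<in> reach x d (Suc N) i" by (simp only: mem_reach)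
    then show ?thesis using True by (simp add: y_def)
  next
    case False
    then show ?thesis using additive_subgroup.zero_closed[OF rsub] by (simp add: y_def)
  qed
  then have "symbol y \<in> L (Suc N)" unfolding L_def using adm by (intro CollectI exI[of _ y]) simp
  then have "symbol y \<in> L N" using N by simp
  then obtain z where z: "admissible z" "\<And>i. z i \<in> reach x d N i" "symbol y = symbol z"
    unfolding L_def by blast
  have car: "y i \<in> carrier R" "z i \<in> carrier R" for i using adm z admissible_carrier by auto
  have "y (d N) \<ominus> z (d N) \<in> reach x d N (d N)"
    using z(3) car pred_subset_reach[OF xc] by (simp add: symbol_eq_iff)
  then have "(y (d N) \<ominus> z (d N)) \<oplus> z (d N) \<in> reach x d N (d N)"
    using z(2) additive_subgroup.a_closed[OF rsub] by blast
  moreover have "(y (d N) \<ominus> z (d N)) \<oplus> z (d N) = x N"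
    using car[of "d N"] xc[of N] by (simp add: minus_eq a_assoc l_neg y_def)
  ultimately show thesis using that by simp
qed

lemma combinations_cong:
  "(\<And>j. j < k \<Longrightarrow> x j = x' j \<and> d j = d' j) \<Longrightarrow> (\<And>j. j < k \<Longrightarrow> x j \<in> carrier R)
    \<Longrightarrow> combinations x d k n = combinations x' d' k n"
proof -
  assume eq: "\<And>j. j < k \<Longrightarrow> x j = x' j \<and> d j = d' j" and xc: "\<And>j. j < k \<Longrightarrow> x j \<in> carrier R"
  have "(\<Oplus>j\<in>{..<k}. g j \<otimes> x j) = (\<Oplus>j\<in>{..<k}. g j \<otimes> x' j)" if "\<forall>j<k. g j \<in> shifted n (d j)" for g
  proof (rule finsum_cong'[OF refl])
    show "(\<lambda>j. g j \<otimes> x' j) \<in> {..<k} \<rightarrow> carrier R"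
    proof
      fix j assume "j \<in> {..<k}"
      then have j: "j < k" by simp
      then have "g j \<in> shifted n (d j)" using that by simp
      then show "g j \<otimes> x' j \<in> carrier R" using shifted_carrier eq[OF j] xc[OF j] by auto
    qed
  qed (use eq in simp)
  then show ?thesis using eq unfolding combinations_def by (smt (verit) Collect_cong)
qed

text \<open>If the elements \<open>x\<^sub>0, \<dots>, x\<^bsub>k-1\<^esub>\<close> do not suffice, choose the next one in the least degree in which they fail. It is not
  reached by the previous ones: otherwise it would differ from a combination of them by an element of smaller degree, which is a combination by
  minimality. So an infinite sequence of choices contradicts \<open>left_noetherian_gr_reach\<close>.\<close>

theorem left_ideal_good_generators:
  assumes noeth: "left_noetherian gr" and L: "left_ideal L R"
  obtains x d k where "\<And>j. j < k \<Longrightarrow> x j \<in> L \<inter> \<Gamma> (d j)" and "\<And>n. L \<inter> \<Gamma> n = combinations x d k n"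
proof -
  have Lsub: "additive_subgroup L R" using L by (simp add: left_ideal_def)
  have "\<exists>x d k. (\<forall>j<k. x j \<in> L \<inter> \<Gamma> (d j)) \<and> (\<forall>n. L \<inter> \<Gamma> n = combinations x d k n)"
  proof (rule ccontr)
    assume no: "\<not> ?thesis"
    \<comment> \<open>A pair consists of a generator and its degree. The membership premise makes the predicate depend only on the first \<open>k\<close> pairs
      of \<open>f\<close>, as required for dependent choice.\<close>
    define P where "P f k r \<longleftrightarrow> fst r \<in> L \<inter> \<Gamma> (snd r) \<and>
      ((\<forall>j<k. fst (f j) \<in> carrier R) \<longrightarrow> fst r \<notin> reach (\<lambda>j. fst (f j)) (\<lambda>j. snd (f j)) k (snd r))"
      for f :: "nat \<Rightarrow> 'a \<times> nat" and k r
    have "\<exists>f. \<forall>k. P f k (f k)"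
    proof (rule dependent_wellorder_choice)
      fix r :: "'a \<times> nat" and f g :: "nat \<Rightarrow> 'a \<times> nat" and k :: nat
      assume "\<And>j. j < k \<Longrightarrow> f j = g j"
      then show "P f k r = P g k r"
        using combinations_cong[of k "\<lambda>j. fst (f j)" "\<lambda>j. fst (g j)" "\<lambda>j. snd (f j)" "\<lambda>j. snd (g j)"]
        unfolding P_def reach_def by auto
    next
      fix k and f :: "nat \<Rightarrow> 'a \<times> nat"
      assume "\<And>j. j < k \<Longrightarrow> P f j (f j)"
      then have f: "fst (f j) \<in> L \<inter> \<Gamma> (snd (f j))" if "j < k" for j using that by (simp add: P_def)
      let ?x = "\<lambda>j. fst (f j)" and ?d = "\<lambda>j. snd (f j)"
      have xc: "?x j \<in> carrier R" if "j < k" for j using f[OF that] filtration_carrier by blast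
      have sub: "combinations ?x ?d k n \<subseteq> L \<inter> \<Gamma> n" for n
        using combinations_subset_left_ideal[OF L, of k ?x] combinations_subset_filtration[of k ?x ?d] f by auto
      have "\<not> (\<forall>n. L \<inter> \<Gamma> n = combinations ?x ?d k n)"
      proof
        assume all: "\<forall>n. L \<inter> \<Gamma> n = combinations ?x ?d k n"
        have "\<forall>j<k. ?x j \<in> L \<inter> \<Gamma> (?d j)" using f by blast
        then have "\<exists>x d k. (\<forall>j<k. x j \<in> L \<inter> \<Gamma> (d j)) \<and> (\<forall>n. L \<inter> \<Gamma> n = combinations x d k n)"
          by (intro exI[of _ ?x] exI[of _ ?d] exI[of _ k] conjI all)
        with no show False by (rule notE)
      qed
      then obtain n0 where "L \<inter> \<Gamma> n0 \<noteq> combinations ?x ?d k n0" by (auto simp only: not_all)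
      then have "\<not> L \<inter> \<Gamma> n0 \<subseteq> combinations ?x ?d k n0" using sub by blast
      define n where "n = (LEAST n. \<not> L \<inter> \<Gamma> n \<subseteq> combinations ?x ?d k n)"
      have n: "\<not> L \<inter> \<Gamma> n \<subseteq> combinations ?x ?d k n"
        unfolding n_def using \<open>\<not> L \<inter> \<Gamma> n0 \<subseteq> combinations ?x ?d k n0\<close> by (rule LeastI)
      have least: "L \<inter> \<Gamma> m \<subseteq> combinations ?x ?d k m" if "m < n" for m
        using that unfolding n_def by (meson not_less_Least)
      obtain y where y: "y \<in> L" "y \<in> \<Gamma> n" "y \<notin> combinations ?x ?d k n" using n by blast
      have "y \<notin> reach ?x ?d k n"
      proof
        assume "y \<in> reach ?x ?d k n"
        then obtain u c where uc: "u \<in> pred n" "c \<in> combinations ?x ?d k n" "y = u \<oplus> c"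
          by (auto simp: mem_reach)
        have csub: "additive_subgroup (combinations ?x ?d k n) R" using xc by (rule combinations_subgroup)
        have c: "c \<in> L" using uc sub by blast
        have car: "u \<in> carrier R" "c \<in> carrier R"
          using uc pred_carrier additive_subgroup.a_Hcarr[OF csub] by auto
        have "u = y \<oplus> \<ominus> c" using uc car by (simp add: a_assoc r_neg)
        then have u: "u \<in> L"
          using y c additive_subgroup.a_closed[OF Lsub] additive_subgroup.a_inv_closed[OF Lsub]
          by simp
        have "u \<in> combinations ?x ?d k n"
        proof (cases n)
          case 0
          then have "u = \<zero>" using uc by (simp add: filtration_pred_def)
          then show ?thesis using additive_subgroup.zero_closed[OF csub] by simp
        next
          case (Suc m)
          then have "u \<in> combinations ?x ?d k m" using uc u least[of m] by (auto simp: filtration_pred_def)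
          then show ?thesis using combinations_mono[of m n] Suc by auto
        qed
        then show False using uc y additive_subgroup.a_closed[OF csub] by simp
      qed
      then show "\<exists>r. P f k r" using y unfolding P_def by (intro exI[of _ "(y, n)"]) auto
    qed
    then obtain f where f: "\<And>k. P f k (f k)" by blast
    then have mem: "fst (f k) \<in> L \<inter> \<Gamma> (snd (f k))" for k by (simp add: P_def)
    then have "fst (f k) \<in> carrier R" for k using filtration_carrier by blast
    then have "fst (f k) \<notin> reach (\<lambda>j. fst (f j)) (\<lambda>j. snd (f j)) k (snd (f k))" for k
      using f[of k] by (simp add: P_def)
    moreover obtain k where "fst (f k) \<in> reach (\<lambda>j. fst (f j)) (\<lambda>j. snd (f j)) k (snd (f k))"
      using left_noetherian_gr_reach[OF noeth, of "\<lambda>j. fst (f j)" "\<lambda>j. snd (f j)"] mem by auto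
    ultimately show False by blast
  qed
  then show thesis using that by blast
qed

end

section \<open>Exponentially growing sequences\<close>

text \<open>Where \<open>a n / \<mu>\<^sup>n\<close> exceeds all its earlier values, \<open>a (n - i) \<le> \<mu>\<^bsup>-i\<^esup> a n\<close> holds for every \<open>i \<le> n\<close>. For \<open>\<mu>\<close> slightly
  above one, exponential growth provides arbitrarily large \<open>n\<close> of this kind, and if they are chosen sparsely enough, the terms of the sum are
  dominated by a geometric series. In the application, \<open>a n\<close> is the dimension of the \<open>n\<close>-th term of a filtered ring. The inequality says that this term
  is not exhausted by the previous one and by the left multiples of one element in each of the degrees \<open>D j\<close>.\<close>

lemma sparse_degrees_of_exponential_growth:
  fixes a :: "nat \<Rightarrow> nat"
  assumes pos: "0 < a 0" and growth: "\<And>n. (C + 1) * a n \<le> C * a (n + d)"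
  obtains D :: "nat \<Rightarrow> nat" where "\<And>k. 0 < D k"
    and "\<And>k. a (D k - 1) + (\<Sum>j \<in> {j. j < k \<and> D j \<le> D k}. a (D k - D j)) < a (D k)"
proof -
  have C: "0 < C" using growth[of 0] pos by (cases C) auto
  have d: "0 < d" using growth[of 0] pos by (cases d) auto
  define \<theta> where "\<theta> = (real C + 1) / real C"
  have \<theta>: "1 < \<theta>" using C by (simp add: \<theta>_def divide_simps)
  \<comment> \<open>With only half of the growth rate divided out, \<open>b\<close> is still unbounded.\<close>
  define \<mu> where "\<mu> = \<theta> powr (1 / (2 * real d))"
  have \<mu>: "1 < \<mu>" using \<theta> d by (simp add: \<mu>_def)
  define b where "b n = real (a n) / \<mu> ^ n" for n
  have \<mu>d: "\<mu> ^ d = sqrt \<theta>"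
    using \<theta> d by (simp add: \<mu>_def powr_half_sqrt[symmetric] powr_powr flip: powr_realpow)
  have step: "sqrt \<theta> * b n \<le> b (n + d)" for n
  proof -
    have "(real C + 1) * real (a n) \<le> real C * real (a (n + d))"
      using growth[of n] by (metis of_nat_1 of_nat_add of_nat_le_iff of_nat_mult)
    then have "\<theta> * real (a n) \<le> real (a (n + d))" using C by (simp add: \<theta>_def field_simps)
    moreover have "sqrt \<theta> * b n = \<theta> * real (a n) / \<mu> ^ (n + d)"
    proof -
      have "sqrt \<theta> * sqrt \<theta> = \<theta>" using \<theta> by simp
      then have "\<theta> * real (a n) / \<mu> ^ (n + d) = (sqrt \<theta> * sqrt \<theta>) * real (a n) / (\<mu> ^ n * sqrt \<theta>)"
        by (simp add: power_add \<mu>d)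
      also have "\<dots> = sqrt \<theta> * (real (a n) / \<mu> ^ n)"
      proof -
        have "(r * r) * x / (y * r) = r * (x / y)" if "r \<noteq> 0" for r x y :: real
          using that by simp
        moreover have "sqrt \<theta> \<noteq> 0" using \<theta> by simp
        ultimately show ?thesis by blast
      qed
      also have "\<dots> = sqrt \<theta> * b n" by (simp add: b_def)
      finally show ?thesis by simp
    qed
    ultimately show ?thesis using \<mu> by (simp add: b_def divide_right_mono)
  qed
  have unbounded: "\<exists>n. B < b n" for B
  proof -
    have geom: "sqrt \<theta> ^ i * b 0 \<le> b (i * d)" for i
    proof (induction i)
      case (Suc i)
      have "sqrt \<theta> ^ Suc i * b 0 \<le> sqrt \<theta> * b (i * d)"
        using Suc \<theta> by (simp add: mult.assoc mult_left_mono)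
      also have "\<dots> \<le> b (i * d + d)" by (rule step)
      finally show ?case by (simp add: add.commute)
    qed simp
    have b0: "0 < b 0" using pos by (simp add: b_def)
    obtain i where "B / b 0 < sqrt \<theta> ^ i" using real_arch_pow[of "sqrt \<theta>" "B / b 0"] \<theta> by auto
    then have "B < sqrt \<theta> ^ i * b 0" using b0 by (simp add: divide_simps)
    then show ?thesis using geom[of i] by (meson less_le_trans)
  qed
  have new_max: "\<exists>n\<ge>m. \<forall>i<n. b i < b n" for m
  proof -
    define B where "B = Max (b ` {..m})"
    have Bm: "i \<le> m \<Longrightarrow> b i \<le> B" for i unfolding B_def by (intro Max_ge) auto
    define n where "n = (LEAST n. B < b n)"
    have n: "B < b n" unfolding n_def using unbounded by (rule LeastI_ex)
    have least: "i < n \<Longrightarrow> b i \<le> B" for i unfolding n_def by (meson not_le not_less_Least)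
    have "m \<le> n" using Bm[of n] n by (cases "n \<le> m") auto
    then show ?thesis using n least by (meson le_less_trans)
  qed
  \<comment> \<open>The fraction of \<open>a (D k)\<close> that is left over by \<open>a (D k - 1)\<close>.\<close>
  define \<delta> where "\<delta> = 1 - 1 / \<mu>"
  have \<delta>: "0 < \<delta>" using \<mu> by (simp add: \<delta>_def)
  have "\<exists>n. 0 < n \<and> (1 / \<mu>) ^ n < \<delta> / 2 ^ (k + 1) \<and> (\<forall>i<n. b i < b n)" for k
  proof -
    obtain m where m: "(1 / \<mu>) ^ m < \<delta> / 2 ^ (k + 1)"
      using real_arch_pow_inv[of "\<delta> / 2 ^ (k + 1)" "1 / \<mu>"] \<delta> \<mu> by auto
    obtain n where n: "n \<ge> Suc m" "\<forall>i<n. b i < b n" using new_max by blast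
    have "(1 / \<mu>) ^ n \<le> (1 / \<mu>) ^ m" using n \<mu> by (intro power_decreasing) auto
    then show ?thesis using n m by (intro exI[of _ n]) auto
  qed
  then obtain D where D: "\<And>k. 0 < D k" "\<And>k. (1 / \<mu>) ^ D k < \<delta> / 2 ^ (k + 1)"
    "\<And>k i. i < D k \<Longrightarrow> b i < b (D k)" by metis
  have "a (D k - 1) + (\<Sum>j \<in> {j. j < k \<and> D j \<le> D k}. a (D k - D j)) < a (D k)" for k
  proof -
    let ?n = "D k" and ?J = "{j. j < k \<and> D j \<le> D k}"
    have a: "real (a i) = b i * \<mu> ^ i" for i using \<mu> by (simp add: b_def)
    have shift: "real (a (?n - i)) \<le> (1 / \<mu>) ^ i * real (a ?n)" if "0 < i" "i \<le> ?n" for i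
    proof -
      have "b (?n - i) \<le> b ?n" using D(3)[of "?n - i" k] that D(1)[of k] by auto
      then have "real (a (?n - i)) \<le> b ?n * \<mu> ^ (?n - i)" using \<mu> by (simp add: a mult_right_mono)
      also have "\<dots> = (1 / \<mu>) ^ i * real (a ?n)" using \<mu> that by (simp add: a power_diff power_divide)
      finally show ?thesis .
    qed
    have apos: "0 < real (a ?n)"
    proof -
      have "b 0 < b ?n" using D by blast
      moreover have "0 < b 0" using pos by (simp add: b_def)
      ultimately show ?thesis using \<mu> by (simp add: a)
    qed
    have half: "(\<Sum>j<k. \<delta> / 2 ^ (j + 1)) < \<delta>"
    proof -
      have "(\<Sum>j<k. \<delta> / 2 ^ (j + 1)) = \<delta> * (1 - 1 / 2 ^ k)" by (induction k) (auto simp: field_simps)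
      then show ?thesis using \<delta> by (simp add: mult_less_cancel_left2)
    qed
    have "(\<Sum>j\<in>?J. (1 / \<mu>) ^ D j) \<le> (\<Sum>j<k. (1 / \<mu>) ^ D j)"
      using \<mu> by (intro sum_mono2) auto
    also have "\<dots> \<le> (\<Sum>j<k. \<delta> / 2 ^ (j + 1))" by (intro sum_mono less_imp_le D)
    also note half
    finally have J: "(\<Sum>j\<in>?J. (1 / \<mu>) ^ D j) < \<delta>" .
    have "real (a (?n - 1) + (\<Sum>j\<in>?J. a (?n - D j))) = real (a (?n - 1)) + (\<Sum>j\<in>?J. real (a (?n - D j)))"
      by simp
    also have "\<dots> \<le> (1 / \<mu>) ^ 1 * real (a ?n) + (\<Sum>j\<in>?J. (1 / \<mu>) ^ D j * real (a ?n))"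
      using D(1) by (intro add_mono sum_mono shift) (auto simp: Suc_le_eq)
    also have "\<dots> = (1 / \<mu> + (\<Sum>j\<in>?J. (1 / \<mu>) ^ D j)) * real (a ?n)"
      by (simp add: sum_distrib_right distrib_right)
    also have "\<dots> < 1 * real (a ?n)" using J apos by (intro mult_strict_right_mono) (auto simp: \<delta>_def)
    finally show ?thesis by (simp only: mult_1 of_nat_less_iff)
  qed
  with D(1) that show thesis by blast
qed

section \<open>Matrix units in a prime ring of quotients\<close>

text \<open>Primeness is a statement about ideals. The elementwise form follows from it with \<open>J = {y. a A y = 0}\<close> and
  \<open>I = {x. x A J = 0}\<close>: these are ideals with \<open>I J = 0\<close>, they contain \<open>b\<close> and \<open>a\<close> respectively if \<open>a A b = 0\<close>.\<close>

lemma prime_ringD: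
  assumes "prime_ring A" "a \<in> carrier A" "b \<in> carrier A" "a \<noteq> \<zero>\<^bsub>A\<^esub>" "b \<noteq> \<zero>\<^bsub>A\<^esub>"
  shows "\<exists>r\<in>carrier A. a \<otimes>\<^bsub>A\<^esub> r \<otimes>\<^bsub>A\<^esub> b \<noteq> \<zero>\<^bsub>A\<^esub>"
proof (rule ccontr)
  assume no: "\<not> ?thesis"
  interpret A: ring A using assms(1) by (simp add: prime_ring_def)
  define J where "J = {y \<in> carrier A. \<forall>r\<in>carrier A. a \<otimes>\<^bsub>A\<^esub> r \<otimes>\<^bsub>A\<^esub> y = \<zero>\<^bsub>A\<^esub>}"
  define I where "I = {x \<in> carrier A. \<forall>r\<in>carrier A. \<forall>y\<in>J. x \<otimes>\<^bsub>A\<^esub> r \<otimes>\<^bsub>A\<^esub> y = \<zero>\<^bsub>A\<^esub>}"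
  have Jc: "y \<in> carrier A" if "y \<in> J" for y using that by (simp add: J_def)
  have J_left: "r \<otimes>\<^bsub>A\<^esub> y \<in> J" if "y \<in> J" "r \<in> carrier A" for r y
    using that assms(2) by (auto simp: J_def) (metis A.m_assoc A.m_closed)
  have J: "ideal J A"
  proof (rule idealI)
    show "ring A" by (rule A.ring_axioms)
    show "subgroup J (add_monoid A)"
    proof (rule A.add.subgroupI)
      show "J \<subseteq> carrier A" "J \<noteq> {}" using assms(2) by (auto simp: J_def intro!: exI[of _ "\<zero>\<^bsub>A\<^esub>"])
    qed (use assms(2) in \<open>auto simp: J_def A.r_distr A.r_minus\<close>)
    show "y \<otimes>\<^bsub>A\<^esub> r \<in> J" if "y \<in> J" "r \<in> carrier A" for r y
      using that assms(2) by (auto simp: J_def A.m_assoc[symmetric])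
  qed (rule J_left)
  have I: "ideal I A"
  proof (rule idealI)
    show "ring A" by (rule A.ring_axioms)
    show "subgroup I (add_monoid A)"
    proof (rule A.add.subgroupI)
      show "I \<subseteq> carrier A" "I \<noteq> {}" using Jc by (auto simp: I_def intro!: exI[of _ "\<zero>\<^bsub>A\<^esub>"])
    qed (use Jc in \<open>auto simp: I_def A.l_distr A.l_minus\<close>)
    show "r \<otimes>\<^bsub>A\<^esub> x \<in> I" if "x \<in> I" "r \<in> carrier A" for r x
      using that Jc by (auto simp: I_def A.m_assoc)
    show "x \<otimes>\<^bsub>A\<^esub> r \<in> I" if "x \<in> I" "r \<in> carrier A" for r x
      using that Jc by (auto simp: I_def A.m_assoc) (metis A.m_assoc A.m_closed)
  qed
  have "x \<otimes>\<^bsub>A\<^esub> y = \<zero>\<^bsub>A\<^esub>" if "x \<in> I" "y \<in> J" for x y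
  proof -
    have "x \<otimes>\<^bsub>A\<^esub> \<one>\<^bsub>A\<^esub> \<otimes>\<^bsub>A\<^esub> y = \<zero>\<^bsub>A\<^esub>" "x \<in> carrier A"
      using that A.one_closed unfolding I_def by blast+
    then show ?thesis by (metis A.r_one)
  qed
  then have "I = {\<zero>\<^bsub>A\<^esub>} \<or> J = {\<zero>\<^bsub>A\<^esub>}" using assms(1) I J by (auto simp: prime_ring_def)
  moreover have "b \<in> J" using no assms by (auto simp: J_def)
  moreover have "a \<in> I" using assms by (auto simp: I_def J_def)
  ultimately show False using assms by auto
qed

context ring
begin

definition left_ann :: "'a \<Rightarrow> 'a set" where
  "left_ann x = {q \<in> carrier R. q \<otimes> x = \<zero>}"

definition left_multiples :: "'a \<Rightarrow> 'a set" where
  "left_multiples x = (\<lambda>q. q \<otimes> x) ` carrier R"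

lemma left_idealI:
  assumes "L \<subseteq> carrier R" "\<zero> \<in> L" "\<And>x y. x \<in> L \<Longrightarrow> y \<in> L \<Longrightarrow> x \<oplus> y \<in> L"
    "\<And>r x. r \<in> carrier R \<Longrightarrow> x \<in> L \<Longrightarrow> r \<otimes> x \<in> L"
  shows "left_ideal L R"
proof -
  have "\<ominus> x \<in> L" if "x \<in> L" for x
    using assms(4)[OF a_inv_closed[OF one_closed] that] that assms(1) by (auto simp: l_minus)
  then have "subgroup L (add_monoid R)"
    using assms by (intro add.subgroupI) auto
  then show ?thesis using assms(4) by (auto simp: left_ideal_def additive_subgroupI)
qed

lemma left_idealD:
  assumes "left_ideal L R"
  shows "x \<in> L \<Longrightarrow> x \<in> carrier R" "\<zero> \<in> L" "x \<in> L \<Longrightarrow> y \<in> L \<Longrightarrow> x \<oplus> y \<in> L"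
    "x \<in> L \<Longrightarrow> \<ominus> x \<in> L" "r \<in> carrier R \<Longrightarrow> x \<in> L \<Longrightarrow> r \<otimes> x \<in> L"
  using assms additive_subgroup.a_Hcarr[of L R x] additive_subgroup.zero_closed[of L R]
    additive_subgroup.a_closed[of L R x y] additive_subgroup.a_inv_closed[of L R x]
  by (auto simp: left_ideal_def)

lemma left_ideal_ann: "x \<in> carrier R \<Longrightarrow> left_ideal (left_ann x) R"
  by (rule left_idealI) (auto simp: left_ann_def l_distr m_assoc)

lemma left_ideal_multiples: "x \<in> carrier R \<Longrightarrow> left_ideal (left_multiples x) R"
proof (rule left_idealI)
  assume x: "x \<in> carrier R"
  show "left_multiples x \<subseteq> carrier R" using x by (auto simp: left_multiples_def)
  show "\<zero> \<in> left_multiples x" using x by (auto simp: left_multiples_def intro!: image_eqI[of _ _ \<zero>])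
  show "y \<oplus> z \<in> left_multiples x" if "y \<in> left_multiples x" "z \<in> left_multiples x" for y z
    using that x by (auto simp: left_multiples_def l_distr[symmetric])
  show "r \<otimes> y \<in> left_multiples x" if "r \<in> carrier R" "y \<in> left_multiples x" for r y
    using that x by (auto simp: left_multiples_def m_assoc[symmetric])
qed

text \<open>In a vanishing sum of elements of the \<open>Y\<^sub>i\<close>, all terms but the first lie in \<open>W\<^sub>1\<close>, hence so does the first, which is
  therefore zero; and so on. Thus the \<open>Y\<^sub>i\<close> are independent.\<close>

lemma finsum_eq_zero_descending:
  assumes W: "\<And>i. left_ideal (W i) R" and YW: "\<And>i. Y i \<subseteq> W i" and dec: "\<And>i. W (Suc i) \<subseteq> W i"
    and dis: "\<And>i. Y i \<inter> W (Suc i) \<subseteq> {\<zero>}"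
    and x: "\<And>i. i \<le> n \<Longrightarrow> x i \<in> Y i" and sum: "(\<Oplus>i\<in>{m..n}. x i) = \<zero>" and "m \<le> i" "i \<le> n"
  shows "x i = \<zero>"
  using sum \<open>m \<le> i\<close>
proof (induction "Suc n - m" arbitrary: m)
  case 0 then show ?case using \<open>i \<le> n\<close> by simp
next
  case (Suc l)
  then have m: "m \<le> n" by simp
  have mono: "W j \<subseteq> W k" if "k \<le> j" for j k by (rule lift_Suc_antimono_le[of W, OF dec that])
  have xW: "x j \<in> W (Suc m)" if "j \<in> {Suc m..n}" for j using x[of j] YW[of j] mono[of "Suc m" j] that by auto
  have xc: "x j \<in> carrier R" if "j \<le> n" for j using x[OF that] YW[of j] left_idealD(1)[OF W] by blast
  have "{m..n} = insert m {Suc m..n}" using m by auto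
  then have eq: "x m \<oplus> (\<Oplus>i\<in>{Suc m..n}. x i) = \<zero>" using Suc.prems(1) xc m by simp
  have "finite J \<Longrightarrow> J \<subseteq> {Suc m..n} \<Longrightarrow> (\<Oplus>i\<in>J. x i) \<in> W (Suc m)" for J
  proof (induction J rule: finite_induct)
    case empty then show ?case by (simp add: left_idealD(2)[OF W])
  next
    case (insert j J) then show ?case
      using xW left_idealD(3)[OF W] xc by (subst finsum_insert) auto
  qed
  then have s: "(\<Oplus>i\<in>{Suc m..n}. x i) \<in> W (Suc m)" by simp
  have sc: "(\<Oplus>i\<in>{Suc m..n}. x i) \<in> carrier R" using left_idealD(1)[OF W s] .
  have "x m = \<ominus> (\<Oplus>i\<in>{Suc m..n}. x i)" using eq xc[OF m] sc by (metis minus_equality a_comm minus_minus)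
  then have "x m \<in> W (Suc m)" using left_idealD(4)[OF W s] by simp
  then have 0: "x m = \<zero>" using dis[of m] x[OF m] by auto
  show ?case
  proof (cases "i = m")
    case True then show ?thesis using 0 by simp
  next
    case False
    have "(\<Oplus>i\<in>{Suc m..n}. x i) = \<zero>" using eq 0 sc by simp
    then show ?thesis using Suc.hyps(1)[of "Suc m"] Suc.hyps(2) Suc.prems False by simp
  qed
qed

lemma no_descending_of_left_goldie:
  assumes "left_goldie R" and W: "\<And>i. left_ideal (W i) R" and Y: "\<And>i. left_ideal (Y i) R"
    and "\<And>i. Y i \<subseteq> W i" and "\<And>i. W (Suc i) \<subseteq> W i" and "\<And>i. Y i \<inter> W (Suc i) \<subseteq> {\<zero>}"
  shows "\<exists>i::nat. Y i = {\<zero>}"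
proof (rule ccontr)
  assume "\<not> ?thesis"
  moreover have "independent_family R Y"
    unfolding independent_family_def
  proof (intro allI impI)
    fix n x i assume "(\<forall>i\<le>n. x i \<in> Y i) \<and> (\<Oplus>i\<in>{..n}. x i) = \<zero>" "i \<le> n"
    then show "x i = \<zero>"
      using finsum_eq_zero_descending[where W=W and Y=Y and n=n and x=x and m=0 and i=i] W assms(4,5,6)
      by (simp add: atMost_atLeast0)
  qed
  ultimately show False using assms(1) Y unfolding left_goldie_def by blast
qed

end

text \<open>The ring of \<open>r \<times> r\<close> matrices over the corner \<open>e Q e\<close>: the columns \<open>p' i \<in> Q e\<close> and the rows \<open>p i \<in> e Q\<close> are dual to
  each other, and \<open>p' i \<otimes> p j\<close> are the matrix units. The last two conditions say that \<open>Q e\<close> and \<open>e Q\<close> are simple modules.\<close>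

locale matrix_units = ring Q for Q :: "('q, 'm) ring_scheme" (structure) +
  fixes e :: 'q and r :: nat and p p' :: "nat \<Rightarrow> 'q"
  assumes e_closed: "e \<in> carrier Q" and e_nonzero: "e \<noteq> \<zero>" and e_idem: "e \<otimes> e = e"
    and p_closed: "i < r \<Longrightarrow> p i \<in> carrier Q" and p'_closed: "i < r \<Longrightarrow> p' i \<in> carrier Q"
    and e_p: "i < r \<Longrightarrow> e \<otimes> p i = p i" and p'_e: "i < r \<Longrightarrow> p' i \<otimes> e = p' i"
    and p_p': "i < r \<Longrightarrow> j < r \<Longrightarrow> p i \<otimes> p' j = (if i = j then e else \<zero>)"
    and sum_p'_p: "(\<Oplus>i\<in>{..<r}. p' i \<otimes> p i) = \<one>"
    and left_simple: "q \<in> carrier Q \<Longrightarrow> q \<otimes> e \<noteq> \<zero> \<Longrightarrow> \<exists>q'\<in>carrier Q. q' \<otimes> (q \<otimes> e) = e"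
    and right_simple: "q \<in> carrier Q \<Longrightarrow> e \<otimes> q \<noteq> \<zero> \<Longrightarrow> \<exists>q'\<in>carrier Q. (e \<otimes> q) \<otimes> q' = e"

text \<open>What the ring of fractions of a prime left Goldie ring inherits from that ring. The condition on descending left ideals is the
  form in which the finiteness of independent families is applied.\<close>

locale prime_quotient_ring = ring Q for Q (structure) +
  assumes nontrivial: "\<one> \<noteq> \<zero>"
    and prime: "\<lbrakk>x \<in> carrier Q; y \<in> carrier Q; x \<noteq> \<zero>; y \<noteq> \<zero>\<rbrakk> \<Longrightarrow> \<exists>q\<in>carrier Q. x \<otimes> q \<otimes> y \<noteq> \<zero>"
    and no_descending: "\<And>W Y. \<lbrakk>\<And>i. left_ideal (W i) Q; \<And>i. left_ideal (Y i) Q;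
        \<And>i. Y i \<subseteq> W i; \<And>i. W (Suc i) \<subseteq> W i; \<And>i. Y i \<inter> W (Suc i) \<subseteq> {\<zero>}\<rbrakk> \<Longrightarrow> \<exists>i::nat. Y i = {\<zero>}"
    and maximal_left_ann: "\<lbrakk>S \<subseteq> carrier Q; S \<noteq> {}\<rbrakk>
        \<Longrightarrow> \<exists>x\<in>S. \<forall>y\<in>S. left_ann x \<subseteq> left_ann y \<longrightarrow> left_ann y = left_ann x"
    and regular_unit: "\<lbrakk>c \<in> carrier Q; \<And>q. q \<in> carrier Q \<Longrightarrow> q \<otimes> c = \<zero> \<Longrightarrow> q = \<zero>;
        \<And>q. q \<in> carrier Q \<Longrightarrow> c \<otimes> q = \<zero> \<Longrightarrow> q = \<zero>\<rbrakk> \<Longrightarrow> c \<in> Units Q"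
begin

text \<open>The elements with the same left annihilator as their square. They play the role of regular elements on part of the ring: it turns
  out that \<open>Q\<close> is the direct sum of \<open>Q b\<close> and the left annihilator of \<open>b\<close>.\<close>

definition squareable :: "'a \<Rightarrow> bool" where
  "squareable b \<longleftrightarrow> b \<in> carrier Q \<and> (\<forall>q\<in>carrier Q. q \<otimes> b \<otimes> b = \<zero> \<longrightarrow> q \<otimes> b = \<zero>)"

text \<open>Primeness yields \<open>v\<close> with \<open>a v a \<noteq> 0\<close>. Then \<open>b = a v\<close> has a nonzero square, because the left annihilator of \<open>b\<close> is not larger than that
  of \<open>a\<close> and does not contain \<open>b\<close>; by maximality the square has no larger left annihilator either.\<close>

lemma squareable_of_maximal:
  assumes S: "S \<subseteq> carrier Q - {\<zero>}" "\<And>x q. x \<in> S \<Longrightarrow> q \<in> carrier Q \<Longrightarrow> x \<otimes> q \<noteq> \<zero> \<Longrightarrow> x \<otimes> q \<in> S"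
    and a: "a \<in> S" "\<And>y. y \<in> S \<Longrightarrow> left_ann a \<subseteq> left_ann y \<Longrightarrow> left_ann y = left_ann a"
  shows "\<exists>b\<in>S. squareable b \<and> left_ann b = left_ann a"
proof -
  have ac: "a \<in> carrier Q" "a \<noteq> \<zero>" using S a by auto
  obtain v where v: "v \<in> carrier Q" "a \<otimes> v \<otimes> a \<noteq> \<zero>" using prime[OF ac(1,1,2,2)] by blast
  define b where "b = a \<otimes> v"
  have bc: "b \<in> carrier Q" using ac v by (simp add: b_def)
  have "b \<noteq> \<zero>" using v ac by (auto simp: b_def)
  then have bS: "b \<in> S" using S(2)[OF a(1) v(1)] by (simp add: b_def)
  have "left_ann a \<subseteq> left_ann b" using ac v by (auto simp: left_ann_def b_def m_assoc[symmetric])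
  then have lb: "left_ann b = left_ann a" using a(2) bS by blast
  have "b \<notin> left_ann a" using v by (simp add: left_ann_def b_def)
  then have bb: "b \<otimes> b \<noteq> \<zero>" using lb bc by (auto simp: left_ann_def)
  have "left_ann b \<subseteq> left_ann (b \<otimes> b)" using bc by (auto simp: left_ann_def m_assoc[symmetric])
  then have "left_ann (b \<otimes> b) = left_ann b" using a(2)[OF S(2)[OF bS bc bb]] lb by simp
  then have "squareable b" using bc by (auto simp: squareable_def left_ann_def m_assoc)
  then show ?thesis using bS lb by blast
qed

lemma squareable_right_multiple:
  assumes y: "y \<in> carrier Q" "y \<noteq> \<zero>"
  obtains t where "t \<in> carrier Q" "y \<otimes> t \<noteq> \<zero>" "squareable (y \<otimes> t)"
proof -
  define S where "S = {y \<otimes> t | t. t \<in> carrier Q \<and> y \<otimes> t \<noteq> \<zero>}"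
  have "S \<subseteq> carrier Q" using y by (auto simp: S_def)
  moreover have "y \<otimes> \<one> \<in> S" using y unfolding S_def by (intro CollectI exI[of _ \<one>]) simp
  ultimately obtain a where "a \<in> S" "\<And>z. z \<in> S \<Longrightarrow> left_ann a \<subseteq> left_ann z \<Longrightarrow> left_ann z = left_ann a"
    using maximal_left_ann[of S] by blast
  moreover have "x \<otimes> q \<in> S" if "x \<in> S" "q \<in> carrier Q" "x \<otimes> q \<noteq> \<zero>" for x q
    using that y unfolding S_def by (auto simp: m_assoc)
  moreover have "S \<subseteq> carrier Q - {\<zero>}" using y by (auto simp: S_def)
  ultimately obtain b where "b \<in> S" "squareable b" using squareable_of_maximal[of S a] by blast
  then show thesis using that by (auto simp: S_def)
qed

text \<open>If \<open>b = y t\<close> is squareable, then so is \<open>t b y\<close>: a product of two such factors, multiplied by \<open>t\<close> on the right, is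
  \<open>t b\<^sup>4\<close>.\<close>

lemma squareable_left_multiple:
  assumes y: "y \<in> carrier Q" "y \<noteq> \<zero>"
  obtains t where "t \<in> carrier Q" "t \<otimes> y \<noteq> \<zero>" "squareable (t \<otimes> y)"
proof -
  obtain t where t: "t \<in> carrier Q" "y \<otimes> t \<noteq> \<zero>" "squareable (y \<otimes> t)"
    using squareable_right_multiple[OF y] .
  define b where "b = y \<otimes> t"
  have bc: "b \<in> carrier Q" using y t by (simp add: b_def)
  have canc: "q \<otimes> b = \<zero>" if "q \<in> carrier Q" "q \<otimes> b \<otimes> b = \<zero>" for q
    using t that by (auto simp: squareable_def b_def)
  have yt: "z \<otimes> y \<otimes> t = z \<otimes> b" if "z \<in> carrier Q" for z using that y t by (simp add: b_def m_assoc)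
  have nz: "t \<otimes> b \<otimes> y \<noteq> \<zero>"
  proof
    assume "t \<otimes> b \<otimes> y = \<zero>"
    then have "y \<otimes> (t \<otimes> b \<otimes> y) \<otimes> t = \<zero>" using y t by simp
    then have "b \<otimes> b \<otimes> b = \<zero>" using y t bc by (simp add: m_assoc b_def)
    then have "\<one> \<otimes> b = \<zero>" using canc[of b] canc[of \<one>] bc by simp
    then show False using t bc by (simp add: b_def)
  qed
  have "q \<otimes> (t \<otimes> b \<otimes> y) = \<zero>"
    if q: "q \<in> carrier Q" "q \<otimes> (t \<otimes> b \<otimes> y) \<otimes> (t \<otimes> b \<otimes> y) = \<zero>" for q
  proof -
    have "(q \<otimes> (t \<otimes> b \<otimes> y) \<otimes> (t \<otimes> b \<otimes> y)) \<otimes> t = \<zero>" using q t by simp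
    then have "q \<otimes> t \<otimes> b \<otimes> b \<otimes> b \<otimes> b = \<zero>" using q y t bc by (simp add: m_assoc b_def)
    then have "q \<otimes> t \<otimes> b = \<zero>" using canc q t bc by (metis m_closed)
    then have "(q \<otimes> t \<otimes> b) \<otimes> y = \<zero>" using y by simp
    then show ?thesis using q t bc y by (simp add: m_assoc)
  qed
  then have "squareable (t \<otimes> b \<otimes> y)" using t bc y by (simp add: squareable_def)
  then show thesis using nz t bc by (intro that[of "t \<otimes> b"]) auto
qed

lemma mult_pow_Suc: "b \<in> carrier Q \<Longrightarrow> q \<in> carrier Q \<Longrightarrow> q \<otimes> b [^] Suc i = (q \<otimes> b) \<otimes> b [^] (i::nat)"
  by (metis m_assoc nat_pow_Suc2 nat_pow_closed)

lemma squareable_power: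
  assumes b: "squareable b" shows "q \<in> carrier Q \<Longrightarrow> q \<otimes> b [^] (i::nat) = \<zero> \<Longrightarrow> q \<otimes> b = \<zero>"
proof (induction i arbitrary: q)
  case 0
  then show ?case using b by (simp add: squareable_def)
next
  case (Suc i)
  have bc: "b \<in> carrier Q" using b by (simp add: squareable_def)
  have "(q \<otimes> b) \<otimes> b [^] i = \<zero>"
    using Suc.prems(2) unfolding mult_pow_Suc[OF bc Suc.prems(1)] .
  then have "(q \<otimes> b) \<otimes> b = \<zero>" using Suc.IH[of "q \<otimes> b"] Suc.prems bc by simp
  then show ?case using b Suc.prems by (simp add: squareable_def)
qed

text \<open>If \<open>Y\<close> meets \<open>Q b\<close> plus the left annihilator of \<open>b\<close> trivially, then multiplication by powers of \<open>b\<close> is injective on \<open>Y\<close>, and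
  \<open>Y b\<^sup>i\<close> is contained in \<open>Q b\<^sup>i\<close> and meets \<open>Q b\<^bsup>i+1\<^esup>\<close> trivially. So some \<open>Y b\<^sup>i\<close> vanishes, and with it \<open>Y\<close>.\<close>

lemma squareable_essential:
  assumes b: "squareable b" and Y: "left_ideal Y Q"
    and dis: "\<And>y q z. y \<in> Y \<Longrightarrow> q \<in> carrier Q \<Longrightarrow> z \<in> carrier Q \<Longrightarrow> z \<otimes> b = \<zero> \<Longrightarrow> y = q \<otimes> b \<oplus> z \<Longrightarrow> y = \<zero>"
  shows "Y = {\<zero>}"
proof -
  have bc: "b \<in> carrier Q" using b by (simp add: squareable_def)
  note Yc = left_idealD(1)[OF Y]
  define W Z where "W i = left_multiples (b [^] (i::nat))" and "Z i = (\<lambda>y. y \<otimes> b [^] (i::nat)) ` Y" for i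
  have zero: "y = \<zero>" if "y \<in> Y" "y \<otimes> b [^] i = \<zero>" for y and i :: nat
    using dis[OF that(1) zero_closed Yc[OF that(1)]] squareable_power[OF b Yc[OF that(1)] that(2)]
      Yc[OF that(1)] bc by simp
  have "\<exists>i. Z i = {\<zero>}"
  proof (rule no_descending[of W])
    fix i
    show "left_ideal (W i) Q" unfolding W_def using bc by (intro left_ideal_multiples) simp
    show "left_ideal (Z i) Q"
    proof (rule left_idealI)
      show "Z i \<subseteq> carrier Q" using Yc bc by (auto simp: Z_def)
      show "\<zero> \<in> Z i" using left_idealD(2)[OF Y] bc by (auto simp: Z_def intro!: image_eqI[of _ _ \<zero>])
      show "x \<oplus> y \<in> Z i" if "x \<in> Z i" "y \<in> Z i" for x y
        using that left_idealD(3)[OF Y] Yc bc by (auto simp: Z_def l_distr[symmetric])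
      show "q \<otimes> x \<in> Z i" if "q \<in> carrier Q" "x \<in> Z i" for q x
        using that left_idealD(5)[OF Y] Yc bc by (auto simp: Z_def m_assoc[symmetric])
    qed
    show "Z i \<subseteq> W i" using Yc by (auto simp: Z_def W_def left_multiples_def)
    show "W (Suc i) \<subseteq> W i"
    proof
      fix x assume "x \<in> W (Suc i)"
      then obtain q where "q \<in> carrier Q" "x = q \<otimes> b [^] Suc i" unfolding W_def left_multiples_def by blast
      then have "q \<otimes> b \<in> carrier Q" "x = (q \<otimes> b) \<otimes> b [^] i"
        using bc mult_pow_Suc by blast+
      then show "x \<in> W i" unfolding W_def left_multiples_def by blast
    qed
    show "Z i \<inter> W (Suc i) \<subseteq> {\<zero>}"
    proof
      fix x assume "x \<in> Z i \<inter> W (Suc i)"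
      then obtain y q where yq: "y \<in> Y" "x = y \<otimes> b [^] i" "q \<in> carrier Q" "x = q \<otimes> b [^] Suc i"
        unfolding Z_def W_def left_multiples_def by blast
      have x: "x = (q \<otimes> b) \<otimes> b [^] i"
        using yq(4) unfolding mult_pow_Suc[OF bc yq(3)] .
      have c: "y \<in> carrier Q" "q \<otimes> b \<in> carrier Q" using yq bc Yc by auto
      have "(y \<ominus> q \<otimes> b) \<otimes> b [^] i = \<zero>"
        using x yq(2) c bc by (simp add: minus_eq l_distr l_minus r_neg)
      then have "(y \<ominus> q \<otimes> b) \<otimes> b = \<zero>" using squareable_power[OF b] c by simp
      moreover have "y = q \<otimes> b \<oplus> (y \<ominus> q \<otimes> b)"
        using c by (simp add: minus_eq a_lcomm r_neg)
      ultimately have "y = \<zero>" using dis[OF yq(1,3)] c by blast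
      then show "x \<in> {\<zero>}" using yq bc by simp
    qed
  qed
  then obtain i where "Z i = {\<zero>}" by blast
  then have "y = \<zero>" if "y \<in> Y" for y using zero[OF that, of i] that by (auto simp: Z_def)
  then show ?thesis using left_idealD(2)[OF Y] by blast
qed

text \<open>Because of \<open>x c = 0\<close>, multiplying \<open>q (c + x)\<close> by \<open>c\<close> on the right leaves \<open>q c\<^sup>2\<close>; so \<open>q c\<close> and \<open>q x\<close> vanish separately.\<close>

lemma squareable_sum:
  assumes c: "squareable c" and x: "squareable x" and xc: "x \<otimes> c = \<zero>"
  shows "squareable (c \<oplus> x)"
    and "q \<in> carrier Q \<Longrightarrow> q \<otimes> (c \<oplus> x) = \<zero> \<Longrightarrow> q \<otimes> c = \<zero> \<and> q \<otimes> x = \<zero>"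
proof -
  have cc: "c \<in> carrier Q" and xx: "x \<in> carrier Q" using c x by (auto simp: squareable_def)
  have canc: "z \<otimes> c = \<zero>" if "z \<in> carrier Q" "z \<otimes> c \<otimes> c = \<zero>" for z using c that by (simp add: squareable_def)
  have cancx: "z \<otimes> x = \<zero>" if "z \<in> carrier Q" "z \<otimes> x \<otimes> x = \<zero>" for z using x that by (simp add: squareable_def)
  have tc: "z \<otimes> (c \<oplus> x) \<otimes> c = z \<otimes> c \<otimes> c" if "z \<in> carrier Q" for z
    using that cc xx xc by (simp add: m_assoc l_distr r_distr)
  show split: "q \<otimes> c = \<zero> \<and> q \<otimes> x = \<zero>" if q: "q \<in> carrier Q" "q \<otimes> (c \<oplus> x) = \<zero>" for q
  proof -
    have "q \<otimes> c \<otimes> c = \<zero>" using tc[OF q(1)] q cc by simp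
    then have "q \<otimes> c = \<zero>" using canc q by simp
    then show ?thesis using q cc xx by (simp add: r_distr)
  qed
  have "q \<otimes> (c \<oplus> x) = \<zero>" if q: "q \<in> carrier Q" "q \<otimes> (c \<oplus> x) \<otimes> (c \<oplus> x) = \<zero>" for q
  proof -
    have *: "q \<otimes> (c \<oplus> x) \<otimes> c = \<zero>" "q \<otimes> (c \<oplus> x) \<otimes> x = \<zero>"
      using split[of "q \<otimes> (c \<oplus> x)"] q cc xx by auto
    then have qc: "q \<otimes> c = \<zero>" using tc[OF q(1)] canc q by simp
    then have "q \<otimes> x \<otimes> x = \<zero>" using *(2) q cc xx by (simp add: r_distr)
    then show ?thesis using qc cancx q cc xx by (simp add: r_distr)
  qed
  then show "squareable (c \<oplus> x)" using cc xx by (simp add: squareable_def)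
qed

text \<open>The ideal \<open>E\<close> contains a unit. As long as a squareable element \<open>c\<close> of \<open>E\<close> has a nonzero left annihilator, that annihilator contains a
  squareable \<open>x \<noteq> 0\<close> of \<open>E\<close>, and \<open>c + x\<close> has the smaller left annihilator ann \<open>c\<close> \<open>\<inter>\<close> ann \<open>x\<close>, which meets \<open>Q x\<close> trivially. This
  cannot continue forever. An element \<open>c\<close> with zero left annihilator generates an essential left ideal by \<open>squareable_essential\<close>,
  so it also has zero right annihilator and is a unit.\<close>

theorem essential_left_ideal_full:
  assumes E: "left_ideal E Q" and ess: "\<And>Y. left_ideal Y Q \<Longrightarrow> Y \<inter> E \<subseteq> {\<zero>} \<Longrightarrow> Y = {\<zero>}"
  shows "E = carrier Q"
proof -
  have "\<exists>c\<in>E. squareable c \<and> left_ann c = {\<zero>}"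
  proof (rule ccontr)
    assume no: "\<not> ?thesis"
    have "\<exists>f. \<forall>n. (f n \<in> E \<and> squareable (f n)) \<and> (\<exists>x. x \<in> left_ann (f n) \<and> x \<noteq> \<zero> \<and>
        left_multiples x \<inter> left_ann (f (Suc n)) \<subseteq> {\<zero>} \<and> left_ann (f (Suc n)) \<subseteq> left_ann (f n))"
    proof (rule dependent_nat_choice)
      show "\<exists>c. c \<in> E \<and> squareable c" by (rule exI[of _ \<zero>]) (simp add: squareable_def left_idealD(2)[OF E])
    next
      fix c and n :: nat assume c: "c \<in> E \<and> squareable c"
      then have cc: "c \<in> carrier Q" by (simp add: squareable_def)
      have "left_ann c \<noteq> {\<zero>}" using no c by blast
      then have "\<not> left_ann c \<inter> E \<subseteq> {\<zero>}" using ess[OF left_ideal_ann[OF cc]] by blast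
      then obtain y where y: "y \<in> left_ann c" "y \<in> E" "y \<noteq> \<zero>" by blast
      then have yc: "y \<in> carrier Q" by (simp add: left_ann_def)
      obtain t where t: "t \<in> carrier Q" "t \<otimes> y \<noteq> \<zero>" "squareable (t \<otimes> y)"
        using squareable_left_multiple[OF yc y(3)] .
      let ?x = "t \<otimes> y"
      have x: "?x \<in> E" "?x \<in> left_ann c" using left_idealD(5)[OF E t(1) y(2)] left_idealD(5)[OF left_ideal_ann[OF cc] t(1) y(1)] by auto
      then have xc: "?x \<otimes> c = \<zero>" by (simp add: left_ann_def)
      note sq = squareable_sum[OF conjunct2[OF c] t(3) xc]
      have "left_ann (c \<oplus> ?x) \<subseteq> left_ann c" using sq(2) by (auto simp: left_ann_def)
      moreover have "left_multiples ?x \<inter> left_ann (c \<oplus> ?x) \<subseteq> {\<zero>}"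
      proof
        fix z assume "z \<in> left_multiples ?x \<inter> left_ann (c \<oplus> ?x)"
        then obtain q where q: "q \<in> carrier Q" "z = q \<otimes> ?x" "z \<in> carrier Q" "z \<otimes> (c \<oplus> ?x) = \<zero>"
          by (auto simp: left_multiples_def left_ann_def)
        then have "q \<otimes> ?x \<otimes> ?x = \<zero>" using sq(2)[of z] by simp
        then have "q \<otimes> ?x = \<zero>" using t(3) q(1) unfolding squareable_def by blast
          then show "z \<in> {\<zero>}" using q(2) by simp
      qed
      ultimately show "\<exists>d. (d \<in> E \<and> squareable d) \<and> (\<exists>x. x \<in> left_ann c \<and> x \<noteq> \<zero> \<and>
          left_multiples x \<inter> left_ann d \<subseteq> {\<zero>} \<and> left_ann d \<subseteq> left_ann c)"
        using x t sq(1) c left_idealD(3)[OF E] by (intro exI[of _ "c \<oplus> ?x"]) blast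
    qed
    then obtain f where f: "\<And>n. squareable (f n)" "\<And>n. \<exists>x. x \<in> left_ann (f n) \<and> x \<noteq> \<zero> \<and>
        left_multiples x \<inter> left_ann (f (Suc n)) \<subseteq> {\<zero>} \<and> left_ann (f (Suc n)) \<subseteq> left_ann (f n)" by blast
    then obtain x where x: "\<And>n. x n \<in> left_ann (f n)" "\<And>n. x n \<noteq> \<zero>"
      "\<And>n. left_multiples (x n) \<inter> left_ann (f (Suc n)) \<subseteq> {\<zero>}" "\<And>n. left_ann (f (Suc n)) \<subseteq> left_ann (f n)" by metis
    have fc: "f n \<in> carrier Q" for n using f(1) by (simp add: squareable_def)
    have xc: "x n \<in> carrier Q" for n using x(1) by (simp add: left_ann_def)
    have "\<exists>n. left_multiples (x n) = {\<zero>}"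
    proof (rule no_descending[of "\<lambda>n. left_ann (f n)" "\<lambda>n. left_multiples (x n)"])
      show "left_multiples (x i) \<subseteq> left_ann (f i)" for i
        using left_idealD(5)[OF left_ideal_ann[OF fc] _ x(1)] by (auto simp: left_multiples_def)
    qed (use x fc xc left_ideal_ann left_ideal_multiples in auto)
    then obtain n where "left_multiples (x n) = {\<zero>}" by blast
    moreover have "\<one> \<otimes> x n \<in> left_multiples (x n)" unfolding left_multiples_def by blast
    ultimately show False using x(2)[of n] xc by simp
  qed
  then obtain c where c: "c \<in> E" "squareable c" "left_ann c = {\<zero>}" by blast
  have cc: "c \<in> carrier Q" using c by (simp add: squareable_def)
  have left: "q = \<zero>" if "q \<in> carrier Q" "q \<otimes> c = \<zero>" for q using c(3) that by (auto simp: left_ann_def)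
  have right: "y = \<zero>" if y: "y \<in> carrier Q" "c \<otimes> y = \<zero>" for y
  proof (rule ccontr)
    assume "y \<noteq> \<zero>"
    then obtain t where t: "t \<in> carrier Q" "y \<otimes> t \<noteq> \<zero>" "squareable (y \<otimes> t)"
      using squareable_right_multiple[OF y(1)] by blast
    define b where "b = y \<otimes> t"
    have bc: "b \<in> carrier Q" "b \<noteq> \<zero>" and cb: "c \<otimes> b = \<zero>" using y t cc by (auto simp: b_def m_assoc[symmetric])
    have "left_multiples b = {\<zero>}"
    proof (rule squareable_essential[OF c(2) left_ideal_multiples[OF bc(1)]])
      fix z q w assume *: "z \<in> left_multiples b" "q \<in> carrier Q" "w \<in> carrier Q" "w \<otimes> c = \<zero>" "z = q \<otimes> c \<oplus> w"
      then obtain q' where q': "q' \<in> carrier Q" "z = q' \<otimes> b" by (auto simp: left_multiples_def)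
      have "z = q \<otimes> c" using * left cc by simp
      then have "z \<otimes> b = \<zero>" using cb * cc bc by (simp add: m_assoc)
      then show "z = \<zero>" using t(3) q' by (simp add: squareable_def b_def)
    qed
    moreover have "\<one> \<otimes> b \<in> left_multiples b" unfolding left_multiples_def by blast
    ultimately show False using bc by simp
  qed
  have u: "c \<in> Units Q" using regular_unit[OF cc left right] .
  then have "inv c \<otimes> c \<in> E" using left_idealD(5)[OF E _ c(1)] Units_inv_closed by blast
  then have 1: "\<one> \<in> E" using Units_l_inv[OF u] by simp
  have "q \<in> E" if "q \<in> carrier Q" for q using left_idealD(5)[OF E that 1] that by simp
  then show ?thesis using left_idealD(1)[OF E] by blast
qed

text \<open>The sum of \<open>Q b\<close> and the left annihilator of \<open>b\<close> is essential by \<open>squareable_essential\<close>.\<close>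

lemma squareable_decomposition:
  assumes b: "squareable b"
  obtains q y where "q \<in> carrier Q" "y \<in> carrier Q" "y \<otimes> b = \<zero>" "\<one> = q \<otimes> b \<oplus> y"
proof -
  have bc: "b \<in> carrier Q" using b by (simp add: squareable_def)
  define E where "E = {q \<otimes> b \<oplus> y | q y. q \<in> carrier Q \<and> y \<in> carrier Q \<and> y \<otimes> b = \<zero>}"
  have "left_ideal E Q"
  proof (rule left_idealI)
    show "E \<subseteq> carrier Q" using bc by (auto simp: E_def)
    show "\<zero> \<in> E" using bc unfolding E_def by (intro CollectI exI[of _ \<zero>]) simp
    show "x \<oplus> z \<in> E" if "x \<in> E" "z \<in> E" for x z
    proof -
      obtain q y q' y' where *: "q \<in> carrier Q" "y \<in> carrier Q" "y \<otimes> b = \<zero>" "x = q \<otimes> b \<oplus> y"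
        "q' \<in> carrier Q" "y' \<in> carrier Q" "y' \<otimes> b = \<zero>" "z = q' \<otimes> b \<oplus> y'"
        using \<open>x \<in> E\<close> \<open>z \<in> E\<close> unfolding E_def by blast
      then have "x \<oplus> z = (q \<oplus> q') \<otimes> b \<oplus> (y \<oplus> y')" using bc by (simp add: l_distr a_ac)
      moreover have "(y \<oplus> y') \<otimes> b = \<zero>" using * bc by (simp add: l_distr)
      ultimately show ?thesis using * unfolding E_def by blast
    qed
    show "a \<otimes> x \<in> E" if "a \<in> carrier Q" "x \<in> E" for a x
    proof -
      obtain q y where *: "q \<in> carrier Q" "y \<in> carrier Q" "y \<otimes> b = \<zero>" "x = q \<otimes> b \<oplus> y"
        using \<open>x \<in> E\<close> unfolding E_def by blast
      then have "a \<otimes> x = (a \<otimes> q) \<otimes> b \<oplus> a \<otimes> y" "a \<otimes> y \<otimes> b = \<zero>"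
        using bc that by (simp_all add: r_distr m_assoc)
      then show ?thesis using * that unfolding E_def by blast
    qed
  qed
  moreover have "Y = {\<zero>}" if Y: "left_ideal Y Q" "Y \<inter> E \<subseteq> {\<zero>}" for Y
  proof (rule squareable_essential[OF b Y(1)])
    fix y q z assume "y \<in> Y" "q \<in> carrier Q" "z \<in> carrier Q" "z \<otimes> b = \<zero>" "y = q \<otimes> b \<oplus> z"
    then have "y \<in> Y \<inter> E" unfolding E_def by blast
    then show "y = \<zero>" using Y by blast
  qed
  ultimately have "E = carrier Q" by (rule essential_left_ideal_full)
  then have "\<one> \<in> E" by simp
  then show thesis using that unfolding E_def by blast
qed

text \<open>Let the left annihilator of \<open>b\<close> be maximal among those of nonzero elements, with \<open>b\<close> squareable. In \<open>1 = q b + y\<close> the element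
  \<open>e = q b\<close> is an idempotent with the same left annihilator. By maximality, every nonzero \<open>z \<in> e Q e\<close> has this left annihilator too and
  is squareable; decomposing \<open>1\<close> along \<open>z\<close> then yields a left inverse of \<open>z\<close> in \<open>e Q e\<close>, which is thus a division ring.\<close>

lemma primitive_idempotent:
  obtains e where "e \<in> carrier Q" "e \<noteq> \<zero>" "e \<otimes> e = e"
    and "\<And>z. z \<in> carrier Q \<Longrightarrow> z \<noteq> \<zero> \<Longrightarrow> e \<otimes> z = z \<Longrightarrow> z \<otimes> e = z \<Longrightarrow>
      \<exists>w\<in>carrier Q. e \<otimes> w = w \<and> w \<otimes> e = w \<and> w \<otimes> z = e \<and> z \<otimes> w = e"
proof -
  have "carrier Q - {\<zero>} \<noteq> {}" using nontrivial by auto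
  then obtain a where a: "a \<in> carrier Q - {\<zero>}"
    "\<And>y. y \<in> carrier Q - {\<zero>} \<Longrightarrow> left_ann a \<subseteq> left_ann y \<Longrightarrow> left_ann y = left_ann a"
    using maximal_left_ann[of "carrier Q - {\<zero>}"] by blast
  then obtain b where b: "b \<in> carrier Q - {\<zero>}" "squareable b" "left_ann b = left_ann a"
    using squareable_of_maximal[of "carrier Q - {\<zero>}" a] by auto
  have bc: "b \<in> carrier Q" using b by simp
  obtain q y where qy: "q \<in> carrier Q" "y \<in> carrier Q" "y \<otimes> b = \<zero>" "\<one> = q \<otimes> b \<oplus> y"
    using squareable_decomposition[OF b(2)] .
  define e where "e = q \<otimes> b"
  have ec: "e \<in> carrier Q" using qy bc by (simp add: e_def)
  have one: "e \<oplus> y = \<one>" using qy(4) by (simp only: e_def)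
  have "(e \<oplus> y) \<otimes> b = b" using bc by (simp add: one)
  then have eb: "e \<otimes> b = b" using qy(1-3) ec bc by (simp add: l_distr)
  have le: "left_ann e = left_ann b"
  proof (intro subset_antisym subsetI)
    fix r assume "r \<in> left_ann e"
    then have r: "r \<in> carrier Q" "r \<otimes> e = \<zero>" by (auto simp: left_ann_def)
    have "r \<otimes> e \<otimes> b = r \<otimes> b" using r(1) ec bc eb by (simp only: m_assoc)
    then show "r \<in> left_ann b" using r bc by (simp add: left_ann_def)
  next
    fix r assume "r \<in> left_ann b"
    then have r: "r \<in> carrier Q" "r \<otimes> b = \<zero>" by (auto simp: left_ann_def)
    have "(r \<otimes> q) \<otimes> b \<otimes> b = r \<otimes> (e \<otimes> b)" using r qy bc by (simp add: e_def m_assoc)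
    then have "(r \<otimes> q) \<otimes> b = \<zero>" using b(2) r qy eb by (simp add: squareable_def)
    then show "r \<in> left_ann e" using r qy bc by (simp add: left_ann_def e_def m_assoc)
  qed
  have "y \<in> left_ann e" using qy le by (simp add: left_ann_def)
  then have ye: "y \<otimes> e = \<zero>" by (simp add: left_ann_def)
  have "(e \<oplus> y) \<otimes> e = e" using ec by (simp add: one)
  then have ee: "e \<otimes> e = e" using qy(1-3) ec ye by (simp add: l_distr)
  have e0: "e \<noteq> \<zero>" using eb b by auto
  have linv: "\<exists>w\<in>carrier Q. e \<otimes> w = w \<and> w \<otimes> e = w \<and> w \<otimes> z = e"
    if z: "z \<in> carrier Q" "z \<noteq> \<zero>" "e \<otimes> z = z" "z \<otimes> e = z" for z
  proof -
    have max: "left_ann u = left_ann e" if "u \<in> carrier Q" "u \<noteq> \<zero>" "e \<otimes> u = u" for u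
    proof -
      have "left_ann a \<subseteq> left_ann u"
      proof
        fix r assume "r \<in> left_ann a"
        then have "r \<in> carrier Q" "r \<otimes> e = \<zero>" using le b(3) by (auto simp: left_ann_def)
        then show "r \<in> left_ann u" using that ec by (simp add: left_ann_def) (metis l_null m_assoc)
      qed
      then show ?thesis using a(2)[of u] that le b(3) by simp
    qed
    have lz: "left_ann z = left_ann e" using max z by simp
    have "z \<notin> left_ann e" using z by (simp add: left_ann_def)
    then have "z \<notin> left_ann z" unfolding lz .
    then have zz: "z \<otimes> z \<noteq> \<zero>" using z by (simp add: left_ann_def)
    have "left_ann (z \<otimes> z) = left_ann e" using max[of "z \<otimes> z"] z zz ec by (simp add: m_assoc[symmetric])
    then have lzz: "left_ann (z \<otimes> z) = left_ann z" by (simp only: lz)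
    have "q \<otimes> z = \<zero>" if "q \<in> carrier Q" "q \<otimes> z \<otimes> z = \<zero>" for q
    proof -
      have "q \<in> left_ann (z \<otimes> z)" using that z by (simp add: left_ann_def m_assoc)
      then show ?thesis unfolding lzz by (simp add: left_ann_def)
    qed
    then have "squareable z" using z by (simp add: squareable_def)
    then obtain q' w where w: "q' \<in> carrier Q" "w \<in> carrier Q" "w \<otimes> z = \<zero>" "\<one> = q' \<otimes> z \<oplus> w"
      by (rule squareable_decomposition)
    have "w \<in> left_ann z" using w by (simp add: left_ann_def)
    then have "w \<in> left_ann e" by (simp only: lz)
    then have we: "w \<otimes> e = \<zero>" by (simp add: left_ann_def)
    have "(q' \<otimes> z \<oplus> w) \<otimes> e = e" using w(4)[symmetric] ec by simp
    then have eq: "e = q' \<otimes> z" using w(1,2) we z ec by (simp add: l_distr m_assoc)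
    have "(e \<otimes> q' \<otimes> e) \<otimes> z = e \<otimes> (q' \<otimes> (e \<otimes> z))" using z w ec by (simp add: m_assoc)
    also have "\<dots> = e" using z eq ee by simp
    finally have "(e \<otimes> q' \<otimes> e) \<otimes> z = e" .
    moreover have "e \<otimes> (e \<otimes> q' \<otimes> e) = e \<otimes> q' \<otimes> e" "(e \<otimes> q' \<otimes> e) \<otimes> e = e \<otimes> q' \<otimes> e"
      using ec w ee by (simp_all add: m_assoc[symmetric]) (simp add: m_assoc ee)
    ultimately show ?thesis using ec w by (intro bexI[of _ "e \<otimes> q' \<otimes> e"]) auto
  qed
  show thesis
  proof (rule that[OF ec e0 ee])
    fix z assume z: "z \<in> carrier Q" "z \<noteq> \<zero>" "e \<otimes> z = z" "z \<otimes> e = z"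
    obtain w where w: "w \<in> carrier Q" "e \<otimes> w = w" "w \<otimes> e = w" "w \<otimes> z = e" using linv[OF z] by blast
    have "w \<noteq> \<zero>" using w e0 z by auto
    then obtain v where v: "v \<in> carrier Q" "e \<otimes> v = v" "v \<otimes> e = v" "v \<otimes> w = e" using linv w by blast
    have "z \<otimes> w = (v \<otimes> w) \<otimes> z \<otimes> w" unfolding v(4) z(3) by (rule refl)
    also have "\<dots> = v \<otimes> (w \<otimes> z) \<otimes> w" using v(1) z(1) w(1) by (simp add: m_assoc)
    also have "\<dots> = e" unfolding w(4) v(3,4) by (rule refl)
    finally have "z \<otimes> w = e" .
    then show "\<exists>w\<in>carrier Q. e \<otimes> w = w \<and> w \<otimes> e = w \<and> w \<otimes> z = e \<and> z \<otimes> w = e"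
      using w by blast
  qed
qed

text \<open>A maximal family of dual pairs of rows and columns is finite, because the left ideals \<open>Q p\<^sub>i\<close> are independent. The idempotent
  \<open>g = 1 - \<Sum> p'\<^sub>i p\<^sub>i\<close> annihilates the family on both sides; if it were not zero, primeness would give a nonzero element of
  \<open>e Q g Q e\<close> and hence a further dual pair.\<close>

theorem matrix_units_exist:
  obtains e r p p' where "matrix_units Q e r p p'"
proof -
  obtain e where ec: "e \<in> carrier Q" and e0: "e \<noteq> \<zero>" and ee: "e \<otimes> e = e"
    and div: "\<And>z. z \<in> carrier Q \<Longrightarrow> z \<noteq> \<zero> \<Longrightarrow> e \<otimes> z = z \<Longrightarrow> z \<otimes> e = z \<Longrightarrow>
      \<exists>w\<in>carrier Q. e \<otimes> w = w \<and> w \<otimes> e = w \<and> w \<otimes> z = e \<and> z \<otimes> w = e"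
    using primitive_idempotent by blast
  have e2: "e \<otimes> (e \<otimes> x) = e \<otimes> x" "x \<otimes> e \<otimes> e = x \<otimes> e" if "x \<in> carrier Q" for x
    using ec ee that by (simp_all add: m_assoc[symmetric]) (simp add: m_assoc ee)
  have corner: "\<exists>w\<in>carrier Q. e \<otimes> w = w \<and> w \<otimes> e = w \<and> w \<otimes> (e \<otimes> x \<otimes> e) = e \<and> (e \<otimes> x \<otimes> e) \<otimes> w = e"
    if "x \<in> carrier Q" "e \<otimes> x \<otimes> e \<noteq> \<zero>" for x
    using that ec e2 by (intro div) (simp_all add: m_assoc)
  have lsimple: "\<exists>q'\<in>carrier Q. q' \<otimes> (q \<otimes> e) = e" if q: "q \<in> carrier Q" "q \<otimes> e \<noteq> \<zero>" for q
  proof -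
    obtain u where u: "u \<in> carrier Q" "e \<otimes> u \<otimes> (q \<otimes> e) \<noteq> \<zero>" using prime[OF ec _ e0 q(2)] q ec by auto
    then have "e \<otimes> (u \<otimes> q) \<otimes> e \<noteq> \<zero>" using q ec by (simp add: m_assoc)
    then obtain w where w: "w \<in> carrier Q" "w \<otimes> (e \<otimes> (u \<otimes> q) \<otimes> e) = e" using corner[of "u \<otimes> q"] u q by auto
    then have "(w \<otimes> e \<otimes> u) \<otimes> (q \<otimes> e) = e" using u q ec by (simp add: m_assoc)
    then show ?thesis using w u ec by (intro bexI[of _ "w \<otimes> e \<otimes> u"]) auto
  qed
  have rsimple: "\<exists>q'\<in>carrier Q. (e \<otimes> q) \<otimes> q' = e" if q: "q \<in> carrier Q" "e \<otimes> q \<noteq> \<zero>" for q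
  proof -
    obtain u where u: "u \<in> carrier Q" "(e \<otimes> q) \<otimes> u \<otimes> e \<noteq> \<zero>" using prime[OF _ ec q(2) e0] q ec by auto
    then have "e \<otimes> (q \<otimes> u) \<otimes> e \<noteq> \<zero>" using q ec by (simp add: m_assoc)
    then obtain w where w: "w \<in> carrier Q" "(e \<otimes> (q \<otimes> u) \<otimes> e) \<otimes> w = e" using corner[of "q \<otimes> u"] u q by auto
    then have "(e \<otimes> q) \<otimes> (u \<otimes> e \<otimes> w) = e" using u q ec by (simp add: m_assoc)
    then show ?thesis using w u ec by (intro bexI[of _ "u \<otimes> e \<otimes> w"]) auto
  qed
  \<comment> \<open>The pairs consist of a row and a column, dual to each other and orthogonal to the first \<open>k\<close> pairs of \<open>f\<close>.\<close>
  define P where "P f k x \<longleftrightarrow> fst x \<in> carrier Q \<and> snd x \<in> carrier Q \<and> e \<otimes> fst x = fst x \<and> snd x \<otimes> e = snd x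
      \<and> fst x \<otimes> snd x = e \<and> (\<forall>j<k. fst x \<otimes> snd (f j) = \<zero> \<and> fst (f j) \<otimes> snd x = \<zero>)"
    for f :: "nat \<Rightarrow> 'a \<times> 'a" and k x
  have "\<not> (\<exists>f. \<forall>k. P f k (f k))"
  proof
    assume "\<exists>f. \<forall>k. P f k (f k)"
    then obtain f where f: "\<And>k. P f k (f k)" by blast
    define W where "W i = {q \<in> carrier Q. \<forall>j<i. q \<otimes> snd (f j) = \<zero>}" for i :: nat
    have fc: "fst (f i) \<in> carrier Q" "snd (f i) \<in> carrier Q" for i using f[of i] by (auto simp: P_def)
    have "\<exists>i. left_multiples (fst (f i)) = {\<zero>}"
    proof (rule no_descending[of W "\<lambda>i. left_multiples (fst (f i))"])
      fix i
      show "left_ideal (W i) Q" using fc by (intro left_idealI) (auto simp: W_def l_distr m_assoc)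
      show "left_ideal (left_multiples (fst (f i))) Q" using fc by (intro left_ideal_multiples)
      show "left_multiples (fst (f i)) \<subseteq> W i"
        using f[of i] fc by (auto simp: left_multiples_def W_def P_def m_assoc)
      show "W (Suc i) \<subseteq> W i" by (auto simp: W_def)
      show "left_multiples (fst (f i)) \<inter> W (Suc i) \<subseteq> {\<zero>}"
      proof
        fix x assume "x \<in> left_multiples (fst (f i)) \<inter> W (Suc i)"
        then obtain q where q: "q \<in> carrier Q" "x = q \<otimes> fst (f i)" "q \<otimes> fst (f i) \<otimes> snd (f i) = \<zero>"
          by (auto simp: left_multiples_def W_def)
        then have "q \<otimes> e = \<zero>" using f[of i] fc by (simp add: m_assoc P_def)
        moreover have "e \<otimes> fst (f i) = fst (f i)" using f[of i] by (simp add: P_def)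
        then have "x = (q \<otimes> e) \<otimes> fst (f i)" using q(2) m_assoc[OF q(1) ec fc(1)[of i]] by simp
        ultimately show "x \<in> {\<zero>}" using fc by simp
      qed
    qed
    then obtain i where "left_multiples (fst (f i)) = {\<zero>}" by blast
    moreover have "\<one> \<otimes> fst (f i) \<in> left_multiples (fst (f i))" unfolding left_multiples_def by blast
    ultimately have "fst (f i) = \<zero>" using fc by simp
    then have "fst (f i) \<otimes> snd (f i) = \<zero>" using fc(2) by simp
    then show False using f[of i] e0 by (simp add: P_def)
  qed
  moreover have "P f k x = P g k x" if "\<And>j. j < k \<Longrightarrow> f j = g j" for f g k x
    using that by (auto simp: P_def)
  ultimately obtain r f where f: "\<And>j. j < r \<Longrightarrow> P f j (f j)" and max: "\<not> (\<exists>x. P f r x)"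
    using dependent_wellorder_choice[of P] by metis
  define p p' where "p i = fst (f i)" and "p' i = snd (f i)" for i
  have pc: "p i \<in> carrier Q" "p' i \<in> carrier Q" "e \<otimes> p i = p i" "p' i \<otimes> e = p' i" "p i \<otimes> p' i = e"
    if "i < r" for i using f[OF that] by (auto simp: P_def p_def p'_def)
  have orth: "p i \<otimes> p' j = \<zero>" if "i < r" "j < r" "i \<noteq> j" for i j
    using f[OF that(1)] f[OF that(2)] that(3) by (cases i j rule: linorder_cases) (auto simp: P_def p_def p'_def)
  define \<Sigma> where "\<Sigma> = (\<Oplus>i\<in>{..<r}. p' i \<otimes> p i)"
  have \<Sigma>c: "\<Sigma> \<in> carrier Q" unfolding \<Sigma>_def using pc by (intro finsum_closed) auto
  have p\<Sigma>: "p j \<otimes> \<Sigma> = p j" if j: "j < r" for j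
  proof -
    have "p j \<otimes> \<Sigma> = (\<Oplus>i\<in>{..<r}. p j \<otimes> (p' i \<otimes> p i))"
      unfolding \<Sigma>_def using pc j by (intro finsum_rdistr) auto
    also have "\<dots> = (\<Oplus>i\<in>{..<r}. if j = i then p i else \<zero>)"
      using pc j orth by (intro finsum_cong') (auto simp: m_assoc[symmetric])
    also have "\<dots> = p j" using pc j by (intro add.finprod_singleton) auto
    finally show ?thesis .
  qed
  have \<Sigma>p': "\<Sigma> \<otimes> p' j = p' j" if j: "j < r" for j
  proof -
    have "\<Sigma> \<otimes> p' j = (\<Oplus>i\<in>{..<r}. (p' i \<otimes> p i) \<otimes> p' j)"
      unfolding \<Sigma>_def using pc j by (intro finsum_ldistr) auto
    also have "\<dots> = (\<Oplus>i\<in>{..<r}. if j = i then p' i else \<zero>)"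
      using pc j orth by (intro finsum_cong') (auto simp: m_assoc)
    also have "\<dots> = p' j" using pc j by (intro add.finprod_singleton) auto
    finally show ?thesis .
  qed
  define g where "g = \<one> \<ominus> \<Sigma>"
  have gc: "g \<in> carrier Q" using \<Sigma>c by (simp add: g_def)
  have pg: "p j \<otimes> g = \<zero>" and gp': "g \<otimes> p' j = \<zero>" if "j < r" for j
    using pc[OF that] p\<Sigma>[OF that] \<Sigma>p'[OF that] \<Sigma>c
    by (simp_all add: g_def minus_eq r_distr l_distr r_minus l_minus r_neg)
  have "\<Sigma> \<otimes> g = \<zero>"
  proof -
    have "\<Sigma> \<otimes> g = (\<Oplus>i\<in>{..<r}. (p' i \<otimes> p i) \<otimes> g)"
      unfolding \<Sigma>_def using pc gc by (intro finsum_ldistr) auto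
    also have "\<dots> = (\<Oplus>i\<in>{..<r}. \<zero>)" using pc pg gc by (intro finsum_cong') (auto simp: m_assoc)
    finally show ?thesis by simp
  qed
  then have gg: "g \<otimes> g = g" using gc \<Sigma>c by (subst g_def) (simp add: minus_eq l_distr l_minus)
  have "g = \<zero>"
  proof (rule ccontr)
    assume g0: "g \<noteq> \<zero>"
    obtain u where u: "u \<in> carrier Q" "e \<otimes> u \<otimes> g \<noteq> \<zero>" using prime[OF ec gc e0 g0] by blast
    then obtain v where v: "v \<in> carrier Q" "(e \<otimes> u \<otimes> g) \<otimes> v \<otimes> e \<noteq> \<zero>"
      using prime[of "e \<otimes> u \<otimes> g" e] ec gc e0 by auto
    then have "e \<otimes> (u \<otimes> g \<otimes> v) \<otimes> e \<noteq> \<zero>" using u gc ec by (simp add: m_assoc)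
    then obtain w where w: "w \<in> carrier Q" "e \<otimes> w = w" "w \<otimes> (e \<otimes> (u \<otimes> g \<otimes> v) \<otimes> e) = e"
      using corner[of "u \<otimes> g \<otimes> v"] u v gc by auto
    define x x' where "x = w \<otimes> e \<otimes> u \<otimes> g" and "x' = g \<otimes> v \<otimes> e"
    have "x \<otimes> x' = w \<otimes> e \<otimes> u \<otimes> (g \<otimes> g) \<otimes> v \<otimes> e"
      using u v w gc ec by (simp add: x_def x'_def m_assoc)
    also have "\<dots> = e" using w u v gc ec unfolding gg by (simp add: m_assoc)
    finally have "x \<otimes> x' = e" .
    moreover have "e \<otimes> x = x" using w u v gc ec by (simp add: x_def m_assoc[symmetric])
    moreover have "x' \<otimes> e = x'" using v gc ec ee by (simp add: x'_def m_assoc)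
    moreover have "x \<otimes> p' j = \<zero>" "p j \<otimes> x' = \<zero>" if "j < r" for j
    proof -
      have "x \<otimes> p' j = w \<otimes> e \<otimes> u \<otimes> (g \<otimes> p' j)" "p j \<otimes> x' = (p j \<otimes> g) \<otimes> v \<otimes> e"
        using pc[OF that] w u v gc ec by (simp_all add: x_def x'_def m_assoc)
      then show "x \<otimes> p' j = \<zero>" "p j \<otimes> x' = \<zero>" using pg[OF that] gp'[OF that] w u v ec by simp_all
    qed
    ultimately have "P f r (x, x')"
      using w u v gc ec by (simp add: P_def p_def p'_def x_def x'_def)
    then show False using max by blast
  qed
  then have "\<Sigma> = \<one>" using \<Sigma>c unfolding g_def by (metis r_right_minus_eq one_closed)
  then have "matrix_units Q e r p p'"
    using ec e0 ee pc orth lsimple rsimple unfolding \<Sigma>_def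
    by unfold_locales auto
  then show thesis by (rule that)
qed

end

section \<open>Rings of fractions\<close>

context ring
begin

lemma unit_left_cancel:
  assumes u: "u \<in> Units R" and q: "q \<in> carrier R" "u \<otimes> q = \<zero>" shows "q = \<zero>"
proof -
  have "q = (inv u \<otimes> u) \<otimes> q" using u q(1) Units_l_inv by simp
  also have "\<dots> = inv u \<otimes> (u \<otimes> q)"
    using q(1) Units_inv_closed[OF u] Units_closed[OF u] by (simp only: m_assoc)
  finally show ?thesis using q(2) Units_inv_closed[OF u] by simp
qed

lemma unit_right_cancel:
  assumes u: "u \<in> Units R" and q: "q \<in> carrier R" "q \<otimes> u = \<zero>" shows "q = \<zero>"
proof -
  have "q = q \<otimes> (u \<otimes> inv u)" using u q(1) Units_r_inv by simp
  also have "\<dots> = (q \<otimes> u) \<otimes> inv u"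
    using q(1) Units_inv_closed[OF u] Units_closed[OF u] by (simp only: m_assoc)
  finally show ?thesis using q(2) Units_inv_closed[OF u] by simp
qed

end

locale fractions = A: ring A + Q: ring Q
  for A :: "('a, 'm) ring_scheme" and Q :: "('q, 'n) ring_scheme" +
  fixes \<phi> :: "'a \<Rightarrow> 'q"
  assumes fractions: "ring_of_fractions A Q \<phi>"
begin

lemma phi_hom: "\<phi> \<in> ring_hom A Q"
  using fractions by (simp add: ring_of_fractions_def)

lemma phi_closed: "a \<in> carrier A \<Longrightarrow> \<phi> a \<in> carrier Q"
  using phi_hom by (rule ring_hom_closed)

lemma phi_mult: "a \<in> carrier A \<Longrightarrow> b \<in> carrier A \<Longrightarrow> \<phi> (a \<otimes>\<^bsub>A\<^esub> b) = \<phi> a \<otimes>\<^bsub>Q\<^esub> \<phi> b"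
  using phi_hom by (rule ring_hom_mult)

lemma phi_add: "a \<in> carrier A \<Longrightarrow> b \<in> carrier A \<Longrightarrow> \<phi> (a \<oplus>\<^bsub>A\<^esub> b) = \<phi> a \<oplus>\<^bsub>Q\<^esub> \<phi> b"
  using phi_hom by (rule ring_hom_add)

lemma phi_one: "\<phi> \<one>\<^bsub>A\<^esub> = \<one>\<^bsub>Q\<^esub>"
  using phi_hom by (rule ring_hom_one)

lemma phi_zero: "\<phi> \<zero>\<^bsub>A\<^esub> = \<zero>\<^bsub>Q\<^esub>"
  using ring_hom_zero[OF phi_hom A.ring_axioms Q.ring_axioms] .

lemma phi_inj: "a \<in> carrier A \<Longrightarrow> b \<in> carrier A \<Longrightarrow> \<phi> a = \<phi> b \<Longrightarrow> a = b"
  using fractions by (auto simp: ring_of_fractions_def inj_on_def)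

lemma phi_eq_zero: "a \<in> carrier A \<Longrightarrow> \<phi> a = \<zero>\<^bsub>Q\<^esub> \<Longrightarrow> a = \<zero>\<^bsub>A\<^esub>"
  using phi_inj[of a "\<zero>\<^bsub>A\<^esub>"] phi_zero by simp

lemma regular_closed: "s \<in> regular_elements A \<Longrightarrow> s \<in> carrier A"
  by (simp add: regular_elements_def)

lemma regular_one: "\<one>\<^bsub>A\<^esub> \<in> regular_elements A"
  by (simp add: regular_elements_def)

lemma phi_unit: "s \<in> regular_elements A \<Longrightarrow> \<phi> s \<in> Units Q"
  using fractions by (auto simp: ring_of_fractions_def)

lemma left_fraction:
  assumes "q \<in> carrier Q"
  obtains s a where "s \<in> regular_elements A" "a \<in> carrier A" "\<phi> s \<otimes>\<^bsub>Q\<^esub> q = \<phi> a"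
proof -
  obtain s a where *: "s \<in> regular_elements A" "a \<in> carrier A" "q = inv\<^bsub>Q\<^esub> (\<phi> s) \<otimes>\<^bsub>Q\<^esub> \<phi> a"
    using fractions assms unfolding ring_of_fractions_def by blast
  have "\<phi> s \<otimes>\<^bsub>Q\<^esub> q = (\<phi> s \<otimes>\<^bsub>Q\<^esub> inv\<^bsub>Q\<^esub> (\<phi> s)) \<otimes>\<^bsub>Q\<^esub> \<phi> a"
    unfolding *(3) using * phi_closed regular_closed Q.Units_inv_closed[OF phi_unit] by (simp add: Q.m_assoc)
  also have "\<dots> = \<phi> a" using Q.Units_r_inv[OF phi_unit[OF *(1)]] phi_closed[OF *(2)] by simp
  finally show thesis using that * by blast
qed

lemma right_fraction:
  assumes "q \<in> carrier Q"
  obtains s a where "s \<in> regular_elements A" "a \<in> carrier A" "q \<otimes>\<^bsub>Q\<^esub> \<phi> s = \<phi> a"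
proof -
  obtain s a where *: "s \<in> regular_elements A" "a \<in> carrier A" "q = \<phi> a \<otimes>\<^bsub>Q\<^esub> inv\<^bsub>Q\<^esub> (\<phi> s)"
    using fractions assms unfolding ring_of_fractions_def by blast
  have "q \<otimes>\<^bsub>Q\<^esub> \<phi> s = \<phi> a \<otimes>\<^bsub>Q\<^esub> (inv\<^bsub>Q\<^esub> (\<phi> s) \<otimes>\<^bsub>Q\<^esub> \<phi> s)"
    unfolding *(3) using * phi_closed regular_closed Q.Units_inv_closed[OF phi_unit] by (simp add: Q.m_assoc)
  also have "\<dots> = \<phi> a" using Q.Units_l_inv[OF phi_unit[OF *(1)]] phi_closed[OF *(2)] by simp
  finally show thesis using that * by blast
qed

lemma regular_left_cancel:
  assumes "s \<in> regular_elements A" "q \<in> carrier Q" "\<phi> s \<otimes>\<^bsub>Q\<^esub> q = \<zero>\<^bsub>Q\<^esub>" shows "q = \<zero>\<^bsub>Q\<^esub>"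
  using Q.unit_left_cancel[OF phi_unit[OF assms(1)] assms(2,3)] .

lemma regular_right_cancel:
  assumes "s \<in> regular_elements A" "q \<in> carrier Q" "q \<otimes>\<^bsub>Q\<^esub> \<phi> s = \<zero>\<^bsub>Q\<^esub>" shows "q = \<zero>\<^bsub>Q\<^esub>"
  using Q.unit_right_cancel[OF phi_unit[OF assms(1)] assms(2,3)] .

lemma regular_if_unit:
  assumes "a \<in> carrier A" "\<phi> a \<in> Units Q" shows "a \<in> regular_elements A"
proof -
  have "x = \<zero>\<^bsub>A\<^esub>" if x: "x \<in> carrier A" "a \<otimes>\<^bsub>A\<^esub> x = \<zero>\<^bsub>A\<^esub>" for x
  proof -
    have "\<phi> a \<otimes>\<^bsub>Q\<^esub> \<phi> x = \<zero>\<^bsub>Q\<^esub>" using phi_mult[OF assms(1) x(1)] x(2) phi_zero by simp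
    from Q.unit_left_cancel[OF assms(2) phi_closed[OF x(1)] this] show ?thesis by (rule phi_eq_zero[OF x(1)])
  qed
  moreover have "x = \<zero>\<^bsub>A\<^esub>" if x: "x \<in> carrier A" "x \<otimes>\<^bsub>A\<^esub> a = \<zero>\<^bsub>A\<^esub>" for x
  proof -
    have "\<phi> x \<otimes>\<^bsub>Q\<^esub> \<phi> a = \<zero>\<^bsub>Q\<^esub>" using phi_mult[OF x(1) assms(1)] x(2) phi_zero by simp
    from Q.unit_right_cancel[OF assms(2) phi_closed[OF x(1)] this] show ?thesis by (rule phi_eq_zero[OF x(1)])
  qed
  ultimately show ?thesis using assms(1) unfolding regular_elements_def by blast
qed

lemma regular_mult:
  assumes "s \<in> regular_elements A" "t \<in> regular_elements A" shows "s \<otimes>\<^bsub>A\<^esub> t \<in> regular_elements A"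
  using assms by (intro regular_if_unit) (simp_all add: phi_mult phi_unit regular_closed Q.Units_m_closed)

text \<open>Fractions are cleared one after another: the next one is multiplied by the denominator found so far before its own denominator
  is chosen.\<close>

lemma right_common_denominator:
  assumes "finite J" "\<And>j. j \<in> J \<Longrightarrow> q j \<in> carrier Q"
  obtains c where "c \<in> regular_elements A" "\<And>j. j \<in> J \<Longrightarrow> q j \<otimes>\<^bsub>Q\<^esub> \<phi> c \<in> \<phi> ` carrier A"
proof -
  have "\<exists>c\<in>regular_elements A. \<forall>j\<in>J. q j \<otimes>\<^bsub>Q\<^esub> \<phi> c \<in> \<phi> ` carrier A"
    using assms
  proof (induction J rule: finite_induct)
    case empty then show ?case using regular_one by auto
  next
    case (insert j J)
    then obtain c where c: "c \<in> regular_elements A" "\<forall>i\<in>J. q i \<otimes>\<^bsub>Q\<^esub> \<phi> c \<in> \<phi> ` carrier A" by auto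
    note cc = regular_closed[OF c(1)]
    have qc: "q j \<otimes>\<^bsub>Q\<^esub> \<phi> c \<in> carrier Q" using insert.prems phi_closed cc by auto
    obtain s a where s: "s \<in> regular_elements A" "a \<in> carrier A" "q j \<otimes>\<^bsub>Q\<^esub> \<phi> c \<otimes>\<^bsub>Q\<^esub> \<phi> s = \<phi> a"
      using right_fraction[OF qc] .
    note sc = regular_closed[OF s(1)]
    have assoc: "q i \<otimes>\<^bsub>Q\<^esub> \<phi> (c \<otimes>\<^bsub>A\<^esub> s) = q i \<otimes>\<^bsub>Q\<^esub> \<phi> c \<otimes>\<^bsub>Q\<^esub> \<phi> s" if "i \<in> insert j J" for i
      using insert.prems[OF that] cc sc phi_closed by (simp add: phi_mult Q.m_assoc)
    have "q i \<otimes>\<^bsub>Q\<^esub> \<phi> (c \<otimes>\<^bsub>A\<^esub> s) \<in> \<phi> ` carrier A" if i: "i \<in> insert j J" for i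
    proof (cases "i = j")
      case True then show ?thesis using assoc[OF i] s by simp
    next
      case False
      then obtain b where b: "b \<in> carrier A" "q i \<otimes>\<^bsub>Q\<^esub> \<phi> c = \<phi> b" using c(2) i by auto
      then have "q i \<otimes>\<^bsub>Q\<^esub> \<phi> (c \<otimes>\<^bsub>A\<^esub> s) = \<phi> (b \<otimes>\<^bsub>A\<^esub> s)" using assoc[OF i] sc phi_mult by simp
      then show ?thesis using b sc by blast
    qed
    then show ?case using regular_mult[OF c(1) s(1)] by blast
  qed
  then show thesis using that by blast
qed

lemma left_common_denominator:
  assumes "finite J" "\<And>j. j \<in> J \<Longrightarrow> q j \<in> carrier Q"
  obtains c where "c \<in> regular_elements A" "\<And>j. j \<in> J \<Longrightarrow> \<phi> c \<otimes>\<^bsub>Q\<^esub> q j \<in> \<phi> ` carrier A"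
proof -
  have "\<exists>c\<in>regular_elements A. \<forall>j\<in>J. \<phi> c \<otimes>\<^bsub>Q\<^esub> q j \<in> \<phi> ` carrier A"
    using assms
  proof (induction J rule: finite_induct)
    case empty then show ?case using regular_one by auto
  next
    case (insert j J)
    then obtain c where c: "c \<in> regular_elements A" "\<forall>i\<in>J. \<phi> c \<otimes>\<^bsub>Q\<^esub> q i \<in> \<phi> ` carrier A" by auto
    note cc = regular_closed[OF c(1)]
    have qc: "\<phi> c \<otimes>\<^bsub>Q\<^esub> q j \<in> carrier Q" using insert.prems phi_closed cc by auto
    obtain s a where s: "s \<in> regular_elements A" "a \<in> carrier A" "\<phi> s \<otimes>\<^bsub>Q\<^esub> (\<phi> c \<otimes>\<^bsub>Q\<^esub> q j) = \<phi> a"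
      using left_fraction[OF qc] .
    note sc = regular_closed[OF s(1)]
    have assoc: "\<phi> (s \<otimes>\<^bsub>A\<^esub> c) \<otimes>\<^bsub>Q\<^esub> q i = \<phi> s \<otimes>\<^bsub>Q\<^esub> (\<phi> c \<otimes>\<^bsub>Q\<^esub> q i)" if "i \<in> insert j J" for i
      using insert.prems[OF that] cc sc phi_closed by (simp add: phi_mult Q.m_assoc)
    have "\<phi> (s \<otimes>\<^bsub>A\<^esub> c) \<otimes>\<^bsub>Q\<^esub> q i \<in> \<phi> ` carrier A" if i: "i \<in> insert j J" for i
    proof (cases "i = j")
      case True then show ?thesis using assoc[OF i] s by simp
    next
      case False
      then obtain b where b: "b \<in> carrier A" "\<phi> c \<otimes>\<^bsub>Q\<^esub> q i = \<phi> b" using c(2) i by auto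
      then have "\<phi> (s \<otimes>\<^bsub>A\<^esub> c) \<otimes>\<^bsub>Q\<^esub> q i = \<phi> (s \<otimes>\<^bsub>A\<^esub> b)" using assoc[OF i] sc phi_mult by simp
      then show ?thesis using b sc by blast
    qed
    then show ?case using regular_mult[OF s(1) c(1)] by blast
  qed
  then show thesis using that by blast
qed

lemma left_common_multiple:
  assumes "c \<in> regular_elements A" "c' \<in> regular_elements A"
  obtains b b' where "b \<in> carrier A" "b' \<in> carrier A" "b \<otimes>\<^bsub>A\<^esub> c = b' \<otimes>\<^bsub>A\<^esub> c'" "b \<otimes>\<^bsub>A\<^esub> c \<in> regular_elements A"
proof -
  note cc = regular_closed[OF assms(1)] regular_closed[OF assms(2)]
  have i: "inv\<^bsub>Q\<^esub> (\<phi> c') \<in> carrier Q" using phi_unit[OF assms(2)] by simp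
  have ci: "\<phi> c \<otimes>\<^bsub>Q\<^esub> inv\<^bsub>Q\<^esub> (\<phi> c') \<in> carrier Q" using cc i phi_closed by simp
  obtain s a where s: "s \<in> regular_elements A" "a \<in> carrier A"
    "\<phi> s \<otimes>\<^bsub>Q\<^esub> (\<phi> c \<otimes>\<^bsub>Q\<^esub> inv\<^bsub>Q\<^esub> (\<phi> c')) = \<phi> a" using left_fraction[OF ci] .
  note sc = regular_closed[OF s(1)]
  have "\<phi> (a \<otimes>\<^bsub>A\<^esub> c') = \<phi> s \<otimes>\<^bsub>Q\<^esub> (\<phi> c \<otimes>\<^bsub>Q\<^esub> inv\<^bsub>Q\<^esub> (\<phi> c')) \<otimes>\<^bsub>Q\<^esub> \<phi> c'"
    using s cc phi_mult by simp
  also have "\<dots> = \<phi> s \<otimes>\<^bsub>Q\<^esub> (\<phi> c \<otimes>\<^bsub>Q\<^esub> (inv\<^bsub>Q\<^esub> (\<phi> c') \<otimes>\<^bsub>Q\<^esub> \<phi> c'))"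
    using sc cc i phi_closed by (simp add: Q.m_assoc)
  also have "\<dots> = \<phi> (s \<otimes>\<^bsub>A\<^esub> c)"
    using Q.Units_l_inv[OF phi_unit[OF assms(2)]] sc cc phi_closed phi_mult by simp
  finally have "s \<otimes>\<^bsub>A\<^esub> c = a \<otimes>\<^bsub>A\<^esub> c'" using phi_inj[of "a \<otimes>\<^bsub>A\<^esub> c'" "s \<otimes>\<^bsub>A\<^esub> c"] s(2) sc cc by simp
  then show thesis using that[of s a] sc s regular_mult[OF s(1) assms(1)] by simp
qed

lemma right_common_multiple:
  assumes "c \<in> regular_elements A" "c' \<in> regular_elements A"
  obtains b b' where "b \<in> carrier A" "b' \<in> carrier A" "c \<otimes>\<^bsub>A\<^esub> b = c' \<otimes>\<^bsub>A\<^esub> b'" "c \<otimes>\<^bsub>A\<^esub> b \<in> regular_elements A"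
proof -
  note cc = regular_closed[OF assms(1)] regular_closed[OF assms(2)]
  have i: "inv\<^bsub>Q\<^esub> (\<phi> c') \<in> carrier Q" using phi_unit[OF assms(2)] by simp
  have ci: "inv\<^bsub>Q\<^esub> (\<phi> c') \<otimes>\<^bsub>Q\<^esub> \<phi> c \<in> carrier Q" using cc i phi_closed by simp
  obtain s a where s: "s \<in> regular_elements A" "a \<in> carrier A"
    "(inv\<^bsub>Q\<^esub> (\<phi> c') \<otimes>\<^bsub>Q\<^esub> \<phi> c) \<otimes>\<^bsub>Q\<^esub> \<phi> s = \<phi> a" using right_fraction[OF ci] .
  note sc = regular_closed[OF s(1)]
  have "\<phi> (c' \<otimes>\<^bsub>A\<^esub> a) = \<phi> c' \<otimes>\<^bsub>Q\<^esub> ((inv\<^bsub>Q\<^esub> (\<phi> c') \<otimes>\<^bsub>Q\<^esub> \<phi> c) \<otimes>\<^bsub>Q\<^esub> \<phi> s)"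
    using s cc phi_mult by simp
  also have "\<dots> = (\<phi> c' \<otimes>\<^bsub>Q\<^esub> inv\<^bsub>Q\<^esub> (\<phi> c')) \<otimes>\<^bsub>Q\<^esub> (\<phi> c \<otimes>\<^bsub>Q\<^esub> \<phi> s)"
    using sc cc i phi_closed by (simp add: Q.m_assoc)
  also have "\<dots> = \<phi> (c \<otimes>\<^bsub>A\<^esub> s)"
    using Q.Units_r_inv[OF phi_unit[OF assms(2)]] sc cc phi_closed phi_mult by simp
  finally have "c \<otimes>\<^bsub>A\<^esub> s = c' \<otimes>\<^bsub>A\<^esub> a" using phi_inj[of "c' \<otimes>\<^bsub>A\<^esub> a" "c \<otimes>\<^bsub>A\<^esub> s"] s(2) sc cc by simp
  then show thesis using that[of s a] sc s regular_mult[OF assms(1) s(1)] by simp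
qed

lemma left_ann_fraction:
  assumes "b \<in> carrier A" "s \<in> regular_elements A" "x \<in> carrier Q" "x \<otimes>\<^bsub>Q\<^esub> \<phi> s = \<phi> b" "q \<in> carrier Q"
  shows "q \<otimes>\<^bsub>Q\<^esub> x = \<zero>\<^bsub>Q\<^esub> \<longleftrightarrow> q \<otimes>\<^bsub>Q\<^esub> \<phi> b = \<zero>\<^bsub>Q\<^esub>"
proof -
  have sc: "\<phi> s \<in> carrier Q" using assms(2) phi_closed regular_closed by simp
  have eq: "q \<otimes>\<^bsub>Q\<^esub> \<phi> b = (q \<otimes>\<^bsub>Q\<^esub> x) \<otimes>\<^bsub>Q\<^esub> \<phi> s" unfolding assms(4)[symmetric] using assms sc by (simp add: Q.m_assoc)
  show ?thesis using regular_right_cancel[OF assms(2), of "q \<otimes>\<^bsub>Q\<^esub> x"] assms(3,5) sc by (auto simp: eq)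
qed

text \<open>Everything is transferred from \<open>A\<close> by clearing denominators: a left ideal of \<open>Q\<close> is determined by its intersection with \<open>A\<close>, and
  \<open>x \<in> Q\<close> has the same left annihilator as \<open>x s \<in> A\<close> for a regular element \<open>s\<close>.\<close>

theorem prime_quotient_ring:
  assumes prime: "prime_ring A" and goldie: "left_goldie A"
  shows "prime_quotient_ring Q"
proof
  show "\<one>\<^bsub>Q\<^esub> \<noteq> \<zero>\<^bsub>Q\<^esub>"
  proof
    assume "\<one>\<^bsub>Q\<^esub> = \<zero>\<^bsub>Q\<^esub>"
    then have "\<one>\<^bsub>A\<^esub> = \<zero>\<^bsub>A\<^esub>" using phi_one phi_eq_zero[of "\<one>\<^bsub>A\<^esub>"] by simp
    then show False using prime A.one_zeroD unfolding prime_ring_def by blast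
  qed
next
  fix x y assume xy: "x \<in> carrier Q" "y \<in> carrier Q" "x \<noteq> \<zero>\<^bsub>Q\<^esub>" "y \<noteq> \<zero>\<^bsub>Q\<^esub>"
  obtain s a where s: "s \<in> regular_elements A" "a \<in> carrier A" "\<phi> s \<otimes>\<^bsub>Q\<^esub> x = \<phi> a" using left_fraction[OF xy(1)] .
  obtain t b where t: "t \<in> regular_elements A" "b \<in> carrier A" "y \<otimes>\<^bsub>Q\<^esub> \<phi> t = \<phi> b" using right_fraction[OF xy(2)] .
  have "a \<noteq> \<zero>\<^bsub>A\<^esub>" using regular_left_cancel[OF s(1) xy(1)] s(3) xy(3) phi_zero by auto
  moreover have "b \<noteq> \<zero>\<^bsub>A\<^esub>" using regular_right_cancel[OF t(1) xy(2)] t(3) xy(4) phi_zero by auto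
  ultimately obtain r where r: "r \<in> carrier A" "a \<otimes>\<^bsub>A\<^esub> r \<otimes>\<^bsub>A\<^esub> b \<noteq> \<zero>\<^bsub>A\<^esub>" using prime_ringD[OF prime s(2) t(2)] by blast
  note c = phi_closed[OF regular_closed[OF s(1)]] phi_closed[OF regular_closed[OF t(1)]] phi_closed[OF r(1)]
  have "x \<otimes>\<^bsub>Q\<^esub> \<phi> r \<otimes>\<^bsub>Q\<^esub> y \<noteq> \<zero>\<^bsub>Q\<^esub>"
  proof
    assume 0: "x \<otimes>\<^bsub>Q\<^esub> \<phi> r \<otimes>\<^bsub>Q\<^esub> y = \<zero>\<^bsub>Q\<^esub>"
    have "\<phi> (a \<otimes>\<^bsub>A\<^esub> r \<otimes>\<^bsub>A\<^esub> b) = \<phi> s \<otimes>\<^bsub>Q\<^esub> x \<otimes>\<^bsub>Q\<^esub> \<phi> r \<otimes>\<^bsub>Q\<^esub> (y \<otimes>\<^bsub>Q\<^esub> \<phi> t)"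
      using s t r phi_mult by simp
    also have "\<dots> = \<phi> s \<otimes>\<^bsub>Q\<^esub> (x \<otimes>\<^bsub>Q\<^esub> \<phi> r \<otimes>\<^bsub>Q\<^esub> y) \<otimes>\<^bsub>Q\<^esub> \<phi> t" using c xy by (simp add: Q.m_assoc)
    finally have "\<phi> (a \<otimes>\<^bsub>A\<^esub> r \<otimes>\<^bsub>A\<^esub> b) = \<zero>\<^bsub>Q\<^esub>" using 0 c by simp
    then show False using phi_eq_zero r s t by simp
  qed
  then show "\<exists>q\<in>carrier Q. x \<otimes>\<^bsub>Q\<^esub> q \<otimes>\<^bsub>Q\<^esub> y \<noteq> \<zero>\<^bsub>Q\<^esub>" using c by blast
next
  fix W Y :: "nat \<Rightarrow> 'q set"
  assume W: "\<And>i. left_ideal (W i) Q" and Y: "\<And>i. left_ideal (Y i) Q"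
    and YW: "\<And>i. Y i \<subseteq> W i" and dec: "\<And>i. W (Suc i) \<subseteq> W i" and dis: "\<And>i. Y i \<inter> W (Suc i) \<subseteq> {\<zero>\<^bsub>Q\<^esub>}"
  define pull where "pull L = {a \<in> carrier A. \<phi> a \<in> L}" for L
  have pull: "left_ideal (pull L) A" if L: "left_ideal L Q" for L
    by (rule A.left_idealI) (use Q.left_idealD[OF L] in \<open>auto simp: pull_def phi_zero phi_add phi_mult phi_closed\<close>)
  have "\<exists>i. pull (Y i) = {\<zero>\<^bsub>A\<^esub>}"
  proof (rule A.no_descending_of_left_goldie[OF goldie, of "\<lambda>i. pull (W i)"])
    show "pull (Y i) \<inter> pull (W (Suc i)) \<subseteq> {\<zero>\<^bsub>A\<^esub>}" for i
      using dis[of i] phi_eq_zero by (auto simp: pull_def)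
    show "pull (Y i) \<subseteq> pull (W i)" for i using YW[of i] by (auto simp: pull_def)
    show "pull (W (Suc i)) \<subseteq> pull (W i)" for i using dec[of i] by (auto simp: pull_def)
  qed (intro pull W Y)+
  then obtain i where i: "pull (Y i) = {\<zero>\<^bsub>A\<^esub>}" by blast
  have "y = \<zero>\<^bsub>Q\<^esub>" if y: "y \<in> Y i" for y
  proof -
    have yc: "y \<in> carrier Q" using Q.left_idealD(1)[OF Y y] .
    obtain s a where s: "s \<in> regular_elements A" "a \<in> carrier A" "\<phi> s \<otimes>\<^bsub>Q\<^esub> y = \<phi> a" using left_fraction[OF yc] .
    have "\<phi> a \<in> Y i" using Q.left_idealD(5)[OF Y phi_closed[OF regular_closed[OF s(1)]] y] s(3) by simp
    then have "a \<in> pull (Y i)" using s by (simp add: pull_def)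
    then have "\<phi> s \<otimes>\<^bsub>Q\<^esub> y = \<zero>\<^bsub>Q\<^esub>" using i s phi_zero by simp
    then show ?thesis by (rule regular_left_cancel[OF s(1) yc])
  qed
  then show "\<exists>i. Y i = {\<zero>\<^bsub>Q\<^esub>}" using Q.left_idealD(2)[OF Y] by blast
next
  fix S :: "'q set" assume S: "S \<subseteq> carrier Q" "S \<noteq> {}"
  show "\<exists>x\<in>S. \<forall>y\<in>S. Q.left_ann x \<subseteq> Q.left_ann y \<longrightarrow> Q.left_ann y = Q.left_ann x"
  proof (rule ccontr)
    assume no: "\<not> ?thesis"
    have "\<exists>x. \<forall>n. x n \<in> S \<and> Q.left_ann (x n) \<subset> Q.left_ann (x (Suc n))"
      by (rule dependent_nat_choice) (use S no in blast)+
    then obtain x where x: "\<And>n. x n \<in> S" "\<And>n. Q.left_ann (x n) \<subset> Q.left_ann (x (Suc n))" by blast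
    have xc: "x n \<in> carrier Q" for n using x S by blast
    have "\<exists>s b. s \<in> regular_elements A \<and> b \<in> carrier A \<and> x n \<otimes>\<^bsub>Q\<^esub> \<phi> s = \<phi> b" for n
      using right_fraction[OF xc[of n]] by metis
    then obtain s b where sb: "\<And>n. s n \<in> regular_elements A" "\<And>n. b n \<in> carrier A" "\<And>n. x n \<otimes>\<^bsub>Q\<^esub> \<phi> (s n) = \<phi> (b n)"
      by metis
    have ann: "a \<in> left_annihilator A {b n} \<longleftrightarrow> a \<in> carrier A \<and> \<phi> a \<in> Q.left_ann (x n)" for a n
    proof -
      have "a \<otimes>\<^bsub>A\<^esub> b n = \<zero>\<^bsub>A\<^esub> \<longleftrightarrow> \<phi> a \<otimes>\<^bsub>Q\<^esub> \<phi> (b n) = \<zero>\<^bsub>Q\<^esub>" if "a \<in> carrier A"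
        unfolding phi_mult[OF that sb(2), symmetric]
        using phi_eq_zero[OF A.m_closed[OF that sb(2)]] phi_zero by auto
      then show ?thesis
        using left_ann_fraction[OF sb(2) sb(1) xc sb(3), of "\<phi> a" n] phi_closed
        by (auto simp: left_annihilator_def Q.left_ann_def)
    qed
    have "(\<forall>n. {b n} \<subseteq> carrier A) \<and> (\<forall>n. left_annihilator A {b n} \<subseteq> left_annihilator A {b (Suc n)})"
      using sb(2) x(2) ann by blast
    moreover have "(\<forall>n. {b n} \<subseteq> carrier A) \<and> (\<forall>n. left_annihilator A {b n} \<subseteq> left_annihilator A {b (Suc n)})
        \<longrightarrow> (\<exists>N. \<forall>n\<ge>N. left_annihilator A {b n} = left_annihilator A {b N})"
      using conjunct2[OF goldie[unfolded left_goldie_def]] by (rule spec)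
    ultimately obtain N where N: "\<forall>n\<ge>N. left_annihilator A {b n} = left_annihilator A {b N}" by presburger
    have eq: "left_annihilator A {b (Suc N)} = left_annihilator A {b N}" by (rule N[rule_format]) simp
    have "Q.left_ann (x (Suc N)) \<subseteq> Q.left_ann (x N)"
    proof
      fix q assume q: "q \<in> Q.left_ann (x (Suc N))"
      then have qc: "q \<in> carrier Q" by (simp add: Q.left_ann_def)
      obtain t a where t: "t \<in> regular_elements A" "a \<in> carrier A" "\<phi> t \<otimes>\<^bsub>Q\<^esub> q = \<phi> a" using left_fraction[OF qc] .
      have tc: "\<phi> t \<in> carrier Q" using t phi_closed regular_closed by simp
      have "\<phi> a \<in> Q.left_ann (x (Suc N))"
        using Q.left_idealD(5)[OF Q.left_ideal_ann[OF xc] tc q] t by simp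
      then have "\<phi> a \<in> Q.left_ann (x N)" using ann t(2) eq by blast
      then have "\<phi> t \<otimes>\<^bsub>Q\<^esub> (q \<otimes>\<^bsub>Q\<^esub> x N) = \<zero>\<^bsub>Q\<^esub>"
        unfolding t(3)[symmetric] using qc tc xc by (simp add: Q.left_ann_def Q.m_assoc)
      then have "q \<otimes>\<^bsub>Q\<^esub> x N = \<zero>\<^bsub>Q\<^esub>" by (rule regular_left_cancel[OF t(1) Q.m_closed[OF qc xc]])
      then show "q \<in> Q.left_ann (x N)" using qc by (simp add: Q.left_ann_def)
    qed
    then show False using x(2)[of N] by blast
  qed
next
  fix c assume c: "c \<in> carrier Q" "\<And>q. q \<in> carrier Q \<Longrightarrow> q \<otimes>\<^bsub>Q\<^esub> c = \<zero>\<^bsub>Q\<^esub> \<Longrightarrow> q = \<zero>\<^bsub>Q\<^esub>"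
    "\<And>q. q \<in> carrier Q \<Longrightarrow> c \<otimes>\<^bsub>Q\<^esub> q = \<zero>\<^bsub>Q\<^esub> \<Longrightarrow> q = \<zero>\<^bsub>Q\<^esub>"
  obtain t a where t: "t \<in> regular_elements A" "a \<in> carrier A" "c \<otimes>\<^bsub>Q\<^esub> \<phi> t = \<phi> a" using right_fraction[OF c(1)] .
  have tc: "\<phi> t \<in> carrier Q" using t phi_closed regular_closed by simp
  have "x = \<zero>\<^bsub>A\<^esub>" if x: "x \<in> carrier A" "a \<otimes>\<^bsub>A\<^esub> x = \<zero>\<^bsub>A\<^esub>" for x
  proof -
    have "c \<otimes>\<^bsub>Q\<^esub> (\<phi> t \<otimes>\<^bsub>Q\<^esub> \<phi> x) = \<phi> (a \<otimes>\<^bsub>A\<^esub> x)"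
      using t(3)[symmetric] c(1) tc phi_closed[OF x(1)] phi_mult[OF t(2) x(1)] by (simp add: Q.m_assoc)
    then have "c \<otimes>\<^bsub>Q\<^esub> (\<phi> t \<otimes>\<^bsub>Q\<^esub> \<phi> x) = \<zero>\<^bsub>Q\<^esub>" using x(2) phi_zero by simp
    from c(3)[OF Q.m_closed[OF tc phi_closed[OF x(1)]] this]
    have "\<phi> t \<otimes>\<^bsub>Q\<^esub> \<phi> x = \<zero>\<^bsub>Q\<^esub>" .
    then have "\<phi> x = \<zero>\<^bsub>Q\<^esub>" by (rule regular_left_cancel[OF t(1) phi_closed[OF x(1)]])
    then show ?thesis using phi_eq_zero x by simp
  qed
  moreover have "x = \<zero>\<^bsub>A\<^esub>" if x: "x \<in> carrier A" "x \<otimes>\<^bsub>A\<^esub> a = \<zero>\<^bsub>A\<^esub>" for x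
  proof -
    have "(\<phi> x \<otimes>\<^bsub>Q\<^esub> c) \<otimes>\<^bsub>Q\<^esub> \<phi> t = \<phi> (x \<otimes>\<^bsub>A\<^esub> a)"
      using t(3)[symmetric] c(1) tc phi_closed[OF x(1)] phi_mult[OF x(1) t(2)] by (simp add: Q.m_assoc)
    then have "\<phi> x \<otimes>\<^bsub>Q\<^esub> c = \<zero>\<^bsub>Q\<^esub>" using regular_right_cancel[OF t(1) Q.m_closed[OF phi_closed[OF x(1)] c(1)]] x(2) phi_zero by simp
    with phi_closed[OF x(1)] have "\<phi> x = \<zero>\<^bsub>Q\<^esub>" by (rule c(2))
    then show ?thesis using phi_eq_zero x by simp
  qed
  ultimately have "a \<in> regular_elements A" using t(2) unfolding regular_elements_def by blast
  then have ua: "\<phi> a \<in> Units Q" and ut: "\<phi> t \<in> Units Q" using phi_unit t by auto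
  have it: "inv\<^bsub>Q\<^esub> (\<phi> t) \<in> Units Q" using ut by simp
  have "\<phi> a \<otimes>\<^bsub>Q\<^esub> inv\<^bsub>Q\<^esub> (\<phi> t) = c \<otimes>\<^bsub>Q\<^esub> (\<phi> t \<otimes>\<^bsub>Q\<^esub> inv\<^bsub>Q\<^esub> (\<phi> t))"
    unfolding t(3)[symmetric] using c(1) tc Q.Units_closed[OF it] by (simp add: Q.m_assoc)
  also have "\<dots> = c" using Q.Units_r_inv[OF ut] c(1) by simp
  finally show "c \<in> Units Q" using Q.Units_m_closed[OF ua it] by simp
qed

end

section \<open>Tensor products\<close>

text \<open>The tensor products \<open>Q \<otimes>\<^sub>A N\<close> and \<open>N \<otimes>\<^sub>A Q\<close> are both instances, with the roles of the two factors exchanged.\<close>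

locale balanced_pair = A: ring A + M: comm_group M + N: comm_group N
  for A :: "('a, 'r) ring_scheme" and M :: "('x, 'm) monoid_scheme" and N :: "('y, 'n) monoid_scheme" +
  fixes \<rho> :: "'x \<Rightarrow> 'a \<Rightarrow> 'x" and \<sigma> :: "'a \<Rightarrow> 'y \<Rightarrow> 'y"
  assumes right_action_closed: "x \<in> carrier M \<Longrightarrow> a \<in> carrier A \<Longrightarrow> \<rho> x a \<in> carrier M"
    and left_action_closed: "a \<in> carrier A \<Longrightarrow> y \<in> carrier N \<Longrightarrow> \<sigma> a y \<in> carrier N"
begin

abbreviation formal_sums :: "('x \<times> 'y \<Rightarrow>\<^sub>0 int) monoid" where
  "formal_sums \<equiv> free_Abelian_group (carrier M \<times> carrier N)"

abbreviation relations :: "('x \<times> 'y \<Rightarrow>\<^sub>0 int) set" where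
  "relations \<equiv> tensor_relations A M \<rho> N \<sigma>"

abbreviation tensor :: "('x \<times> 'y \<Rightarrow>\<^sub>0 int) set monoid" where
  "tensor \<equiv> tensor_product A M \<rho> N \<sigma>"

inductive_set relators :: "('x \<times> 'y \<Rightarrow>\<^sub>0 int) set" where
  left_add: "x \<in> carrier M \<Longrightarrow> x' \<in> carrier M \<Longrightarrow> y \<in> carrier N \<Longrightarrow>
    frag_of (x \<otimes>\<^bsub>M\<^esub> x', y) - frag_of (x, y) - frag_of (x', y) \<in> relators"
| right_add: "x \<in> carrier M \<Longrightarrow> y \<in> carrier N \<Longrightarrow> y' \<in> carrier N \<Longrightarrow>
    frag_of (x, y \<otimes>\<^bsub>N\<^esub> y') - frag_of (x, y) - frag_of (x, y') \<in> relators"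
| balance: "x \<in> carrier M \<Longrightarrow> a \<in> carrier A \<Longrightarrow> y \<in> carrier N \<Longrightarrow>
    frag_of (\<rho> x a, y) - frag_of (x, \<sigma> a y) \<in> relators"

lemma relations_eq: "relations = generate formal_sums relators"
proof -
  have "{frag_of (x \<otimes>\<^bsub>M\<^esub> x', y) - frag_of (x, y) - frag_of (x', y) | x x' y.
         x \<in> carrier M \<and> x' \<in> carrier M \<and> y \<in> carrier N} \<union>
      {frag_of (x, y \<otimes>\<^bsub>N\<^esub> y') - frag_of (x, y) - frag_of (x, y') | x y y'.
         x \<in> carrier M \<and> y \<in> carrier N \<and> y' \<in> carrier N} \<union>
      {frag_of (\<rho> x a, y) - frag_of (x, \<sigma> a y) | x a y.
         x \<in> carrier M \<and> a \<in> carrier A \<and> y \<in> carrier N} = relators" (is "?L = _")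
  proof (intro subset_antisym subsetI)
    fix z assume "z \<in> ?L" then show "z \<in> relators" by (elim UnE) (auto intro: relators.intros)
  next
    fix z assume "z \<in> relators" then show "z \<in> ?L" by (cases rule: relators.cases) blast+
  qed
  then show ?thesis by (simp only: tensor_relations_def)
qed

lemma keys_frag_diff: "Poly_Mapping.keys u \<subseteq> S \<Longrightarrow> Poly_Mapping.keys v \<subseteq> S \<Longrightarrow> Poly_Mapping.keys (u - v) \<subseteq> S"
  using keys_diff[of u v] by blast

lemma formal_diff: "u \<in> carrier formal_sums \<Longrightarrow> v \<in> carrier formal_sums \<Longrightarrow> u - v \<in> carrier formal_sums"
  using keys_frag_diff[of u "carrier M \<times> carrier N" v] by simp

lemma formal_add: "u \<in> carrier formal_sums \<Longrightarrow> v \<in> carrier formal_sums \<Longrightarrow> u + v \<in> carrier formal_sums"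
  using monoid.m_closed[OF group.is_monoid[OF group_free_Abelian_group], of u "carrier M \<times> carrier N" v] by simp

lemma frag_closed: "x \<in> carrier M \<Longrightarrow> y \<in> carrier N \<Longrightarrow> frag_of (x, y) \<in> carrier formal_sums"
  by simp

lemma relators_closed: "z \<in> relators \<Longrightarrow> z \<in> carrier formal_sums"
  by (erule relators.cases)
    (simp_all only:, (intro formal_diff frag_closed M.m_closed N.m_closed left_action_closed right_action_closed; assumption)+)

lemma formal_sums_group: "group formal_sums" "comm_group formal_sums"
  by (simp_all add: abelian_free_Abelian_group)

lemma relations_subgroup: "subgroup relations formal_sums"
  unfolding relations_eq using relators_closed
  by (intro group.generate_is_subgroup formal_sums_group) auto

lemma relations_normal: "relations \<lhd> formal_sums"
  using comm_group.subgroup_imp_normal[OF formal_sums_group(2) relations_subgroup] .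

lemma relations_closed: "z \<in> relations \<Longrightarrow> z \<in> carrier formal_sums"
  using subgroup.mem_carrier[OF relations_subgroup] .

lemma tensor_comm_group: "comm_group tensor"
  unfolding tensor_product_def
  by (rule comm_group.abelian_FactGroup[OF formal_sums_group(2) relations_subgroup])

sublocale T: comm_group tensor by (rule tensor_comm_group)

definition proj :: "('x \<times> 'y \<Rightarrow>\<^sub>0 int) \<Rightarrow> ('x \<times> 'y \<Rightarrow>\<^sub>0 int) set" where
  "proj c = relations #>\<^bsub>formal_sums\<^esub> c"

lemma proj_hom: "proj \<in> hom formal_sums tensor"
  unfolding proj_def tensor_product_def by (rule normal.r_coset_hom_Mod[OF relations_normal])

lemma proj_closed: "c \<in> carrier formal_sums \<Longrightarrow> proj c \<in> carrier tensor"
  using proj_hom by (auto simp: hom_def)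

lemma proj_add: "c \<in> carrier formal_sums \<Longrightarrow> d \<in> carrier formal_sums \<Longrightarrow> proj (c + d) = proj c \<otimes>\<^bsub>tensor\<^esub> proj d"
  using hom_mult[OF proj_hom, of c d] by simp

lemma tensor_carrier: "carrier tensor = proj ` carrier formal_sums"
  by (auto simp: tensor_product_def FactGroup_def RCOSETS_def proj_def)

lemma proj_eq_iff:
  assumes c: "c \<in> carrier formal_sums" and d: "d \<in> carrier formal_sums"
  shows "proj c = proj d \<longleftrightarrow> c - d \<in> relations"
proof
  assume "proj c = proj d"
  moreover have "c \<in> proj c" unfolding proj_def
    by (rule group.rcos_self[OF formal_sums_group(1) c relations_subgroup])
  ultimately have "c \<in> relations #>\<^bsub>formal_sums\<^esub> d" by (simp add: proj_def)
  then show "c - d \<in> relations" by (auto simp: r_coset_def)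
next
  assume *: "c - d \<in> relations"
  then have "c \<in> relations #>\<^bsub>formal_sums\<^esub> d" unfolding r_coset_def by (intro UN_I[OF *]) simp
  from group.repr_independence[OF formal_sums_group(1) this d relations_subgroup]
  show "proj c = proj d" by (simp add: proj_def)
qed

lemma proj_zero: "proj 0 = \<one>\<^bsub>tensor\<^esub>"
  using hom_one[OF proj_hom formal_sums_group(1) T.is_group] by simp

lemma proj_minus: "c \<in> carrier formal_sums \<Longrightarrow> proj (- c) = inv\<^bsub>tensor\<^esub> (proj c)"
  using group_hom.hom_inv[OF group_hom.intro[OF formal_sums_group(1) T.is_group group_hom_axioms.intro[OF proj_hom]], of c]
  by simp

lemma proj_diff:
  assumes "c \<in> carrier formal_sums" "d \<in> carrier formal_sums"
  shows "proj (c - d) = proj c \<otimes>\<^bsub>tensor\<^esub> inv\<^bsub>tensor\<^esub> proj d"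
  using proj_add[of c "- d"] assms proj_minus[of d] by simp

definition pure :: "'x \<Rightarrow> 'y \<Rightarrow> ('x \<times> 'y \<Rightarrow>\<^sub>0 int) set" where
  "pure x y = proj (frag_of (x, y))"

lemma pure_closed: "x \<in> carrier M \<Longrightarrow> y \<in> carrier N \<Longrightarrow> pure x y \<in> carrier tensor"
  unfolding pure_def by (rule proj_closed) simp

lemma pure_mult_left:
  assumes "x \<in> carrier M" "x' \<in> carrier M" "y \<in> carrier N"
  shows "pure (x \<otimes>\<^bsub>M\<^esub> x') y = pure x y \<otimes>\<^bsub>tensor\<^esub> pure x' y"
proof -
  have "frag_of (x \<otimes>\<^bsub>M\<^esub> x', y) - (frag_of (x, y) + frag_of (x', y)) \<in> relations"
    unfolding relations_eq diff_diff_add[symmetric] using assms by (intro generate.incl relators.intros)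
  then have "proj (frag_of (x \<otimes>\<^bsub>M\<^esub> x', y)) = proj (frag_of (x, y) + frag_of (x', y))"
    using assms by (subst proj_eq_iff) (auto simp del: carrier_free_Abelian_group_iff intro!: frag_closed formal_add)
  then show ?thesis using assms by (simp only: pure_def proj_add frag_closed)
qed

lemma pure_mult_right:
  assumes "x \<in> carrier M" "y \<in> carrier N" "y' \<in> carrier N"
  shows "pure x (y \<otimes>\<^bsub>N\<^esub> y') = pure x y \<otimes>\<^bsub>tensor\<^esub> pure x y'"
proof -
  have "frag_of (x, y \<otimes>\<^bsub>N\<^esub> y') - (frag_of (x, y) + frag_of (x, y')) \<in> relations"
    unfolding relations_eq diff_diff_add[symmetric] using assms by (intro generate.incl relators.intros)
  then have "proj (frag_of (x, y \<otimes>\<^bsub>N\<^esub> y')) = proj (frag_of (x, y) + frag_of (x, y'))"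
    using assms by (subst proj_eq_iff) (auto simp del: carrier_free_Abelian_group_iff intro!: frag_closed formal_add)
  then show ?thesis using assms by (simp only: pure_def proj_add frag_closed)
qed

lemma pure_balance:
  assumes "x \<in> carrier M" "a \<in> carrier A" "y \<in> carrier N"
  shows "pure (\<rho> x a) y = pure x (\<sigma> a y)"
proof -
  have "frag_of (\<rho> x a, y) - frag_of (x, \<sigma> a y) \<in> relations"
    unfolding relations_eq using assms by (intro generate.incl relators.intros)
  then show ?thesis unfolding pure_def
    using assms by (subst proj_eq_iff) (auto simp: left_action_closed right_action_closed)
qed

text \<open>The tensor product is generated by pure tensors; closure under \<open>t u\<^sup>-\<^sup>1\<close> covers products and inverses at once.\<close>

lemma tensor_induct [consumes 1, case_names pure mult_inv]:
  assumes t: "t \<in> carrier tensor"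
    and pure: "\<And>x y. x \<in> carrier M \<Longrightarrow> y \<in> carrier N \<Longrightarrow> P (pure x y)"
    and mult_inv: "\<And>t u. t \<in> carrier tensor \<Longrightarrow> u \<in> carrier tensor \<Longrightarrow> P t \<Longrightarrow> P u \<Longrightarrow> P (t \<otimes>\<^bsub>tensor\<^esub> inv\<^bsub>tensor\<^esub> u)"
  shows "P t"
proof -
  have 1: "P \<one>\<^bsub>tensor\<^esub>"
  proof -
    have c: "pure \<one>\<^bsub>M\<^esub> \<one>\<^bsub>N\<^esub> \<in> carrier tensor" "P (pure \<one>\<^bsub>M\<^esub> \<one>\<^bsub>N\<^esub>)" by (simp_all add: pure_closed pure)
    from mult_inv[OF c(1,1,2,2)] show ?thesis using c(1) by simp
  qed
  obtain c where c: "c \<in> carrier formal_sums" "t = proj c" using t by (auto simp: tensor_carrier)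
  have "Poly_Mapping.keys c \<subseteq> carrier M \<times> carrier N" using c by simp
  then have "c \<in> carrier formal_sums \<and> P (proj c)"
  proof (induction c rule: frag_induction)
    case zero then show ?case using 1 by (simp add: proj_zero)
  next
    case (one x) then show ?case using pure[of "fst x" "snd x"] by (auto simp: pure_def)
  next
    case (diff a b)
    then have "a - b \<in> carrier formal_sums" by (intro formal_diff) simp_all
    then show ?case using diff mult_inv[OF proj_closed proj_closed, of a b] by (simp only: proj_diff)
  qed
  then show ?thesis using c by simp
qed

lemma hom_eqI:
  assumes G: "group G" and h: "h \<in> hom tensor G" "h' \<in> hom tensor G"
    and eq: "\<And>x y. x \<in> carrier M \<Longrightarrow> y \<in> carrier N \<Longrightarrow> h (pure x y) = h' (pure x y)"
    and t: "t \<in> carrier tensor"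
  shows "h t = h' t"
  using t
proof (induction t rule: tensor_induct)
  case (pure x y) then show ?case by (rule eq)
next
  case (mult_inv t u)
  interpret h: group_hom tensor G h by (intro group_hom.intro group_hom_axioms.intro T.is_group G h)
  interpret h': group_hom tensor G h' by (intro group_hom.intro group_hom_axioms.intro T.is_group G h)
  show ?case using mult_inv by simp
qed

lemma tensor_map_hom:
  assumes f: "f \<in> hom M M" and g: "g \<in> hom N N"
    and f\<rho>: "\<And>x a. x \<in> carrier M \<Longrightarrow> a \<in> carrier A \<Longrightarrow> f (\<rho> x a) = \<rho> (f x) a"
    and g\<sigma>: "\<And>y a. y \<in> carrier N \<Longrightarrow> a \<in> carrier A \<Longrightarrow> g (\<sigma> a y) = \<sigma> a (g y)"
  shows "tensor_map A M \<rho> N \<sigma> f g \<in> hom tensor tensor"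
    and "x \<in> carrier M \<Longrightarrow> y \<in> carrier N \<Longrightarrow> tensor_map A M \<rho> N \<sigma> f g (pure x y) = pure (f x) (g y)"
proof -
  define E where "E = frag_extend (\<lambda>(x, y). frag_of (f x, g y))"
  have fc: "f x \<in> carrier M" if "x \<in> carrier M" for x using f that by (auto simp: hom_def)
  have gc: "g y \<in> carrier N" if "y \<in> carrier N" for y using g that by (auto simp: hom_def)
  have E_of: "E (frag_of (x, y)) = frag_of (f x, g y)" for x y by (simp add: E_def)
  have E_diff: "E (a - b) = E a - E b" and E_add: "E (a + b) = E a + E b" and E_0: "E 0 = 0"
    and E_minus: "E (- a) = - E a" for a b
    by (simp_all add: E_def frag_extend_diff frag_extend_add frag_extend_minus)
  have E_closed: "E c \<in> carrier formal_sums" if "c \<in> carrier formal_sums" for c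
  proof -
    have "Poly_Mapping.keys c \<subseteq> carrier M \<times> carrier N" using that by simp
    then show ?thesis
    proof (induction c rule: frag_induction)
      case zero then show ?case by (simp add: E_0)
    next
      case (one z) then show ?case using fc gc by (auto simp: E_of)
    next
      case (diff a b) then show ?case unfolding E_diff by (rule formal_diff)
    qed
  qed
  have E_relators: "E z \<in> relators" if "z \<in> relators" for z
    using that
  proof (cases rule: relators.cases)
    case (left_add x x' y)
    then show ?thesis using relators.left_add[OF fc fc gc, of x x' y] hom_mult[OF f, of x x']
      by (simp add: E_diff E_of)
  next
    case (right_add x y y')
    then show ?thesis using relators.right_add[OF fc gc gc, of x y y'] hom_mult[OF g, of y y']
      by (simp add: E_diff E_of)
  next
    case (balance x a y)
    then show ?thesis using relators.balance[OF fc _ gc, of x a y] f\<rho>[of x a] g\<sigma>[of y a]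
      by (simp add: E_diff E_of)
  qed
  have E_relations: "E z \<in> relations" if "z \<in> relations" for z
    using that unfolding relations_eq
  proof (induction z rule: generate.induct)
    case one then show ?case using generate.one[of formal_sums relators] by (simp add: E_0)
  next
    case (incl h) then show ?case by (intro generate.incl E_relators)
  next
    case (inv h)
    then have "inv\<^bsub>formal_sums\<^esub> (E h) \<in> generate formal_sums relators" by (intro generate.inv E_relators)
    then show ?case using relators_closed[OF inv] relators_closed[OF E_relators[OF inv]] by (simp add: E_minus)
  next
    case (eng h1 h2)
    then show ?case using generate.eng[of "E h1" formal_sums relators "E h2"] by (simp add: E_add)
  qed
  have map_proj: "tensor_map A M \<rho> N \<sigma> f g (proj c) = proj (E c)" if c: "c \<in> carrier formal_sums" for c
  proof -
    have "proj (E c') = proj (E c)" if "c' \<in> proj c" for c'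
    proof -
      obtain z where z: "z \<in> relations" "c' = z + c" using \<open>c' \<in> proj c\<close> by (auto simp: proj_def r_coset_def)
      then have c': "c' \<in> carrier formal_sums"
        using formal_add[OF relations_closed[OF z(1)] c] by (simp only:)
      have "E c' - E c \<in> relations" using E_relations[OF z(1)] z by (simp add: E_add)
      then show ?thesis using proj_eq_iff[OF E_closed[OF c'] E_closed[OF c]] by simp
    qed
    moreover have "c \<in> proj c" unfolding proj_def
      by (rule group.rcos_self[OF formal_sums_group(1) c relations_subgroup])
    ultimately have "(\<Union>c'\<in>proj c. proj (E c')) = proj (E c)" by blast
    then show ?thesis by (simp add: tensor_map_def proj_def E_def)
  qed
  show "tensor_map A M \<rho> N \<sigma> f g \<in> hom tensor tensor"
  proof (rule homI)
    fix t u assume "t \<in> carrier tensor" "u \<in> carrier tensor"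
    then obtain c d where c: "c \<in> carrier formal_sums" "t = proj c" and d: "d \<in> carrier formal_sums" "u = proj d"
      by (auto simp: tensor_carrier)
    show "tensor_map A M \<rho> N \<sigma> f g t \<in> carrier tensor"
      using c by (simp only: map_proj proj_closed E_closed)
    have cd: "c + d \<in> carrier formal_sums"
      using formal_add[OF c(1) d(1)] .
    show "tensor_map A M \<rho> N \<sigma> f g (t \<otimes>\<^bsub>tensor\<^esub> u) = tensor_map A M \<rho> N \<sigma> f g t \<otimes>\<^bsub>tensor\<^esub> tensor_map A M \<rho> N \<sigma> f g u"
      unfolding c(2) d(2) proj_add[OF c(1) d(1), symmetric] map_proj[OF c(1)] map_proj[OF d(1)] map_proj[OF cd] E_add
      by (rule proj_add[OF E_closed[OF c(1)] E_closed[OF d(1)]])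
  qed
  show "tensor_map A M \<rho> N \<sigma> f g (pure x y) = pure (f x) (g y)" if "x \<in> carrier M" "y \<in> carrier N"
    unfolding pure_def using map_proj[OF frag_closed[OF that]] by (simp only: E_of)
qed

end

section \<open>Modules and extension of scalars to the ring of fractions\<close>

lemma opposite_ring_simps [simp]:
  "carrier (opposite_ring A) = carrier A" "x \<otimes>\<^bsub>opposite_ring A\<^esub> y = y \<otimes>\<^bsub>A\<^esub> x"
  "\<one>\<^bsub>opposite_ring A\<^esub> = \<one>\<^bsub>A\<^esub>" "\<zero>\<^bsub>opposite_ring A\<^esub> = \<zero>\<^bsub>A\<^esub>" "x \<oplus>\<^bsub>opposite_ring A\<^esub> y = x \<oplus>\<^bsub>A\<^esub> y"
  by (simp_all add: opposite_ring_def)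

lemma (in ring) ring_opposite: "ring (opposite_ring R)"
proof (rule ringI)
  show "abelian_group (opposite_ring R)"
  proof (rule abelian_groupI)
    show "\<exists>y\<in>carrier (opposite_ring R). y \<oplus>\<^bsub>opposite_ring R\<^esub> x = \<zero>\<^bsub>opposite_ring R\<^esub>"
      if "x \<in> carrier (opposite_ring R)" for x
      using that by (intro bexI[of _ "\<ominus> x"]) (simp_all add: l_neg)
  qed (simp_all add: a_assoc, simp add: a_comm)
  show "Group.monoid (opposite_ring R)"
    by (rule monoidI) (auto simp: m_assoc)
qed (auto simp: l_distr r_distr)

lemma (in comm_group) hom_pointwise_mult:
  assumes f: "f \<in> hom H G" and g: "g \<in> hom H G" shows "(\<lambda>x. f x \<otimes> g x) \<in> hom H G"
proof (rule homI)
  have c: "x \<in> carrier H \<Longrightarrow> f x \<in> carrier G" "x \<in> carrier H \<Longrightarrow> g x \<in> carrier G" for x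
    using f g by (auto simp: hom_def)
  show "f x \<otimes> g x \<in> carrier G" if "x \<in> carrier H" for x using c that by simp
  show "f (x \<otimes>\<^bsub>H\<^esub> y) \<otimes> g (x \<otimes>\<^bsub>H\<^esub> y) = (f x \<otimes> g x) \<otimes> (f y \<otimes> g y)"
    if "x \<in> carrier H" "y \<in> carrier H" for x y
    using c that by (simp add: hom_mult[OF f] hom_mult[OF g] m_ac)
qed

locale left_module = ring Q + V: comm_group V
  for Q :: "('q, 'm) ring_scheme" (structure) and V :: "('v, 'n) monoid_scheme" +
  fixes act :: "'q \<Rightarrow> 'v \<Rightarrow> 'v"
  assumes act_hom: "q \<in> carrier Q \<Longrightarrow> act q \<in> hom V V"
    and act_mult: "q \<in> carrier Q \<Longrightarrow> q' \<in> carrier Q \<Longrightarrow> v \<in> carrier V \<Longrightarrow> act (q \<otimes> q') v = act q (act q' v)"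
    and act_add: "q \<in> carrier Q \<Longrightarrow> q' \<in> carrier Q \<Longrightarrow> v \<in> carrier V \<Longrightarrow> act (q \<oplus> q') v = act q v \<otimes>\<^bsub>V\<^esub> act q' v"
    and act_one: "v \<in> carrier V \<Longrightarrow> act \<one> v = v"
begin

lemma act_closed: "q \<in> carrier Q \<Longrightarrow> v \<in> carrier V \<Longrightarrow> act q v \<in> carrier V"
  using act_hom by (auto simp: hom_def)

lemma act_distrib: "q \<in> carrier Q \<Longrightarrow> v \<in> carrier V \<Longrightarrow> w \<in> carrier V \<Longrightarrow> act q (v \<otimes>\<^bsub>V\<^esub> w) = act q v \<otimes>\<^bsub>V\<^esub> act q w"
  using act_hom by (auto simp: hom_def)

lemma act_unit: "q \<in> carrier Q \<Longrightarrow> act q \<one>\<^bsub>V\<^esub> = \<one>\<^bsub>V\<^esub>"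
  using hom_one[OF act_hom V.is_group V.is_group] .

lemma act_inv: "q \<in> carrier Q \<Longrightarrow> v \<in> carrier V \<Longrightarrow> act q (inv\<^bsub>V\<^esub> v) = inv\<^bsub>V\<^esub> (act q v)"
  using group_hom.hom_inv[OF group_hom.intro[OF V.is_group V.is_group group_hom_axioms.intro[OF act_hom]]] .

lemma act_zero: "v \<in> carrier V \<Longrightarrow> act \<zero> v = \<one>\<^bsub>V\<^esub>"
  using act_add[of \<zero> \<zero> v] act_closed[of \<zero> v] by simp

lemma act_minus: "q \<in> carrier Q \<Longrightarrow> v \<in> carrier V \<Longrightarrow> act (\<ominus> q) v = inv\<^bsub>V\<^esub> (act q v)"
  using act_add[of "\<ominus> q" q v] act_closed[of q v] act_closed[of "\<ominus> q" v] act_zero[of v]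
  by (simp add: l_neg V.inv_equality)

lemma act_finprod:
  assumes q: "q \<in> carrier Q" and fin: "finite J" and v: "\<And>j. j \<in> J \<Longrightarrow> v j \<in> carrier V"
  shows "act q (finprod V v J) = finprod V (\<lambda>j. act q (v j)) J"
  using fin v
proof (induction J rule: finite_induct)
  case empty then show ?case using q by (simp add: act_unit)
next
  case (insert j J)
  then show ?case using q
    by (subst V.finprod_insert, simp, simp, simp, simp, subst V.finprod_insert)
      (auto simp: act_closed act_distrib V.finprod_closed Pi_def)
qed

lemma act_finsum:
  assumes v: "v \<in> carrier V" and fin: "finite J" and q: "\<And>j. j \<in> J \<Longrightarrow> q j \<in> carrier Q"
  shows "act (\<Oplus>j\<in>J. q j) v = finprod V (\<lambda>j. act (q j) v) J"
  using fin q
proof (induction J rule: finite_induct)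
  case empty then show ?case using v by (simp add: act_zero)
next
  case (insert j J)
  then show ?case using v
    by (subst finsum_insert, simp, simp, simp, simp, subst V.finprod_insert)
      (auto simp: act_closed act_add finsum_closed Pi_def)
qed

end

locale left_scalar_extension = A: ring A + Q: ring Q + N: left_module A N \<sigma>
  for A :: "('a, 'r) ring_scheme" and Q :: "('q, 'p) ring_scheme"
    and N :: "('y, 'n) monoid_scheme" and \<sigma> +
  fixes \<phi> :: "'a \<Rightarrow> 'q"
  assumes hom: "\<phi> \<in> ring_hom A Q"
begin

definition \<rho> :: "'q \<Rightarrow> 'a \<Rightarrow> 'q" where "\<rho> q a = q \<otimes>\<^bsub>Q\<^esub> \<phi> a"

sublocale pair: balanced_pair A "add_monoid Q" N \<rho> \<sigma>
proof
  show "x \<in> carrier (add_monoid Q) \<Longrightarrow> a \<in> carrier A \<Longrightarrow> \<rho> x a \<in> carrier (add_monoid Q)" for x a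
    using ring_hom_closed[OF hom] by (simp add: \<rho>_def)
qed (simp add: N.act_closed)

abbreviation "V \<equiv> tensor_product A (add_monoid Q) \<rho> N \<sigma>"

definition act where "act q = tensor_map A (add_monoid Q) \<rho> N \<sigma> (\<lambda>p. q \<otimes>\<^bsub>Q\<^esub> p) id"

lemma act_hom: "q \<in> carrier Q \<Longrightarrow> act q \<in> hom V V"
  unfolding act_def
  by (rule pair.tensor_map_hom(1)) (auto simp: hom_def \<rho>_def Q.r_distr Q.m_assoc ring_hom_closed[OF hom])

lemma act_pure: "q \<in> carrier Q \<Longrightarrow> p \<in> carrier Q \<Longrightarrow> n \<in> carrier N \<Longrightarrow> act q (pair.pure p n) = pair.pure (q \<otimes>\<^bsub>Q\<^esub> p) n"
  unfolding act_def
  by (subst pair.tensor_map_hom(2)) (auto simp: hom_def \<rho>_def Q.r_distr Q.m_assoc ring_hom_closed[OF hom])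

lemma module: "left_module Q V act"
proof (intro left_module.intro left_module_axioms.intro Q.ring_axioms pair.tensor_comm_group)
  have comp: "(\<lambda>v. act q (act q' v)) \<in> hom V V" if "q \<in> carrier Q" "q' \<in> carrier Q" for q q'
    using act_hom[OF that(1)] act_hom[OF that(2)] by (auto simp: hom_def)
  have sum: "(\<lambda>v. act q v \<otimes>\<^bsub>V\<^esub> act q' v) \<in> hom V V" if "q \<in> carrier Q" "q' \<in> carrier Q" for q q'
    by (intro pair.T.hom_pointwise_mult act_hom that)
  show "act q \<in> hom V V" if "q \<in> carrier Q" for q using act_hom that .
  show "act (q \<otimes>\<^bsub>Q\<^esub> q') v = act q (act q' v)" if "q \<in> carrier Q" "q' \<in> carrier Q" "v \<in> carrier V" for q q' v
    using that by (intro pair.hom_eqI[OF pair.T.is_group act_hom comp _ that(3)]) (auto simp: act_pure Q.m_assoc)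
  show "act (q \<oplus>\<^bsub>Q\<^esub> q') v = act q v \<otimes>\<^bsub>V\<^esub> act q' v" if "q \<in> carrier Q" "q' \<in> carrier Q" "v \<in> carrier V" for q q' v
    using that pair.pure_mult_left
    by (intro pair.hom_eqI[OF pair.T.is_group act_hom sum _ that(3)]) (auto simp: act_pure Q.l_distr)
  show "act \<one>\<^bsub>Q\<^esub> v = v" if "v \<in> carrier V" for v
    using that by (intro pair.hom_eqI[OF pair.T.is_group act_hom _ _ that, of "\<one>\<^bsub>Q\<^esub>" "\<lambda>v. v"])
      (auto simp: act_pure hom_def)
qed

definition unit :: "'y \<Rightarrow> ('q \<times> 'y \<Rightarrow>\<^sub>0 int) set" where "unit n = pair.pure \<one>\<^bsub>Q\<^esub> n"

lemma unit_hom: "unit \<in> hom N V"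
  by (auto simp: hom_def unit_def pair.pure_closed pair.pure_mult_right)

lemma act_unit:
  assumes "a \<in> carrier A" "n \<in> carrier N" shows "act (\<phi> a) (unit n) = unit (\<sigma> a n)"
  using assms ring_hom_closed[OF hom assms(1)] pair.pure_balance[of "\<one>\<^bsub>Q\<^esub>" a n]
  by (simp add: unit_def act_pure \<rho>_def)

end

text \<open>A right module is treated as a left module over the opposite ring, so that one theory of modules serves both sides.\<close>

locale right_scalar_extension = A: ring A + Q: ring Q + N: left_module "opposite_ring A" N "\<lambda>a n. \<rho> n a"
  for A :: "('a, 'r) ring_scheme" and Q :: "('q, 'p) ring_scheme"
    and N :: "('y, 'n) monoid_scheme" and \<rho> +
  fixes \<phi> :: "'a \<Rightarrow> 'q"
  assumes hom: "\<phi> \<in> ring_hom A Q"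
begin

definition \<sigma> :: "'a \<Rightarrow> 'q \<Rightarrow> 'q" where "\<sigma> a q = \<phi> a \<otimes>\<^bsub>Q\<^esub> q"

sublocale pair: balanced_pair A N "add_monoid Q" \<rho> \<sigma>
proof
  show "a \<in> carrier A \<Longrightarrow> y \<in> carrier (add_monoid Q) \<Longrightarrow> \<sigma> a y \<in> carrier (add_monoid Q)" for y a
    using ring_hom_closed[OF hom] by (simp add: \<sigma>_def)
qed (use N.act_closed in simp)

abbreviation "V \<equiv> tensor_product A N \<rho> (add_monoid Q) \<sigma>"

definition act where "act q = tensor_map A N \<rho> (add_monoid Q) \<sigma> id (\<lambda>p. p \<otimes>\<^bsub>Q\<^esub> q)"

lemma act_hom: "q \<in> carrier Q \<Longrightarrow> act q \<in> hom V V"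
  unfolding act_def
  by (rule pair.tensor_map_hom(1)) (auto simp: hom_def \<sigma>_def Q.l_distr Q.m_assoc ring_hom_closed[OF hom])

lemma act_pure: "q \<in> carrier Q \<Longrightarrow> p \<in> carrier Q \<Longrightarrow> n \<in> carrier N \<Longrightarrow> act q (pair.pure n p) = pair.pure n (p \<otimes>\<^bsub>Q\<^esub> q)"
  unfolding act_def
  by (subst pair.tensor_map_hom(2)) (auto simp: hom_def \<sigma>_def Q.l_distr Q.m_assoc ring_hom_closed[OF hom])

lemma module: "left_module (opposite_ring Q) V act"
proof (intro left_module.intro left_module_axioms.intro Q.ring_opposite pair.tensor_comm_group)
  have comp: "(\<lambda>v. act q (act q' v)) \<in> hom V V" if "q \<in> carrier Q" "q' \<in> carrier Q" for q q'
    using act_hom[OF that(1)] act_hom[OF that(2)] by (auto simp: hom_def)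
  have sum: "(\<lambda>v. act q v \<otimes>\<^bsub>V\<^esub> act q' v) \<in> hom V V" if "q \<in> carrier Q" "q' \<in> carrier Q" for q q'
    by (intro pair.T.hom_pointwise_mult act_hom that)
  show "act q \<in> hom V V" if "q \<in> carrier (opposite_ring Q)" for q using act_hom that by simp
  show "act (q \<otimes>\<^bsub>opposite_ring Q\<^esub> q') v = act q (act q' v)"
    if "q \<in> carrier (opposite_ring Q)" "q' \<in> carrier (opposite_ring Q)" "v \<in> carrier V" for q q' v
    using that by (intro pair.hom_eqI[OF pair.T.is_group act_hom comp _ that(3)]) (auto simp: act_pure Q.m_assoc)
  show "act (q \<oplus>\<^bsub>opposite_ring Q\<^esub> q') v = act q v \<otimes>\<^bsub>V\<^esub> act q' v"
    if "q \<in> carrier (opposite_ring Q)" "q' \<in> carrier (opposite_ring Q)" "v \<in> carrier V" for q q' v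
    using that pair.pure_mult_right
    by (intro pair.hom_eqI[OF pair.T.is_group act_hom sum _ that(3)]) (auto simp: act_pure Q.r_distr)
  show "act \<one>\<^bsub>opposite_ring Q\<^esub> v = v" if "v \<in> carrier V" for v
    using that by (intro pair.hom_eqI[OF pair.T.is_group act_hom _ _ that, of "\<one>\<^bsub>opposite_ring Q\<^esub>" "\<lambda>v. v"])
      (auto simp: act_pure hom_def)
qed

definition unit :: "'y \<Rightarrow> ('y \<times> 'q \<Rightarrow>\<^sub>0 int) set" where "unit n = pair.pure n \<one>\<^bsub>Q\<^esub>"

lemma unit_hom: "unit \<in> hom N V"
  by (auto simp: hom_def unit_def pair.pure_closed pair.pure_mult_left)

lemma act_unit:
  assumes "a \<in> carrier A" "n \<in> carrier N" shows "act (\<phi> a) (unit n) = unit (\<rho> n a)"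
  using assms ring_hom_closed[OF hom assms(1)] pair.pure_balance[of n a "\<one>\<^bsub>Q\<^esub>"]
  by (simp add: unit_def act_pure \<sigma>_def)

end

locale left_module_fractions = fractions A Q \<phi> + left_module A N \<sigma>
  for A :: "('a, 'r) ring_scheme" and Q :: "('q, 'p) ring_scheme" and \<phi>
    and N :: "('y, 'n) monoid_scheme" and \<sigma>
begin

sublocale ext: left_scalar_extension A Q N \<sigma> \<phi>
  by (intro left_scalar_extension.intro left_scalar_extension_axioms.intro A.ring_axioms Q.ring_axioms
      left_module_axioms phi_hom)

text \<open>The relation that makes \<open>1 \<otimes> n\<close> vanish is a combination of finitely many defining relations. If \<open>c\<close> clears the left
  denominators of all elements of \<open>Q\<close> that occur in them, then \<open>q \<otimes> x \<mapsto> (c q) x\<close> is well defined on these terms, takes values in \<open>N\<close> and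
  respects the relations; so it maps \<open>1 \<otimes> n\<close> to \<open>c n = 0\<close>.\<close>

theorem unit_kernel_torsion:
  assumes n: "n \<in> carrier N" and zero: "ext.unit n = \<one>\<^bsub>ext.V\<^esub>"
  obtains c where "c \<in> regular_elements A" "\<sigma> c n = \<one>\<^bsub>N\<^esub>"
proof -
  let ?F = "free_Abelian_group (carrier Q \<times> carrier N)"
  have F: "group ?F" by simp
  define good where "good c = {z \<in> carrier Q \<times> carrier N. \<phi> c \<otimes>\<^bsub>Q\<^esub> fst z \<in> \<phi> ` carrier A}" for c
  define pull where "pull x = inv_into (carrier A) \<phi> x" for x
  have pull_phi: "pull (\<phi> a) = a" if "a \<in> carrier A" for a
    unfolding pull_def using that phi_inj by (intro inv_into_f_f inj_onI)
  \<comment> \<open>The value of \<open>(c q) x\<close> at \<open>z = (q, x)\<close>, with a default where \<open>c\<close> does not clear the denominator of \<open>q\<close>.\<close>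
  define val where "val c z = (if z \<in> good c then \<sigma> (pull (\<phi> c \<otimes>\<^bsub>Q\<^esub> fst z)) (snd z) else \<one>\<^bsub>N\<^esub>)" for c z
  have "\<exists>h. h \<in> hom ?F N \<and> (\<forall>z\<in>carrier Q \<times> carrier N. h (frag_of z) = val c z)" for c
  proof -
    have "val c ` (carrier Q \<times> carrier N) \<subseteq> carrier N"
    proof (intro image_subsetI)
      fix z assume z: "z \<in> carrier Q \<times> carrier N"
      show "val c z \<in> carrier N"
      proof (cases "z \<in> good c")
        case True
        then obtain a where "a \<in> carrier A" "\<phi> c \<otimes>\<^bsub>Q\<^esub> fst z = \<phi> a" unfolding good_def by blast
        then show ?thesis using True z by (auto simp: val_def pull_phi intro: act_closed)
      qed (simp add: val_def)
    qed
    then show ?thesis using V.free_Abelian_group_universal[of "val c" "carrier Q \<times> carrier N"] by metis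
  qed
  then obtain H where H: "\<And>c. H c \<in> hom ?F N"
    "\<And>c z. z \<in> carrier Q \<times> carrier N \<Longrightarrow> H c (frag_of z) = val c z" by metis
  have H_closed: "H c z \<in> carrier N" if "z \<in> carrier ?F" for c z using H(1)[of c] that by (auto simp: hom_def)
  have H_add: "H c (z + w) = H c z \<otimes>\<^bsub>N\<^esub> H c w" if "z \<in> carrier ?F" "w \<in> carrier ?F" for c z w
    using hom_mult[OF H(1) that] by simp
  have H_minus: "H c (- z) = inv\<^bsub>N\<^esub> (H c z)" if "z \<in> carrier ?F" for c z
    using group_hom.hom_inv[OF group_hom.intro[OF F V.is_group group_hom_axioms.intro[OF H(1)]], of z c] that by simp
  have H_diff: "H c (z - w) = H c z \<otimes>\<^bsub>N\<^esub> inv\<^bsub>N\<^esub> (H c w)" if "z \<in> carrier ?F" "w \<in> carrier ?F" for c z w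
    using H_add[of z "- w" c] H_minus[of w c] that by simp
  have H_zero: "H c 0 = \<one>\<^bsub>N\<^esub>" for c using hom_one[OF H(1) F V.is_group] by simp
  have H_frag: "H c (frag_of (q, n)) = \<sigma> a n"
    if "q \<in> carrier Q" "n \<in> carrier N" "a \<in> carrier A" "\<phi> c \<otimes>\<^bsub>Q\<^esub> q = \<phi> a" for c q n a
    using that H(2)[of "(q, n)" c] by (simp add: val_def good_def pull_phi)
  have goodI: "(q, n) \<in> good c" if "q \<in> carrier Q" "n \<in> carrier N" "a \<in> carrier A" "\<phi> c \<otimes>\<^bsub>Q\<^esub> q = \<phi> a" for c q n a
    using that by (simp add: good_def)
  have good_mult: "\<phi> (b \<otimes>\<^bsub>A\<^esub> c) \<otimes>\<^bsub>Q\<^esub> q = \<phi> (b \<otimes>\<^bsub>A\<^esub> a)"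
    if "b \<in> carrier A" "c \<in> carrier A" "q \<in> carrier Q" "a \<in> carrier A" "\<phi> c \<otimes>\<^bsub>Q\<^esub> q = \<phi> a" for b c q a
    using that phi_closed by (simp add: phi_mult Q.m_assoc)
  have good_mono: "good c \<subseteq> good (b \<otimes>\<^bsub>A\<^esub> c)" if "b \<in> carrier A" "c \<in> carrier A" for b c
  proof
    fix z assume z: "z \<in> good c"
    then obtain a where a: "a \<in> carrier A" "\<phi> c \<otimes>\<^bsub>Q\<^esub> fst z = \<phi> a" by (auto simp: good_def)
    then show "z \<in> good (b \<otimes>\<^bsub>A\<^esub> c)" using z good_mult[OF that, of "fst z" a] that by (auto simp: good_def)
  qed
  have scale: "H (b \<otimes>\<^bsub>A\<^esub> c) z = \<sigma> b (H c z)"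
    if b: "b \<in> carrier A" and c: "c \<in> carrier A" and z: "Poly_Mapping.keys z \<subseteq> good c" for b c z
  proof -
    have "z \<in> carrier ?F \<and> H (b \<otimes>\<^bsub>A\<^esub> c) z = \<sigma> b (H c z)"
      using z
    proof (induction z rule: frag_induction)
      case zero then show ?case using b by (simp add: H_zero act_unit)
    next
      case (one z)
      then obtain q n a where a: "z = (q, n)" "q \<in> carrier Q" "n \<in> carrier N" "a \<in> carrier A" "\<phi> c \<otimes>\<^bsub>Q\<^esub> q = \<phi> a"
        by (cases z) (auto simp: good_def)
      then show ?case
        using H_frag[OF a(2-5)] H_frag[OF a(2,3) _ good_mult[OF b c a(2,4,5)]] b by (simp add: act_mult)
    next
      case (diff u v)
      then have "u - v \<in> carrier ?F" using ext.pair.formal_diff[of u v] by simp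
      then show ?case using diff b by (simp add: H_diff H_closed act_distrib act_inv)
    qed
    then show ?thesis by simp
  qed
  define P where "P z \<longleftrightarrow> z \<in> carrier ?F \<and> (\<exists>c\<in>regular_elements A. Poly_Mapping.keys z \<subseteq> good c \<and> H c z = \<one>\<^bsub>N\<^esub>)" for z
  have P_add: "P (z + w)" if P: "P z" "P w" for z w
  proof -
    obtain c where c: "c \<in> regular_elements A" "Poly_Mapping.keys z \<subseteq> good c" "H c z = \<one>\<^bsub>N\<^esub>" using P(1) by (auto simp: P_def)
    obtain c' where c': "c' \<in> regular_elements A" "Poly_Mapping.keys w \<subseteq> good c'" "H c' w = \<one>\<^bsub>N\<^esub>" using P(2) by (auto simp: P_def)
    have zw: "z \<in> carrier ?F" "w \<in> carrier ?F" using P by (auto simp: P_def)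
    obtain b b' where b: "b \<in> carrier A" "b' \<in> carrier A" "b \<otimes>\<^bsub>A\<^esub> c = b' \<otimes>\<^bsub>A\<^esub> c'" "b \<otimes>\<^bsub>A\<^esub> c \<in> regular_elements A"
      using left_common_multiple[OF c(1) c'(1)] .
    note cc = regular_closed[OF c(1)] regular_closed[OF c'(1)]
    have "H (b \<otimes>\<^bsub>A\<^esub> c) z = \<one>\<^bsub>N\<^esub>" using scale[OF b(1) cc(1) c(2)] c(3) act_unit[OF b(1)] by simp
    moreover have "H (b \<otimes>\<^bsub>A\<^esub> c) w = \<one>\<^bsub>N\<^esub>" using scale[OF b(2) cc(2) c'(2)] c'(3) act_unit[OF b(2)] b(3) by simp
    moreover have "Poly_Mapping.keys z \<subseteq> good (b \<otimes>\<^bsub>A\<^esub> c)" using good_mono[OF b(1) cc(1)] c(2) by blast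
    moreover have "Poly_Mapping.keys w \<subseteq> good (b \<otimes>\<^bsub>A\<^esub> c)" using good_mono[OF b(2) cc(2)] c'(2) b(3) by simp
    moreover have "Poly_Mapping.keys (z + w) \<subseteq> Poly_Mapping.keys z \<union> Poly_Mapping.keys w" by (rule keys_add)
    moreover have "z + w \<in> carrier ?F" using ext.pair.formal_add[of z w] zw by simp
    ultimately show ?thesis unfolding P_def using b(4) H_add[OF zw, of "b \<otimes>\<^bsub>A\<^esub> c"] by (intro conjI bexI[of _ "b \<otimes>\<^bsub>A\<^esub> c"]) auto
  qed
  have P_minus: "P (- z)" if "P z" for z
    using that H_minus by (auto simp: P_def keys_minus)
  have P_relator: "P z" if z: "z \<in> ext.pair.relators" for z
  proof -
    have zF: "z \<in> carrier ?F" using ext.pair.relators_closed[OF z] by simp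
    show ?thesis using z
    proof (cases rule: ext.pair.relators.cases)
      case (left_add x x' y)
      have xc: "x \<in> carrier Q" "x' \<in> carrier Q" using left_add by auto
      obtain c where c: "c \<in> regular_elements A" "\<And>j. j \<in> {x, x'} \<Longrightarrow> \<phi> c \<otimes>\<^bsub>Q\<^esub> j \<in> \<phi> ` carrier A"
        using left_common_denominator[of "{x, x'}" "\<lambda>q. q"] xc by auto
      obtain a a' where a: "a \<in> carrier A" "\<phi> c \<otimes>\<^bsub>Q\<^esub> x = \<phi> a" "a' \<in> carrier A" "\<phi> c \<otimes>\<^bsub>Q\<^esub> x' = \<phi> a'" using c(2) by blast
      have cc: "\<phi> c \<in> carrier Q" using phi_closed regular_closed c by simp
      have s: "\<phi> c \<otimes>\<^bsub>Q\<^esub> (x \<oplus>\<^bsub>Q\<^esub> x') = \<phi> (a \<oplus>\<^bsub>A\<^esub> a')" using a xc cc by (simp add: phi_add Q.r_distr)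
      have k: "Poly_Mapping.keys z \<subseteq> good c" unfolding left_add(1)
        using goodI[OF xc(1) left_add(4) a(1,2)] goodI[OF xc(2) left_add(4) a(3,4)]
          goodI[OF Q.a_closed[OF xc] left_add(4) A.a_closed[OF a(1,3)] s]
        by (intro ext.pair.keys_frag_diff) (auto simp: keys_frag_of)
      have "H c z = \<sigma> (a \<oplus>\<^bsub>A\<^esub> a') y \<otimes>\<^bsub>N\<^esub> inv\<^bsub>N\<^esub> (\<sigma> a y) \<otimes>\<^bsub>N\<^esub> inv\<^bsub>N\<^esub> (\<sigma> a' y)"
        unfolding left_add(1) using left_add(4) xc ext.pair.formal_diff
        by (simp add: H_diff H_frag[OF xc(1) left_add(4) a(1,2)] H_frag[OF xc(2) left_add(4) a(3,4)]
          H_frag[OF Q.a_closed[OF xc] left_add(4) A.a_closed[OF a(1,3)] s] del: carrier_free_Abelian_group_iff)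
      also have "\<dots> = \<one>\<^bsub>N\<^esub>" using a left_add(4) act_closed
        by (simp add: act_add V.m_comm[of "\<sigma> a y"] V.m_assoc)
      finally show ?thesis using zF c k by (auto simp: P_def)
    next
      case (right_add x y y')
      have xc: "x \<in> carrier Q" using right_add by auto
      obtain c where c: "c \<in> regular_elements A" "\<And>j. j \<in> {x} \<Longrightarrow> \<phi> c \<otimes>\<^bsub>Q\<^esub> j \<in> \<phi> ` carrier A"
        using left_common_denominator[of "{x}" "\<lambda>q. q"] xc by auto
      obtain a where a: "a \<in> carrier A" "\<phi> c \<otimes>\<^bsub>Q\<^esub> x = \<phi> a" using c(2) by blast
      have yy: "y \<otimes>\<^bsub>N\<^esub> y' \<in> carrier N" using right_add by simp
      have k: "Poly_Mapping.keys z \<subseteq> good c" unfolding right_add(1)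
        using goodI[OF xc right_add(3) a] goodI[OF xc right_add(4) a] goodI[OF xc yy a]
        by (intro ext.pair.keys_frag_diff) (auto simp: keys_frag_of)
      have "H c z = \<sigma> a (y \<otimes>\<^bsub>N\<^esub> y') \<otimes>\<^bsub>N\<^esub> inv\<^bsub>N\<^esub> (\<sigma> a y) \<otimes>\<^bsub>N\<^esub> inv\<^bsub>N\<^esub> (\<sigma> a y')"
        unfolding right_add(1) using right_add(3,4) xc ext.pair.formal_diff
        by (simp add: H_diff H_frag[OF xc right_add(3) a] H_frag[OF xc right_add(4) a]
          H_frag[OF xc yy a] del: carrier_free_Abelian_group_iff)
      also have "\<dots> = \<one>\<^bsub>N\<^esub>" using a right_add(3,4) act_closed
        by (simp add: act_distrib V.m_comm[of "\<sigma> a y"] V.m_assoc)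
      finally show ?thesis using zF c k by (auto simp: P_def)
    next
      case (balance x b y)
      have xc: "x \<in> carrier Q" using balance by auto
      obtain c where c: "c \<in> regular_elements A" "\<And>j. j \<in> {x} \<Longrightarrow> \<phi> c \<otimes>\<^bsub>Q\<^esub> j \<in> \<phi> ` carrier A"
        using left_common_denominator[of "{x}" "\<lambda>q. q"] xc by auto
      obtain a where a: "a \<in> carrier A" "\<phi> c \<otimes>\<^bsub>Q\<^esub> x = \<phi> a" using c(2) by blast
      have cc: "\<phi> c \<in> carrier Q" using phi_closed regular_closed c by simp
      have by': "\<sigma> b y \<in> carrier N" using balance act_closed by simp
      have xb: "ext.\<rho> x b \<in> carrier Q" using xc balance(3) phi_closed by (simp add: ext.\<rho>_def)
      have s: "\<phi> c \<otimes>\<^bsub>Q\<^esub> ext.\<rho> x b = \<phi> (a \<otimes>\<^bsub>A\<^esub> b)"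
        using a xc cc balance(3) phi_closed by (simp add: ext.\<rho>_def phi_mult Q.m_assoc[symmetric])
      have ab: "a \<otimes>\<^bsub>A\<^esub> b \<in> carrier A" using a balance by simp
      have k: "Poly_Mapping.keys z \<subseteq> good c" unfolding balance(1)
        using goodI[OF xc by' a] goodI[OF xb balance(4) ab s]
        by (intro ext.pair.keys_frag_diff) (auto simp: keys_frag_of)
      have "H c z = \<sigma> (a \<otimes>\<^bsub>A\<^esub> b) y \<otimes>\<^bsub>N\<^esub> inv\<^bsub>N\<^esub> (\<sigma> a (\<sigma> b y))"
        unfolding balance(1) using balance(4) xc by' xb
        by (simp add: H_diff H_frag[OF xc by' a] H_frag[OF xb balance(4) ab s] del: carrier_free_Abelian_group_iff)
      also have "\<dots> = \<one>\<^bsub>N\<^esub>" using a balance(3,4) act_closed by (simp add: act_mult)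
      finally show ?thesis using zF c k by (auto simp: P_def)
    qed
  qed
  have P_relations: "P z" if "z \<in> ext.pair.relations" for z
    using that unfolding ext.pair.relations_eq
  proof (induction z rule: generate.induct)
    case one
    then show ?case using regular_one by (auto simp: P_def H_zero)
  next
    case (incl h) then show ?case by (rule P_relator)
  next
    case (inv h)
    then show ?case using P_minus[OF P_relator[OF inv]] ext.pair.relators_closed[OF inv] by simp
  next
    case (eng h1 h2) then show ?case using P_add by simp
  qed
  have f: "frag_of (\<one>\<^bsub>Q\<^esub>, n) \<in> carrier ?F" using n by simp
  have "ext.pair.proj (frag_of (\<one>\<^bsub>Q\<^esub>, n)) = ext.pair.proj 0"
    using zero by (simp add: ext.unit_def ext.pair.pure_def ext.pair.proj_zero)
  then have "frag_of (\<one>\<^bsub>Q\<^esub>, n) - 0 \<in> ext.pair.relations" using f by (subst (asm) ext.pair.proj_eq_iff) auto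
  then have "P (frag_of (\<one>\<^bsub>Q\<^esub>, n))" using P_relations by simp
  then obtain c where c: "c \<in> regular_elements A" "H c (frag_of (\<one>\<^bsub>Q\<^esub>, n)) = \<one>\<^bsub>N\<^esub>" by (auto simp: P_def)
  have cc: "c \<in> carrier A" using c(1) by (rule regular_closed)
  have "H c (frag_of (\<one>\<^bsub>Q\<^esub>, n)) = \<sigma> c n" using H_frag[OF Q.one_closed n cc] phi_closed[OF cc] by simp
  then show thesis using that c by simp
qed

end

locale right_module_fractions = fractions A Q \<phi> + N: left_module "opposite_ring A" N "\<lambda>a n. \<rho> n a"
  for A :: "('a, 'r) ring_scheme" and Q :: "('q, 'p) ring_scheme" and \<phi>
    and N :: "('y, 'n) monoid_scheme" and \<rho>
begin

sublocale ext: right_scalar_extension A Q N \<rho> \<phi>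
  by (intro right_scalar_extension.intro right_scalar_extension_axioms.intro A.ring_axioms Q.ring_axioms
      N.left_module_axioms phi_hom)

lemma clear_right_denominator:
  assumes "w \<in> carrier ext.V"
  obtains c n where "c \<in> regular_elements A" "n \<in> carrier N" "ext.act (\<phi> c) w = ext.unit n"
proof -
  interpret W: left_module "opposite_ring Q" ext.V ext.act by (rule ext.module)
  have "\<exists>c n. c \<in> regular_elements A \<and> n \<in> carrier N \<and> ext.act (\<phi> c) w = ext.unit n"
    using assms
  proof (induction w rule: ext.pair.tensor_induct)
    case (pure n q)
    then have q: "q \<in> carrier Q" by simp
    obtain s a where s: "s \<in> regular_elements A" "a \<in> carrier A" "q \<otimes>\<^bsub>Q\<^esub> \<phi> s = \<phi> a" using right_fraction[OF q] .
    have "ext.act (\<phi> s) (ext.pair.pure n q) = ext.pair.pure n (\<phi> a)"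
      using pure q s phi_closed[OF regular_closed[OF s(1)]] by (simp add: ext.act_pure)
    also have "\<dots> = ext.unit (\<rho> n a)"
      using ext.pair.pure_balance[OF pure(1) s(2), of "\<one>\<^bsub>Q\<^esub>"] phi_closed[OF s(2)] by (simp add: ext.unit_def ext.\<sigma>_def)
    finally show ?case using s N.act_closed[of a n] pure(1) by auto
  next
    case (mult_inv t u)
    then obtain c n c' n' where c: "c \<in> regular_elements A" "n \<in> carrier N" "ext.act (\<phi> c) t = ext.unit n"
      and c': "c' \<in> regular_elements A" "n' \<in> carrier N" "ext.act (\<phi> c') u = ext.unit n'" by blast
    obtain b b' where b: "b \<in> carrier A" "b' \<in> carrier A" "c \<otimes>\<^bsub>A\<^esub> b = c' \<otimes>\<^bsub>A\<^esub> b'" "c \<otimes>\<^bsub>A\<^esub> b \<in> regular_elements A"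
      using right_common_multiple[OF c(1) c'(1)] .
    note cc = regular_closed[OF c(1)] regular_closed[OF c'(1)]
    have 1: "ext.act (\<phi> (c \<otimes>\<^bsub>A\<^esub> b)) t = ext.unit (\<rho> n b)"
      using W.act_mult[of "\<phi> b" "\<phi> c" t] mult_inv.hyps(1) c b(1) cc(1) phi_closed
      by (simp add: phi_mult ext.act_unit)
    have 2: "ext.act (\<phi> (c \<otimes>\<^bsub>A\<^esub> b)) u = ext.unit (\<rho> n' b')"
      unfolding b(3) using W.act_mult[of "\<phi> b'" "\<phi> c'" u] mult_inv.hyps(2) c' b(2) cc(2) phi_closed
      by (simp add: phi_mult ext.act_unit)
    have d: "\<phi> (c \<otimes>\<^bsub>A\<^esub> b) \<in> carrier (opposite_ring Q)" using phi_closed cc b by simp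
    have nn: "\<rho> n b \<in> carrier N" "\<rho> n' b' \<in> carrier N"
      using N.act_closed[of b n] N.act_closed[of b' n'] b c c' by auto
    interpret u: group_hom N ext.V ext.unit
      by (intro group_hom.intro group_hom_axioms.intro N.V.is_group ext.pair.T.is_group ext.unit_hom)
    have "ext.act (\<phi> (c \<otimes>\<^bsub>A\<^esub> b)) (t \<otimes>\<^bsub>ext.V\<^esub> inv\<^bsub>ext.V\<^esub> u) = ext.unit (\<rho> n b \<otimes>\<^bsub>N\<^esub> inv\<^bsub>N\<^esub> (\<rho> n' b'))"
      using mult_inv.hyps d nn 1 2 by (simp add: W.act_distrib W.act_inv)
    then show ?case using b(4) nn by blast
  qed
  then show thesis using that by blast
qed

end

section \<open>Modules over a ring with matrix units\<close>

lemma (in matrix_units) opposite_matrix_units: "matrix_units (opposite_ring Q) e r p' p"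
proof (intro matrix_units.intro matrix_units_axioms.intro ring_opposite)
  have "(\<Oplus>\<^bsub>opposite_ring Q\<^esub>i\<in>{..<r}. p' i \<otimes> p i) = (\<Oplus>i\<in>{..<r}. p' i \<otimes> p i)"
    by (simp add: finsum_def finprod_def opposite_ring_def)
  then show "(\<Oplus>\<^bsub>opposite_ring Q\<^esub>i\<in>{..<r}. p i \<otimes>\<^bsub>opposite_ring Q\<^esub> p' i) = \<one>\<^bsub>opposite_ring Q\<^esub>"
    using sum_p'_p by simp
  show "\<exists>q'\<in>carrier (opposite_ring Q). q' \<otimes>\<^bsub>opposite_ring Q\<^esub> (q \<otimes>\<^bsub>opposite_ring Q\<^esub> e) = e"
    if "q \<in> carrier (opposite_ring Q)" "q \<otimes>\<^bsub>opposite_ring Q\<^esub> e \<noteq> \<zero>\<^bsub>opposite_ring Q\<^esub>" for q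
    using right_simple[of q] that by simp
  show "\<exists>q'\<in>carrier (opposite_ring Q). (e \<otimes>\<^bsub>opposite_ring Q\<^esub> q) \<otimes>\<^bsub>opposite_ring Q\<^esub> q' = e"
    if "q \<in> carrier (opposite_ring Q)" "e \<otimes>\<^bsub>opposite_ring Q\<^esub> q \<noteq> \<zero>\<^bsub>opposite_ring Q\<^esub>" for q
    using left_simple[of q] that by simp
qed (use e_closed e_nonzero e_idem p_closed p'_closed e_p p'_e p_p' in auto)

locale module_over_matrix_units = left_module Q V act + matrix_units Q e r p p'
  for Q :: "('q, 'm) ring_scheme" (structure) and V :: "('v, 'n) monoid_scheme" and act e r p p'
begin

sublocale op: operator_group V "carrier Q" act
  by (intro operator_group.intro operator_group_axioms.intro V.comm_group_axioms act_hom)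

definition cyclic :: "'v \<Rightarrow> 'v set" where "cyclic v = (\<lambda>q. act q v) ` carrier Q"

definition corner_span :: "(nat \<Rightarrow> 'v) \<Rightarrow> nat \<Rightarrow> 'v set" where
  "corner_span u = op.family_product (\<lambda>l. cyclic (u l))"

lemma cyclic_closed: "v \<in> carrier V \<Longrightarrow> cyclic v \<subseteq> carrier V"
  by (auto simp: cyclic_def act_closed)

lemma cyclic_stable: "v \<in> carrier V \<Longrightarrow> op.stable (cyclic v)"
proof (rule op.stableI)
  assume v: "v \<in> carrier V"
  show "cyclic v \<subseteq> carrier V" using v by (rule cyclic_closed)
  show "\<one>\<^bsub>V\<^esub> \<in> cyclic v" using act_zero[OF v] unfolding cyclic_def by force
  show "x \<otimes>\<^bsub>V\<^esub> y \<in> cyclic v" if "x \<in> cyclic v" "y \<in> cyclic v" for x y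
    using that v unfolding cyclic_def by (auto simp: act_add[symmetric])
  show "inv\<^bsub>V\<^esub> x \<in> cyclic v" if "x \<in> cyclic v" for x
    using that v unfolding cyclic_def by (auto simp: act_minus[symmetric])
  show "act k x \<in> cyclic v" if "k \<in> carrier Q" "x \<in> cyclic v" for k x
    using that v unfolding cyclic_def by (auto simp: act_mult[symmetric])
qed

lemma cyclic_self: "v \<in> carrier V \<Longrightarrow> v \<in> cyclic v"
  unfolding cyclic_def by (rule image_eqI[of _ _ \<one>]) (simp_all add: act_one)

text \<open>As \<open>e u\<^sub>l = u\<^sub>l\<close>, the module \<open>Q u\<^sub>l\<close> is a quotient of the simple module \<open>Q e\<close>. Therefore the sum of these modules
  is direct and has length \<open>m\<close> as soon as no \<open>u\<^sub>l\<close> lies in the span of its predecessors.\<close>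

definition corner_independent :: "(nat \<Rightarrow> 'v) \<Rightarrow> nat \<Rightarrow> bool" where
  "corner_independent u m \<longleftrightarrow> (\<forall>l<m. u l \<in> carrier V \<and> act e (u l) = u l \<and> u l \<notin> corner_span u l)"

lemma span_stable: "(\<And>l. l < m \<Longrightarrow> u l \<in> carrier V) \<Longrightarrow> op.stable (corner_span u m)"
  unfolding corner_span_def by (intro op.stable_family_product cyclic_stable)

lemma span_0: "corner_span u 0 = {\<one>\<^bsub>V\<^esub>}"
  by (simp add: corner_span_def op.family_product_0)

lemma span_Suc: "(\<And>l. l \<le> m \<Longrightarrow> u l \<in> carrier V) \<Longrightarrow> corner_span u (Suc m) = set_mult V (corner_span u m) (cyclic (u m))"
  unfolding corner_span_def by (intro op.family_product_Suc cyclic_closed)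

lemma span_cong:
  assumes "\<And>l. l < m \<Longrightarrow> u l = u' l" shows "corner_span u m = corner_span u' m"
proof -
  have "finprod V v {..<m} = finprod V v {..<m}" for v by simp
  show ?thesis unfolding corner_span_def op.family_product_def using assms by (metis (no_types, lifting))
qed

text \<open>Otherwise \<open>w = \<Sum> p'\<^sub>i p\<^sub>i w\<close> would lie in \<open>W\<close>.\<close>

lemma corner_vector_outside:
  assumes W: "op.stable W" and w: "w \<in> carrier V" "w \<notin> W"
  obtains i where "i < r" "act (p i) w \<notin> W"
proof -
  have "\<exists>i<r. act (p i) w \<notin> W"
  proof (rule ccontr)
    assume "\<not> ?thesis"
    then have in_W: "act (p' i \<otimes> p i) w \<in> W" if "i < r" for i
      using op.stable_op[OF W p'_closed[OF that]] act_mult[OF p'_closed[OF that] p_closed[OF that] w(1)] that by auto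
    have "w = act (\<Oplus>i\<in>{..<r}. p' i \<otimes> p i) w" using w by (simp add: sum_p'_p act_one)
    also have "\<dots> = finprod V (\<lambda>i. act (p' i \<otimes> p i) w) {..<r}"
      using w p_closed p'_closed by (intro act_finsum) auto
    also have "\<dots> \<in> op.family_product (\<lambda>_. W) r" using in_W by (auto simp: op.family_product_def)
    also have "\<dots> \<subseteq> W" by (rule op.family_product_subset[OF _ W]) simp
    finally show False using w by simp
  qed
  then show thesis using that by blast
qed

lemma e_p_vector: "i < r \<Longrightarrow> w \<in> carrier V \<Longrightarrow> act e (act (p i) w) = act (p i) w"
  using act_mult[OF e_closed p_closed, of i w] e_p by simp

text \<open>A nonzero \<open>q \<in> Q e\<close> has a left multiple \<open>e\<close>, which fixes \<open>v\<close>.\<close>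

lemma corner_coefficient_zero:
  assumes W: "op.stable W" and v: "v \<in> carrier V" "act e v = v" "v \<notin> W"
    and q: "q \<in> carrier Q" "q \<otimes> e = q" "act q v \<in> W"
  shows "q = \<zero>"
proof (rule ccontr)
  assume "q \<noteq> \<zero>"
  then obtain q' where q': "q' \<in> carrier Q" "q' \<otimes> q = e" using left_simple[OF q(1)] q(2) by auto
  have "act q' (act q v) \<in> W" using op.stable_op[OF W q'(1) q(3)] .
  then show False using act_mult[OF q'(1) q(1) v(1)] q'(2) v by simp
qed

lemma has_chain_span:
  assumes "corner_independent u m" shows "has_chain V (carrier Q) act (corner_span u m) m"
  using assms
proof (induction m)
  case 0 then show ?case by (simp add: span_0 has_chain.zero op.stable_trivial)
next
  case (Suc m)
  then have ind: "corner_independent u m" by (simp add: corner_independent_def)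
  have uc: "u l \<in> carrier V" if "l \<le> m" for l using Suc.prems that by (simp add: corner_independent_def)
  have out: "u m \<notin> corner_span u m" using Suc.prems by (simp add: corner_independent_def)
  have st: "op.stable (corner_span u m)" using uc by (intro span_stable) auto
  note eq = span_Suc[of m u, OF uc]
  have sub: "corner_span u m \<subseteq> corner_span u (Suc m)"
    using op.subset_set_mult1[OF st cyclic_stable] uc[of m] eq by simp
  have "u m \<in> corner_span u (Suc m)"
    using op.subset_set_mult2[OF st cyclic_stable] uc[of m] eq cyclic_self by auto
  then have "corner_span u m \<subset> corner_span u (Suc m)" using sub out by blast
  moreover have "op.stable (corner_span u (Suc m))" using uc by (intro span_stable) auto
  ultimately show ?case using Suc.IH[OF ind] by (intro has_chain.Suc)
qed

lemma independent_of_chain: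
  assumes "has_chain V (carrier Q) act W n"
  shows "\<exists>u. corner_independent u n \<and> (\<forall>l<n. u l \<in> W)"
  using assms
proof (induction rule: has_chain.induct)
  case (zero W) then show ?case by (simp add: corner_independent_def)
next
  case (Suc W' n W)
  then obtain u where u: "corner_independent u n" "\<forall>l<n. u l \<in> W'" by blast
  have W': "op.stable W'" using Suc.hyps(1) by (rule has_chain_stable)
  obtain w where w: "w \<in> W" "w \<notin> W'" using Suc.hyps by blast
  have wc: "w \<in> carrier V" using op.stable_subset[OF Suc.hyps(2) w(1)] .
  obtain i where i: "i < r" "act (p i) w \<notin> W'" using corner_vector_outside[OF W' wc w(2)] .
  define v where "v = act (p i) w"
  define u' where "u' l = (if l < n then u l else v)" for l
  have span_eq: "corner_span u' l = corner_span u l" if "l \<le> n" for l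
    by (rule span_cong) (use that in \<open>simp add: u'_def\<close>)
  have "corner_span u n \<subseteq> W'" unfolding corner_span_def
  proof (rule op.family_product_subset[OF _ W'])
    fix l assume "l < n"
    then show "cyclic (u l) \<subseteq> W'" using u(2) op.stable_op[OF W'] by (auto simp: cyclic_def)
  qed
  then have "v \<notin> corner_span u' n" using i span_eq[of n] by (auto simp: v_def)
  moreover have "v \<in> carrier V" "act e v = v" using i wc act_closed p_closed e_p_vector by (auto simp: v_def)
  ultimately have "corner_independent u' (Suc n)"
    using u(1) span_eq by (auto simp: corner_independent_def u'_def less_Suc_eq)
  moreover have "v \<in> W" unfolding v_def using op.stable_op[OF Suc.hyps(2) p_closed[OF i(1)] w(1)] .
  then have "\<forall>l<Suc n. u' l \<in> W" using u(2) Suc.hyps(3) by (auto simp: u'_def)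
  ultimately show ?case by blast
qed

lemma independent_coefficients_zero:
  assumes "corner_independent u m" and "\<And>l. l < m \<Longrightarrow> q l \<in> carrier Q" and "\<And>l. l < m \<Longrightarrow> q l \<otimes> e = q l"
    and "finprod V (\<lambda>l. act (q l) (u l)) {..<m} = \<one>\<^bsub>V\<^esub>" and "l < m"
  shows "q l = \<zero>"
  using assms
proof (induction m arbitrary: l)
  case 0 then show ?case by simp
next
  case (Suc m)
  have ind: "corner_independent u m" using Suc.prems(1) by (simp add: corner_independent_def)
  have um: "u m \<in> carrier V" "act e (u m) = u m" "u m \<notin> corner_span u m" using Suc.prems(1) by (auto simp: corner_independent_def)
  have uc: "u l \<in> carrier V" if "l < m" for l using ind that by (simp add: corner_independent_def)
  have c: "act (q l) (u l) \<in> carrier V" if "l \<le> m" for l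
    using that Suc.prems(2) uc um by (cases "l = m") (auto intro!: act_closed)
  let ?s = "finprod V (\<lambda>l. act (q l) (u l)) {..<m}"
  have s: "?s \<in> corner_span u m" using Suc.prems(2) by (auto simp: corner_span_def op.family_product_def cyclic_def)
  have st: "op.stable (corner_span u m)" using uc by (rule span_stable)
  have sc: "?s \<in> carrier V" using op.stable_subset[OF st s] .
  have "?s \<otimes>\<^bsub>V\<^esub> act (q m) (u m) = \<one>\<^bsub>V\<^esub>"
    using Suc.prems(4) op.finprod_lessThan_Suc[of m "\<lambda>l. act (q l) (u l)"] c by simp
  then have "act (q m) (u m) = inv\<^bsub>V\<^esub> ?s" using sc c[of m] by (metis V.inv_equality V.inv_inv V.m_comm order_refl)
  then have "act (q m) (u m) \<in> corner_span u m" using op.stable_inv[OF st s] by simp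
  then have 0: "q m = \<zero>" using corner_coefficient_zero[OF st um, of "q m"] Suc.prems by simp
  have "?s = \<one>\<^bsub>V\<^esub>" using \<open>?s \<otimes>\<^bsub>V\<^esub> act (q m) (u m) = \<one>\<^bsub>V\<^esub>\<close> 0 um sc by (simp add: act_zero)
  then have "q l = \<zero>" if "l < m" for l using Suc.IH[OF ind, of l] Suc.prems(2,3) that by simp
  then show ?case using 0 Suc.prems(5) by (auto simp: less_Suc_eq)
qed

lemma independent_coefficients_unique:
  assumes u: "corner_independent u m" and q: "\<And>l. l < m \<Longrightarrow> q l \<in> carrier Q \<and> q l \<otimes> e = q l"
    and q': "\<And>l. l < m \<Longrightarrow> q' l \<in> carrier Q \<and> q' l \<otimes> e = q' l"
    and eq: "finprod V (\<lambda>l. act (q l) (u l)) {..<m} = finprod V (\<lambda>l. act (q' l) (u l)) {..<m}" and l: "l < m"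
  shows "q l = q' l"
proof -
  have uc: "u l \<in> carrier V" if "l < m" for l using u that by (simp add: corner_independent_def)
  let ?d = "\<lambda>l. q l \<ominus> q' l"
  have c: "(\<lambda>l. act (?d l) (u l)) \<in> {..<m} \<rightarrow> carrier V" "(\<lambda>l. act (q' l) (u l)) \<in> {..<m} \<rightarrow> carrier V"
    using q q' uc by (auto intro!: act_closed)
  have "finprod V (\<lambda>l. act (?d l) (u l)) {..<m} \<otimes>\<^bsub>V\<^esub> finprod V (\<lambda>l. act (q' l) (u l)) {..<m}
      = finprod V (\<lambda>l. act (?d l) (u l) \<otimes>\<^bsub>V\<^esub> act (q' l) (u l)) {..<m}"
    by (rule V.finprod_multf[symmetric]) (use c in auto)
  also have "\<dots> = finprod V (\<lambda>l. act (q l) (u l)) {..<m}"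
  proof (rule V.finprod_cong'[OF refl])
    show "act (?d l) (u l) \<otimes>\<^bsub>V\<^esub> act (q' l) (u l) = act (q l) (u l)" if "l \<in> {..<m}" for l
    proof -
      have "?d l \<oplus> q' l = q l" using q q' that by (simp add: minus_eq a_assoc l_neg)
      then show ?thesis using act_add[of "?d l" "q' l" "u l"] q q' uc that by simp
    qed
  qed (use q uc in \<open>auto intro!: act_closed\<close>)
  finally have "finprod V (\<lambda>l. act (?d l) (u l)) {..<m} = \<one>\<^bsub>V\<^esub>"
    using eq V.finprod_closed[OF c(1)] V.finprod_closed[OF c(2)] by (metis V.r_cancel_one)
  moreover have "?d l \<otimes> e = ?d l" if "l < m" for l
    using q[OF that] q'[OF that] e_closed by (simp add: minus_eq l_distr l_minus)
  ultimately have "?d l = \<zero>" using independent_coefficients_zero[OF u, of ?d l] q q' l by simp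
  then show ?thesis using q[OF l] q'[OF l] by simp
qed

text \<open>A chain of maximal length gives as many independent vectors. Their span is everything, because otherwise it could be
  lengthened to a longer chain.\<close>

theorem basis_of_bounded_chains:
  assumes bound: "\<And>n. has_chain V (carrier Q) act (carrier V) n \<Longrightarrow> n \<le> s"
  obtains m u where "m \<le> s" "corner_independent u m"
    "\<And>v. v \<in> carrier V \<Longrightarrow> \<exists>q. (\<forall>l<m. q l \<in> carrier Q \<and> q l \<otimes> e = q l) \<and> v = finprod V (\<lambda>l. act (q l) (u l)) {..<m}"
proof -
  have top: "op.stable (carrier V)" by (rule op.stableI) (auto simp: act_closed)
  define m where "m = (GREATEST n. has_chain V (carrier Q) act (carrier V) n)"
  have m: "has_chain V (carrier Q) act (carrier V) m" unfolding m_def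
    by (rule GreatestI_nat[of _ 0 s]) (use bound top in \<open>auto intro: has_chain.zero\<close>)
  have no: "\<not> has_chain V (carrier Q) act (carrier V) (Suc m)"
  proof
    assume "has_chain V (carrier Q) act (carrier V) (Suc m)"
    then have "Suc m \<le> m" unfolding m_def by (rule Greatest_le_nat[of _ _ s]) (use bound in auto)
    then show False by simp
  qed
  obtain u where u: "corner_independent u m" using independent_of_chain[OF m] by blast
  have uc: "u l \<in> carrier V" "act e (u l) = u l" if "l < m" for l using u that by (auto simp: corner_independent_def)
  have st: "op.stable (corner_span u m)" using uc(1) by (rule span_stable)
  have "corner_span u m = carrier V"
  proof (rule ccontr)
    assume "corner_span u m \<noteq> carrier V"
    then have "corner_span u m \<subset> carrier V" using op.stable_subset[OF st] by blast
    then show False using no has_chain.Suc[OF has_chain_span[OF u] top] by blast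
  qed
  then have "\<exists>q. (\<forall>l<m. q l \<in> carrier Q \<and> q l \<otimes> e = q l) \<and> v = finprod V (\<lambda>l. act (q l) (u l)) {..<m}"
    if v: "v \<in> carrier V" for v
  proof -
    have "v \<in> corner_span u m" using v \<open>corner_span u m = carrier V\<close> by simp
    then obtain w where w: "\<forall>l<m. w l \<in> cyclic (u l)" "v = finprod V w {..<m}"
      by (auto simp: corner_span_def op.family_product_def)
    then have "\<forall>l. \<exists>q. l < m \<longrightarrow> q \<in> carrier Q \<and> w l = act q (u l)" by (auto simp: cyclic_def)
    then obtain q where q: "\<And>l. l < m \<Longrightarrow> q l \<in> carrier Q \<and> w l = act (q l) (u l)" by metis
    have "w l = act (q l \<otimes> e) (u l)" if "l < m" for l
      using q[OF that] uc[OF that] act_mult[of "q l" e "u l"] e_closed by simp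
    then have "v = finprod V (\<lambda>l. act (q l \<otimes> e) (u l)) {..<m}"
      unfolding w(2) using q uc e_closed by (intro V.finprod_cong') (auto intro!: act_closed)
    moreover have "\<forall>l<m. q l \<otimes> e \<in> carrier Q \<and> q l \<otimes> e \<otimes> e = q l \<otimes> e"
      using q e_closed by (simp add: m_assoc e_idem)
    ultimately show ?thesis by (intro exI[of _ "\<lambda>l. q l \<otimes> e"]) simp
  qed
  then show thesis using that[OF bound[OF m] u] by blast
qed

end

section \<open>Linear algebra over the ring of fractions with cleared denominators\<close>

lemma (in comm_group) finprod_mult_lessThan:
  assumes "\<And>j. j < (k::nat) \<Longrightarrow> f j \<in> carrier G" "\<And>j. j < k \<Longrightarrow> g j \<in> carrier G"
  shows "finprod G (\<lambda>j. f j \<otimes> g j) {..<k} = finprod G f {..<k} \<otimes> finprod G g {..<k}"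
  using assms by (intro finprod_multf) auto

lemma (in group_hom) hom_finprod_lessThan:
  assumes "comm_group G" "comm_group H" "\<And>j. j < (k::nat) \<Longrightarrow> f j \<in> carrier G"
  shows "h (finprod G f {..<k}) = finprod H (\<lambda>j. h (f j)) {..<k}"
proof -
  interpret G: comm_group G by fact
  interpret H: comm_group H by fact
  show ?thesis using assms(3)
  proof (induction k)
    case (Suc k)
    have "finprod G f {..<Suc k} = f k \<otimes>\<^bsub>G\<^esub> finprod G f {..<k}"
      using Suc.prems by (subst lessThan_Suc, subst G.finprod_insert) auto
    moreover have "finprod H (\<lambda>j. h (f j)) {..<Suc k} = h (f k) \<otimes>\<^bsub>H\<^esub> finprod H (\<lambda>j. h (f j)) {..<k}"
      using Suc.prems by (subst lessThan_Suc, subst H.finprod_insert) auto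
    moreover have "finprod G f {..<k} \<in> carrier G" using Suc.prems by (intro G.finprod_closed) auto
    ultimately show ?case using Suc by simp
  qed simp
qed

locale left_module_over_fractions = left_module_fractions A Q \<phi> N \<sigma> + units: matrix_units Q e r p p'
  for A :: "('a, 'r) ring_scheme" and Q :: "('q, 'p) ring_scheme" and \<phi>
    and N :: "('y, 'n) monoid_scheme" and \<sigma> and e r p p'
begin

text \<open>Since \<open>Q \<otimes>\<^sub>A N\<close> is a sum of \<open>m\<close> copies of \<open>Q e\<close>, the coordinates of \<open>1 \<otimes> n\<close> are elements of \<open>Q e\<close>. With a common
  denominator they become elements \<open>f l n\<close> of \<open>A\<close>, and \<open>r\<close> of them, one in each of \<open>r\<close> copies of \<open>Q e\<close>, fit into one copy of \<open>Q\<close>. The elements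
  \<open>b i\<close> of \<open>A\<close> perform this packing: the sum of the \<open>f l (n i) b i\<close> determines all its summands. So \<open>N\<^sup>r\<close> maps to \<open>A\<^sup>m\<close>, and the
  kernel consists of torsion elements.\<close>

theorem coordinate_maps:
  fixes k s :: nat
  assumes bound: "\<And>n. has_chain ext.V (carrier Q) ext.act (carrier ext.V) n \<Longrightarrow> n \<le> s"
    and gen: "\<And>j. j < k \<Longrightarrow> y j \<in> carrier N"
      "\<And>n. n \<in> carrier N \<Longrightarrow> \<exists>a. (\<forall>j<k. a j \<in> carrier A) \<and> n = finprod N (\<lambda>j. \<sigma> (a j) (y j)) {..<k}"
  obtains m f b where "m \<le> s"
    and "\<And>i. i < r \<Longrightarrow> b i \<in> carrier A"
    and "\<And>l n. l < m \<Longrightarrow> n \<in> carrier N \<Longrightarrow> f l n \<in> carrier A"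
    and "\<And>l n n'. l < m \<Longrightarrow> n \<in> carrier N \<Longrightarrow> n' \<in> carrier N \<Longrightarrow> f l (n \<otimes>\<^bsub>N\<^esub> n') = f l n \<oplus>\<^bsub>A\<^esub> f l n'"
    and "\<And>l n a. l < m \<Longrightarrow> n \<in> carrier N \<Longrightarrow> a \<in> carrier A \<Longrightarrow> f l (\<sigma> a n) = a \<otimes>\<^bsub>A\<^esub> f l n"
    and "\<And>n. n \<in> carrier N \<Longrightarrow> (\<And>l. l < m \<Longrightarrow> f l n = \<zero>\<^bsub>A\<^esub>) \<Longrightarrow> ext.unit n = \<one>\<^bsub>ext.V\<^esub>"
    and "\<And>l n i. l < m \<Longrightarrow> (\<And>i. i < r \<Longrightarrow> n i \<in> carrier N) \<Longrightarrow> (\<Oplus>\<^bsub>A\<^esub>i\<in>{..<r}. f l (n i) \<otimes>\<^bsub>A\<^esub> b i) = \<zero>\<^bsub>A\<^esub>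
      \<Longrightarrow> i < r \<Longrightarrow> f l (n i) = \<zero>\<^bsub>A\<^esub>"
proof -
  interpret W: module_over_matrix_units Q ext.V ext.act e r p p'
    by (intro module_over_matrix_units.intro ext.module units.matrix_units_axioms)
  obtain m u where m: "m \<le> s" and u: "W.corner_independent u m"
    and gen_u: "\<And>v. v \<in> carrier ext.V \<Longrightarrow>
      \<exists>q. (\<forall>l<m. q l \<in> carrier Q \<and> q l \<otimes>\<^bsub>Q\<^esub> e = q l) \<and> v = finprod ext.V (\<lambda>l. ext.act (q l) (u l)) {..<m}"
    using W.basis_of_bounded_chains[OF bound] by blast
  have uc: "u l \<in> carrier ext.V" if "l < m" for l using u that by (simp add: W.corner_independent_def)
  have tc: "ext.unit n \<in> carrier ext.V" if "n \<in> carrier N" for n using ext.unit_hom that by (auto simp: hom_def)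
  have "\<forall>n. \<exists>q. n \<in> carrier N \<longrightarrow> (\<forall>l<m. q l \<in> carrier Q \<and> q l \<otimes>\<^bsub>Q\<^esub> e = q l)
      \<and> ext.unit n = finprod ext.V (\<lambda>l. ext.act (q l) (u l)) {..<m}"
    using gen_u[OF tc] by blast
  then obtain C where C0: "\<forall>n. n \<in> carrier N \<longrightarrow> (\<forall>l<m. C n l \<in> carrier Q \<and> C n l \<otimes>\<^bsub>Q\<^esub> e = C n l)
      \<and> ext.unit n = finprod ext.V (\<lambda>l. ext.act (C n l) (u l)) {..<m}"
    by (rule choice[THEN exE])
  have C: "C n l \<in> carrier Q \<and> C n l \<otimes>\<^bsub>Q\<^esub> e = C n l" if "n \<in> carrier N" "l < m" for n l
    using C0 that by simp
  have C_unit: "ext.unit n = finprod ext.V (\<lambda>l. ext.act (C n l) (u l)) {..<m}" if "n \<in> carrier N" for n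
    using C0 that by simp
  have actc: "ext.act q (u l) \<in> carrier ext.V" if "q \<in> carrier Q" "l < m" for q l using that uc W.act_closed by simp
  have C_add: "C (n \<otimes>\<^bsub>N\<^esub> n') l = C n l \<oplus>\<^bsub>Q\<^esub> C n' l" if n: "n \<in> carrier N" "n' \<in> carrier N" and l: "l < m" for n n' l
  proof (rule W.independent_coefficients_unique[OF u _ _ _ l])
    show "C (n \<otimes>\<^bsub>N\<^esub> n') l \<in> carrier Q \<and> C (n \<otimes>\<^bsub>N\<^esub> n') l \<otimes>\<^bsub>Q\<^esub> e = C (n \<otimes>\<^bsub>N\<^esub> n') l" if "l < m" for l using C n that by simp
    show "C n l \<oplus>\<^bsub>Q\<^esub> C n' l \<in> carrier Q \<and> (C n l \<oplus>\<^bsub>Q\<^esub> C n' l) \<otimes>\<^bsub>Q\<^esub> e = C n l \<oplus>\<^bsub>Q\<^esub> C n' l" if "l < m" for l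
      using C[OF n(1) that] C[OF n(2) that] units.e_closed by (simp add: Q.l_distr)
    have "finprod ext.V (\<lambda>l. ext.act (C (n \<otimes>\<^bsub>N\<^esub> n') l) (u l)) {..<m} = ext.unit n \<otimes>\<^bsub>ext.V\<^esub> ext.unit n'"
      using C_unit[of "n \<otimes>\<^bsub>N\<^esub> n'"] n hom_mult[OF ext.unit_hom n] by simp
    also have "\<dots> = finprod ext.V (\<lambda>l. ext.act (C n l) (u l) \<otimes>\<^bsub>ext.V\<^esub> ext.act (C n' l) (u l)) {..<m}"
      unfolding C_unit[OF n(1)] C_unit[OF n(2)] using C n actc
      by (intro ext.pair.T.finprod_mult_lessThan[symmetric]) auto
    also have "\<dots> = finprod ext.V (\<lambda>l. ext.act (C n l \<oplus>\<^bsub>Q\<^esub> C n' l) (u l)) {..<m}"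
      using C n actc uc by (intro ext.pair.T.finprod_cong') (auto simp: W.act_add)
    finally show "finprod ext.V (\<lambda>l. ext.act (C (n \<otimes>\<^bsub>N\<^esub> n') l) (u l)) {..<m}
      = finprod ext.V (\<lambda>l. ext.act (C n l \<oplus>\<^bsub>Q\<^esub> C n' l) (u l)) {..<m}" .
  qed
  have C_scale: "C (\<sigma> a n) l = \<phi> a \<otimes>\<^bsub>Q\<^esub> C n l" if n: "n \<in> carrier N" and a: "a \<in> carrier A" and l: "l < m" for n a l
  proof (rule W.independent_coefficients_unique[OF u _ _ _ l])
    have an: "\<sigma> a n \<in> carrier N" using act_closed a n by simp
    note ac = phi_closed[OF a]
    show "C (\<sigma> a n) l \<in> carrier Q \<and> C (\<sigma> a n) l \<otimes>\<^bsub>Q\<^esub> e = C (\<sigma> a n) l" if "l < m" for l using C an that by simp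
    show "\<phi> a \<otimes>\<^bsub>Q\<^esub> C n l \<in> carrier Q \<and> (\<phi> a \<otimes>\<^bsub>Q\<^esub> C n l) \<otimes>\<^bsub>Q\<^esub> e = \<phi> a \<otimes>\<^bsub>Q\<^esub> C n l" if "l < m" for l
      using C[OF n that] ac units.e_closed by (simp add: Q.m_assoc)
    have "finprod ext.V (\<lambda>l. ext.act (C (\<sigma> a n) l) (u l)) {..<m} = ext.act (\<phi> a) (ext.unit n)"
      using C_unit[OF an] ext.act_unit[OF a n] by simp
    also have "\<dots> = finprod ext.V (\<lambda>l. ext.act (\<phi> a) (ext.act (C n l) (u l))) {..<m}"
      unfolding C_unit[OF n] using C n actc ac by (intro W.act_finprod) auto
    also have "\<dots> = finprod ext.V (\<lambda>l. ext.act (\<phi> a \<otimes>\<^bsub>Q\<^esub> C n l) (u l)) {..<m}"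
      using C n actc uc ac by (intro ext.pair.T.finprod_cong') (auto simp: W.act_mult W.act_closed)
    finally show "finprod ext.V (\<lambda>l. ext.act (C (\<sigma> a n) l) (u l)) {..<m}
      = finprod ext.V (\<lambda>l. ext.act (\<phi> a \<otimes>\<^bsub>Q\<^esub> C n l) (u l)) {..<m}" .
  qed
  have Cy: "C (y (fst jl)) (snd jl) \<in> carrier Q" if "jl \<in> {..<k} \<times> {..<m}" for jl
    using that C[OF gen(1), of "fst jl" "snd jl"] by auto
  \<comment> \<open>A common right denominator for the coordinates of the generators serves for all of \<open>N\<close>, since the coordinates are left linear.\<close>
  have "\<exists>c\<in>regular_elements A. \<forall>jl\<in>{..<k} \<times> {..<m}. C (y (fst jl)) (snd jl) \<otimes>\<^bsub>Q\<^esub> \<phi> c \<in> \<phi> ` carrier A"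
  proof (rule right_common_denominator)
    show "finite ({..<k} \<times> {..<m})" by simp
    show "C (y (fst jl)) (snd jl) \<in> carrier Q" if "jl \<in> {..<k} \<times> {..<m}" for jl using Cy that .
  qed blast
  then obtain c where c: "c \<in> regular_elements A"
    and c_den: "\<And>jl. jl \<in> {..<k} \<times> {..<m} \<Longrightarrow> C (y (fst jl)) (snd jl) \<otimes>\<^bsub>Q\<^esub> \<phi> c \<in> \<phi> ` carrier A"
    by blast
  have cc: "c \<in> carrier A" "\<phi> c \<in> carrier Q" using c regular_closed phi_closed by auto
  have C_gen: "C (finprod N (\<lambda>j. \<sigma> (a j) (y j)) {..<i}) l \<otimes>\<^bsub>Q\<^esub> \<phi> c \<in> \<phi> ` carrier A"
    if "i \<le> k" "\<And>j. j < i \<Longrightarrow> a j \<in> carrier A" "l < m" for a i l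
    using that
  proof (induction i)
    case 0
    have "C \<one>\<^bsub>N\<^esub> l \<oplus>\<^bsub>Q\<^esub> C \<one>\<^bsub>N\<^esub> l = C \<one>\<^bsub>N\<^esub> l" using C_add[of "\<one>\<^bsub>N\<^esub>" "\<one>\<^bsub>N\<^esub>" l] 0 by simp
    then have "C \<one>\<^bsub>N\<^esub> l = \<zero>\<^bsub>Q\<^esub>" using C[of "\<one>\<^bsub>N\<^esub>" l] 0 by simp
    then have "C \<one>\<^bsub>N\<^esub> l \<otimes>\<^bsub>Q\<^esub> \<phi> c = \<phi> \<zero>\<^bsub>A\<^esub>" using cc by (simp add: phi_zero)
    then show ?case by simp
  next
    case (Suc i)
    let ?n = "finprod N (\<lambda>j. \<sigma> (a j) (y j)) {..<i}"
    have car: "\<sigma> (a j) (y j) \<in> carrier N" if "j \<le> i" for j using act_closed gen(1) Suc.prems that by simp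
    have nc: "?n \<in> carrier N" using car by (intro V.finprod_closed) auto
    have "finprod N (\<lambda>j. \<sigma> (a j) (y j)) {..<Suc i} = \<sigma> (a i) (y i) \<otimes>\<^bsub>N\<^esub> ?n"
      using car by (subst lessThan_Suc, subst V.finprod_insert) auto
    then have "C (finprod N (\<lambda>j. \<sigma> (a j) (y j)) {..<Suc i}) l = \<phi> (a i) \<otimes>\<^bsub>Q\<^esub> C (y i) l \<oplus>\<^bsub>Q\<^esub> C ?n l"
      using C_add[OF car[of i] nc] C_scale[of "y i" "a i"] gen(1) Suc.prems by simp
    moreover obtain a1 where a1: "a1 \<in> carrier A" "C ?n l \<otimes>\<^bsub>Q\<^esub> \<phi> c = \<phi> a1" using Suc by auto
    moreover obtain a2 where a2: "a2 \<in> carrier A" "C (y i) l \<otimes>\<^bsub>Q\<^esub> \<phi> c = \<phi> a2" using c_den[of "(i, l)"] Suc.prems by auto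
    moreover have ai: "a i \<in> carrier A" "y i \<in> carrier N" using Suc.prems gen(1) by auto
    ultimately have "C (finprod N (\<lambda>j. \<sigma> (a j) (y j)) {..<Suc i}) l \<otimes>\<^bsub>Q\<^esub> \<phi> c = \<phi> (a i \<otimes>\<^bsub>A\<^esub> a2 \<oplus>\<^bsub>A\<^esub> a1)"
      using cc C[OF ai(2) Suc.prems(3)] C[OF nc Suc.prems(3)] phi_closed[OF ai(1)]
      by (simp add: Q.l_distr Q.m_assoc phi_add phi_mult)
    then show ?case using ai a1 a2 by (simp only: imageI A.a_closed A.m_closed)
  qed
  have "\<forall>l n. \<exists>a. l < m \<and> n \<in> carrier N \<longrightarrow> a \<in> carrier A \<and> \<phi> a = C n l \<otimes>\<^bsub>Q\<^esub> \<phi> c"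
  proof (intro allI)
    fix l n
    show "\<exists>a. l < m \<and> n \<in> carrier N \<longrightarrow> a \<in> carrier A \<and> \<phi> a = C n l \<otimes>\<^bsub>Q\<^esub> \<phi> c"
    proof (cases "l < m \<and> n \<in> carrier N")
      case True
      then obtain a where a: "\<forall>j<k. a j \<in> carrier A" "n = finprod N (\<lambda>j. \<sigma> (a j) (y j)) {..<k}" using gen(2) by blast
      have "C n l \<otimes>\<^bsub>Q\<^esub> \<phi> c \<in> \<phi> ` carrier A" unfolding a(2) using C_gen[of k a l] a(1) True by simp
      then show ?thesis by auto
    qed blast
  qed
  then obtain f where f: "\<And>l n. l < m \<Longrightarrow> n \<in> carrier N \<Longrightarrow> f l n \<in> carrier A"
    and \<phi>f: "\<And>l n. l < m \<Longrightarrow> n \<in> carrier N \<Longrightarrow> \<phi> (f l n) = C n l \<otimes>\<^bsub>Q\<^esub> \<phi> c" by metis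
  have uc': "\<phi> c \<in> Units Q" using phi_unit[OF c] .
  then have ic: "inv\<^bsub>Q\<^esub> (\<phi> c) \<in> carrier Q" by simp
  \<comment> \<open>The element \<open>b i\<close> is the row \<open>p i\<close>, corrected by \<open>c\<^sup>-\<^sup>1\<close> to undo the first denominator and multiplied by a second
  one.\<close>
  obtain c' where c': "c' \<in> regular_elements A"
    and c'_den: "\<And>i. i \<in> {..<r} \<Longrightarrow> (inv\<^bsub>Q\<^esub> (\<phi> c) \<otimes>\<^bsub>Q\<^esub> p i) \<otimes>\<^bsub>Q\<^esub> \<phi> c' \<in> \<phi> ` carrier A"
    using right_common_denominator[of "{..<r}" "\<lambda>i. inv\<^bsub>Q\<^esub> (\<phi> c) \<otimes>\<^bsub>Q\<^esub> p i"] ic units.p_closed by auto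
  have cc': "\<phi> c' \<in> carrier Q" using c' regular_closed phi_closed by auto
  have "\<forall>i. \<exists>a. i < r \<longrightarrow> a \<in> carrier A \<and> \<phi> a = inv\<^bsub>Q\<^esub> (\<phi> c) \<otimes>\<^bsub>Q\<^esub> p i \<otimes>\<^bsub>Q\<^esub> \<phi> c'" using c'_den by force
  then obtain b where b: "\<And>i. i < r \<Longrightarrow> b i \<in> carrier A"
    and \<phi>b: "\<And>i. i < r \<Longrightarrow> \<phi> (b i) = inv\<^bsub>Q\<^esub> (\<phi> c) \<otimes>\<^bsub>Q\<^esub> p i \<otimes>\<^bsub>Q\<^esub> \<phi> c'" by metis
  have zero: "C n l = \<zero>\<^bsub>Q\<^esub> \<longleftrightarrow> f l n = \<zero>\<^bsub>A\<^esub>" if "l < m" "n \<in> carrier N" for l n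
    using \<phi>f[OF that] C[OF that(2,1)] regular_right_cancel[OF c, of "C n l"] phi_eq_zero[OF f[OF that]] phi_zero cc by auto
  show thesis
  proof (rule that[OF m b f])
    show "f l (n \<otimes>\<^bsub>N\<^esub> n') = f l n \<oplus>\<^bsub>A\<^esub> f l n'" if "l < m" "n \<in> carrier N" "n' \<in> carrier N" for l n n'
      using that f C cc C_add[of n n' l] by (intro phi_inj) (simp_all add: phi_add \<phi>f Q.l_distr)
    show "f l (\<sigma> a n) = a \<otimes>\<^bsub>A\<^esub> f l n" if "l < m" "n \<in> carrier N" "a \<in> carrier A" for l n a
      using that f C cc C_scale[of n a l] phi_closed[OF that(3)]
      by (intro phi_inj) (simp_all add: phi_mult \<phi>f act_closed Q.m_assoc)
    show "ext.unit n = \<one>\<^bsub>ext.V\<^esub>" if n: "n \<in> carrier N" and 0: "\<And>l. l < m \<Longrightarrow> f l n = \<zero>\<^bsub>A\<^esub>" for n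
    proof -
      have "ext.unit n = finprod ext.V (\<lambda>l. \<one>\<^bsub>ext.V\<^esub>) {..<m}"
        unfolding C_unit[OF n] using zero[OF _ n] 0 W.act_zero[OF uc]
        by (intro ext.pair.T.finprod_cong') auto
      then show ?thesis by (simp add: ext.pair.T.finprod_one_eqI)
    qed
    show "f l (n i) = \<zero>\<^bsub>A\<^esub>" if l: "l < m" and n: "\<And>i. i < r \<Longrightarrow> n i \<in> carrier N"
      and sum: "(\<Oplus>\<^bsub>A\<^esub>i\<in>{..<r}. f l (n i) \<otimes>\<^bsub>A\<^esub> b i) = \<zero>\<^bsub>A\<^esub>" and i: "i < r" for l n i
    proof -
      have D: "C (n j) l \<in> carrier Q" "C (n j) l \<otimes>\<^bsub>Q\<^esub> e = C (n j) l" if "j < r" for j using C[OF n[OF that] l] by auto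
      have term_eq: "\<phi> (f l (n j) \<otimes>\<^bsub>A\<^esub> b j) = (C (n j) l \<otimes>\<^bsub>Q\<^esub> p j) \<otimes>\<^bsub>Q\<^esub> \<phi> c'" if j: "j < r" for j
      proof -
        have "\<phi> (f l (n j) \<otimes>\<^bsub>A\<^esub> b j) = C (n j) l \<otimes>\<^bsub>Q\<^esub> (\<phi> c \<otimes>\<^bsub>Q\<^esub> inv\<^bsub>Q\<^esub> (\<phi> c)) \<otimes>\<^bsub>Q\<^esub> p j \<otimes>\<^bsub>Q\<^esub> \<phi> c'"
          using f[OF l n[OF j]] b[OF j] D[OF j] cc cc' ic units.p_closed[OF j]
          by (simp add: phi_mult \<phi>f[OF l n[OF j]] \<phi>b[OF j] Q.m_assoc)
        then show ?thesis using Q.Units_r_inv[OF uc'] D[OF j] by simp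
      qed
      have "\<phi> (\<Oplus>\<^bsub>A\<^esub>j\<in>{..<r}. f l (n j) \<otimes>\<^bsub>A\<^esub> b j) = (\<Oplus>\<^bsub>Q\<^esub>j\<in>{..<r}. \<phi> (f l (n j) \<otimes>\<^bsub>A\<^esub> b j))"
      proof -
        interpret h: group_hom "add_monoid A" "add_monoid Q" \<phi>
          by (intro group_hom.intro group_hom_axioms.intro A.a_group Q.a_group)
            (auto simp: hom_def phi_closed phi_add)
        show ?thesis unfolding finsum_def
          using f[OF l n] b by (intro h.hom_finprod_lessThan A.a_comm_group Q.a_comm_group) auto
      qed
      also have "\<dots> = (\<Oplus>\<^bsub>Q\<^esub>j\<in>{..<r}. (C (n j) l \<otimes>\<^bsub>Q\<^esub> p j) \<otimes>\<^bsub>Q\<^esub> \<phi> c')"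
        using D units.p_closed cc' by (intro Q.finsum_cong') (auto simp: term_eq)
      also have "\<dots> = (\<Oplus>\<^bsub>Q\<^esub>j\<in>{..<r}. C (n j) l \<otimes>\<^bsub>Q\<^esub> p j) \<otimes>\<^bsub>Q\<^esub> \<phi> c'"
        using D units.p_closed cc' by (intro Q.finsum_ldistr[symmetric]) auto
      finally have "(\<Oplus>\<^bsub>Q\<^esub>j\<in>{..<r}. C (n j) l \<otimes>\<^bsub>Q\<^esub> p j) \<otimes>\<^bsub>Q\<^esub> \<phi> c' = \<zero>\<^bsub>Q\<^esub>" using sum phi_zero by simp
      then have S0: "(\<Oplus>\<^bsub>Q\<^esub>j\<in>{..<r}. C (n j) l \<otimes>\<^bsub>Q\<^esub> p j) = \<zero>\<^bsub>Q\<^esub>"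
        using regular_right_cancel[OF c'] D units.p_closed by (simp add: Q.finsum_closed Pi_def)
      \<comment> \<open>Multiplication by the column \<open>p' i\<close> singles out the coordinate of \<open>n i\<close>.\<close>
      have "\<zero>\<^bsub>Q\<^esub> = (\<Oplus>\<^bsub>Q\<^esub>j\<in>{..<r}. C (n j) l \<otimes>\<^bsub>Q\<^esub> p j) \<otimes>\<^bsub>Q\<^esub> p' i" using S0 units.p'_closed[OF i] by simp
      also have "\<dots> = (\<Oplus>\<^bsub>Q\<^esub>j\<in>{..<r}. (C (n j) l \<otimes>\<^bsub>Q\<^esub> p j) \<otimes>\<^bsub>Q\<^esub> p' i)"
        using D units.p_closed units.p'_closed[OF i] by (intro Q.finsum_ldistr) auto
      also have "\<dots> = (\<Oplus>\<^bsub>Q\<^esub>j\<in>{..<r}. if i = j then C (n j) l else \<zero>\<^bsub>Q\<^esub>)"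
        using D units.p_closed units.p'_closed[OF i] units.p_p'[OF _ i] units.e_closed
        by (intro Q.finsum_cong') (auto simp: Q.m_assoc)
      also have "\<dots> = C (n i) l" using D i by (intro Q.add.finprod_singleton) auto
      finally show ?thesis using zero[OF l n[OF i]] by simp
    qed
  qed
qed

end

locale right_module_over_fractions = right_module_fractions A Q \<phi> N \<rho> + units: matrix_units Q e r p p'
  for A :: "('a, 'r) ring_scheme" and Q :: "('q, 'p) ring_scheme" and \<phi>
    and N :: "('y, 'n) monoid_scheme" and \<rho> and e r p p'
begin

lemma unit_closed: "n \<in> carrier N \<Longrightarrow> ext.unit n \<in> carrier ext.V"
  using ext.unit_hom by (auto simp: hom_def)

lemma clear_right_denominators:
  assumes "finite J" "\<And>j. j \<in> J \<Longrightarrow> w j \<in> carrier ext.V"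
  obtains c where "c \<in> regular_elements A" "\<And>j. j \<in> J \<Longrightarrow> \<exists>n\<in>carrier N. ext.act (\<phi> c) (w j) = ext.unit n"
proof -
  interpret W: left_module "opposite_ring Q" ext.V ext.act by (rule ext.module)
  have "\<exists>c\<in>regular_elements A. \<forall>j\<in>J. \<exists>n\<in>carrier N. ext.act (\<phi> c) (w j) = ext.unit n"
    using assms
  proof (induction J rule: finite_induct)
    case empty then show ?case using regular_one by auto
  next
    case (insert j J)
    then obtain c where c: "c \<in> regular_elements A" "\<forall>i\<in>J. \<exists>n\<in>carrier N. ext.act (\<phi> c) (w i) = ext.unit n" by auto
    note cc = regular_closed[OF c(1)] phi_closed[OF regular_closed[OF c(1)]]
    have wc: "ext.act (\<phi> c) (w j) \<in> carrier ext.V" using W.act_closed insert.prems cc by simp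
    obtain s n where s: "s \<in> regular_elements A" "n \<in> carrier N" "ext.act (\<phi> s) (ext.act (\<phi> c) (w j)) = ext.unit n"
      using clear_right_denominator[OF wc] .
    note sc = regular_closed[OF s(1)] phi_closed[OF regular_closed[OF s(1)]]
    have comp: "ext.act (\<phi> (c \<otimes>\<^bsub>A\<^esub> s)) (w i) = ext.act (\<phi> s) (ext.act (\<phi> c) (w i))" if "i \<in> insert j J" for i
      using W.act_mult[of "\<phi> s" "\<phi> c" "w i"] insert.prems[OF that] cc sc by (simp add: phi_mult)
    have "\<exists>n\<in>carrier N. ext.act (\<phi> (c \<otimes>\<^bsub>A\<^esub> s)) (w i) = ext.unit n" if i: "i \<in> insert j J" for i
    proof (cases "i = j")
      case True then show ?thesis using comp[OF i] s by auto
    next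
      case False
      then obtain n' where n': "n' \<in> carrier N" "ext.act (\<phi> c) (w i) = ext.unit n'" using c(2) i by auto
      then show ?thesis using comp[OF i] ext.act_unit[OF sc(1) n'(1)] N.act_closed[of s n'] sc by auto
    qed
    then show ?case using regular_mult[OF c(1) s(1)] by blast
  qed
  then show thesis using that by blast
qed

text \<open>A chain of length \<open>n\<close> in \<open>N \<otimes>\<^sub>A Q\<close> yields \<open>n\<close> independent copies of \<open>e Q\<close> in it. Since \<open>Q\<close> is a sum of \<open>r\<close>
  such copies, with \<open>p i\<close> as the projections, \<open>A\<^sup>n\<close> embeds into \<open>N\<^sup>r\<close>. Up to denominators, \<open>z i j\<close> is \<open>u\<^sub>j p\<^sub>i\<close>, and row
  \<open>i\<close> of the embedding determines the products of \<open>p\<^sub>i\<close> with the entries of a vector, for which \<open>b i\<close> stands.\<close>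

theorem embedding_elements:
  assumes chain: "has_chain ext.V (carrier Q) ext.act (carrier ext.V) n"
  obtains z b where "\<And>i j. i < r \<Longrightarrow> j < n \<Longrightarrow> z i j \<in> carrier N"
    and "\<And>i. i < r \<Longrightarrow> b i \<in> carrier A"
    and "\<And>i j a. i < r \<Longrightarrow> (\<And>j. j < n \<Longrightarrow> a j \<in> carrier A) \<Longrightarrow>
      finprod N (\<lambda>j. \<rho> (z i j) (a j)) {..<n} = \<one>\<^bsub>N\<^esub> \<Longrightarrow> j < n \<Longrightarrow> b i \<otimes>\<^bsub>A\<^esub> a j = \<zero>\<^bsub>A\<^esub>"
    and "\<And>a. a \<in> carrier A \<Longrightarrow> (\<And>i. i < r \<Longrightarrow> b i \<otimes>\<^bsub>A\<^esub> a = \<zero>\<^bsub>A\<^esub>) \<Longrightarrow> a = \<zero>\<^bsub>A\<^esub>"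
proof -
  interpret W: module_over_matrix_units "opposite_ring Q" ext.V ext.act e r p' p
    by (intro module_over_matrix_units.intro ext.module units.opposite_matrix_units)
  have "has_chain ext.V (carrier (opposite_ring Q)) ext.act (carrier ext.V) n" using chain by simp
  then obtain u where u: "W.corner_independent u n" using W.independent_of_chain by blast
  have uc: "u j \<in> carrier ext.V" if "j < n" for j using u that by (simp add: W.corner_independent_def)
  note pc = units.p_closed
  let ?w = "\<lambda>ij. ext.act (p (fst ij)) (u (snd ij))"
  have wc: "?w ij \<in> carrier ext.V" if "ij \<in> {..<r} \<times> {..<n}" for ij
    using that W.act_closed[of "p (fst ij)" "u (snd ij)"] pc[of "fst ij"] uc[of "snd ij"] by auto
  have "\<exists>c\<in>regular_elements A. \<forall>ij\<in>{..<r} \<times> {..<n}. \<exists>n\<in>carrier N. ext.act (\<phi> c) (?w ij) = ext.unit n"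
  proof (rule clear_right_denominators)
    show "finite ({..<r} \<times> {..<n})" by simp
    show "?w ij \<in> carrier ext.V" if "ij \<in> {..<r} \<times> {..<n}" for ij using wc that .
  qed blast
  then obtain c where c: "c \<in> regular_elements A"
    and cz: "\<And>ij. ij \<in> {..<r} \<times> {..<n} \<Longrightarrow> \<exists>n\<in>carrier N. ext.act (\<phi> c) (?w ij) = ext.unit n"
    by blast
  have "\<forall>i j. \<exists>x. i < r \<and> j < n \<longrightarrow> x \<in> carrier N \<and> ext.act (\<phi> c) (ext.act (p i) (u j)) = ext.unit x"
    using cz by force
  then obtain z where z: "\<And>i j. i < r \<Longrightarrow> j < n \<Longrightarrow> z i j \<in> carrier N"
    and z_unit: "\<And>i j. i < r \<Longrightarrow> j < n \<Longrightarrow> ext.act (\<phi> c) (ext.act (p i) (u j)) = ext.unit (z i j)" by metis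
  have cc: "\<phi> c \<in> carrier Q" using c regular_closed phi_closed by simp
  obtain d where d: "d \<in> regular_elements A" and dd: "\<And>i. i \<in> {..<r} \<Longrightarrow> \<phi> d \<otimes>\<^bsub>Q\<^esub> (p i \<otimes>\<^bsub>Q\<^esub> \<phi> c) \<in> \<phi> ` carrier A"
    using left_common_denominator[of "{..<r}" "\<lambda>i. p i \<otimes>\<^bsub>Q\<^esub> \<phi> c"] pc cc by auto
  have dc: "\<phi> d \<in> carrier Q" using d regular_closed phi_closed by simp
  have "\<forall>i. \<exists>x. i < r \<longrightarrow> x \<in> carrier A \<and> \<phi> x = \<phi> d \<otimes>\<^bsub>Q\<^esub> (p i \<otimes>\<^bsub>Q\<^esub> \<phi> c)" using dd by force
  then obtain b where b: "\<And>i. i < r \<Longrightarrow> b i \<in> carrier A"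
    and \<phi>b: "\<And>i. i < r \<Longrightarrow> \<phi> (b i) = \<phi> d \<otimes>\<^bsub>Q\<^esub> (p i \<otimes>\<^bsub>Q\<^esub> \<phi> c)" by metis
  have b_mult: "\<phi> (b i \<otimes>\<^bsub>A\<^esub> a) = \<phi> d \<otimes>\<^bsub>Q\<^esub> (p i \<otimes>\<^bsub>Q\<^esub> (\<phi> c \<otimes>\<^bsub>Q\<^esub> \<phi> a))" if "i < r" "a \<in> carrier A" for i a
    using that b[OF that(1)] pc[OF that(1)] cc dc phi_closed[OF that(2)] by (simp add: phi_mult \<phi>b Q.m_assoc)
  show thesis
  proof (rule that[OF z b])
    fix i j a
    assume i: "i < r" and a: "\<And>j. j < n \<Longrightarrow> a j \<in> carrier A"
      and prod: "finprod N (\<lambda>j. \<rho> (z i j) (a j)) {..<n} = \<one>\<^bsub>N\<^esub>" and j: "j < n"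
    define q where "q j = p i \<otimes>\<^bsub>Q\<^esub> (\<phi> c \<otimes>\<^bsub>Q\<^esub> \<phi> (a j))" for j
    have qc: "q j \<in> carrier Q" if "j < n" for j using pc[OF i] cc phi_closed[OF a[OF that]] by (simp add: q_def)
    have zc: "\<rho> (z i j) (a j) \<in> carrier N" if "j < n" for j using N.act_closed[of "a j" "z i j"] a[OF that] z[OF i that] by simp
    interpret h: group_hom N ext.V ext.unit
      by (intro group_hom.intro group_hom_axioms.intro N.V.is_group ext.pair.T.is_group ext.unit_hom)
    have "ext.act (q j) (u j) = ext.unit (\<rho> (z i j) (a j))" if j: "j < n" for j
    proof -
      have "ext.act (q j) (u j) = ext.act (\<phi> (a j)) (ext.act (\<phi> c) (ext.act (p i) (u j)))"
        using W.act_mult[of "\<phi> (a j)" "p i \<otimes>\<^bsub>Q\<^esub> \<phi> c" "u j"] W.act_mult[of "\<phi> c" "p i" "u j"]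
          pc[OF i] cc phi_closed[OF a[OF j]] uc[OF j] by (simp add: q_def Q.m_assoc)
      then show ?thesis using z_unit[OF i j] ext.act_unit[OF a[OF j] z[OF i j]] by simp
    qed
    then have "finprod ext.V (\<lambda>j. ext.act (q j) (u j)) {..<n} = finprod ext.V (\<lambda>j. ext.unit (\<rho> (z i j) (a j))) {..<n}"
      using zc unit_closed by (intro ext.pair.T.finprod_cong') auto
    also have "\<dots> = ext.unit (finprod N (\<lambda>j. \<rho> (z i j) (a j)) {..<n})"
      using zc by (intro h.hom_finprod_lessThan[symmetric] N.V.comm_group_axioms ext.pair.tensor_comm_group)
    also have "\<dots> = \<one>\<^bsub>ext.V\<^esub>" using prod h.hom_one by simp
    finally have "q j = \<zero>\<^bsub>opposite_ring Q\<^esub>"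
      using qc units.e_p[OF i] pc[OF i] units.e_closed cc phi_closed a j
      by (intro W.independent_coefficients_zero[OF u, of q]) (simp_all add: q_def Q.m_assoc[symmetric])
    then have "\<phi> (b i \<otimes>\<^bsub>A\<^esub> a j) = \<zero>\<^bsub>Q\<^esub>" using b_mult[OF i a[OF j]] dc by (simp add: q_def)
    then show "b i \<otimes>\<^bsub>A\<^esub> a j = \<zero>\<^bsub>A\<^esub>" using phi_eq_zero b[OF i] a[OF j] by simp
  next
    fix a assume a: "a \<in> carrier A" and 0: "\<And>i. i < r \<Longrightarrow> b i \<otimes>\<^bsub>A\<^esub> a = \<zero>\<^bsub>A\<^esub>"
    let ?y = "\<phi> c \<otimes>\<^bsub>Q\<^esub> \<phi> a"
    have yc: "?y \<in> carrier Q" using cc phi_closed[OF a] by simp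
    have py: "p i \<otimes>\<^bsub>Q\<^esub> ?y = \<zero>\<^bsub>Q\<^esub>" if i: "i < r" for i
      using regular_left_cancel[OF d, of "p i \<otimes>\<^bsub>Q\<^esub> ?y"] b_mult[OF i a] 0[OF i] phi_zero pc[OF i] yc by simp
    have "?y = (\<Oplus>\<^bsub>Q\<^esub>i\<in>{..<r}. p' i \<otimes>\<^bsub>Q\<^esub> p i) \<otimes>\<^bsub>Q\<^esub> ?y" using yc by (simp only: units.sum_p'_p Q.l_one)
    also have "\<dots> = (\<Oplus>\<^bsub>Q\<^esub>i\<in>{..<r}. (p' i \<otimes>\<^bsub>Q\<^esub> p i) \<otimes>\<^bsub>Q\<^esub> ?y)"
      using yc pc units.p'_closed by (intro Q.finsum_ldistr) auto
    also have "\<dots> = (\<Oplus>\<^bsub>Q\<^esub>i\<in>{..<r}. \<zero>\<^bsub>Q\<^esub>)"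
    proof (rule Q.finsum_cong'[OF refl])
      show "p' i \<otimes>\<^bsub>Q\<^esub> p i \<otimes>\<^bsub>Q\<^esub> ?y = \<zero>\<^bsub>Q\<^esub>" if "i \<in> {..<r}" for i
        using that py[of i] Q.m_assoc[OF units.p'_closed pc yc, of i i] units.p'_closed[of i] by simp
    qed simp
    finally have "?y = \<zero>\<^bsub>Q\<^esub>" by simp
    then have "\<phi> a = \<zero>\<^bsub>Q\<^esub>" by (rule regular_left_cancel[OF c phi_closed[OF a]])
    then show "a = \<zero>\<^bsub>A\<^esub>" by (rule phi_eq_zero[OF a])
  qed
qed

end

section \<open>Subquotients of a ring as modules over a quotient ring\<close>

context ideal
begin

lemma quot_carrier: "carrier (R Quot I) = (\<lambda>x. I +> x) ` carrier R"
  by (auto simp: FactRing_def A_RCOSETS_def' a_r_coset_def')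

lemma quot_simps:
  "x \<in> carrier R \<Longrightarrow> y \<in> carrier R \<Longrightarrow> (I +> x) \<otimes>\<^bsub>R Quot I\<^esub> (I +> y) = I +> (x \<otimes> y)"
  "x \<in> carrier R \<Longrightarrow> y \<in> carrier R \<Longrightarrow> (I +> x) \<oplus>\<^bsub>R Quot I\<^esub> (I +> y) = I +> (x \<oplus> y)"
  "\<zero>\<^bsub>R Quot I\<^esub> = I" "\<one>\<^bsub>R Quot I\<^esub> = I +> \<one>"
  by (simp_all add: FactRing_def rcoset_mult_add a_rcos_sum)

lemma quot_coset_zero_iff: "x \<in> carrier R \<Longrightarrow> I +> x = \<zero>\<^bsub>R Quot I\<^esub> \<longleftrightarrow> x \<in> I"
  using a_rcos_self a_rcos_const unfolding quot_simps(3) by metis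

end

locale ideal_subquotient = ring R + I: ideal I R + J1: ideal J\<^sub>1 R + J2: ideal J\<^sub>2 R
  for R :: "('a, 'n) ring_scheme" (structure) and I J\<^sub>1 J\<^sub>2 +
  assumes J1_J2: "J\<^sub>1 \<subseteq> J\<^sub>2"
    and I_J2: "r \<in> I \<Longrightarrow> x \<in> J\<^sub>2 \<Longrightarrow> r \<otimes> x \<in> J\<^sub>1"
    and J2_I: "x \<in> J\<^sub>2 \<Longrightarrow> r \<in> I \<Longrightarrow> x \<otimes> r \<in> J\<^sub>1"
begin

abbreviation "A \<equiv> R Quot I"
abbreviation "N \<equiv> subquotient R J\<^sub>2 J\<^sub>1"
abbreviation "lact \<equiv> \<lambda>a m. [mod J\<^sub>1:] a \<Otimes> m"
abbreviation "ract \<equiv> \<lambda>m a. [mod J\<^sub>1:] m \<Otimes> a"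

lemmas A_ring = I.quotient_is_ring and A_carrier = I.quot_carrier and A_simps = I.quot_simps
  and A_coset_zero_iff = I.quot_coset_zero_iff

lemma J2_closed: "x \<in> J\<^sub>2 \<Longrightarrow> x \<in> carrier R"
  by (rule J2.a_Hcarr)

lemma N_carrier: "carrier N = (\<lambda>x. J\<^sub>1 +> x) ` J\<^sub>2"
  by (auto simp: subquotient_def A_FactGroup_def FactGroup_def RCOSETS_def a_r_coset_def r_coset_def)

lemma N_mult: "x \<in> J\<^sub>2 \<Longrightarrow> y \<in> J\<^sub>2 \<Longrightarrow> (J\<^sub>1 +> x) \<otimes>\<^bsub>N\<^esub> (J\<^sub>1 +> y) = J\<^sub>1 +> (x \<oplus> y)"
proof -
  assume "x \<in> J\<^sub>2" "y \<in> J\<^sub>2"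
  then have "(J\<^sub>1 +> x) <+> (J\<^sub>1 +> y) = J\<^sub>1 +> (x \<oplus> y)" using J1.a_rcos_sum J2_closed by simp
  then show ?thesis by (simp add: subquotient_def A_FactGroup_def FactGroup_def set_add_def set_mult_def)
qed

lemma N_one: "\<one>\<^bsub>N\<^esub> = J\<^sub>1"
  by (simp add: subquotient_def A_FactGroup_def FactGroup_def)

lemma N_coset_one_iff: "x \<in> J\<^sub>2 \<Longrightarrow> J\<^sub>1 +> x = \<one>\<^bsub>N\<^esub> \<longleftrightarrow> x \<in> J\<^sub>1"
  using J1.a_rcos_self[OF J2_closed] J1.a_rcos_const unfolding N_one by metis

lemma N_comm_group: "comm_group N"
proof (rule comm_groupI)
  show "\<one>\<^bsub>N\<^esub> \<in> carrier N"
    using J1.a_rcos_const[OF J1.zero_closed] J2.zero_closed unfolding N_one N_carrier by blast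
  show "\<exists>y\<in>carrier N. y \<otimes>\<^bsub>N\<^esub> x = \<one>\<^bsub>N\<^esub>" if x: "x \<in> carrier N" for x
  proof -
    obtain y where y: "y \<in> J\<^sub>2" "x = J\<^sub>1 +> y" using x by (auto simp: N_carrier)
    then have "(J\<^sub>1 +> (\<ominus> y)) \<otimes>\<^bsub>N\<^esub> x = \<one>\<^bsub>N\<^esub>"
      using J1.a_rcos_const[OF J1.zero_closed] J2_closed by (simp add: N_mult l_neg N_one)
    then show ?thesis using y by (auto simp: N_carrier)
  qed
  show "\<one>\<^bsub>N\<^esub> \<otimes>\<^bsub>N\<^esub> x = x" if x: "x \<in> carrier N" for x
  proof -
    obtain y where y: "y \<in> J\<^sub>2" "x = J\<^sub>1 +> y" using x by (auto simp: N_carrier)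
    have "\<one>\<^bsub>N\<^esub> = J\<^sub>1 +> \<zero>" using J1.a_rcos_const[OF J1.zero_closed] by (simp add: N_one)
    then show ?thesis using y J2_closed by (simp add: N_mult)
  qed
qed (auto simp: N_carrier N_mult J2_closed a_ac)

lemma coset_product_eq:
  assumes x: "x \<in> carrier R" and y: "y \<in> carrier R"
    and eq: "\<And>u v. u \<in> U \<Longrightarrow> v \<in> V \<Longrightarrow> u \<otimes> v \<in> carrier R \<and> u \<otimes> v \<ominus> x \<otimes> y \<in> J\<^sub>1"
    and mem: "x \<in> U" "y \<in> V"
  shows "[mod J\<^sub>1:] U \<Otimes> V = J\<^sub>1 +> (x \<otimes> y)"
proof -
  have "J\<^sub>1 +> (u \<otimes> v) = J\<^sub>1 +> (x \<otimes> y)" if "u \<in> U" "v \<in> V" for u v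
  proof -
    have "u \<otimes> v \<in> J\<^sub>1 +> (x \<otimes> y)"
      using J1.a_rcos_module_minus[OF ring_axioms, of "x \<otimes> y" "u \<otimes> v"] eq[OF that] x y by simp
    then show ?thesis using J1.a_repr_independence'[of "u \<otimes> v" "x \<otimes> y"] x y by simp
  qed
  then show ?thesis unfolding rcoset_mult_def using mem by (intro subset_antisym) blast+
qed

text \<open>For \<open>u = i + r\<close> and \<open>v = j + x\<close> the difference of \<open>u v\<close> and \<open>r x\<close> is \<open>u j + i x\<close>, which lies in \<open>J\<^sub>1\<close> because of
  \<open>I J\<^sub>2 \<subseteq> J\<^sub>1\<close>.\<close>

lemma lact_coset:
  assumes r: "r \<in> carrier R" and x: "x \<in> J\<^sub>2"
  shows "lact (I +> r) (J\<^sub>1 +> x) = J\<^sub>1 +> (r \<otimes> x)"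
proof (rule coset_product_eq)
  note xc = J2_closed[OF x]
  fix u v assume "u \<in> I +> r" "v \<in> J\<^sub>1 +> x"
  then obtain i j where i: "i \<in> I" "u = i \<oplus> r" and j: "j \<in> J\<^sub>1" "v = j \<oplus> x" by (auto simp: a_r_coset_def')
  have c: "i \<in> carrier R" "j \<in> carrier R" using i j I.a_Hcarr J1.a_Hcarr by auto
  have "u \<otimes> v \<ominus> r \<otimes> x = u \<otimes> j \<oplus> i \<otimes> x"
    using i j c r xc by (simp add: minus_eq l_distr r_distr a_ac r_neg1 r_neg2) (simp add: r_neg)
  moreover have "u \<otimes> j \<in> J\<^sub>1" using J1.I_l_closed[OF j(1)] i c r by simp
  ultimately show "u \<otimes> v \<in> carrier R \<and> u \<otimes> v \<ominus> r \<otimes> x \<in> J\<^sub>1"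
    using I_J2[OF i(1) x] i j c r xc by simp
qed (use r x J2_closed I.a_rcos_self J1.a_rcos_self in auto)

lemma ract_coset:
  assumes r: "r \<in> carrier R" and x: "x \<in> J\<^sub>2"
  shows "ract (J\<^sub>1 +> x) (I +> r) = J\<^sub>1 +> (x \<otimes> r)"
proof (rule coset_product_eq)
  note xc = J2_closed[OF x]
  fix v u assume "u \<in> I +> r" "v \<in> J\<^sub>1 +> x"
  then obtain i j where i: "i \<in> I" "u = i \<oplus> r" and j: "j \<in> J\<^sub>1" "v = j \<oplus> x" by (auto simp: a_r_coset_def')
  have c: "i \<in> carrier R" "j \<in> carrier R" using i j I.a_Hcarr J1.a_Hcarr by auto
  have "v \<otimes> u \<ominus> x \<otimes> r = j \<otimes> u \<oplus> x \<otimes> i"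
    using i j c r xc by (simp add: minus_eq l_distr r_distr a_ac r_neg1 r_neg2) (simp add: r_neg)
  moreover have "j \<otimes> u \<in> J\<^sub>1" using J1.I_r_closed[OF j(1)] i c r by simp
  ultimately show "v \<otimes> u \<in> carrier R \<and> v \<otimes> u \<ominus> x \<otimes> r \<in> J\<^sub>1"
    using J2_I[OF x i(1)] i j c r xc by simp
qed (use r x J2_closed I.a_rcos_self J1.a_rcos_self in auto)

lemma left_module_N: "left_module A N lact"
proof (intro left_module.intro left_module_axioms.intro A_ring N_comm_group)
  show "lact q \<in> hom N N" if q: "q \<in> carrier A" for q
  proof -
    obtain r where "r \<in> carrier R" "q = I +> r" using q by (auto simp: A_carrier)
    then show ?thesis
      by (auto simp: hom_def N_carrier lact_coset N_mult J2_closed r_distr J2.I_l_closed)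
  qed
qed (auto simp: A_carrier N_carrier A_simps lact_coset N_mult J2_closed m_assoc l_distr J2.I_l_closed)

lemma right_module_N: "left_module (opposite_ring A) N (\<lambda>a m. ract m a)"
proof (intro left_module.intro left_module_axioms.intro ring.ring_opposite A_ring N_comm_group)
  show "(\<lambda>m. ract m q) \<in> hom N N" if q: "q \<in> carrier (opposite_ring A)" for q
  proof -
    obtain r where "r \<in> carrier R" "q = I +> r" using q by (auto simp: A_carrier)
    then show ?thesis
      by (auto simp: hom_def N_carrier ract_coset N_mult J2_closed l_distr J2.I_r_closed)
  qed
qed (auto simp: A_carrier N_carrier A_simps ract_coset N_mult J2_closed m_assoc r_distr J2.I_r_closed)

end

section \<open>Induced filtrations and their growth\<close>

locale filtered_algebra = assoc_algebra K R
  for K :: "('k, 'm) ring_scheme" and R :: "('k, 'a, 'n) module_scheme" +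
  fixes \<Gamma> :: "nat \<Rightarrow> 'a set"
  assumes filtration: "N_filtration K R \<Gamma>"
begin

lemma filtration_submodule: "submodule (\<Gamma> n) K R"
  using filtration by (simp add: N_filtration_def)

sublocale filt: filtered_ring R \<Gamma>
proof (intro filtered_ring.intro filtered_ring_axioms.intro algebra_ring.ring_axioms)
  show "additive_subgroup (\<Gamma> n) R" for n
    using filtration_submodule[of n] by (auto simp: submodule_def intro: additive_subgroupI)
  show "\<Gamma> n \<subseteq> \<Gamma> (Suc n)" for n using filtration by (simp add: N_filtration_def)
  show "\<one>\<^bsub>R\<^esub> \<in> \<Gamma> 0" using filtration by (simp add: N_filtration_def)
  show "(\<Union>n. \<Gamma> n) = carrier R" using filtration by (simp add: N_filtration_def)
  show "x \<otimes>\<^bsub>R\<^esub> y \<in> \<Gamma> (i + j)" if "x \<in> \<Gamma> i" "y \<in> \<Gamma> j" for x y i j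
    using filtration that by (simp add: N_filtration_def)
qed

abbreviation scale :: "'k \<Rightarrow> 'a \<Rightarrow> 'a" where "scale \<equiv> \<lambda>k x. k \<odot>\<^bsub>R\<^esub> x"

sublocale RR: operator_group "add_monoid R" "carrier K" scale
  by (intro operator_group.intro operator_group_axioms.intro M.a_comm_group)
    (auto simp: hom_def smult_r_distr smult_closed)

lemma submodule_iff_stable: "submodule W K R \<longleftrightarrow> RR.stable W"
  by (auto simp: submodule_def submodule_axioms_def stable_subgroup_def)

lemma line_stable: "b \<in> carrier R \<Longrightarrow> RR.stable ((\<lambda>k. scale k b) ` carrier K)"
proof (rule RR.stableI)
  assume b: "b \<in> carrier R"
  show "(\<lambda>k. scale k b) ` carrier K \<subseteq> carrier (add_monoid R)" using b smult_closed by auto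
  show "\<one>\<^bsub>add_monoid R\<^esub> \<in> (\<lambda>k. scale k b) ` carrier K"
    using smult_l_null[OF b] by (auto intro!: image_eqI[of _ _ "\<zero>\<^bsub>K\<^esub>"])
  show "x \<otimes>\<^bsub>add_monoid R\<^esub> y \<in> (\<lambda>k. scale k b) ` carrier K"
    if "x \<in> (\<lambda>k. scale k b) ` carrier K" "y \<in> (\<lambda>k. scale k b) ` carrier K" for x y
    using that b by (auto simp: smult_l_distr[symmetric])
  show "scale c x \<in> (\<lambda>k. scale k b) ` carrier K" if "c \<in> carrier K" "x \<in> (\<lambda>k. scale k b) ` carrier K" for c x
    using that b by (auto simp: smult_assoc1[symmetric])
  show "inv\<^bsub>add_monoid R\<^esub> x \<in> (\<lambda>k. scale k b) ` carrier K" if "x \<in> (\<lambda>k. scale k b) ` carrier K" for x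
    using that b by (auto simp: a_inv_def[symmetric] smult_l_minus[symmetric])
qed

lemma line_length:
  assumes b: "b \<in> carrier R" shows "RR.len ((\<lambda>k. scale k b) ` carrier K) \<le> 1"
proof (rule enat_le_by_nat)
  let ?L = "(\<lambda>k. scale k b) ` carrier K"
  have eq: "U = {\<zero>\<^bsub>R\<^esub>}" if U: "RR.stable U" "U \<subset> ?L" for U
  proof (rule ccontr)
    assume "U \<noteq> {\<zero>\<^bsub>R\<^esub>}"
    moreover have "\<zero>\<^bsub>R\<^esub> \<in> U" using RR.stable_one[OF U(1)] by simp
    ultimately obtain x where x: "x \<in> U" "x \<noteq> \<zero>\<^bsub>R\<^esub>" by blast
    then obtain k where k: "k \<in> carrier K" "x = scale k b" using U(2) by blast
    have "k \<noteq> \<zero>\<^bsub>K\<^esub>" using x k smult_l_null[OF b] by auto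
    then have ku: "k \<in> Units K" using k(1) field_Units by simp
    have "scale (inv\<^bsub>K\<^esub> k) x = b"
      unfolding k(2) using ku b R.Units_inv_closed R.Units_closed R.Units_l_inv
      by (simp add: smult_assoc1[symmetric] smult_one)
    then have "b \<in> U" using RR.stable_op[OF U(1) R.Units_inv_closed[OF ku] x(1)] by simp
    then have "?L \<subseteq> U" using RR.stable_op[OF U(1)] by blast
    then show False using U(2) by blast
  qed
  fix n assume "enat n \<le> RR.len ?L"
  then have chain: "has_chain (add_monoid R) (carrier K) scale ?L n"
    using le_stable_length_iff[OF line_stable[OF b]] by simp
  have "\<not> Suc (Suc 0) \<le> n"
  proof
    assume "Suc (Suc 0) \<le> n"
    then have "has_chain (add_monoid R) (carrier K) scale ?L (Suc (Suc 0))" using has_chain_downward[OF chain] by simp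
    then obtain U where U: "has_chain (add_monoid R) (carrier K) scale U (Suc 0)" "U \<subset> ?L"
      by (cases rule: has_chain.cases) auto
    then obtain U' where U': "has_chain (add_monoid R) (carrier K) scale U' 0" "U' \<subset> U"
      by (cases rule: has_chain.cases) auto
    show False using eq[OF has_chain_stable[OF U(1)] U(2)] U'(2) RR.stable_one[OF has_chain_stable[OF U'(1)]] by auto
  qed
  then show "enat n \<le> 1" by (simp add: one_enat_def)
qed

lemma enat_finite_le: "x \<le> y \<Longrightarrow> y \<noteq> \<infinity> \<Longrightarrow> x \<noteq> (\<infinity>::enat)"
  by (metis infinity_ileE not_infinity_eq)

text \<open>Each member of a finite spanning set contributes a line, of length at most one.\<close>

lemma finite_dim_length:
  assumes "finite_dim_subspace K R V" shows "RR.len V \<noteq> \<infinity>"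
proof -
  obtain B where B: "finite B" "B \<subseteq> V" "\<And>W. submodule W K R \<Longrightarrow> B \<subseteq> W \<Longrightarrow> V \<subseteq> W" and V: "submodule V K R"
    using assms by (auto simp: finite_dim_subspace_def)
  have Vs: "RR.stable V" using V submodule_iff_stable by simp
  have "\<exists>W. RR.stable W \<and> B \<subseteq> W \<and> RR.len W \<noteq> \<infinity>"
    using B(1,2)
  proof (induction B rule: finite_induct)
    case empty
    then show ?case using RR.stable_trivial RR.len_trivial by (intro exI[of _ "{\<one>\<^bsub>add_monoid R\<^esub>}"]) simp
  next
    case (insert b B)
    then obtain W where W: "RR.stable W" "B \<subseteq> W" "RR.len W \<noteq> \<infinity>" by auto
    have b: "b \<in> carrier R" using insert.prems RR.stable_subset[OF Vs] by auto
    let ?L = "(\<lambda>k. scale k b) ` carrier K"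
    note L = line_stable[OF b]
    have "b = scale \<one>\<^bsub>K\<^esub> b" using b by (simp add: smult_one)
    then have "b \<in> ?L" by blast
    then have "insert b B \<subseteq> set_mult (add_monoid R) W ?L"
      using RR.subset_set_mult1[OF W(1) L] RR.subset_set_mult2[OF W(1) L] W(2) by blast
    moreover have "RR.len (set_mult (add_monoid R) W ?L) \<le> RR.len W + RR.len ?L"
      by (rule RR.len_set_mult_le[OF W(1) L])
    then have "RR.len (set_mult (add_monoid R) W ?L) \<noteq> \<infinity>"
    proof (rule enat_finite_le)
      have "RR.len ?L \<noteq> \<infinity>" by (rule enat_finite_le[OF line_length[OF b]]) (simp add: one_enat_def)
      then show "RR.len W + RR.len ?L \<noteq> \<infinity>" using W(3) by (simp add: plus_eq_infty_iff_enat)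
    qed
    ultimately show ?case using RR.stable_set_mult[OF W(1) L] by blast
  qed
  then obtain W where W: "RR.stable W" "B \<subseteq> W" "RR.len W \<noteq> \<infinity>" by blast
  have "V \<subseteq> W" using B(3) W submodule_iff_stable by simp
  then have "RR.len V \<le> RR.len W" by (rule stable_length_mono[OF Vs W(1)])
  then show ?thesis using W(3) by (rule enat_finite_le)
qed

end

locale filtered_quotient = filtered_algebra K R \<Gamma> + I: ideal I R
  for K :: "('k, 'm) ring_scheme" and R :: "('k, 'a, 'n) module_scheme" and \<Gamma> and I
begin

abbreviation "B \<equiv> R Quot I"

definition \<pi> :: "'a \<Rightarrow> 'a set" where "\<pi> x = I +>\<^bsub>R\<^esub> x"

text \<open>The scalars, seen as central elements of the quotient ring; the subspaces of a module over it are the subgroups stable under them.\<close>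

definition \<kappa> :: "'k \<Rightarrow> 'a set" where "\<kappa> k = \<pi> (scale k \<one>\<^bsub>R\<^esub>)"

definition level :: "nat \<Rightarrow> 'a set set" where "level n = \<pi> ` \<Gamma> n"

sublocale B: ring B
  by (rule I.quotient_is_ring)

lemma B_carrier: "carrier B = \<pi> ` carrier R"
  using I.quot_carrier by (simp add: \<pi>_def)

lemma \<pi>_closed: "x \<in> carrier R \<Longrightarrow> \<pi> x \<in> carrier B"
  by (simp add: B_carrier)

lemma \<pi>_mult: "x \<in> carrier R \<Longrightarrow> y \<in> carrier R \<Longrightarrow> \<pi> (x \<otimes>\<^bsub>R\<^esub> y) = \<pi> x \<otimes>\<^bsub>B\<^esub> \<pi> y"
  by (simp add: \<pi>_def I.quot_simps)

lemma \<pi>_add: "x \<in> carrier R \<Longrightarrow> y \<in> carrier R \<Longrightarrow> \<pi> (x \<oplus>\<^bsub>R\<^esub> y) = \<pi> x \<oplus>\<^bsub>B\<^esub> \<pi> y"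
  by (simp add: \<pi>_def I.quot_simps)

lemma \<pi>_one: "\<pi> \<one>\<^bsub>R\<^esub> = \<one>\<^bsub>B\<^esub>"
  by (simp add: \<pi>_def I.quot_simps)

lemma \<pi>_zero: "\<pi> \<zero>\<^bsub>R\<^esub> = \<zero>\<^bsub>B\<^esub>"
  using I.quot_coset_zero_iff[of "\<zero>\<^bsub>R\<^esub>"] by (simp add: \<pi>_def)

lemma scalar_closed: "k \<in> carrier K \<Longrightarrow> scale k \<one>\<^bsub>R\<^esub> \<in> carrier R"
  by (simp add: smult_closed)

lemma scalar_mult: "k \<in> carrier K \<Longrightarrow> x \<in> carrier R \<Longrightarrow> scale k \<one>\<^bsub>R\<^esub> \<otimes>\<^bsub>R\<^esub> x = scale k x"
  by (simp add: smult_mult_left)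

lemma mult_scalar: "k \<in> carrier K \<Longrightarrow> x \<in> carrier R \<Longrightarrow> x \<otimes>\<^bsub>R\<^esub> scale k \<one>\<^bsub>R\<^esub> = scale k x"
  by (simp add: smult_mult_right)

lemma \<kappa>_closed: "k \<in> carrier K \<Longrightarrow> \<kappa> k \<in> carrier B"
  by (simp add: \<kappa>_def \<pi>_closed scalar_closed)

lemma \<kappa>_\<pi>: "k \<in> carrier K \<Longrightarrow> x \<in> carrier R \<Longrightarrow> \<kappa> k \<otimes>\<^bsub>B\<^esub> \<pi> x = \<pi> (scale k x)"
  by (simp add: \<kappa>_def \<pi>_mult[symmetric] scalar_closed scalar_mult)

lemma \<kappa>_central: "k \<in> carrier K \<Longrightarrow> b \<in> carrier B \<Longrightarrow> b \<otimes>\<^bsub>B\<^esub> \<kappa> k = \<kappa> k \<otimes>\<^bsub>B\<^esub> b"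
proof -
  assume k: "k \<in> carrier K" and "b \<in> carrier B"
  then obtain x where x: "x \<in> carrier R" "b = \<pi> x" unfolding B_carrier by blast
  have "b \<otimes>\<^bsub>B\<^esub> \<kappa> k = \<pi> (x \<otimes>\<^bsub>R\<^esub> scale k \<one>\<^bsub>R\<^esub>)"
    unfolding x(2) \<kappa>_def by (rule \<pi>_mult[OF x(1) scalar_closed[OF k], symmetric])
  then show ?thesis unfolding x(2) \<kappa>_\<pi>[OF k x(1)] mult_scalar[OF k x(1)] .
qed

sublocale BB: operator_group "add_monoid B" "carrier K" "\<lambda>k b. \<kappa> k \<otimes>\<^bsub>B\<^esub> b"
  by (intro operator_group.intro operator_group_axioms.intro B.a_comm_group)
    (auto simp: hom_def B.r_distr \<kappa>_closed)

lemma \<pi>_linear: "RR.stable V \<Longrightarrow> linear_on (add_monoid R) (carrier K) scale (add_monoid B) (\<lambda>k b. \<kappa> k \<otimes>\<^bsub>B\<^esub> b) V \<pi>"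
  by (intro linear_on.intro linear_on_axioms.intro RR.operator_group_axioms BB.operator_group_axioms)
    (use RR.stable_subset[of V] in \<open>auto simp: \<pi>_closed \<pi>_add \<kappa>_\<pi>\<close>)

lemma left_mult_linear:
  assumes "b \<in> carrier B" "BB.stable V"
  shows "linear_on (add_monoid B) (carrier K) (\<lambda>k b. \<kappa> k \<otimes>\<^bsub>B\<^esub> b) (add_monoid B) (\<lambda>k b. \<kappa> k \<otimes>\<^bsub>B\<^esub> b) V (\<lambda>y. b \<otimes>\<^bsub>B\<^esub> y)"
proof (intro linear_on.intro linear_on_axioms.intro BB.operator_group_axioms assms(2))
  have c: "x \<in> carrier B" if "x \<in> V" for x using BB.stable_subset[OF assms(2) that] by simp
  show "b \<otimes>\<^bsub>B\<^esub> x \<in> carrier (add_monoid B)" if "x \<in> V" for x using c[OF that] assms(1) by simp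
  show "b \<otimes>\<^bsub>B\<^esub> (x \<otimes>\<^bsub>add_monoid B\<^esub> y) = (b \<otimes>\<^bsub>B\<^esub> x) \<otimes>\<^bsub>add_monoid B\<^esub> (b \<otimes>\<^bsub>B\<^esub> y)" if "x \<in> V" "y \<in> V" for x y
    using c[OF that(1)] c[OF that(2)] assms(1) by (simp add: B.r_distr)
  show "b \<otimes>\<^bsub>B\<^esub> (\<kappa> k \<otimes>\<^bsub>B\<^esub> x) = \<kappa> k \<otimes>\<^bsub>B\<^esub> (b \<otimes>\<^bsub>B\<^esub> x)" if "k \<in> carrier K" "x \<in> V" for k x
    using B.m_assoc[OF assms(1) \<kappa>_closed[OF that(1)] c[OF that(2)]]
      B.m_assoc[OF \<kappa>_closed[OF that(1)] assms(1) c[OF that(2)]] \<kappa>_central[OF that(1) assms(1)] by simp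
qed

lemma right_mult_linear:
  assumes "b \<in> carrier B" "BB.stable V"
  shows "linear_on (add_monoid B) (carrier K) (\<lambda>k b. \<kappa> k \<otimes>\<^bsub>B\<^esub> b) (add_monoid B) (\<lambda>k b. \<kappa> k \<otimes>\<^bsub>B\<^esub> b) V (\<lambda>y. y \<otimes>\<^bsub>B\<^esub> b)"
  by (intro linear_on.intro linear_on_axioms.intro BB.operator_group_axioms assms(2))
    (use BB.stable_subset[OF assms(2)] assms(1) in \<open>auto simp: B.l_distr B.m_assoc \<kappa>_closed\<close>)

lemma filtration_stable: "RR.stable (\<Gamma> n)"
  using filtration_submodule submodule_iff_stable by simp

lemma level_stable: "BB.stable (level n)"
  unfolding level_def using linear_on.stable_image[OF \<pi>_linear[OF filtration_stable] filtration_stable order.refl] .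

lemma level_closed: "b \<in> level n \<Longrightarrow> b \<in> carrier B"
  using BB.stable_subset[OF level_stable] by simp

lemma level_mono: "m \<le> n \<Longrightarrow> level m \<subseteq> level n"
  unfolding level_def using filt.filtration_mono by (rule image_mono)

lemma level_mult: "b \<in> level i \<Longrightarrow> c \<in> level j \<Longrightarrow> b \<otimes>\<^bsub>B\<^esub> c \<in> level (i + j)"
  unfolding level_def using filt.filtration_mult filt.filtration_carrier by (force simp: \<pi>_mult[symmetric])

lemma level_Union: "b \<in> carrier B \<Longrightarrow> \<exists>n. b \<in> level n"
proof -
  assume "b \<in> carrier B"
  then obtain x where x: "x \<in> carrier R" "b = \<pi> x" unfolding B_carrier by blast
  then obtain n where "x \<in> \<Gamma> n" unfolding filt.filtration_Union[symmetric] by blast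
  then show ?thesis using x unfolding level_def by blast
qed

lemma level_bound:
  assumes "finite J" "\<And>j. j \<in> J \<Longrightarrow> b j \<in> carrier B"
  obtains n where "\<And>j. j \<in> J \<Longrightarrow> b j \<in> level n"
proof -
  have "\<exists>n. \<forall>j\<in>J. b j \<in> level n" using assms
  proof (induction J rule: finite_induct)
    case (insert j J)
    then obtain n where n: "\<forall>j\<in>J. b j \<in> level n" by auto
    obtain m where m: "b j \<in> level m" using level_Union insert.prems by blast
    have "\<forall>i\<in>insert j J. b i \<in> level (max m n)"
      using n m level_mono[of n "max m n"] level_mono[of m "max m n"] by auto
    then show ?case by blast
  qed simp
  then show thesis using that by blast
qed

lemma level_length_le: "BB.len (level n) \<le> RR.len (\<Gamma> n)"
  unfolding level_def by (rule linear_on.length_image_le[OF \<pi>_linear[OF filtration_stable]])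

lemma shifted_stable: "RR.stable (filt.shifted n d)"
  using filtration_stable RR.stable_trivial by (simp add: filt.shifted_def)

text \<open>The argument of Stephenson and Zhang. If the inequality failed for all \<open>n\<close>, the dimensions would grow exponentially, and in the
  sparse degrees \<open>D k\<close> of \<open>sparse_degrees_of_exponential_growth\<close> there would always be room for an element of \<open>\<Gamma> (D k)\<close> that is not
  reached by those chosen before, since what they reach has too small an image in \<open>R/I\<close>. This contradicts
  \<open>left_noetherian_gr_reach\<close>.\<close>

theorem subexponential_growth:
  assumes noeth: "left_noetherian (gr_ring R \<Gamma>)" and fin: "\<And>n. finite_dim_subspace K R (\<Gamma> n)"
    and proper: "\<one>\<^bsub>R\<^esub> \<notin> I"
  shows "\<exists>n. of_nat C * BB.len (level (n + d)) < of_nat (C + 1) * BB.len (level n)"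
proof (rule ccontr)
  assume no: "\<not> ?thesis"
  have finite_len: "BB.len (level n) \<noteq> \<infinity>" for n
    by (rule enat_finite_le[OF level_length_le finite_dim_length[OF fin]])
  define a where "a n = the_enat (BB.len (level n))" for n
  have a: "BB.len (level n) = enat (a n)" for n using finite_len[of n] by (auto simp: a_def)
  have growth: "(C + 1) * a n \<le> C * a (n + d)" for n
  proof -
    have "of_nat (C + 1) * BB.len (level n) \<le> of_nat C * BB.len (level (n + d))" using no by (auto simp: not_less)
    then show ?thesis by (simp only: a of_nat_eq_enat times_enat_simps enat_ord_simps)
  qed
  have "0 < a 0"
  proof -
    have "\<one>\<^bsub>B\<^esub> \<in> level 0" unfolding level_def \<pi>_one[symmetric] using filt.filtration_one by (rule imageI)
    moreover have "\<one>\<^bsub>B\<^esub> \<noteq> \<zero>\<^bsub>B\<^esub>"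
      using I.quot_coset_zero_iff[of "\<one>\<^bsub>R\<^esub>"] proper \<pi>_one by (simp add: \<pi>_def)
    ultimately have "{\<one>\<^bsub>add_monoid B\<^esub>} \<subset> level 0" using BB.stable_one[OF level_stable, of 0] by auto
    then have "has_chain (add_monoid B) (carrier K) (\<lambda>k b. \<kappa> k \<otimes>\<^bsub>B\<^esub> b) (level 0) (Suc 0)"
      by (intro has_chain.Suc[OF has_chain.zero[OF BB.stable_trivial] level_stable])
    then have "enat (Suc 0) \<le> enat (a 0)" using le_stable_length_iff[OF level_stable, of "Suc 0" 0] a by simp
    then show ?thesis by simp
  qed
  then obtain D :: "nat \<Rightarrow> nat" where D: "\<And>k. 0 < D k"
    "\<And>k. a (D k - 1) + (\<Sum>j \<in> {j. j < k \<and> D j \<le> D k}. a (D k - D j)) < a (D k)"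
    using sparse_degrees_of_exponential_growth[of a C d] growth by blast
  have new: "\<exists>y. y \<in> \<Gamma> (D k) \<and> y \<notin> filt.reach f D k (D k)" if f: "\<And>j. j < k \<Longrightarrow> f j \<in> \<Gamma> (D j)" for k f
  proof (rule ccontr)
    assume "\<not> ?thesis"
    then have all: "y \<in> filt.reach f D k (D k)" if "y \<in> \<Gamma> (D k)" for y using that by blast
    have fc: "f j \<in> carrier R" if "j < k" for j using filt.filtration_carrier[OF f[OF that]] .
    define U where "U j = (\<lambda>y. y \<otimes>\<^bsub>B\<^esub> \<pi> (f j)) ` \<pi> ` filt.shifted (D k) (D j)" for j
    have sh: "BB.stable (\<pi> ` filt.shifted (D k) e)" for e
      using linear_on.stable_image[OF \<pi>_linear[OF shifted_stable] shifted_stable order.refl] .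
    have Us: "BB.stable (U j)" if "j < k" for j
      unfolding U_def using linear_on.stable_image[OF right_mult_linear[OF \<pi>_closed[OF fc[OF that]] sh] sh order.refl] .
    have Ul: "BB.len (U j) \<le> (if D j \<le> D k then enat (a (D k - D j)) else 0)" if j: "j < k" for j
    proof -
      have "BB.len (U j) \<le> BB.len (\<pi> ` filt.shifted (D k) (D j))"
        unfolding U_def by (rule linear_on.length_image_le[OF right_mult_linear[OF \<pi>_closed[OF fc[OF j]] sh]])
      also have "\<dots> = (if D j \<le> D k then enat (a (D k - D j)) else 0)"
      proof (cases "D j \<le> D k")
        case True
        then have "\<pi> ` filt.shifted (D k) (D j) = level (D k - D j)" by (simp add: filt.shifted_def level_def)
        then show ?thesis using a[of "D k - D j"] True by (simp only: if_True)
      next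
        case False
        then have "\<pi> ` filt.shifted (D k) (D j) = {\<one>\<^bsub>add_monoid B\<^esub>}" by (simp add: filt.shifted_def \<pi>_zero)
        then show ?thesis using BB.len_trivial False by (simp only: if_False)
      qed
      finally show ?thesis .
    qed
    have "level (D k) \<subseteq> set_mult (add_monoid B) (level (D k - 1)) (BB.family_product U k)"
    proof
      fix b assume "b \<in> level (D k)"
      then obtain y where y: "y \<in> \<Gamma> (D k)" "b = \<pi> y" by (auto simp: level_def)
      obtain u c where uc: "u \<in> filt.pred (D k)" "c \<in> filt.combinations f D k (D k)" "y = u \<oplus>\<^bsub>R\<^esub> c"
        using all[OF y(1)] unfolding filt.mem_reach by blast
      obtain g where g: "\<forall>j<k. g j \<in> filt.shifted (D k) (D j)" "c = (\<Oplus>\<^bsub>R\<^esub>j\<in>{..<k}. g j \<otimes>\<^bsub>R\<^esub> f j)"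
        using uc(2) by (auto simp: filt.combinations_def)
      have gc: "g j \<in> carrier R" if "j < k" for j using g(1) filt.shifted_carrier that by blast
      interpret h: group_hom "add_monoid R" "add_monoid B" \<pi>
        by (intro group_hom.intro group_hom_axioms.intro M.a_group B.a_group) (auto simp: hom_def \<pi>_closed \<pi>_add)
      have "\<pi> c = finprod (add_monoid B) (\<lambda>j. \<pi> (g j \<otimes>\<^bsub>R\<^esub> f j)) {..<k}"
        unfolding g(2) finsum_def using gc fc by (intro h.hom_finprod_lessThan M.a_comm_group B.a_comm_group) simp
      then have "\<pi> c \<in> BB.family_product U k"
        using g(1) gc fc unfolding BB.family_product_def
        by (intro CollectI exI[of _ "\<lambda>j. \<pi> (g j \<otimes>\<^bsub>R\<^esub> f j)"]) (auto simp: U_def \<pi>_mult)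
      moreover have "\<pi> u \<in> level (D k - 1)"
        using uc(1) D(1)[of k] by (cases "D k") (auto simp: filtration_pred_def level_def)
      moreover have "b = \<pi> u \<otimes>\<^bsub>add_monoid B\<^esub> \<pi> c"
      proof -
        have "c \<in> carrier R" unfolding g(2) using gc fc by (intro M.finsum_closed) auto
        then show ?thesis using y(2) uc(3) filt.pred_carrier[OF uc(1)] by (simp add: \<pi>_add)
      qed
      ultimately show "b \<in> set_mult (add_monoid B) (level (D k - 1)) (BB.family_product U k)"
        using BB.set_multI by simp
    qed
    then have "BB.len (level (D k)) \<le> BB.len (set_mult (add_monoid B) (level (D k - 1)) (BB.family_product U k))"
      using Us by (intro stable_length_mono BB.stable_set_mult BB.stable_family_product level_stable)
    also have "\<dots> \<le> BB.len (level (D k - 1)) + BB.len (BB.family_product U k)"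
      using Us by (intro BB.len_set_mult_le BB.stable_family_product level_stable)
    also have "\<dots> \<le> BB.len (level (D k - 1)) + (\<Sum>j<k. BB.len (U j))"
      using Us by (intro add_left_mono BB.len_family_product_le)
    also have "\<dots> \<le> enat (a (D k - 1)) + (\<Sum>j<k. if D j \<le> D k then enat (a (D k - D j)) else 0)"
      unfolding a using Ul by (intro add_mono sum_mono order.refl) simp
    also have "(\<Sum>j<k. if D j \<le> D k then enat (a (D k - D j)) else 0)
        = enat (\<Sum>j \<in> {j. j < k \<and> D j \<le> D k}. a (D k - D j))"
    proof -
      have "(\<Sum>j<k. if D j \<le> D k then enat (a (D k - D j)) else 0) = of_nat (\<Sum>j<k. if D j \<le> D k then a (D k - D j) else 0)"
        unfolding of_nat_sum by (intro sum.cong) (auto simp: of_nat_eq_enat zero_enat_def)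
      also have "(\<Sum>j<k. if D j \<le> D k then a (D k - D j) else 0) = (\<Sum>j \<in> {j. j < k \<and> D j \<le> D k}. a (D k - D j))"
        by (simp add: sum.If_cases) (intro sum.cong; auto)
      finally show ?thesis by (simp only: of_nat_eq_enat)
    qed
    finally show False using D(2)[of k] unfolding a by simp
  qed
  \<comment> \<open>The membership premise makes the predicate depend only on the first \<open>k\<close> values of \<open>f\<close>.\<close>
  define P where "P f k y \<longleftrightarrow> y \<in> \<Gamma> (D k) \<and> ((\<forall>j<k. f j \<in> \<Gamma> (D j)) \<longrightarrow> y \<notin> filt.reach f D k (D k))" for f k y
  have "\<exists>f. \<forall>k. P f k (f k)"
  proof (rule dependent_wellorder_choice)
    fix r f g k assume eq: "\<And>j. j < (k::nat) \<Longrightarrow> f j = (g j :: 'a)"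
    show "P f k r = P g k r"
    proof (cases "\<forall>j<k. f j \<in> \<Gamma> (D j)")
      case True
      then have "filt.combinations f D k (D k) = filt.combinations g D k (D k)"
        using eq filt.filtration_carrier by (intro filt.combinations_cong) auto
      then show ?thesis using eq unfolding P_def filt.reach_def by auto
    qed (use eq in \<open>auto simp: P_def\<close>)
  next
    fix k f assume "\<And>j. j < (k::nat) \<Longrightarrow> P f j (f j)"
    then have "f j \<in> \<Gamma> (D j)" if "j < k" for j using that by (simp add: P_def)
    from new[OF this] show "\<exists>r. P f k r" by (auto simp: P_def)
  qed
  then obtain f where f: "\<And>k. P f k (f k)" by blast
  then have mem: "f k \<in> \<Gamma> (D k)" for k by (simp add: P_def)
  then have out: "f k \<notin> filt.reach f D k (D k)" for k using f[of k] by (simp add: P_def)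
  obtain k where "f k \<in> filt.reach f D k (D k)"
    by (rule filt.left_noetherian_gr_reach[of f D, OF noeth mem])
  with out show False by (rule notE)
qed

end

locale filtered_subquotient = filtered_quotient K R \<Gamma> I + sq: ideal_subquotient R I J\<^sub>1 J\<^sub>2
  for K :: "('k, 'm) ring_scheme" and R :: "('k, 'a, 'n) module_scheme" and \<Gamma> and I J\<^sub>1 J\<^sub>2
begin

abbreviation "N \<equiv> subquotient R J\<^sub>2 J\<^sub>1"
abbreviation "lact \<equiv> \<lambda>a m. [mod J\<^sub>1:] a \<Otimes>\<^bsub>R\<^esub> m"
abbreviation "ract \<equiv> \<lambda>m a. [mod J\<^sub>1:] m \<Otimes>\<^bsub>R\<^esub> a"

sublocale L: left_module B N lact
  by (rule sq.left_module_N)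

sublocale O: left_module "opposite_ring B" N "\<lambda>a m. ract m a"
  by (rule sq.right_module_N)

definition cls :: "'a \<Rightarrow> 'a set" where "cls x = J\<^sub>1 +>\<^bsub>R\<^esub> x"

definition nlevel :: "nat \<Rightarrow> 'a set set" where "nlevel n = cls ` (J\<^sub>2 \<inter> \<Gamma> n)"

lemma N_carrier: "carrier N = cls ` J\<^sub>2"
  by (simp add: sq.N_carrier cls_def)

lemma cls_closed: "x \<in> J\<^sub>2 \<Longrightarrow> cls x \<in> carrier N"
  by (simp add: N_carrier)

lemma cls_add: "x \<in> J\<^sub>2 \<Longrightarrow> y \<in> J\<^sub>2 \<Longrightarrow> cls (x \<oplus>\<^bsub>R\<^esub> y) = cls x \<otimes>\<^bsub>N\<^esub> cls y"
  by (simp add: cls_def sq.N_mult)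

lemma lact_cls: "r \<in> carrier R \<Longrightarrow> x \<in> J\<^sub>2 \<Longrightarrow> lact (\<pi> r) (cls x) = cls (r \<otimes>\<^bsub>R\<^esub> x)"
  by (simp add: cls_def \<pi>_def sq.lact_coset)

lemma ract_cls: "r \<in> carrier R \<Longrightarrow> x \<in> J\<^sub>2 \<Longrightarrow> ract (cls x) (\<pi> r) = cls (x \<otimes>\<^bsub>R\<^esub> r)"
  by (simp add: cls_def \<pi>_def sq.ract_coset)

lemma J2_scale: "k \<in> carrier K \<Longrightarrow> x \<in> J\<^sub>2 \<Longrightarrow> scale k x \<in> J\<^sub>2"
  using sq.J2.I_l_closed[of x "scale k \<one>\<^bsub>R\<^esub>"] scalar_closed[of k] scalar_mult[of k x] sq.J2_closed[of x] by simp

lemma scale_cls: "k \<in> carrier K \<Longrightarrow> x \<in> J\<^sub>2 \<Longrightarrow> lact (\<kappa> k) (cls x) = cls (scale k x)"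
  using lact_cls[OF scalar_closed, of k x] scalar_mult[of k x] sq.J2_closed[of x] by (simp add: \<kappa>_def)

sublocale NN: operator_group N "carrier K" "\<lambda>k m. lact (\<kappa> k) m"
  by (intro operator_group.intro operator_group_axioms.intro L.V.comm_group_axioms L.act_hom \<kappa>_closed)

lemma J2_stable: "RR.stable J\<^sub>2"
  unfolding stable_subgroup_def using sq.J2.a_subgroup J2_scale by blast

lemma cls_linear: "RR.stable V \<Longrightarrow> V \<subseteq> J\<^sub>2 \<Longrightarrow>
  linear_on (add_monoid R) (carrier K) scale N (\<lambda>k m. lact (\<kappa> k) m) V cls"
  by (intro linear_on.intro linear_on_axioms.intro RR.operator_group_axioms NN.operator_group_axioms)
    (auto simp: cls_closed cls_add scale_cls subset_iff)

lemma nlevel_stable: "NN.stable (nlevel n)"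
proof -
  have st: "RR.stable (J\<^sub>2 \<inter> \<Gamma> n)" by (rule RR.stable_Int[OF J2_stable filtration_stable])
  show ?thesis unfolding nlevel_def
    by (rule linear_on.stable_image[OF cls_linear[OF st] st order.refl]) simp
qed

lemma nlevel_closed: "m \<in> nlevel n \<Longrightarrow> m \<in> carrier N"
  using NN.stable_subset[OF nlevel_stable] .

lemma nlevel_mono: "m \<le> n \<Longrightarrow> nlevel m \<subseteq> nlevel n"
  unfolding nlevel_def using filt.filtration_mono[of m n] by blast

lemma nlevel_Union: "m \<in> carrier N \<Longrightarrow> \<exists>n. m \<in> nlevel n"
proof -
  assume "m \<in> carrier N"
  then obtain x where x: "x \<in> J\<^sub>2" "m = cls x" unfolding N_carrier by blast
  then obtain n where "x \<in> \<Gamma> n" using sq.J2_closed[OF x(1)] unfolding filt.filtration_Union[symmetric] by blast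
  then show ?thesis using x unfolding nlevel_def by blast
qed

lemma nlevel_bound:
  assumes "finite J" "\<And>j. j \<in> J \<Longrightarrow> b j \<in> carrier N"
  shows "\<exists>n. \<forall>j\<in>J. b j \<in> nlevel n"
  using assms
proof (induction J rule: finite_induct)
  case (insert j J)
  then obtain n where n: "\<forall>j\<in>J. b j \<in> nlevel n" by auto
  obtain m where m: "b j \<in> nlevel m" using nlevel_Union insert.prems by blast
  have "\<forall>i\<in>insert j J. b i \<in> nlevel (max m n)"
    using n m nlevel_mono[of n "max m n"] nlevel_mono[of m "max m n"] by auto
  then show ?case by blast
qed simp

lemma ract_nlevel: "m \<in> nlevel i \<Longrightarrow> b \<in> level j \<Longrightarrow> ract m b \<in> nlevel (i + j)"
proof -
  assume "m \<in> nlevel i" "b \<in> level j"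
  then obtain x r where x: "x \<in> J\<^sub>2" "x \<in> \<Gamma> i" "m = cls x" and r: "r \<in> \<Gamma> j" "b = \<pi> r"
    unfolding nlevel_def level_def by blast
  have rc: "r \<in> carrier R" using filt.filtration_carrier[OF r(1)] .
  have "x \<otimes>\<^bsub>R\<^esub> r \<in> J\<^sub>2 \<inter> \<Gamma> (i + j)" using sq.J2.I_r_closed[OF x(1) rc] filt.filtration_mult[OF x(2) r(1)] by blast
  then show ?thesis unfolding x(3) r(2) ract_cls[OF rc x(1)] nlevel_def by (rule imageI)
qed

lemma ract_linear:
  assumes m: "m \<in> carrier N" and V: "BB.stable V"
  shows "linear_on (add_monoid B) (carrier K) (\<lambda>k b. \<kappa> k \<otimes>\<^bsub>B\<^esub> b) N (\<lambda>k m. lact (\<kappa> k) m) V (\<lambda>b. ract m b)"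
proof (intro linear_on.intro linear_on_axioms.intro BB.operator_group_axioms NN.operator_group_axioms V)
  have c: "b \<in> carrier B" if "b \<in> V" for b using BB.stable_subset[OF V that] by simp
  show "ract m b \<in> carrier N" if "b \<in> V" for b using O.act_closed[of b m] c[OF that] m by simp
  show "ract m (b \<otimes>\<^bsub>add_monoid B\<^esub> b') = ract m b \<otimes>\<^bsub>N\<^esub> ract m b'" if "b \<in> V" "b' \<in> V" for b b'
    using O.act_add[of b b' m] c[OF that(1)] c[OF that(2)] m by simp
  show "ract m (\<kappa> k \<otimes>\<^bsub>B\<^esub> b) = lact (\<kappa> k) (ract m b)" if k: "k \<in> carrier K" and b: "b \<in> V" for k b
  proof -
    obtain x where x: "x \<in> J\<^sub>2" "m = cls x" using m unfolding N_carrier by blast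
    obtain y where y: "y \<in> carrier R" "b = \<pi> y" using c[OF b] unfolding B_carrier by blast
    have xc: "x \<in> carrier R" using x sq.J2_closed by simp
    have "ract m (\<kappa> k \<otimes>\<^bsub>B\<^esub> b) = cls (x \<otimes>\<^bsub>R\<^esub> scale k y)"
      unfolding x(2) y(2) \<kappa>_\<pi>[OF k y(1)] using ract_cls[OF smult_closed[OF k y(1)] x(1)] .
    also have "\<dots> = cls (scale k (x \<otimes>\<^bsub>R\<^esub> y))" using k xc y(1) by (simp add: smult_mult_right)
    also have "\<dots> = lact (\<kappa> k) (ract m b)"
      unfolding x(2) y(2) ract_cls[OF y(1) x(1)] using scale_cls[OF k sq.J2.I_r_closed[OF x(1) y(1)]] by simp
    finally show ?thesis .
  qed
qed

lemma lact_linear: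
  assumes m: "m \<in> carrier N" and V: "BB.stable V"
  shows "linear_on (add_monoid B) (carrier K) (\<lambda>k b. \<kappa> k \<otimes>\<^bsub>B\<^esub> b) N (\<lambda>k m. lact (\<kappa> k) m) V (\<lambda>b. lact b m)"
  by (intro linear_on.intro linear_on_axioms.intro BB.operator_group_axioms NN.operator_group_axioms V)
    (use BB.stable_subset[OF V] m in \<open>auto simp: L.act_closed L.act_add L.act_mult \<kappa>_closed\<close>)

lemma left_linear_map_linear:
  assumes V: "NN.stable V" and f: "\<And>m. m \<in> carrier N \<Longrightarrow> f m \<in> carrier B"
    and add: "\<And>m m'. m \<in> carrier N \<Longrightarrow> m' \<in> carrier N \<Longrightarrow> f (m \<otimes>\<^bsub>N\<^esub> m') = f m \<oplus>\<^bsub>B\<^esub> f m'"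
    and mult: "\<And>m b. m \<in> carrier N \<Longrightarrow> b \<in> carrier B \<Longrightarrow> f (lact b m) = b \<otimes>\<^bsub>B\<^esub> f m"
  shows "linear_on N (carrier K) (\<lambda>k m. lact (\<kappa> k) m) (add_monoid B) (\<lambda>k b. \<kappa> k \<otimes>\<^bsub>B\<^esub> b) V f"
  by (intro linear_on.intro linear_on_axioms.intro BB.operator_group_axioms NN.operator_group_axioms V)
    (use NN.stable_subset[OF V] f add mult in \<open>auto simp: \<kappa>_closed\<close>)

lemma cls_finsum:
  assumes "\<And>j. j < (k::nat) \<Longrightarrow> w j \<in> J\<^sub>2"
  shows "(\<Oplus>\<^bsub>R\<^esub>j\<in>{..<k}. w j) \<in> J\<^sub>2 \<and> cls (\<Oplus>\<^bsub>R\<^esub>j\<in>{..<k}. w j) = finprod N (\<lambda>j. cls (w j)) {..<k}"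
  using assms
proof (induction k)
  case 0
  have "cls \<zero>\<^bsub>R\<^esub> = \<one>\<^bsub>N\<^esub>" using sq.N_coset_one_iff[of "\<zero>\<^bsub>R\<^esub>"] by (simp add: cls_def)
  then show ?case by simp
next
  case (Suc k)
  have w: "w j \<in> carrier (add_monoid R)" if "j \<le> k" for j using sq.J2_closed[of "w j"] Suc.prems that by simp
  have eq: "(\<Oplus>\<^bsub>R\<^esub>j\<in>{..<Suc k}. w j) = (\<Oplus>\<^bsub>R\<^esub>j\<in>{..<k}. w j) \<oplus>\<^bsub>R\<^esub> w k"
    unfolding finsum_def using RR.finprod_lessThan_Suc[of k w] w by simp
  have "finprod N (\<lambda>j. cls (w j)) {..<Suc k} = finprod N (\<lambda>j. cls (w j)) {..<k} \<otimes>\<^bsub>N\<^esub> cls (w k)"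
    using Suc.prems by (intro NN.finprod_lessThan_Suc cls_closed) simp
  then show ?case unfolding eq using Suc by (simp add: cls_add)
qed

text \<open>Good generators of a left ideal generate its image in the subquotient with coefficients of controlled degree.\<close>

lemma combination_class:
  assumes y: "\<And>j. j < k \<Longrightarrow> y j \<in> J\<^sub>2" and x: "x \<in> filt.combinations y d k n"
  shows "\<exists>g. (\<forall>j<k. g j \<in> level n) \<and> cls x = finprod N (\<lambda>j. lact (g j) (cls (y j))) {..<k}"
proof -
  obtain g where g: "\<forall>j<k. g j \<in> filt.shifted n (d j)" "x = (\<Oplus>\<^bsub>R\<^esub>j\<in>{..<k}. g j \<otimes>\<^bsub>R\<^esub> y j)"
    using x by (auto simp: filt.combinations_def)
  have gc: "g j \<in> carrier R" if "j < k" for j using g(1) filt.shifted_carrier that by blast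
  have gy: "g j \<otimes>\<^bsub>R\<^esub> y j \<in> J\<^sub>2" if "j < k" for j using sq.J2.I_l_closed[OF y gc] that by simp
  have "cls x = finprod N (\<lambda>j. cls (g j \<otimes>\<^bsub>R\<^esub> y j)) {..<k}"
    unfolding g(2) using cls_finsum[of k "\<lambda>j. g j \<otimes>\<^bsub>R\<^esub> y j"] gy by simp
  also have "\<dots> = finprod N (\<lambda>j. lact (\<pi> (g j)) (cls (y j))) {..<k}"
    using gc y gy cls_closed by (intro L.V.finprod_cong') (auto simp: lact_cls)
  finally show ?thesis using g(1) filt.shifted_subset by (intro exI[of _ "\<lambda>j. \<pi> (g j)"]) (auto simp: level_def)
qed

end

lemma has_chain_imp_strict_sequence:
  "has_chain G S \<sigma> V n \<Longrightarrow> \<exists>M :: nat \<Rightarrow> _ set. M n = V \<and> (\<forall>i\<le>n. stable_subgroup G S \<sigma> (M i)) \<and> (\<forall>i<n. M i \<subset> M (Suc i))"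
proof (induction rule: has_chain.induct)
  case (zero V) then show ?case by (intro exI[of _ "\<lambda>_. V"]) simp
next
  case (Suc U n V)
  then obtain M :: "nat \<Rightarrow> _ set" where M: "M n = U" "\<forall>i\<le>n. stable_subgroup G S \<sigma> (M i)" "\<forall>i<n. M i \<subset> M (Suc i)" by blast
  show ?case
    by (rule exI[of _ "\<lambda>i. if i \<le> n then M i else V"]) (use M Suc.hyps in \<open>auto simp: le_Suc_eq less_Suc_eq Suc_le_eq\<close>)
qed

lemma le_module_length_iff:
  assumes top: "stable_subgroup G S \<sigma> (carrier G)"
  shows "enat n \<le> module_length S G \<sigma> \<longleftrightarrow> has_chain G S \<sigma> (carrier G) n"
proof
  assume chain: "has_chain G S \<sigma> (carrier G) n"
  obtain M :: "nat \<Rightarrow> _ set" where M: "\<forall>i\<le>n. stable_subgroup G S \<sigma> (M i)" "\<forall>i<n. M i \<subset> M (Suc i)"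
    using has_chain_imp_strict_sequence[OF chain] by blast
  then have "(\<forall>i\<le>n. subgroup (M i) G \<and> (\<forall>q\<in>S. \<sigma> q ` M i \<subseteq> M i)) \<and> (\<forall>i<n. M i \<subset> M (Suc i))"
    by (auto simp: stable_subgroup_def)
  then show "enat n \<le> module_length S G \<sigma>" unfolding module_length_def by (intro Sup_upper) blast
next
  assume le: "enat n \<le> module_length S G \<sigma>"
  show "has_chain G S \<sigma> (carrier G) n"
  proof (cases n)
    case 0 then show ?thesis using top by (simp add: has_chain.zero)
  next
    case (Suc m)
    then have "enat m < module_length S G \<sigma>" using le by (simp add: Suc_ile_eq)
    then obtain l M where l: "m < l" and M: "\<forall>i\<le>l. subgroup (M i) G \<and> (\<forall>q\<in>S. \<sigma> q ` M i \<subseteq> M i)" "\<forall>i<l. (M i :: _ set) \<subset> M (Suc i)"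
      unfolding module_length_def less_Sup_iff by auto
    have st: "stable_subgroup G S \<sigma> (M i)" if "i \<le> l" for i using M(1) that by (auto simp: stable_subgroup_def)
    have "has_chain G S \<sigma> (M i) i" if "i \<le> l" for i
      using that
    proof (induction i)
      case 0 then show ?case using st by (simp add: has_chain.zero)
    next
      case (Suc i) then show ?case using st[of "Suc i"] M(2) by (intro has_chain.Suc[of _ _ _ "M i"]) auto
    qed
    then have "has_chain G S \<sigma> (M l) l" by simp
    moreover have "M l \<subseteq> carrier G" using M(1) subgroup.subset by blast
    ultimately have "has_chain G S \<sigma> (carrier G) l" using top by (rule has_chain_mono)
    then show ?thesis by (rule has_chain_downward) (use l Suc in simp)
  qed
qed

section \<open>Rank estimates\<close>

context filtered_subquotient
begin

text \<open>The matrix \<open>z\<close> embeds \<open>A\<^sup>t\<close> into \<open>N\<^sup>r\<close>. Its row \<open>i\<close> determines the products of \<open>b i\<close> with the entries of a vector, which gives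
  \<open>t\<close> times the dimension of \<open>b i\<close> times the \<open>n\<close>-th term of \<open>A\<close> as a lower bound for that of a term of \<open>N\<close>; and the \<open>n\<close>-th term of \<open>A\<close>
  embeds into the sum of these products over all \<open>i\<close>.\<close>

lemma right_rank_estimate:
  fixes t r :: nat
  assumes z: "\<And>i j. i < r \<Longrightarrow> j < t \<Longrightarrow> z i j \<in> carrier N" and b: "\<And>i. i < r \<Longrightarrow> b i \<in> carrier B"
    and det: "\<And>i j a. i < r \<Longrightarrow> (\<And>j. j < t \<Longrightarrow> a j \<in> carrier B) \<Longrightarrow>
      finprod N (\<lambda>j. ract (z i j) (a j)) {..<t} = \<one>\<^bsub>N\<^esub> \<Longrightarrow> j < t \<Longrightarrow> b i \<otimes>\<^bsub>B\<^esub> a j = \<zero>\<^bsub>B\<^esub>"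
    and inj: "\<And>a. a \<in> carrier B \<Longrightarrow> (\<And>i. i < r \<Longrightarrow> b i \<otimes>\<^bsub>B\<^esub> a = \<zero>\<^bsub>B\<^esub>) \<Longrightarrow> a = \<zero>\<^bsub>B\<^esub>"
  shows "\<exists>d. \<forall>n. of_nat t * BB.len (level n) \<le> of_nat r * NN.len (nlevel (n + d))"
proof -
  have "\<exists>d. \<forall>ij\<in>{..<r} \<times> {..<t}. z (fst ij) (snd ij) \<in> nlevel d"
    by (rule nlevel_bound) (use z in auto)
  then obtain d where d: "\<And>i j. i < r \<Longrightarrow> j < t \<Longrightarrow> z i j \<in> nlevel d" by force
  have "of_nat t * BB.len (level n) \<le> of_nat r * NN.len (nlevel (n + d))" for n
  proof -
    let ?b = "\<lambda>i y. b i \<otimes>\<^bsub>B\<^esub> y"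
    have bl: "linear_on (add_monoid B) (carrier K) (\<lambda>k b. \<kappa> k \<otimes>\<^bsub>B\<^esub> b) (add_monoid B) (\<lambda>k b. \<kappa> k \<otimes>\<^bsub>B\<^esub> b) (level n) (?b i)"
      if "i < r" for i using left_mult_linear[OF b[OF that] level_stable] .
    have "BB.len (level n) \<le> BB.len {v \<in> level n. \<forall>i<r. ?b i v = \<one>\<^bsub>add_monoid B\<^esub>} + (\<Sum>i<r. BB.len (?b i ` level n))"
      by (rule length_le_common_kernel(1)[OF BB.operator_group_axioms level_stable bl])
    moreover have "{v \<in> level n. \<forall>i<r. ?b i v = \<one>\<^bsub>add_monoid B\<^esub>} = {\<one>\<^bsub>add_monoid B\<^esub>}"
      using inj level_closed b BB.stable_one[OF level_stable, of n] by (auto simp: B.r_null)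
    ultimately have le: "BB.len (level n) \<le> (\<Sum>i<r. BB.len (?b i ` level n))" by (simp only: BB.len_trivial add_0)
    have each: "of_nat t * BB.len (?b i ` level n) \<le> NN.len (nlevel (n + d))" if i: "i < r" for i
    proof -
      have "(\<Sum>j<t. BB.len (?b i ` level n)) \<le> NN.len (nlevel (n + d))"
      proof (rule sum_length_le_of_determined[where V="\<lambda>_. level n" and g="\<lambda>j y. ract (z i j) y" and h="\<lambda>_. ?b i"])
        show "linear_on (add_monoid B) (carrier K) (\<lambda>k b. \<kappa> k \<otimes>\<^bsub>B\<^esub> b) N (\<lambda>k m. lact (\<kappa> k) m) (level n) (\<lambda>y. ract (z i j) y)"
          if "j < t" for j using ract_linear[OF z[OF i that] level_stable] .
        show "?b i (v j) = \<one>\<^bsub>add_monoid B\<^esub>"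
          if v: "\<forall>j<t. v j \<in> level n" and vz: "finprod N (\<lambda>j. ract (z i j) (v j)) {..<t} = \<one>\<^bsub>N\<^esub>" and j: "j < t" for v j
        proof -
          have vc: "v j \<in> carrier B" if "j < t" for j using v that level_closed by blast
          show ?thesis using det[OF i vc vz j] by simp
        qed
        show "(\<lambda>y. ract (z i j) y) ` level n \<subseteq> nlevel (n + d)" if "j < t" for j
          using ract_nlevel[OF d[OF i that]] unfolding add.commute[of n d] by auto
      qed (rule NN.operator_group_axioms BB.operator_group_axioms nlevel_stable bl[OF i])+
      then show ?thesis by simp
    qed
    have "of_nat t * BB.len (level n) \<le> of_nat t * (\<Sum>i<r. BB.len (?b i ` level n))"
      using le by (rule mult_left_mono) simp
    also have "\<dots> = (\<Sum>i<r. of_nat t * BB.len (?b i ` level n))" by (rule sum_distrib_left)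
    also have "\<dots> \<le> (\<Sum>i<r. NN.len (nlevel (n + d)))" using each by (intro sum_mono) simp
    finally show ?thesis by simp
  qed
  then show ?thesis by blast
qed

text \<open>Each \<open>f l\<close> raises degrees by a bounded amount, because it is left linear and \<open>N\<close> has generators with coefficients of controlled
  degree. As the sum of the \<open>f l (n i) b i\<close> determines all its summands, \<open>r\<close> times the dimension of the image of a term of \<open>N\<close> under \<open>f l\<close> is at most
  that of a term of \<open>A\<close>; and up to torsion, a term of \<open>N\<close> embeds into the sum of its images under the \<open>m\<close> maps.\<close>

lemma left_rank_estimate:
  fixes m r k :: nat
  assumes b: "\<And>i. i < r \<Longrightarrow> b i \<in> carrier B"
    and f: "\<And>l n. l < m \<Longrightarrow> n \<in> carrier N \<Longrightarrow> f l n \<in> carrier B"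
    and add: "\<And>l n n'. l < m \<Longrightarrow> n \<in> carrier N \<Longrightarrow> n' \<in> carrier N \<Longrightarrow> f l (n \<otimes>\<^bsub>N\<^esub> n') = f l n \<oplus>\<^bsub>B\<^esub> f l n'"
    and mult: "\<And>l n a. l < m \<Longrightarrow> n \<in> carrier N \<Longrightarrow> a \<in> carrier B \<Longrightarrow> f l (lact a n) = a \<otimes>\<^bsub>B\<^esub> f l n"
    and det: "\<And>l n i. l < m \<Longrightarrow> (\<And>i. i < r \<Longrightarrow> n i \<in> carrier N) \<Longrightarrow> (\<Oplus>\<^bsub>B\<^esub>i\<in>{..<r}. f l (n i) \<otimes>\<^bsub>B\<^esub> b i) = \<zero>\<^bsub>B\<^esub>
      \<Longrightarrow> i < r \<Longrightarrow> f l (n i) = \<zero>\<^bsub>B\<^esub>"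
    and ker: "\<And>n. n \<in> carrier N \<Longrightarrow> (\<And>l. l < m \<Longrightarrow> f l n = \<zero>\<^bsub>B\<^esub>) \<Longrightarrow> n \<in> T"
    and T: "\<And>n. NN.stable (nlevel n \<inter> T)"
    and y: "\<And>j. j < k \<Longrightarrow> y j \<in> J\<^sub>2" and gen: "\<And>n. J\<^sub>2 \<inter> \<Gamma> n = filt.combinations y d k n"
  shows "\<exists>d. \<forall>n. of_nat r * NN.len (nlevel n) \<le> of_nat r * NN.len (nlevel n \<inter> T) + of_nat m * BB.len (level (n + d))"
proof -
  obtain d1 where d1: "\<And>lj. lj \<in> {..<m} \<times> {..<k} \<Longrightarrow> f (fst lj) (cls (y (snd lj))) \<in> level d1"
    by (rule level_bound[of "{..<m} \<times> {..<k}" "\<lambda>lj. f (fst lj) (cls (y (snd lj)))"]) (use f y cls_closed in auto)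
  obtain d2 where d2: "\<And>i. i \<in> {..<r} \<Longrightarrow> b i \<in> level d2"
    by (rule level_bound[of "{..<r}" b]) (use b in auto)
  have f_level: "f l x \<in> level (n + d1)" if l: "l < m" and x: "x \<in> nlevel n" for l x n
  proof -
    obtain u where u: "u \<in> filt.combinations y d k n" "x = cls u" using x gen by (auto simp: nlevel_def)
    obtain g where g: "\<forall>j<k. g j \<in> level n" "x = finprod N (\<lambda>j. lact (g j) (cls (y j))) {..<k}"
      using combination_class[OF y u(1)] u(2) by auto
    have gc: "g j \<in> carrier B" if "j < k" for j using g(1) level_closed that by blast
    interpret h: group_hom N "add_monoid B" "f l"
      by (intro group_hom.intro group_hom_axioms.intro L.V.is_group B.a_group) (auto simp: hom_def f[OF l] add[OF l])
    have "f l x = finprod (add_monoid B) (\<lambda>j. f l (lact (g j) (cls (y j)))) {..<k}"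
      unfolding g(2) using gc y cls_closed L.act_closed
      by (intro h.hom_finprod_lessThan L.V.comm_group_axioms B.a_comm_group) simp
    moreover have "f l (lact (g j) (cls (y j))) \<in> level (n + d1)" if j: "j < k" for j
      using mult[OF l cls_closed[OF y[OF j]] gc[OF j]] level_mult[of "g j" n "f l (cls (y j))" d1] g(1) d1[of "(l, j)"] l j
      by simp
    ultimately have "f l x \<in> BB.family_product (\<lambda>_. level (n + d1)) k"
      unfolding BB.family_product_def by blast
    then show ?thesis using BB.family_product_subset[of k "\<lambda>_. level (n + d1)" "level (n + d1)"] level_stable by blast
  qed
  let ?d = "d1 + d2"
  have "of_nat r * NN.len (nlevel n) \<le> of_nat r * NN.len (nlevel n \<inter> T) + of_nat m * BB.len (level (n + ?d))" for n
  proof -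
    have fl: "linear_on N (carrier K) (\<lambda>k m. lact (\<kappa> k) m) (add_monoid B) (\<lambda>k b. \<kappa> k \<otimes>\<^bsub>B\<^esub> b) (nlevel n) (f l)"
      if "l < m" for l using left_linear_map_linear[OF nlevel_stable f[OF that] add[OF that] mult[OF that]] .
    let ?Z = "{v \<in> nlevel n. \<forall>l<m. f l v = \<one>\<^bsub>add_monoid B\<^esub>}"
    have kerlen: "NN.len (nlevel n) \<le> NN.len ?Z + (\<Sum>l<m. BB.len (f l ` nlevel n))"
      by (rule length_le_common_kernel(1)[OF NN.operator_group_axioms nlevel_stable fl])
    have Zs: "NN.stable ?Z"
      by (rule length_le_common_kernel(2)[OF NN.operator_group_axioms nlevel_stable fl])
    have "?Z \<subseteq> nlevel n \<inter> T" using ker nlevel_closed by auto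
    then have "NN.len ?Z \<le> NN.len (nlevel n \<inter> T)" by (rule stable_length_mono[OF Zs T])
    with kerlen have le: "NN.len (nlevel n) \<le> NN.len (nlevel n \<inter> T) + (\<Sum>l<m. BB.len (f l ` nlevel n))"
      by (rule order_trans[OF _ add_right_mono])
    have each: "of_nat r * BB.len (f l ` nlevel n) \<le> BB.len (level (n + ?d))" if l: "l < m" for l
    proof -
      have "(\<Sum>i<r. BB.len (f l ` nlevel n)) \<le> BB.len (level (n + ?d))"
      proof (rule sum_length_le_of_determined[where V="\<lambda>_. nlevel n" and g="\<lambda>i v. f l v \<otimes>\<^bsub>B\<^esub> b i" and h="\<lambda>_. f l"])
        show "linear_on N (carrier K) (\<lambda>k m. lact (\<kappa> k) m) (add_monoid B) (\<lambda>k b. \<kappa> k \<otimes>\<^bsub>B\<^esub> b) (nlevel n) (\<lambda>v. f l v \<otimes>\<^bsub>B\<^esub> b i)"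
          if "i < r" for i
          using nlevel_closed[of _ n] f[OF l] add[OF l] mult[OF l] b[OF that]
          by (intro linear_on.intro linear_on_axioms.intro BB.operator_group_axioms NN.operator_group_axioms nlevel_stable)
            (simp_all add: B.l_distr B.m_assoc \<kappa>_closed)
        show "f l (v i) = \<one>\<^bsub>add_monoid B\<^esub>"
          if v: "\<forall>i<r. v i \<in> nlevel n" and vz: "finprod (add_monoid B) (\<lambda>i. f l (v i) \<otimes>\<^bsub>B\<^esub> b i) {..<r} = \<one>\<^bsub>add_monoid B\<^esub>"
            and i: "i < r" for v i
        proof -
          have vc: "v i \<in> carrier N" if "i < r" for i using v that nlevel_closed by blast
          have "(\<Oplus>\<^bsub>B\<^esub>i\<in>{..<r}. f l (v i) \<otimes>\<^bsub>B\<^esub> b i) = \<zero>\<^bsub>B\<^esub>"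
            using vz unfolding finsum_def by simp
          from det[OF l vc this i] show ?thesis by simp
        qed
        show "(\<lambda>v. f l v \<otimes>\<^bsub>B\<^esub> b i) ` nlevel n \<subseteq> level (n + ?d)" if "i < r" for i
          using level_mult[OF f_level[OF l] d2[of i]] that by (auto simp: add.assoc)
      qed (rule NN.operator_group_axioms BB.operator_group_axioms level_stable fl[OF l])+
      then show ?thesis by simp
    qed
    have "of_nat r * NN.len (nlevel n) \<le> of_nat r * (NN.len (nlevel n \<inter> T) + (\<Sum>l<m. BB.len (f l ` nlevel n)))"
      using le by (rule mult_left_mono) simp
    also have "\<dots> = of_nat r * NN.len (nlevel n \<inter> T) + (\<Sum>l<m. of_nat r * BB.len (f l ` nlevel n))"
      by (simp only: distrib_left sum_distrib_left)
    also have "\<dots> \<le> of_nat r * NN.len (nlevel n \<inter> T) + (\<Sum>l<m. BB.len (level (n + ?d)))"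
      using each by (intro add_left_mono sum_mono) simp
    finally show ?thesis by simp
  qed
  then show ?thesis by blast
qed

text \<open>The torsion in a term of \<open>N\<close> lies in the sum of the \<open>A y\<^sub>j\<close>. The map \<open>b \<mapsto> b y\<^sub>j\<close> kills \<open>A c\<^sub>j\<close>, which is as
  large as \<open>A\<close> because \<open>c\<^sub>j\<close> is regular, up to the bounded degree of \<open>c\<^sub>j\<close>.\<close>

lemma torsion_estimate:
  fixes k :: nat
  assumes y: "\<And>j. j < k \<Longrightarrow> y j \<in> J\<^sub>2"
    and T: "\<And>n. NN.stable (nlevel n \<inter> T)" and gen: "\<And>x n. x \<in> J\<^sub>2 \<inter> \<Gamma> n \<Longrightarrow> cls x \<in> T \<Longrightarrow> x \<in> filt.combinations y d k n"
    and c: "\<And>j. j < k \<Longrightarrow> c j \<in> regular_elements B" "\<And>j. j < k \<Longrightarrow> lact (c j) (cls (y j)) = \<one>\<^bsub>N\<^esub>"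
  shows "\<exists>d. \<forall>n. NN.len (nlevel (n + d) \<inter> T) + of_nat k * BB.len (level n) \<le> of_nat k * BB.len (level (n + d))"
proof -
  have cc: "c j \<in> carrier B" if "j < k" for j using c(1)[OF that] by (simp add: regular_elements_def)
  obtain e where e: "\<And>j. j \<in> {..<k} \<Longrightarrow> c j \<in> level e"
    by (rule level_bound[of "{..<k}" c]) (use cc in auto)
  define U where "U n j = (\<lambda>b. lact b (cls (y j))) ` level n" for n j
  have yl: "linear_on (add_monoid B) (carrier K) (\<lambda>k b. \<kappa> k \<otimes>\<^bsub>B\<^esub> b) N (\<lambda>k m. lact (\<kappa> k) m) (level n) (\<lambda>b. lact b (cls (y j)))"
    if "j < k" for j n using lact_linear[OF cls_closed[OF y[OF that]] level_stable] .
  have Us: "NN.stable (U n j)" if "j < k" for n j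
    unfolding U_def using linear_on.stable_image[OF yl[OF that] level_stable order.refl] .
  have T_le: "NN.len (nlevel n \<inter> T) \<le> (\<Sum>j<k. NN.len (U n j))" for n
  proof -
    have "nlevel n \<inter> T \<subseteq> NN.family_product (U n) k"
    proof
      fix m assume m: "m \<in> nlevel n \<inter> T"
      then obtain x where x: "x \<in> J\<^sub>2 \<inter> \<Gamma> n" "m = cls x" by (auto simp: nlevel_def)
      then have "x \<in> filt.combinations y d k n" using gen m by simp
      from combination_class[OF y this] obtain g where
        g: "\<forall>j<k. g j \<in> level n" "m = finprod N (\<lambda>j. lact (g j) (cls (y j))) {..<k}" using x(2) by auto
      then show "m \<in> NN.family_product (U n) k"
        unfolding NN.family_product_def U_def by blast
    qed
    then have "NN.len (nlevel n \<inter> T) \<le> NN.len (NN.family_product (U n) k)"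
      by (intro stable_length_mono T NN.stable_family_product Us)
    also have "\<dots> \<le> (\<Sum>j<k. NN.len (U n j))" by (intro NN.len_family_product_le Us)
    finally show ?thesis .
  qed
  have U_le: "NN.len (U (n + e) j) + BB.len (level n) \<le> BB.len (level (n + e))" if j: "j < k" for n j
  proof -
    note yj = yl[OF j, of "n + e"] and cj = right_mult_linear[OF cc[OF j] level_stable[of n]]
    let ?ker = "level (n + e) \<inter> (\<lambda>b. lact b (cls (y j))) -` {\<one>\<^bsub>N\<^esub>}"
    have "BB.len (level n) \<le> BB.len ((\<lambda>b. b \<otimes>\<^bsub>B\<^esub> c j) ` level n)"
    proof (rule linear_on.length_le_image[OF cj])
      fix b assume b: "b \<in> level n" "b \<otimes>\<^bsub>B\<^esub> c j = \<one>\<^bsub>add_monoid B\<^esub>"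
      have "b = \<zero>\<^bsub>B\<^esub>" if "b \<in> carrier B" "b \<otimes>\<^bsub>B\<^esub> c j = \<zero>\<^bsub>B\<^esub>" for b
        using c(1)[OF j] that unfolding regular_elements_def by blast
      from this[OF level_closed[OF b(1)]] b(2) show "b = \<one>\<^bsub>add_monoid B\<^esub>" by simp
    qed
    also have "\<dots> \<le> BB.len ?ker"
    proof (rule stable_length_mono[OF linear_on.stable_image[OF cj level_stable order.refl] linear_on.stable_kernel[OF yj]])
      show "(\<lambda>b. b \<otimes>\<^bsub>B\<^esub> c j) ` level n \<subseteq> ?ker"
      proof
        fix x assume "x \<in> (\<lambda>b. b \<otimes>\<^bsub>B\<^esub> c j) ` level n"
        then obtain b where b: "b \<in> level n" "x = b \<otimes>\<^bsub>B\<^esub> c j" by blast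
        have "lact (b \<otimes>\<^bsub>B\<^esub> c j) (cls (y j)) = \<one>\<^bsub>N\<^esub>"
          using L.act_mult[OF level_closed[OF b(1)] cc[OF j] cls_closed[OF y[OF j]]] c(2)[OF j]
            L.act_unit[OF level_closed[OF b(1)]] by simp
        then show "x \<in> ?ker" using level_mult[OF b(1) e[of j]] j b(2) by simp
      qed
    qed
    finally have "BB.len (level n) \<le> BB.len ?ker" .
    then have "BB.len (level n) + NN.len (U (n + e) j) \<le> BB.len ?ker + NN.len (U (n + e) j)" by (rule add_right_mono)
    also have "\<dots> \<le> BB.len (level (n + e))" unfolding U_def by (rule linear_on.kernel_image_le_length[OF yj])
    finally show ?thesis by (simp add: add.commute)
  qed
  have "NN.len (nlevel (n + e) \<inter> T) + of_nat k * BB.len (level n) \<le> of_nat k * BB.len (level (n + e))" for n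
  proof -
    have "NN.len (nlevel (n + e) \<inter> T) + of_nat k * BB.len (level n)
        \<le> (\<Sum>j<k. NN.len (U (n + e) j)) + of_nat k * BB.len (level n)" using T_le by (rule add_right_mono)
    also have "\<dots> = (\<Sum>j<k. NN.len (U (n + e) j) + BB.len (level n))" by (simp add: sum.distrib)
    also have "\<dots> \<le> (\<Sum>j<k. BB.len (level (n + e)))" using U_le by (intro sum_mono) simp
    finally show ?thesis by simp
  qed
  then show ?thesis by blast
qed

end

theorem theorem3p2:
  fixes K :: "('k, 'm) ring_scheme"
    and R :: "('k, 'a, 'n) module_scheme"
    and Q :: "('q, 'p) ring_scheme"
    and \<phi> :: "'a set \<Rightarrow> 'q"
    and I J\<^sub>1 J\<^sub>2 :: "'a set"
    and s t :: enat
  assumes "assoc_algebra K R"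
    and "ideal I R" and "ideal J\<^sub>1 R" and "ideal J\<^sub>2 R" and "J\<^sub>1 \<subset> J\<^sub>2"
    and "prime_ring (R Quot I)" and "goldie_ring (R Quot I)"
    and "\<forall>r\<in>I. \<forall>x\<in>J\<^sub>2. r \<otimes>\<^bsub>R\<^esub> x \<in> J\<^sub>1"
    and "\<forall>x\<in>J\<^sub>2. \<forall>r\<in>I. x \<otimes>\<^bsub>R\<^esub> r \<in> J\<^sub>1"
    and "ring_of_fractions (R Quot I) Q \<phi>"
    and "left_goldie_rank (R Quot I) Q \<phi> (subquotient R J\<^sub>2 J\<^sub>1) (\<lambda>a m. [mod J\<^sub>1:] a \<Otimes>\<^bsub>R\<^esub> m) = s"
    and "right_goldie_rank (R Quot I) Q \<phi> (subquotient R J\<^sub>2 J\<^sub>1) (\<lambda>m a. [mod J\<^sub>1:] m \<Otimes>\<^bsub>R\<^esub> a) = t"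
    and "s < t"
  shows "\<not> (\<exists>\<Gamma>. finite_N_filtration K R \<Gamma> \<and> left_noetherian (gr_ring R \<Gamma>))"
proof
  assume "\<exists>\<Gamma>. finite_N_filtration K R \<Gamma> \<and> left_noetherian (gr_ring R \<Gamma>)"
  then obtain \<Gamma> where filt: "N_filtration K R \<Gamma>" and fin: "\<And>n. finite_dim_subspace K R (\<Gamma> n)"
    and noeth: "left_noetherian (gr_ring R \<Gamma>)" by (auto simp: finite_N_filtration_def)
  interpret F: filtered_subquotient K R \<Gamma> I J\<^sub>1 J\<^sub>2
  proof (intro filtered_subquotient.intro filtered_quotient.intro filtered_algebra.intro filtered_algebra_axioms.intro
      ideal_subquotient.intro ideal_subquotient_axioms.intro assms(1-4) filt)
    show "ring R" using assms(2) by (rule ideal.axioms(2))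
  qed (use assms(5,8,9) in auto)
  have "ring Q" using assms(10) by (simp add: ring_of_fractions_def)
  then interpret frac: fractions F.B Q \<phi>
    by (intro fractions.intro fractions_axioms.intro F.B.ring_axioms assms(10))
  have goldie: "left_goldie F.B" using assms(7) by (simp add: goldie_ring_def)
  interpret pq: prime_quotient_ring Q by (rule frac.prime_quotient_ring[OF assms(6) goldie])
  obtain e r p p' where "matrix_units Q e r p p'" using pq.matrix_units_exist .
  then interpret units: matrix_units Q e r p p' .
  interpret LM: left_module_over_fractions F.B Q \<phi> F.N F.lact e r p p'
    by (intro left_module_over_fractions.intro left_module_fractions.intro frac.fractions_axioms
        F.L.left_module_axioms units.matrix_units_axioms)
  interpret RM: right_module_over_fractions F.B Q \<phi> F.N F.ract e r p p'
    by (intro right_module_over_fractions.intro right_module_fractions.intro frac.fractions_axioms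
        F.O.left_module_axioms units.matrix_units_axioms)
  have s: "module_length (carrier Q) LM.ext.V LM.ext.act = s"
    using assms(11) unfolding left_goldie_rank_def Let_def LM.ext.act_def[abs_def] LM.ext.\<rho>_def[abs_def] .
  have t: "module_length (carrier Q) RM.ext.V RM.ext.act = t"
    using assms(12) unfolding right_goldie_rank_def Let_def RM.ext.act_def[abs_def] RM.ext.\<sigma>_def[abs_def] .
  obtain s' where s': "s = enat s'" using assms(13) by (cases s) auto
  interpret LV: left_module Q LM.ext.V LM.ext.act by (rule LM.ext.module)
  interpret RV: left_module "opposite_ring Q" RM.ext.V RM.ext.act by (rule RM.ext.module)
  have Ltop: "stable_subgroup LM.ext.V (carrier Q) LM.ext.act (carrier LM.ext.V)"
    unfolding stable_subgroup_def using LV.act_closed group.subgroup_self[OF LM.ext.pair.T.is_group] by simp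
  have Rtop: "stable_subgroup RM.ext.V (carrier Q) RM.ext.act (carrier RM.ext.V)"
    unfolding stable_subgroup_def using RV.act_closed group.subgroup_self[OF RM.ext.pair.T.is_group] by simp
  have Lbound: "n \<le> s'" if "has_chain LM.ext.V (carrier Q) LM.ext.act (carrier LM.ext.V) n" for n
    using le_module_length_iff[OF Ltop, of n] that s s' by simp
  have Rchain: "has_chain RM.ext.V (carrier Q) RM.ext.act (carrier RM.ext.V) (Suc s')"
    using le_module_length_iff[OF Rtop, of "Suc s'"] t s' assms(13) by (simp add: Suc_ile_eq)
  have J2L: "left_ideal J\<^sub>2 R"
    using F.sq.J2.additive_subgroup_axioms F.sq.J2.I_l_closed by (simp add: left_ideal_def)
  obtain y d k where y: "\<And>j. j < k \<Longrightarrow> y j \<in> J\<^sub>2 \<inter> \<Gamma> (d j)" and gen: "\<And>n. J\<^sub>2 \<inter> \<Gamma> n = F.filt.combinations y d k n"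
    by (rule F.filt.left_ideal_good_generators[OF noeth J2L]) (rule that)
  have yJ: "\<And>j. j < k \<Longrightarrow> y j \<in> J\<^sub>2" using y by blast
  have N_gen: "\<exists>a. (\<forall>j<k. a j \<in> carrier F.B) \<and> n = finprod F.N (\<lambda>j. F.lact (a j) (F.cls (y j))) {..<k}"
    if n: "n \<in> carrier F.N" for n
  proof -
    obtain l where "n \<in> F.nlevel l" using F.nlevel_Union[OF n] by blast
    then obtain x where x: "x \<in> J\<^sub>2 \<inter> \<Gamma> l" "n = F.cls x" by (auto simp: F.nlevel_def)
    then have "x \<in> F.filt.combinations y d k l" using gen by simp
    from F.combination_class[OF yJ this] show ?thesis using x(2) F.level_closed by blast
  qed
  \<comment> \<open>The torsion submodule, described as the kernel of \<open>n \<mapsto> 1 \<otimes> n\<close>; its inverse image in \<open>R\<close> is a left ideal.\<close>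
  define T where "T = {n \<in> carrier F.N. LM.ext.unit n = \<one>\<^bsub>LM.ext.V\<^esub>}"
  have unit_closed: "LM.ext.unit n \<in> carrier LM.ext.V" if "n \<in> carrier F.N" for n
    using LM.ext.unit_hom that by (auto simp: hom_def)
  have T_mult: "n \<otimes>\<^bsub>F.N\<^esub> n' \<in> T" if "n \<in> T" "n' \<in> T" for n n'
    using that hom_mult[OF LM.ext.unit_hom, of n n'] by (simp add: T_def)
  have T_act: "F.lact a n \<in> T" if "a \<in> carrier F.B" "n \<in> T" for a n
    using that LM.ext.act_unit[of a n] F.L.act_closed[of a n] LV.act_unit[OF frac.phi_closed[OF that(1)]] by (simp add: T_def)
  have T_one: "\<one>\<^bsub>F.N\<^esub> \<in> T"
    using hom_one[OF LM.ext.unit_hom F.L.V.is_group LM.ext.pair.T.is_group] by (simp add: T_def)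
  have T_inv: "inv\<^bsub>F.N\<^esub> n \<in> T" if "n \<in> T" for n
    using T_act[of "\<ominus>\<^bsub>F.B\<^esub> \<one>\<^bsub>F.B\<^esub>" n] that F.L.act_minus[of "\<one>\<^bsub>F.B\<^esub>" n] F.L.act_one[of n] by (simp add: T_def)
  have T_stable: "F.NN.stable T"
    by (rule F.NN.stableI) (use T_mult T_act T_one T_inv F.\<kappa>_closed in \<open>auto simp: T_def\<close>)
  have T_level: "F.NN.stable (F.nlevel n \<inter> T)" for n by (rule F.NN.stable_Int[OF F.nlevel_stable T_stable])
  have TL: "left_ideal {x \<in> J\<^sub>2. F.cls x \<in> T} R"
  proof (rule F.algebra_ring.left_idealI)
    show "{x \<in> J\<^sub>2. F.cls x \<in> T} \<subseteq> carrier R" using F.sq.J2_closed by blast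
    show "\<zero>\<^bsub>R\<^esub> \<in> {x \<in> J\<^sub>2. F.cls x \<in> T}"
      using T_one F.sq.N_coset_one_iff[of "\<zero>\<^bsub>R\<^esub>"] by (simp add: F.cls_def)
    show "x \<oplus>\<^bsub>R\<^esub> x' \<in> {x \<in> J\<^sub>2. F.cls x \<in> T}" if "x \<in> {x \<in> J\<^sub>2. F.cls x \<in> T}" "x' \<in> {x \<in> J\<^sub>2. F.cls x \<in> T}" for x x'
      using that T_mult by (simp add: F.cls_add)
    show "a \<otimes>\<^bsub>R\<^esub> x \<in> {x \<in> J\<^sub>2. F.cls x \<in> T}" if "a \<in> carrier R" "x \<in> {x \<in> J\<^sub>2. F.cls x \<in> T}" for a x
      using that T_act[OF F.\<pi>_closed[OF that(1)], of "F.cls x"] F.lact_cls[OF that(1), of x] F.sq.J2.I_l_closed[of x a] by simp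
  qed
  obtain y' d' k' where y': "\<And>j. j < k' \<Longrightarrow> y' j \<in> {x \<in> J\<^sub>2. F.cls x \<in> T} \<inter> \<Gamma> (d' j)"
    and gen': "\<And>n. {x \<in> J\<^sub>2. F.cls x \<in> T} \<inter> \<Gamma> n = F.filt.combinations y' d' k' n"
    by (rule F.filt.left_ideal_good_generators[OF noeth TL]) (rule that)
  have "\<exists>c\<in>regular_elements F.B. F.lact c (F.cls (y' j)) = \<one>\<^bsub>F.N\<^esub>" if "j < k'" for j
  proof (rule LM.unit_kernel_torsion)
    show "F.cls (y' j) \<in> carrier F.N" "LM.ext.unit (F.cls (y' j)) = \<one>\<^bsub>LM.ext.V\<^esub>" using y'[OF that] by (auto simp: T_def)
  qed (rule bexI)
  then have "\<forall>j. \<exists>c. j < k' \<longrightarrow> c \<in> regular_elements F.B \<and> F.lact c (F.cls (y' j)) = \<one>\<^bsub>F.N\<^esub>" by blast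
  from choice[OF this] obtain c where
    c: "\<And>j. j < k' \<Longrightarrow> c j \<in> regular_elements F.B" "\<And>j. j < k' \<Longrightarrow> F.lact (c j) (F.cls (y' j)) = \<one>\<^bsub>F.N\<^esub>" by blast
  let ?a = "\<lambda>n. F.BB.len (F.level n)" and ?\<nu> = "\<lambda>n. F.NN.len (F.nlevel n)" and ?\<theta> = "\<lambda>n. F.NN.len (F.nlevel n \<inter> T)"
  have "\<exists>d. \<forall>n. ?\<theta> (n + d) + of_nat k' * ?a n \<le> of_nat k' * ?a (n + d)"
  proof (rule F.torsion_estimate[OF _ T_level _ c])
    show "y' j \<in> J\<^sub>2" if "j < k'" for j using y'[OF that] by blast
    show "x \<in> F.filt.combinations y' d' k' n" if "x \<in> J\<^sub>2 \<inter> \<Gamma> n" "F.cls x \<in> T" for x n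
      unfolding gen'[symmetric] using that by blast
  qed
  then obtain d3 where d3: "\<And>n. ?\<theta> (n + d3) + of_nat k' * ?a n \<le> of_nat k' * ?a (n + d3)" by blast
  have "\<exists>d. \<forall>n. of_nat (Suc s') * ?a n \<le> of_nat r * ?\<nu> (n + d)"
  proof (rule RM.embedding_elements[OF Rchain])
    fix z b
    assume *: "\<And>i j. i < r \<Longrightarrow> j < Suc s' \<Longrightarrow> z i j \<in> carrier F.N" "\<And>i. i < r \<Longrightarrow> b i \<in> carrier F.B"
      "\<And>i j a. i < r \<Longrightarrow> (\<And>j. j < Suc s' \<Longrightarrow> a j \<in> carrier F.B) \<Longrightarrow>
        finprod F.N (\<lambda>j. F.ract (z i j) (a j)) {..<Suc s'} = \<one>\<^bsub>F.N\<^esub> \<Longrightarrow> j < Suc s' \<Longrightarrow> b i \<otimes>\<^bsub>F.B\<^esub> a j = \<zero>\<^bsub>F.B\<^esub>"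
      "\<And>a. a \<in> carrier F.B \<Longrightarrow> (\<And>i. i < r \<Longrightarrow> b i \<otimes>\<^bsub>F.B\<^esub> a = \<zero>\<^bsub>F.B\<^esub>) \<Longrightarrow> a = \<zero>\<^bsub>F.B\<^esub>"
    show ?thesis by (rule F.right_rank_estimate) (fact *)+
  qed
  then obtain d1 where d1: "\<And>n. of_nat (Suc s') * ?a n \<le> of_nat r * ?\<nu> (n + d1)" by blast
  have clsy: "F.cls (y j) \<in> carrier F.N" if "j < k" for j using F.cls_closed[OF yJ[OF that]] .
  have "\<exists>m d. m \<le> s' \<and> (\<forall>n. of_nat r * ?\<nu> n \<le> of_nat r * ?\<theta> n + of_nat m * ?a (n + d))"
  proof (rule LM.coordinate_maps[OF Lbound clsy N_gen])
    fix m f b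
    assume m: "m \<le> s'" and *: "\<And>i. i < r \<Longrightarrow> b i \<in> carrier F.B"
      "\<And>l n. l < m \<Longrightarrow> n \<in> carrier F.N \<Longrightarrow> f l n \<in> carrier F.B"
      "\<And>l n n'. l < m \<Longrightarrow> n \<in> carrier F.N \<Longrightarrow> n' \<in> carrier F.N \<Longrightarrow> f l (n \<otimes>\<^bsub>F.N\<^esub> n') = f l n \<oplus>\<^bsub>F.B\<^esub> f l n'"
      "\<And>l n a. l < m \<Longrightarrow> n \<in> carrier F.N \<Longrightarrow> a \<in> carrier F.B \<Longrightarrow> f l (F.lact a n) = a \<otimes>\<^bsub>F.B\<^esub> f l n"
      and ker: "\<And>n. n \<in> carrier F.N \<Longrightarrow> (\<And>l. l < m \<Longrightarrow> f l n = \<zero>\<^bsub>F.B\<^esub>) \<Longrightarrow> LM.ext.unit n = \<one>\<^bsub>LM.ext.V\<^esub>"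
      and det: "\<And>l n i. l < m \<Longrightarrow> (\<And>i. i < r \<Longrightarrow> n i \<in> carrier F.N) \<Longrightarrow> (\<Oplus>\<^bsub>F.B\<^esub>i\<in>{..<r}. f l (n i) \<otimes>\<^bsub>F.B\<^esub> b i) = \<zero>\<^bsub>F.B\<^esub>
        \<Longrightarrow> i < r \<Longrightarrow> f l (n i) = \<zero>\<^bsub>F.B\<^esub>"
    have "\<exists>d. \<forall>n. of_nat r * ?\<nu> n \<le> of_nat r * ?\<theta> n + of_nat m * ?a (n + d)"
    proof (rule F.left_rank_estimate)
      show "n \<in> T" if "n \<in> carrier F.N" "\<And>l. l < m \<Longrightarrow> f l n = \<zero>\<^bsub>F.B\<^esub>" for n
        using ker[OF that] that(1) by (simp add: T_def)
    qed (fact * det T_level yJ gen)+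
    then show ?thesis using m by blast
  qed
  then obtain m d2 where m: "m \<le> s'" and d2: "\<And>n. of_nat r * ?\<nu> n \<le> of_nat r * ?\<theta> n + of_nat m * ?a (n + d2)" by blast
  have proper: "\<one>\<^bsub>R\<^esub> \<notin> I"
  proof
    assume "\<one>\<^bsub>R\<^esub> \<in> I"
    then have "\<one>\<^bsub>F.B\<^esub> = \<zero>\<^bsub>F.B\<^esub>" using F.I.quot_coset_zero_iff[of "\<one>\<^bsub>R\<^esub>"] F.\<pi>_one by (simp add: F.\<pi>_def)
    then show False using assms(6) F.B.one_zeroD unfolding prime_ring_def by blast
  qed
  \<comment> \<open>Combining the three estimates gives \<open>(s' + 1) a n + r k' a n \<le> s' a (n + d) + r k' a (n + d)\<close>.\<close>
  define C where "C = s' + r * k'"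
  let ?d = "d1 + d3 + d2"
  have a_mono: "?a i \<le> ?a j" if "i \<le> j" for i j
    by (rule stable_length_mono[OF F.level_stable F.level_stable F.level_mono[OF that]])
  have "of_nat (C + 1) * ?a n \<le> of_nat C * ?a (n + ?d)" for n
  proof -
    let ?n = "n + d1 + d3"
    have "of_nat (Suc s') * ?a n \<le> of_nat r * ?\<nu> (n + d1)" by (rule d1)
    also have "\<dots> \<le> of_nat r * ?\<nu> ?n"
      by (intro mult_left_mono stable_length_mono F.nlevel_stable F.nlevel_mono) simp_all
    also have "\<dots> \<le> of_nat r * ?\<theta> ?n + of_nat m * ?a (?n + d2)" by (rule d2)
    finally have 1: "of_nat (Suc s') * ?a n \<le> of_nat r * ?\<theta> ?n + of_nat m * ?a (?n + d2)" .
    have 2: "of_nat r * (?\<theta> ?n + of_nat k' * ?a (n + d1)) \<le> of_nat r * (of_nat k' * ?a ?n)"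
      using d3[of "n + d1"] by (rule mult_left_mono) simp
    have "of_nat (C + 1) * ?a n = of_nat (Suc s') * ?a n + of_nat r * (of_nat k' * ?a n)"
      by (simp add: C_def algebra_simps)
    also have "\<dots> \<le> (of_nat r * ?\<theta> ?n + of_nat m * ?a (?n + d2)) + of_nat r * (of_nat k' * ?a (n + d1))"
      by (intro add_mono 1 mult_left_mono a_mono) simp_all
    also have "\<dots> = of_nat r * (?\<theta> ?n + of_nat k' * ?a (n + d1)) + of_nat m * ?a (?n + d2)"
      by (simp add: algebra_simps)
    also have "\<dots> \<le> of_nat r * (of_nat k' * ?a (?n + d2)) + of_nat s' * ?a (?n + d2)"
    proof (rule add_mono)
      show "of_nat r * (?\<theta> ?n + of_nat k' * ?a (n + d1)) \<le> of_nat r * (of_nat k' * ?a (?n + d2))"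
        by (rule order_trans[OF 2]) (intro mult_left_mono a_mono; simp)
      show "of_nat m * ?a (?n + d2) \<le> of_nat s' * ?a (?n + d2)"
        using m by (intro mult_right_mono) simp_all
    qed
    also have "\<dots> = of_nat C * ?a (n + ?d)" by (simp add: C_def algebra_simps)
    finally show ?thesis .
  qed
  moreover obtain n where "of_nat C * ?a (n + ?d) < of_nat (C + 1) * ?a n"
    using F.subexponential_growth[OF noeth fin proper] by blast
  ultimately show False by (simp add: not_less[symmetric])
qed

end
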